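(* Let $t\in(0,1]$, and for each $n\ge1$ let $L_n=\{1,2,\dots,n\}\subset\mathbb Z$, where $\mathbb Z$ has its usual nearest-neighbour graph structure. For $V\subseteq W\subseteq\mathbb Z$ with $V$ finite let $S_t(V,W):=\sum_{v\in V}X_t^W(v)$. Let $\sigma^2_{\mathrm{BL}}(t):=te^{-4t}$. For blocking RSA, as $n\to\infty$, $$n^{-1}\,\mathrm{Var}\,S_t(L_n,\mathbb Z)\to\sigma^2_{\mathrm{BL}}(t),\qquad n^{-1}\,\mathrm{Var}\,S_t(L_n,L_n)\to\sigma^2_{\mathrm{BL}}(t),$$ $$n^{-1/2}\big(S_t(L_n,\mathbb Z)-ES_t(L_n,\mathbb Z)\big)\xrightarrow{\mathcal D}\mathcal N(0,\sigma^2_{\mathrm{BL}}(t)),$$ $$n^{-1/2}\big(S_t(L_n,L_n)-ES_t(L_n,L_n)\big)\xrightarrow{\mathcal D}\mathcal N(0,\sigma^2_{\mathrm{BL}}(t)).$$ Moreover, for dimer RSA and for the annihilation process these four results still hold with the limiting variance $\sigma^2_{\mathrm{BL}}(t)$ replaced by $\sigma^2_{\mathrm{DI}}(t)$ and $\sigma^2_{\mathrm{AN}}(t)$, respectively, given by $$\sigma^2_{\mathrm{DI}}(t):=4te^{-4t},\qquad\sigma^2_{\mathrm{AN}}(t):=(1+2t)e^{-2t}-e^{-t}.$$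
   Context: $\mathcal N(0,\sigma^2)$ is the normal distribution with mean $0$ and variance $\sigma^2$; $\xrightarrow{\mathcal D}$ is convergence in distribution. A subset of $\mathbb Z$ carries the induced subgraph structure. Processes on a finite graph $W$ with edge set $E$; states are $1$ (occupied) and $0$ (vacant), and $X_t^W(v)$ is the state of $v$ at time $t$. Blocking RSA: $\tau_v$, $v\in W$, are i.i.d. uniform on $(0,1)$. All sites are initially vacant; at time $\tau_v$ site $v$ becomes occupied if and only if none of its neighbours is already occupied; otherwise nothing changes. Occupied sites stay occupied forever. Dimer RSA: $\tau_e$, $e\in E$, are i.i.d. uniform on $(0,1)$. All sites are initially vacant; at time $\tau_e$, $e=\{u,v\}$, if $u$ and $v$ are both vacant then both become occupied; otherwise nothing changes. Occupied sites stay occupied forever. Annihilation process: $\tau_e$, $e\in E$, are i.i.d. uniform on $(0,1)$. All sites are initially occupied; at time $\tau_e$, $e=\{u,v\}$, if $u$ and $v$ are both occupied immediately before, then one of them, each with probability $1/2$ (chosen independently of everything else), becomes vacant; otherwise nothing changes. Vacant sites stay vacant forever. For countably infinite $W$ of bounded degree (such as $\mathbb Z$), $X_t^W(v):=\lim_n X_t^{W_n}(v)$, where $(W_n)$ is any sequence of finite subsets of $W$ with $\bigcup_n\bigcap_{m\ge n}W_m=W$ and the process on the induced subgraph $W_n$ uses the same $\tau$'s and attack directions; almost surely this limit exists for all $v,t$ and does not depend on the sequence. *)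

theory Defs
  imports "HOL-Probability.Probability"
begin

text \<open>
  A graph is given by its set of edges, each edge being a two-element set of vertices. The
  processes are first defined pathwise, for fixed arrival times \<open>\<tau>\<close> and fixed attack directions.
\<close>

definition induced_edges :: "'v set set \<Rightarrow> 'v set \<Rightarrow> 'v set set" where
  "induced_edges E W = {e \<in> E. e \<subseteq> W}"

text \<open>
  The elements of \<open>I\<close> that have arrived by time \<open>t\<close>, in order of arrival. Simultaneous arrivals
  have probability 0; they are ordered arbitrarily.
\<close>

definition arrivals :: "('i \<Rightarrow> real) \<Rightarrow> 'i set \<Rightarrow> real \<Rightarrow> 'i list" where
  "arrivals \<tau> I t =
     (SOME xs. distinct xs \<and> set xs = {i \<in> I. \<tau> i \<le> t} \<and> sorted (map \<tau> xs))"

definition blocking_step :: "'v set set \<Rightarrow> 'v \<Rightarrow> ('v \<Rightarrow> real) \<Rightarrow> 'v \<Rightarrow> real" where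
  "blocking_step E v x = (if \<forall>u. {u, v} \<in> E \<longrightarrow> x u = 0 then x(v := 1) else x)"

definition dimer_step :: "'v set \<Rightarrow> ('v \<Rightarrow> real) \<Rightarrow> 'v \<Rightarrow> real" where
  "dimer_step e x = (if \<forall>u\<in>e. x u = 0 then (\<lambda>w. if w \<in> e then 1 else x w) else x)"

text \<open>\<open>D e \<in> e\<close> is the endpoint of \<open>e\<close> that is attacked at time \<open>\<tau> e\<close>.\<close>

definition annihilation_step ::
  "('v set \<Rightarrow> 'v) \<Rightarrow> 'v set \<Rightarrow> ('v \<Rightarrow> real) \<Rightarrow> 'v \<Rightarrow> real" where
  "annihilation_step D e x = (if \<forall>u\<in>e. x u = 1 then x(D e := 0) else x)"

definition finite_blocking ::
  "'v set set \<Rightarrow> ('v \<Rightarrow> real) \<Rightarrow> real \<Rightarrow> 'v set \<Rightarrow> 'v \<Rightarrow> real" where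
  "finite_blocking E \<tau> t W =
     fold (blocking_step (induced_edges E W)) (arrivals \<tau> W t) (\<lambda>_. 0)"

definition finite_dimer ::
  "'v set set \<Rightarrow> ('v set \<Rightarrow> real) \<Rightarrow> real \<Rightarrow> 'v set \<Rightarrow> 'v \<Rightarrow> real" where
  "finite_dimer E \<tau> t W = fold dimer_step (arrivals \<tau> (induced_edges E W) t) (\<lambda>_. 0)"

definition finite_annihilation ::
  "'v set set \<Rightarrow> ('v set \<Rightarrow> real) \<Rightarrow> ('v set \<Rightarrow> 'v) \<Rightarrow> real \<Rightarrow> 'v set \<Rightarrow> 'v \<Rightarrow> real" where
  "finite_annihilation E \<tau> D t W =
     fold (annihilation_step D) (arrivals \<tau> (induced_edges E W) t) (\<lambda>_. 1)"

text \<open>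
  Extension to infinite vertex sets. The common limit along all exhausting sequences exists almost
  surely for the processes considered here; elsewhere the description denotes one fixed
  unspecified number.
\<close>

definition exhausting :: "(nat \<Rightarrow> 'v set) \<Rightarrow> 'v set \<Rightarrow> bool" where
  "exhausting Ws W \<longleftrightarrow>
     (\<forall>n. finite (Ws n) \<and> Ws n \<subseteq> W) \<and> (\<Union>n. \<Inter>m\<in>{n..}. Ws m) = W"

definition extend_to_infinite :: "('v set \<Rightarrow> 'v \<Rightarrow> real) \<Rightarrow> 'v set \<Rightarrow> 'v \<Rightarrow> real" where
  "extend_to_infinite X W v =
     (if finite W then X W v
      else THE x. \<forall>Ws. exhausting Ws W \<longrightarrow> (\<lambda>n. X (Ws n) v) \<longlonglongrightarrow> x)"

definition blocking_rsa ::
  "'v set set \<Rightarrow> ('v \<Rightarrow> real) \<Rightarrow> real \<Rightarrow> 'v set \<Rightarrow> 'v \<Rightarrow> real" where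
  "blocking_rsa E \<tau> t = extend_to_infinite (finite_blocking E \<tau> t)"

definition dimer_rsa ::
  "'v set set \<Rightarrow> ('v set \<Rightarrow> real) \<Rightarrow> real \<Rightarrow> 'v set \<Rightarrow> 'v \<Rightarrow> real" where
  "dimer_rsa E \<tau> t = extend_to_infinite (finite_dimer E \<tau> t)"

definition annihilation ::
  "'v set set \<Rightarrow> ('v set \<Rightarrow> real) \<Rightarrow> ('v set \<Rightarrow> 'v) \<Rightarrow> real \<Rightarrow> 'v set \<Rightarrow> 'v \<Rightarrow> real" where
  "annihilation E \<tau> D t = extend_to_infinite (finite_annihilation E \<tau> D t)"

definition occupied_count :: "('v set \<Rightarrow> 'v \<Rightarrow> real) \<Rightarrow> 'v set \<Rightarrow> 'v set \<Rightarrow> real" where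
  "occupied_count X V W = (\<Sum>v\<in>V. X W v)"

definition int_edges :: "int set set" where
  "int_edges = {{i, i + 1} | i. True}"

definition segment :: "nat \<Rightarrow> int set" where
  "segment n = {1..int n}"

definition iid_uniform_clocks :: "'a measure \<Rightarrow> ('i \<Rightarrow> 'a \<Rightarrow> real) \<Rightarrow> 'i set \<Rightarrow> bool" where
  "iid_uniform_clocks M \<tau> I \<longleftrightarrow>
     prob_space.indep_vars M (\<lambda>_. borel) \<tau> I \<and>
     (\<forall>i\<in>I. distr M borel (\<tau> i) = uniform_measure lborel {0<..<1})"

text \<open>
  All the variables \<open>\<tau> e\<close> and \<open>D e\<close> together are independent: the pairs are independent of each
  other, and the law of each pair is a product measure.
\<close>

definition uniform_clocks_fair_directions ::
  "'a measure \<Rightarrow> ('v set \<Rightarrow> 'a \<Rightarrow> real) \<Rightarrow> ('v set \<Rightarrow> 'a \<Rightarrow> 'v) \<Rightarrow> 'v set set \<Rightarrow> bool" where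
  "uniform_clocks_fair_directions M \<tau> D E \<longleftrightarrow>
     prob_space.indep_vars M (\<lambda>_. borel \<Otimes>\<^sub>M count_space UNIV) (\<lambda>e \<omega>. (\<tau> e \<omega>, D e \<omega>)) E \<and>
     (\<forall>e\<in>E. distr M (borel \<Otimes>\<^sub>M count_space UNIV) (\<lambda>\<omega>. (\<tau> e \<omega>, D e \<omega>)) =
        uniform_measure lborel {0<..<1} \<Otimes>\<^sub>M measure_pmf (pmf_of_set e))"

text \<open>The library's \<open>normal_density\<close> takes the standard deviation, not the variance.\<close>

definition variance_limit_and_clt :: "'a measure \<Rightarrow> (nat \<Rightarrow> 'a \<Rightarrow> real) \<Rightarrow> real \<Rightarrow> bool" where
  "variance_limit_and_clt M S s2 \<longleftrightarrow>
     (\<lambda>n. prob_space.variance M (S n) / real n) \<longlonglongrightarrow> s2 \<and>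
     weak_conv_m
       (\<lambda>n. distr M borel (\<lambda>\<omega>. (S n \<omega> - prob_space.expectation M (S n)) / sqrt (real n)))
       (density lborel (\<lambda>x. ennreal (normal_density 0 (sqrt s2) x)))"

definition sigma2_BL :: "real \<Rightarrow> real" where
  "sigma2_BL t = t * exp (- 4 * t)"

definition sigma2_DI :: "real \<Rightarrow> real" where
  "sigma2_DI t = 4 * t * exp (- 4 * t)"

definition sigma2_AN :: "real \<Rightarrow> real" where
  "sigma2_AN t = (1 + 2 * t) * exp (- 2 * t) - exp (- t)"

end

theory Submission
  imports Defs
begin

text \<open>
  The proof expresses each count as an alternating sum over intervals of local patterns. Whether
  site \<open>v\<close> becomes occupied in blocking RSA depends on the maximal runs of decreasing
  clocks that start at \<open>v\<close> and go to the right and to the left: the right neighbour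
  blocks \<open>v\<close> if and only if it rings earlier and is not itself blocked by its own
  right neighbour, and so on. So \<open>v\<close> is not blocked from a side exactly if the run on
  this side has even length (\<open>unblocked\<close>), and inclusion-exclusion
  (\<open>of_bool_unblocked\<close>) makes the indicator of this event the sum of
  \<open>(-1)^a\<close> over all \<open>a\<close> such that the first \<open>a\<close> clocks
  decrease. Multiplying the sums for the two sides, summing over \<open>v\<close> and collecting
  the terms that belong to the same interval \<open>I = [v - b, v + a]\<close>, one sums over the
  possible positions \<open>v\<close> of the peak in \<open>I\<close>; the sum of the indicators
  is the indicator \<open>U I\<close> of the event that all clocks on \<open>I\<close> are below
  \<open>t\<close> and have no valley (\<open>valley_free_peaks\<close>). Hence the number of
  occupied sites of \<open>L\<^sub>n\<close> is the sum of \<open>- (-1)^\<bar>I\<bar> * U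
  I\<close> over its nonempty subintervals \<open>I\<close>. In the annihilation process the edges
  of \<open>I\<close> take the place of the sites, \<open>U I\<close> says that all attacks point
  towards a common vertex along decreasing clocks (\<open>funnel_sinks\<close>), and the empty
  intervals, one at each vertex, contribute an additional \<open>n\<close>. Dimer RSA is blocking
  RSA on the line graph, which is \<open>\<int>\<close> again (\<open>dimer_eq_blocking\<close>),
  so its counts are twice those of blocking RSA up to the ends.

  The probability of \<open>U I\<close> is \<open>(2 * t)^m / (2 * m!)\<close> for an interval of
  \<open>m\<close> sites and \<open>t^m / m!\<close> for \<open>m\<close> edges, so long intervals
  are negligible. The locale \<open>interval_pattern\<close> keeps only this decay, locality and
  translation invariance, and derives the central limit theorem from a variance limit: split
  \<open>L\<^sub>n\<close> into blocks of fixed length, apply the classical theorem to the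
  independent block sums, bound the variance of the intervals that fit in no block
  (\<open>variance_altsum_le_hitting_set\<close>), and let the block length grow
  (\<open>altsum_clt\<close>). The locale \<open>overlapping_pattern\<close> adds what is needed
  for the variance: the pattern passes to subintervals, and two patterns on overlapping intervals
  amount to the pattern on the union. In blocking RSA this fails if the intervals have exactly one
  site in common, which may be a valley; the excess probability is an explicit integral
  (\<open>touching\<close>). The increments of the variance then have a limit in terms of three
  power series (\<open>variance_T_limit\<close>), which evaluates to \<open>sigma2_BL\<close> and
  \<open>sigma2_AN\<close>.

  Passing from \<open>L\<^sub>n\<close> to \<open>\<int>\<close> changes only sites whose run
  reaches the boundary of \<open>L\<^sub>n\<close>. The number of such sites has a second moment
  bounded in \<open>n\<close> (\<open>boundary_square_le\<close>), and such errors affect neither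
  limit (\<open>variance_limit_and_clt_transfer\<close>). The same runs show that the limit that
  defines the process on \<open>\<int>\<close> exists.
\<close>

section \<open>Stability of variance limits and central limit theorems\<close>

context prob_space
begin

lemma expectation_of_bool: "expectation (\<lambda>\<omega>. of_bool (P \<omega>)) = prob {\<omega> \<in> space M. P \<omega>}"
proof -
  have "expectation (\<lambda>\<omega>. of_bool (P \<omega>) :: real) = expectation (indicator {\<omega> \<in> space M. P \<omega>})"
    by (intro Bochner_Integration.integral_cong) (auto simp: indicator_def)
  also have "\<dots> = prob ({\<omega> \<in> space M. P \<omega>} \<inter> space M)" by simp
  also have "{\<omega> \<in> space M. P \<omega>} \<inter> space M = {\<omega> \<in> space M. P \<omega>}" by auto
  finally show ?thesis .
qed

lemma integrable_mult_of_squares: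
  fixes X Y :: "'a \<Rightarrow> real"
  assumes [measurable]: "X \<in> borel_measurable M" "Y \<in> borel_measurable M"
    and "integrable M (\<lambda>\<omega>. (X \<omega>)\<^sup>2)" "integrable M (\<lambda>\<omega>. (Y \<omega>)\<^sup>2)"
  shows "integrable M (\<lambda>\<omega>. X \<omega> * Y \<omega>)"
proof (rule Bochner_Integration.integrable_bound)
  show "integrable M (\<lambda>\<omega>. (X \<omega>)\<^sup>2 + (Y \<omega>)\<^sup>2)" using assms by simp
  have "\<bar>x * y\<bar> \<le> x\<^sup>2 + y\<^sup>2" for x y :: real
  proof -
    have "2 * \<bar>x * y\<bar> \<le> x\<^sup>2 + y\<^sup>2"
      using sum_squares_bound[of "\<bar>x\<bar>" "\<bar>y\<bar>"] by (simp add: abs_mult mult.assoc)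
    then show ?thesis by linarith
  qed
  then show "AE \<omega> in M. norm (X \<omega> * Y \<omega>) \<le> norm ((X \<omega>)\<^sup>2 + (Y \<omega>)\<^sup>2)"
    by (intro always_eventually allI) (metis abs_ge_self order_trans real_norm_def)
qed simp

lemma integrable_square_add:
  fixes X Y :: "'a \<Rightarrow> real"
  assumes [measurable]: "X \<in> borel_measurable M" "Y \<in> borel_measurable M"
    and "integrable M (\<lambda>\<omega>. (X \<omega>)\<^sup>2)" "integrable M (\<lambda>\<omega>. (Y \<omega>)\<^sup>2)"
  shows "integrable M (\<lambda>\<omega>. (X \<omega> + Y \<omega>)\<^sup>2)"
  unfolding power2_sum using integrable_mult_of_squares[OF assms] assms
  by (simp add: mult.assoc)

lemma integrable_square_diff:
  fixes X Y :: "'a \<Rightarrow> real"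
  assumes [measurable]: "X \<in> borel_measurable M" "Y \<in> borel_measurable M"
    and "integrable M (\<lambda>\<omega>. (X \<omega>)\<^sup>2)" "integrable M (\<lambda>\<omega>. (Y \<omega>)\<^sup>2)"
  shows "integrable M (\<lambda>\<omega>. (X \<omega> - Y \<omega>)\<^sup>2)"
  unfolding power2_diff using integrable_mult_of_squares[OF assms] assms
  by (simp add: mult.assoc)

lemma Cauchy_Schwarz_expectation:
  fixes X Y :: "'a \<Rightarrow> real"
  assumes [measurable]: "X \<in> borel_measurable M" "Y \<in> borel_measurable M"
    and X: "integrable M (\<lambda>\<omega>. (X \<omega>)\<^sup>2)" and Y: "integrable M (\<lambda>\<omega>. (Y \<omega>)\<^sup>2)"
  shows "\<bar>expectation (\<lambda>\<omega>. X \<omega> * Y \<omega>)\<bar>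
    \<le> sqrt (expectation (\<lambda>\<omega>. (X \<omega>)\<^sup>2)) * sqrt (expectation (\<lambda>\<omega>. (Y \<omega>)\<^sup>2))"
proof -
  let ?a = "expectation (\<lambda>\<omega>. (X \<omega>)\<^sup>2)" and ?b = "expectation (\<lambda>\<omega>. (Y \<omega>)\<^sup>2)"
    and ?c = "expectation (\<lambda>\<omega>. X \<omega> * Y \<omega>)"
  have XY: "integrable M (\<lambda>\<omega>. X \<omega> * Y \<omega>)" by (rule integrable_mult_of_squares) (use X Y in auto)
  have a0: "0 \<le> ?a" and b0: "0 \<le> ?b" by simp_all
  have quad: "0 \<le> r\<^sup>2 * ?a - 2 * r * s * ?c + s\<^sup>2 * ?b" for r s
  proof -
    have "0 \<le> expectation (\<lambda>\<omega>. (r * X \<omega> - s * Y \<omega>)\<^sup>2)" by simp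
    also have "(\<lambda>\<omega>. (r * X \<omega> - s * Y \<omega>)\<^sup>2)
        = (\<lambda>\<omega>. r\<^sup>2 * (X \<omega>)\<^sup>2 - 2 * r * s * (X \<omega> * Y \<omega>) + s\<^sup>2 * (Y \<omega>)\<^sup>2)"
      by (auto simp: fun_eq_iff power2_eq_square algebra_simps)
    also have "expectation \<dots> = r\<^sup>2 * ?a - 2 * r * s * ?c + s\<^sup>2 * ?b"
      using X Y XY by simp
    finally show ?thesis .
  qed
  have "?c\<^sup>2 \<le> ?a * ?b"
  proof (cases "?b = 0")
    case True
    have "?c = 0"
    proof (rule ccontr)
      assume c: "?c \<noteq> 0"
      \<comment> \<open>With these coefficients and \<open>?b = 0\<close> the quadratic form takes the value
        \<open>-1\<close>.\<close>
      from quad[of 1 "(?a + 1) / (2 * ?c)"] show False using c True by simp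
    qed
    then show ?thesis using True by simp
  next
    case False
    with b0 have bp: "?b > 0" by linarith
    from quad[of 1 "?c / ?b"] have "?c\<^sup>2 / ?b \<le> ?a"
      using bp by (simp add: power2_eq_square field_simps)
    then show ?thesis using bp by (simp add: field_simps)
  qed
  then have "sqrt (?c\<^sup>2) \<le> sqrt (?a * ?b)" by (rule real_sqrt_le_mono)
  then show ?thesis by (simp add: real_sqrt_mult)
qed

lemma variance_le_square:
  fixes X :: "'a \<Rightarrow> real"
  assumes [measurable]: "X \<in> borel_measurable M" and "integrable M (\<lambda>\<omega>. (X \<omega>)\<^sup>2)"
  shows "variance X \<le> expectation (\<lambda>\<omega>. (X \<omega>)\<^sup>2)"
  using variance_eq[of X] square_integrable_imp_integrable[OF assms] assms(2) by simp

lemma expectation_abs_le_sqrt: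
  fixes X :: "'a \<Rightarrow> real"
  assumes [measurable]: "X \<in> borel_measurable M" and "integrable M (\<lambda>\<omega>. (X \<omega>)\<^sup>2)"
  shows "expectation (\<lambda>\<omega>. \<bar>X \<omega>\<bar>) \<le> sqrt (expectation (\<lambda>\<omega>. (X \<omega>)\<^sup>2))"
  using Cauchy_Schwarz_expectation[of "\<lambda>\<omega>. \<bar>X \<omega>\<bar>" "\<lambda>_. 1"] assms by (simp add: prob_space)

lemma centered_square_integrable:
  fixes X :: "'a \<Rightarrow> real"
  assumes [measurable]: "X \<in> borel_measurable M" and "integrable M (\<lambda>\<omega>. (X \<omega>)\<^sup>2)"
  shows "integrable M (\<lambda>\<omega>. (X \<omega> - c)\<^sup>2)"
  by (rule integrable_square_diff) (use assms in auto)

text \<open>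
  The standard deviation is the \<open>L\<^sup>2\<close> norm of the centred variable; the cross
  term is bounded by Cauchy-Schwarz.
\<close>

lemma sqrt_variance_triangle:
  fixes X Y :: "'a \<Rightarrow> real"
  assumes [measurable]: "X \<in> borel_measurable M" "Y \<in> borel_measurable M"
    and X: "integrable M (\<lambda>\<omega>. (X \<omega>)\<^sup>2)" and Y: "integrable M (\<lambda>\<omega>. (Y \<omega>)\<^sup>2)"
  shows "sqrt (variance (\<lambda>\<omega>. X \<omega> + Y \<omega>)) \<le> sqrt (variance X) + sqrt (variance Y)"
proof -
  have iX: "integrable M X" and iY: "integrable M Y"
    by (rule square_integrable_imp_integrable; use X Y in simp)+
  let ?X = "\<lambda>\<omega>. X \<omega> - expectation X" and ?Y = "\<lambda>\<omega>. Y \<omega> - expectation Y"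
  have sX: "integrable M (\<lambda>\<omega>. (?X \<omega>)\<^sup>2)" and sY: "integrable M (\<lambda>\<omega>. (?Y \<omega>)\<^sup>2)"
    by (rule centered_square_integrable; use X Y in simp)+
  have p: "integrable M (\<lambda>\<omega>. ?X \<omega> * ?Y \<omega>)"
    by (rule integrable_mult_of_squares) (use sX sY in auto)
  have "variance (\<lambda>\<omega>. X \<omega> + Y \<omega>) = expectation (\<lambda>\<omega>. (?X \<omega>)\<^sup>2 + 2 * (?X \<omega> * ?Y \<omega>) + (?Y \<omega>)\<^sup>2)"
    using iX iY by (intro Bochner_Integration.integral_cong) (auto simp: power2_eq_square algebra_simps)
  also have "\<dots> = variance X + 2 * expectation (\<lambda>\<omega>. ?X \<omega> * ?Y \<omega>) + variance Y"
    using sX sY p by (subst Bochner_Integration.integral_add; simp?)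
  also have "\<dots> \<le> variance X + 2 * (sqrt (variance X) * sqrt (variance Y)) + variance Y"
    using Cauchy_Schwarz_expectation[of ?X ?Y] sX sY by auto
  also have "\<dots> = (sqrt (variance X) + sqrt (variance Y))\<^sup>2"
    by (simp add: power2_sum variance_positive)
  finally show ?thesis
    by (rule real_le_lsqrt[rotated -1]) (auto simp: variance_positive)
qed

lemma sqrt_variance_diff_le:
  fixes X Y :: "'a \<Rightarrow> real"
  assumes [measurable]: "X \<in> borel_measurable M" "Y \<in> borel_measurable M"
    and X: "integrable M (\<lambda>\<omega>. (X \<omega>)\<^sup>2)" and Y: "integrable M (\<lambda>\<omega>. (Y \<omega>)\<^sup>2)"
  shows "\<bar>sqrt (variance X) - sqrt (variance Y)\<bar> \<le> sqrt (variance (\<lambda>\<omega>. X \<omega> - Y \<omega>))"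
proof -
  have d: "integrable M (\<lambda>\<omega>. (X \<omega> - Y \<omega>)\<^sup>2)" "integrable M (\<lambda>\<omega>. (Y \<omega> - X \<omega>)\<^sup>2)"
    by (rule integrable_square_diff; use X Y in simp)+
  have iX: "integrable M X" and iY: "integrable M Y"
    by (rule square_integrable_imp_integrable; use X Y in simp)+
  have "variance (\<lambda>\<omega>. Y \<omega> - X \<omega>) = variance (\<lambda>\<omega>. X \<omega> - Y \<omega>)"
    using iX iY by (intro Bochner_Integration.integral_cong) (auto simp: power2_eq_square algebra_simps)
  then have "sqrt (variance (\<lambda>\<omega>. Y \<omega> - X \<omega>)) = sqrt (variance (\<lambda>\<omega>. X \<omega> - Y \<omega>))" by (rule arg_cong)
  moreover have "sqrt (variance X) \<le> sqrt (variance (\<lambda>\<omega>. X \<omega> - Y \<omega>)) + sqrt (variance Y)"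
    using sqrt_variance_triangle[of "\<lambda>\<omega>. X \<omega> - Y \<omega>" Y] d Y by simp
  moreover have "sqrt (variance Y) \<le> sqrt (variance (\<lambda>\<omega>. Y \<omega> - X \<omega>)) + sqrt (variance X)"
    using sqrt_variance_triangle[of "\<lambda>\<omega>. Y \<omega> - X \<omega>" X] d X by simp
  ultimately show ?thesis by linarith
qed

lemma iexp_lipschitz: "cmod (iexp x - iexp y) \<le> \<bar>x - y\<bar>"
proof -
  have "iexp x - iexp y = iexp y * (iexp (x - y) - 1)"
    by (simp add: algebra_simps exp_add[symmetric])
  then have "cmod (iexp x - iexp y) = cmod (iexp (x - y) - 1)" by (simp add: norm_mult)
  also have "\<dots> \<le> \<bar>x - y\<bar>" using iexp_approx1[of "x - y" 0] by simp
  finally show ?thesis .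
qed

text \<open>
  The function \<open>iexp\<close> is 1-Lipschitz, so an error that is small in mean changes the
  characteristic function only a little.
\<close>

lemma iexp_expectation_diff:
  fixes X Y :: "'a \<Rightarrow> real"
  assumes [measurable]: "X \<in> borel_measurable M" "Y \<in> borel_measurable M"
    and D: "integrable M (\<lambda>\<omega>. X \<omega> - Y \<omega>)"
  shows "cmod ((CLINT \<omega>|M. iexp (X \<omega>)) - (CLINT \<omega>|M. iexp (Y \<omega>))) \<le> expectation (\<lambda>\<omega>. \<bar>X \<omega> - Y \<omega>\<bar>)"
proof -
  have i: "integrable M (\<lambda>\<omega>. iexp (X \<omega>))" "integrable M (\<lambda>\<omega>. iexp (Y \<omega>))"
    by (intro integrable_iexp; simp)+
  have "(CLINT \<omega>|M. iexp (X \<omega>)) - (CLINT \<omega>|M. iexp (Y \<omega>)) = (CLINT \<omega>|M. iexp (X \<omega>) - iexp (Y \<omega>))"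
    using i by simp
  also have "cmod \<dots> \<le> (LINT \<omega>|M. cmod (iexp (X \<omega>) - iexp (Y \<omega>)))"
    by (rule integral_norm_bound)
  also have "\<dots> \<le> expectation (\<lambda>\<omega>. \<bar>X \<omega> - Y \<omega>\<bar>)"
    using i D by (intro integral_mono) (auto intro: iexp_lipschitz)
  finally show ?thesis .
qed

end

lemma char_normal_distribution:
  assumes s: "0 < s2"
  shows "char (density lborel (\<lambda>x. ennreal (normal_density 0 (sqrt s2) x))) \<theta> = exp (- (s2 * \<theta>\<^sup>2) / 2)"
proof -
  let ?N = "density lborel (\<lambda>x. ennreal (normal_density 0 (sqrt s2) x))"
  interpret S: prob_space std_normal_distribution by (intro prob_space_normal_density) simp
  have "distributed std_normal_distribution lborel (\<lambda>x. x) std_normal_density"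
    by (simp add: distributed_def distr_id2)
  from S.normal_density_affine[OF this, of "sqrt s2" 0] s
  have d: "distributed std_normal_distribution lborel (\<lambda>x. sqrt s2 * x) (\<lambda>x. ennreal (normal_density 0 (sqrt s2) x))"
    by simp
  then have "distr std_normal_distribution lborel (\<lambda>x. sqrt s2 * x) = ?N"
    by (simp add: distributed_def)
  then have e: "?N = distr std_normal_distribution borel (\<lambda>x. sqrt s2 * x)"
    by (metis distr_cong sets_lborel)
  have "char ?N \<theta> = (CLINT x|std_normal_distribution. iexp (\<theta> * (sqrt s2 * x)))"
    unfolding char_def e by (subst integral_distr) auto
  also have "\<dots> = char std_normal_distribution (\<theta> * sqrt s2)"
    unfolding char_def by (simp add: mult.assoc)
  also have "\<dots> = exp (- (s2 * \<theta>\<^sup>2) / 2)"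
    using s by (simp add: char_std_normal_distribution power_mult_distrib mult.commute)
  finally show ?thesis by simp
qed

text \<open>
  By Levy's continuity theorem, weak convergence to a normal law is pointwise convergence of
  characteristic functions, which is stable under the perturbations considered below.
\<close>

lemma variance_limit_and_clt_iff:
  fixes S :: "nat \<Rightarrow> 'a \<Rightarrow> real"
  assumes "prob_space M" and [measurable]: "\<And>n. S n \<in> borel_measurable M" and s: "0 < s2"
  shows "variance_limit_and_clt M S s2 \<longleftrightarrow>
     (\<lambda>n. prob_space.variance M (S n) / real n) \<longlonglongrightarrow> s2 \<and>
     (\<forall>\<theta>. (\<lambda>n. CLINT \<omega>|M. iexp (\<theta> * ((S n \<omega> - prob_space.expectation M (S n)) / sqrt (real n))))
        \<longlonglongrightarrow> exp (- (s2 * \<theta>\<^sup>2) / 2))"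
proof -
  interpret prob_space M by fact
  let ?N = "density lborel (\<lambda>x. ennreal (normal_density 0 (sqrt s2) x))"
  let ?D = "\<lambda>n. distr M borel (\<lambda>\<omega>. (S n \<omega> - expectation (S n)) / sqrt (real n))"
  have N: "real_distribution ?N"
    using s by (simp add: real_distribution_def real_distribution_axioms_def prob_space_normal_density)
  have D: "real_distribution (?D n)" for n
    by (intro real_distribution_distr) simp
  have ch: "char (?D n) \<theta> = (CLINT \<omega>|M. iexp (\<theta> * ((S n \<omega> - expectation (S n)) / sqrt (real n))))" for n \<theta>
    unfolding char_def by (subst integral_distr) auto
  have "weak_conv_m ?D ?N \<longleftrightarrow> (\<forall>\<theta>. (\<lambda>n. char (?D n) \<theta>) \<longlonglongrightarrow> char ?N \<theta>)"
    using levy_continuity1[of ?D ?N, OF D N] levy_continuity[of ?D ?N, OF D N] by blast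
  then show ?thesis
    unfolding variance_limit_and_clt_def by (simp add: ch char_normal_distribution[OF s])
qed

lemma variance_limit_and_clt_affine:
  fixes S :: "nat \<Rightarrow> 'a \<Rightarrow> real"
  assumes P: "prob_space M" and [measurable]: "\<And>n. S n \<in> borel_measurable M"
    and i: "\<And>n. integrable M (\<lambda>\<omega>. (S n \<omega>)\<^sup>2)"
    and s: "0 < s2" and c: "c \<noteq> 0" and S: "variance_limit_and_clt M S s2"
  shows "variance_limit_and_clt M (\<lambda>n \<omega>. c * S n \<omega> + d n) (c\<^sup>2 * s2)"
proof -
  interpret prob_space M by fact
  have iS: "integrable M (S n)" for n by (rule square_integrable_imp_integrable; use i in simp)
  have ex: "expectation (\<lambda>\<omega>. c * S n \<omega> + d n) = c * expectation (S n) + d n" for n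
    using iS by (simp add: prob_space)
  have diff: "c * S n \<omega> + d n - (c * expectation (S n) + d n) = c * (S n \<omega> - expectation (S n))" for n \<omega>
    by (simp add: algebra_simps)
  have "(\<lambda>n. c\<^sup>2 * (variance (S n) / real n)) \<longlonglongrightarrow> c\<^sup>2 * s2"
    using S by (intro tendsto_intros) (simp add: variance_limit_and_clt_def)
  moreover have "(\<lambda>n. CLINT \<omega>|M. iexp (\<theta> * (c * (S n \<omega> - expectation (S n)) / sqrt (real n))))
      \<longlonglongrightarrow> exp (- (c\<^sup>2 * s2 * \<theta>\<^sup>2) / 2)" for \<theta>
  proof -
    have "(\<lambda>n. CLINT \<omega>|M. iexp ((\<theta> * c) * ((S n \<omega> - expectation (S n)) / sqrt (real n))))
      \<longlonglongrightarrow> exp (- (s2 * (\<theta> * c)\<^sup>2) / 2)"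
      using S unfolding variance_limit_and_clt_iff[OF P assms(2) s] by blast
    then show ?thesis by (simp add: power_mult_distrib mult_ac)
  qed
  ultimately show ?thesis
    using s c variance_limit_and_clt_iff[OF P, of "\<lambda>n \<omega>. c * S n \<omega> + d n" "c\<^sup>2 * s2"]
    by (simp only: ex diff) (simp add: power_mult_distrib)
qed

text \<open>
  After division by \<open>sqrt n\<close> an error that is bounded in quadratic mean tends to 0 in
  \<open>L\<^sup>2\<close>. It changes the standard deviation, a seminorm, by a null sequence, and
  likewise the characteristic functions.
\<close>

lemma variance_limit_and_clt_transfer:
  fixes S T :: "nat \<Rightarrow> 'a \<Rightarrow> real"
  assumes P: "prob_space M"
    and mS[measurable]: "\<And>n. S n \<in> borel_measurable M" and mT[measurable]: "\<And>n. T n \<in> borel_measurable M"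
    and iS: "\<And>n. integrable M (\<lambda>\<omega>. (S n \<omega>)\<^sup>2)" and iT: "\<And>n. integrable M (\<lambda>\<omega>. (T n \<omega>)\<^sup>2)"
    and B: "\<And>n. prob_space.expectation M (\<lambda>\<omega>. (T n \<omega> - S n \<omega>)\<^sup>2) \<le> B"
    and s: "0 < s2" and S: "variance_limit_and_clt M S s2"
  shows "variance_limit_and_clt M T s2"
proof -
  interpret prob_space M by fact
  define \<epsilon> where "\<epsilon> n = sqrt B / sqrt (real n)" for n
  have \<epsilon>0: "\<epsilon> \<longlonglongrightarrow> 0" unfolding \<epsilon>_def
    by (rule tendsto_divide_0[OF tendsto_const])
      (intro filterlim_at_top_imp_at_infinity filterlim_compose[OF sqrt_at_top] filterlim_real_sequentially)
  have iD: "integrable M (\<lambda>\<omega>. (T n \<omega> - S n \<omega>)\<^sup>2)" for n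
    by (rule integrable_square_diff) (use iS iT in auto)
  have lS: "integrable M (S n)" and lT: "integrable M (T n)" for n
    by (rule square_integrable_imp_integrable; use iS iT in simp)+
  have vD: "sqrt (variance (\<lambda>\<omega>. T n \<omega> - S n \<omega>)) \<le> sqrt B" for n
    using variance_le_square[OF _ iD[of n]] B[of n] by (intro real_sqrt_le_mono) auto
  have S1: "(\<lambda>n. variance (S n) / real n) \<longlonglongrightarrow> s2"
    using S by (simp add: variance_limit_and_clt_def)
  then have "(\<lambda>n. sqrt (variance (S n) / real n)) \<longlonglongrightarrow> sqrt s2" by (rule tendsto_real_sqrt)
  moreover have "(\<lambda>n. sqrt (variance (T n) / real n) - sqrt (variance (S n) / real n)) \<longlonglongrightarrow> 0"
  proof (rule Lim_null_comparison[OF always_eventually \<epsilon>0], rule allI)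
    fix n
    have "\<bar>sqrt (variance (T n)) - sqrt (variance (S n))\<bar> \<le> sqrt B"
      using sqrt_variance_diff_le[OF mT mS iT iS, of n n] vD[of n] by (rule order.trans)
    then have "\<bar>(sqrt (variance (T n)) - sqrt (variance (S n))) / sqrt (real n)\<bar> \<le> \<epsilon> n"
      unfolding \<epsilon>_def abs_divide by (simp add: divide_right_mono)
    then show "norm (sqrt (variance (T n) / real n) - sqrt (variance (S n) / real n)) \<le> \<epsilon> n"
      by (simp add: real_sqrt_divide diff_divide_distrib)
  qed
  ultimately have "(\<lambda>n. sqrt (variance (T n) / real n)) \<longlonglongrightarrow> sqrt s2"
    by (rule Lim_transform)
  then have "(\<lambda>n. (sqrt (variance (T n) / real n))\<^sup>2) \<longlonglongrightarrow> (sqrt s2)\<^sup>2" by (rule tendsto_power)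
  then have T1: "(\<lambda>n. variance (T n) / real n) \<longlonglongrightarrow> s2"
    using s by (simp add: variance_positive)
  have T2: "(\<lambda>n. CLINT \<omega>|M. iexp (\<theta> * ((T n \<omega> - expectation (T n)) / sqrt (real n))))
      \<longlonglongrightarrow> exp (- (s2 * \<theta>\<^sup>2) / 2)" for \<theta>
  proof (rule Lim_transform)
    show "(\<lambda>n. CLINT \<omega>|M. iexp (\<theta> * ((S n \<omega> - expectation (S n)) / sqrt (real n))))
      \<longlonglongrightarrow> exp (- (s2 * \<theta>\<^sup>2) / 2)"
      using S unfolding variance_limit_and_clt_iff[OF P mS s] by blast
    have "(\<lambda>n. \<bar>\<theta>\<bar> * \<epsilon> n) \<longlonglongrightarrow> 0" using tendsto_mult_right_zero[OF \<epsilon>0] .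
    then show "(\<lambda>n. (CLINT \<omega>|M. iexp (\<theta> * ((T n \<omega> - expectation (T n)) / sqrt (real n))))
        - (CLINT \<omega>|M. iexp (\<theta> * ((S n \<omega> - expectation (S n)) / sqrt (real n))))) \<longlonglongrightarrow> 0"
    proof (rule Lim_null_comparison[OF always_eventually, rotated], intro allI)
      fix n
      let ?D = "\<lambda>\<omega>. T n \<omega> - S n \<omega>"
      have "cmod ((CLINT \<omega>|M. iexp (\<theta> * ((T n \<omega> - expectation (T n)) / sqrt (real n))))
        - (CLINT \<omega>|M. iexp (\<theta> * ((S n \<omega> - expectation (S n)) / sqrt (real n)))))
        \<le> expectation (\<lambda>\<omega>. \<bar>\<theta> * ((T n \<omega> - expectation (T n)) / sqrt (real n))
            - \<theta> * ((S n \<omega> - expectation (S n)) / sqrt (real n))\<bar>)"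
        using lS[of n] lT[of n] by (intro iexp_expectation_diff) auto
      also have "\<dots> = expectation (\<lambda>\<omega>. \<bar>\<theta>\<bar> / sqrt (real n) * \<bar>?D \<omega> - expectation ?D\<bar>)"
      proof (rule Bochner_Integration.integral_cong[OF refl])
        fix \<omega>
        have "\<theta> * ((T n \<omega> - expectation (T n)) / sqrt (real n))
            - \<theta> * ((S n \<omega> - expectation (S n)) / sqrt (real n))
          = \<theta> / sqrt (real n) * (?D \<omega> - expectation ?D)"
          using lS[of n] lT[of n] by (simp add: algebra_simps diff_divide_distrib add_divide_distrib)
        then show "\<bar>\<theta> * ((T n \<omega> - expectation (T n)) / sqrt (real n))
            - \<theta> * ((S n \<omega> - expectation (S n)) / sqrt (real n))\<bar>
          = \<bar>\<theta>\<bar> / sqrt (real n) * \<bar>?D \<omega> - expectation ?D\<bar>"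
          by (simp add: abs_mult abs_divide)
      qed
      also have "\<dots> = \<bar>\<theta>\<bar> / sqrt (real n) * expectation (\<lambda>\<omega>. \<bar>?D \<omega> - expectation ?D\<bar>)" by simp
      also have "\<dots> \<le> \<bar>\<theta>\<bar> / sqrt (real n) * sqrt B"
      proof (intro mult_left_mono)
        have "expectation (\<lambda>\<omega>. \<bar>?D \<omega> - expectation ?D\<bar>) \<le> sqrt (variance ?D)"
          using iD by (intro expectation_abs_le_sqrt centered_square_integrable) auto
        then show "expectation (\<lambda>\<omega>. \<bar>?D \<omega> - expectation ?D\<bar>) \<le> sqrt B" using vD[of n] by linarith
      qed simp
      finally show "norm ((CLINT \<omega>|M. iexp (\<theta> * ((T n \<omega> - expectation (T n)) / sqrt (real n))))
        - (CLINT \<omega>|M. iexp (\<theta> * ((S n \<omega> - expectation (S n)) / sqrt (real n))))) \<le> \<bar>\<theta>\<bar> * \<epsilon> n"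
        by (simp add: \<epsilon>_def)
    qed
  qed
  from T1 T2 show ?thesis
    unfolding variance_limit_and_clt_iff[OF P mT s] by blast
qed

lemma variance_limit_and_clt_affine_AE:
  fixes S :: "nat \<Rightarrow> 'a \<Rightarrow> real"
  assumes P: "prob_space M" and mS [measurable]: "\<And>n. S n \<in> borel_measurable M"
    and iS: "\<And>n. integrable M (\<lambda>\<omega>. (S n \<omega>)\<^sup>2)" and s2: "0 < s2" and S: "variance_limit_and_clt M S s2"
    and c: "c \<noteq> 0" and mZ [measurable]: "\<And>n. Z n \<in> borel_measurable M"
    and eq: "AE \<omega> in M. \<forall>n. Z n \<omega> = c * S n \<omega> + d n"
  shows "variance_limit_and_clt M Z (c\<^sup>2 * s2)"
proof -
  interpret prob_space M by fact
  let ?S = "\<lambda>n \<omega>. c * S n \<omega> + d n"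
  have sq: "integrable M (\<lambda>\<omega>. (?S n \<omega>)\<^sup>2)" for n
    using integrable_square_add[of "\<lambda>\<omega>. c * S n \<omega>" "\<lambda>\<omega>. d n"] iS[of n] by (simp add: power_mult_distrib)
  have ae: "AE \<omega> in M. Z n \<omega> = ?S n \<omega>" for n using eq by eventually_elim simp
  show ?thesis
  proof (rule variance_limit_and_clt_transfer[OF P _ mZ sq])
    show "?S n \<in> borel_measurable M" for n by measurable
    show "0 < c\<^sup>2 * s2" using c s2 by simp
    show "variance_limit_and_clt M ?S (c\<^sup>2 * s2)" by (rule variance_limit_and_clt_affine[OF P mS iS s2 c S])
    show "integrable M (\<lambda>\<omega>. (Z n \<omega>)\<^sup>2)" for n
    proof -
      have "AE \<omega> in M. (?S n \<omega>)\<^sup>2 = (Z n \<omega>)\<^sup>2" using ae[of n] by eventually_elim simp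
      then show ?thesis using sq[of n] by (subst integrable_cong_AE[symmetric, where f="\<lambda>\<omega>. (?S n \<omega>)\<^sup>2"]) auto
    qed
    show "expectation (\<lambda>\<omega>. (Z n \<omega> - ?S n \<omega>)\<^sup>2) \<le> 0" for n
    proof -
      have "AE \<omega> in M. (Z n \<omega> - ?S n \<omega>)\<^sup>2 = 0" using ae[of n] by eventually_elim simp
      then have "expectation (\<lambda>\<omega>. (Z n \<omega> - ?S n \<omega>)\<^sup>2) = expectation (\<lambda>\<omega>. 0)" by (intro integral_cong_AE) auto
      then show ?thesis by simp
    qed
  qed
qed

section \<open>Functionals of an i.i.d. family\<close>

definition depends_on :: "'i set \<Rightarrow> (('i \<Rightarrow> 'b) \<Rightarrow> 'c) \<Rightarrow> bool" where
  "depends_on K F \<longleftrightarrow> (\<forall>x y. (\<forall>i\<in>K. x i = y i) \<longrightarrow> F x = F y)"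

lemma depends_onD:
  assumes "depends_on K F" "\<And>i. i \<in> K \<Longrightarrow> x i = y i"
  shows "F x = F y"
  by (rule assms(1)[unfolded depends_on_def, rule_format]) (rule assms(2))

lemma depends_onI:
  assumes "\<And>x y. (\<And>i. i \<in> K \<Longrightarrow> x i = y i) \<Longrightarrow> F x = F y"
  shows "depends_on K F"
  unfolding depends_on_def by (intro allI impI, rule assms, erule bspec)

locale iid_family = prob_space M for M :: "'a measure" +
  fixes N :: "'b measure" and Q :: "'b measure" and Y :: "'i \<Rightarrow> 'a \<Rightarrow> 'b"
  assumes indep: "indep_vars (\<lambda>_. N) Y UNIV"
    and law: "\<And>i. distr M N (Y i) = Q"
begin

lemma rv [measurable]: "Y i \<in> M \<rightarrow>\<^sub>M N"
  using indep by (auto simp: indep_vars_def)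

lemma path_measurable [measurable]: "(\<lambda>\<omega> i. Y i \<omega>) \<in> M \<rightarrow>\<^sub>M PiM UNIV (\<lambda>_. N)"
  by (rule measurable_PiM_single') (auto intro: measurable_space[OF rv])

lemma sets_Q [measurable_cong]: "sets Q = sets N"
  unfolding law[symmetric, of undefined] by simp

lemma prob_space_Q: "prob_space Q"
  unfolding law[symmetric, of undefined] by (rule prob_space_distr[OF rv])

lemma prob_space_PiM_Q: "prob_space (PiM UNIV (\<lambda>_. Q))"
  by (rule prob_space_PiM) (rule prob_space_Q)

lemma path_law: "distr M (PiM UNIV (\<lambda>_. N)) (\<lambda>\<omega> i. Y i \<omega>) = PiM UNIV (\<lambda>_. Q)"
  using indep_vars_iff_distr_eq_PiM[where I=UNIV and M'="\<lambda>_. N" and X=Y] indep by (simp add: law restrict_UNIV)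

lemma expectation_path:
  fixes F :: "('i \<Rightarrow> 'b) \<Rightarrow> 'c::{banach, second_countable_topology}"
  assumes "F \<in> borel_measurable (PiM UNIV (\<lambda>_. N))"
  shows "(\<integral>\<omega>. F (\<lambda>i. Y i \<omega>) \<partial>M) = (\<integral>x. F x \<partial>PiM UNIV (\<lambda>_. Q))"
  unfolding path_law[symmetric] integral_distr[OF path_measurable assms] ..

text \<open>
  Every one-sided chain of clocks, read in either direction and possibly transformed by
  \<open>z\<close>, is again an i.i.d. sequence; this reduces all computations to sequences
  indexed by \<open>nat\<close>.
\<close>

lemma iid_reindex:
  assumes "inj \<sigma>" and z: "z \<in> N \<rightarrow>\<^sub>M N'"
  shows "iid_family M N' (distr Q N' z) (\<lambda>j \<omega>. z (Y (\<sigma> j) \<omega>))"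
proof
  have "indep_vars (\<lambda>_. N) (\<lambda>j \<omega>. Y (\<sigma> j) \<omega>) UNIV"
  proof (subst indep_vars_iff_distr_eq_PiM)
    let ?R = "PiM UNIV (\<lambda>_. N) :: ('c \<Rightarrow> 'b) measure" and ?S = "PiM UNIV (\<lambda>_. N) :: ('i \<Rightarrow> 'b) measure"
    have m: "(\<lambda>x j. x (\<sigma> j)) \<in> ?S \<rightarrow>\<^sub>M ?R"
      by (rule measurable_PiM_single') (auto simp: space_PiM PiE_iff)
    have "distr M ?R (\<lambda>\<omega> j. Y (\<sigma> j) \<omega>) = distr (distr M ?S (\<lambda>\<omega> i. Y i \<omega>)) ?R (\<lambda>x j. x (\<sigma> j))"
      by (subst distr_distr) (auto simp: comp_def intro: m)
    also have "\<dots> = distr (PiM UNIV (\<lambda>_. Q)) (PiM UNIV (\<lambda>_. Q)) (\<lambda>x j. x (\<sigma> j))"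
      by (intro distr_cong path_law) (auto intro!: sets_PiM_cong simp: sets_Q)
    also have "\<dots> = PiM UNIV (\<lambda>_. Q)"
      using distr_PiM_reindex[of UNIV "\<lambda>_. Q" \<sigma> UNIV] \<open>inj \<sigma>\<close> prob_space_Q by (simp add: restrict_UNIV)
    finally show "distr M (PiM UNIV (\<lambda>_. N)) (\<lambda>x. \<lambda>i\<in>UNIV. Y (\<sigma> i) x)
        = PiM UNIV (\<lambda>i. distr M N (Y (\<sigma> i)))"
      by (simp add: law restrict_UNIV)
  qed auto
  then show "indep_vars (\<lambda>_. N') (\<lambda>j \<omega>. z (Y (\<sigma> j) \<omega>)) UNIV"
    using z by (rule indep_vars_compose2)
next
  fix j show "distr M N' (\<lambda>\<omega>. z (Y (\<sigma> j) \<omega>)) = distr Q N' z"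
    unfolding law[symmetric, of "\<sigma> j"] using z by (subst distr_distr) (auto simp: comp_def)
qed

lemma expectation_reindex:
  fixes F :: "('i \<Rightarrow> 'b) \<Rightarrow> 'c::{banach, second_countable_topology}"
  assumes "inj \<sigma>" and F: "F \<in> borel_measurable (PiM UNIV (\<lambda>_. N))"
  shows "(\<integral>\<omega>. F (\<lambda>i. Y (\<sigma> i) \<omega>) \<partial>M) = (\<integral>\<omega>. F (\<lambda>i. Y i \<omega>) \<partial>M)"
proof -
  interpret R: iid_family M N "distr Q N (\<lambda>x. x)" "\<lambda>j \<omega>. Y (\<sigma> j) \<omega>"
    by (rule iid_reindex[OF assms(1)]) simp
  have "distr Q N (\<lambda>x. x) = Q" by (rule distr_id2) (simp add: sets_Q)
  then show ?thesis using R.expectation_path[OF F] expectation_path[OF F] by simp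
qed

text \<open>
  Replacing one coordinate by an independent copy does not change the law of the family, so this
  coordinate can be integrated out last.
\<close>

lemma expectation_condition:
  fixes F :: "('i \<Rightarrow> 'b) \<Rightarrow> real"
  assumes F[measurable]: "F \<in> borel_measurable (PiM UNIV (\<lambda>_. N))" and B: "\<And>x. \<bar>F x\<bar> \<le> B"
  shows "(\<integral>\<omega>. F (\<lambda>i. Y i \<omega>) \<partial>M) = (\<integral>s. (\<integral>\<omega>. F ((\<lambda>i. Y i \<omega>)(v := s)) \<partial>M) \<partial>Q)"
proof -
  let ?P = "PiM UNIV (\<lambda>_. Q) :: ('i \<Rightarrow> 'b) measure"
  interpret Q: prob_space Q by (rule prob_space_Q)
  interpret PP: prob_space ?P by (rule prob_space_PiM_Q)
  interpret QP: pair_prob_space Q ?P ..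
  have up[measurable]: "(\<lambda>p. (snd p)(v := fst p)) \<in> N \<Otimes>\<^sub>M PiM UNIV (\<lambda>_. N) \<rightarrow>\<^sub>M PiM UNIV (\<lambda>_. N)"
    by (rule measurable_PiM_single') (auto simp: fun_upd_def space_pair_measure space_PiM PiE_iff)
  have eq: "distr (Q \<Otimes>\<^sub>M ?P) ?P (\<lambda>(x, X). X(v := x)) = ?P"
    using distr_pair_PiM_eq_PiM[of UNIV "\<lambda>_. Q" v] prob_space_Q by simp
  have "(\<integral>\<omega>. F (\<lambda>i. Y i \<omega>) \<partial>M) = (\<integral>x. F x \<partial>distr (Q \<Otimes>\<^sub>M ?P) ?P (\<lambda>(x, X). X(v := x)))"
    unfolding eq by (rule expectation_path) fact
  also have "\<dots> = (\<integral>p. F ((snd p)(v := fst p)) \<partial>(Q \<Otimes>\<^sub>M ?P))"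
    by (subst integral_distr) (auto simp: case_prod_beta)
  also have "\<dots> = (\<integral>s. (\<integral>x. F (x(v := s)) \<partial>?P) \<partial>Q)"
  proof -
    have "integrable (Q \<Otimes>\<^sub>M ?P) (\<lambda>p. F ((snd p)(v := fst p)))"
      by (rule QP.integrable_const_bound[of _ B]) (use B in auto)
    from QP.integral_fst'[OF this] show ?thesis by (simp only: fst_conv snd_conv)
  qed
  also have "\<dots> = (\<integral>s. (\<integral>\<omega>. F ((\<lambda>i. Y i \<omega>)(v := s)) \<partial>M) \<partial>Q)"
  proof (rule Bochner_Integration.integral_cong[OF refl])
    fix s assume s: "s \<in> space Q"
    then have "s \<in> space N" using sets_eq_imp_space_eq[OF sets_Q] by simp
    then have "(\<lambda>x. x(v := s)) \<in> PiM UNIV (\<lambda>_. N) \<rightarrow>\<^sub>M PiM UNIV (\<lambda>_. N)"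
      by (intro measurable_PiM_single') (auto simp: fun_upd_def space_PiM PiE_iff)
    then have "(\<lambda>x. F (x(v := s))) \<in> borel_measurable (PiM UNIV (\<lambda>_. N))"
      by measurable
    from expectation_path[OF this] show "(\<integral>x. F (x(v := s)) \<partial>?P) = (\<integral>\<omega>. F ((\<lambda>i. Y i \<omega>)(v := s)) \<partial>M)"
      by simp
  qed
  finally show ?thesis .
qed

text \<open>
  A functional of the coordinates in \<open>K j\<close> can be computed from the restricted
  family, and restrictions to disjoint sets are independent.
\<close>

lemma indep_vars_local:
  fixes F :: "'j \<Rightarrow> ('i \<Rightarrow> 'b) \<Rightarrow> 'c::topological_space"
  assumes disj: "disjoint_family_on K L"
    and F: "\<And>j. j \<in> L \<Longrightarrow> F j \<in> PiM UNIV (\<lambda>_. N) \<rightarrow>\<^sub>M borel"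
    and dep: "\<And>j. j \<in> L \<Longrightarrow> depends_on (K j) (F j)"
  shows "indep_vars (\<lambda>_. borel) (\<lambda>j \<omega>. F j (\<lambda>i. Y i \<omega>)) L"
proof -
  obtain \<omega>0 where "\<omega>0 \<in> space M" using not_empty by blast
  then have d: "Y i \<omega>0 \<in> space N" for i by (rule measurable_space[OF rv])
  \<comment> \<open>The coordinates outside \<open>K j\<close> are filled with the values at a fixed sample
    point.\<close>
  define ext where "ext j x = (\<lambda>i. if i \<in> K j then x i else Y i \<omega>0)" for j and x :: "'i \<Rightarrow> 'b"
  have ext: "ext j \<in> PiM (K j) (\<lambda>_. N) \<rightarrow>\<^sub>M PiM UNIV (\<lambda>_. N)" for j
    unfolding ext_def
  proof (rule measurable_PiM_single')
    fix i show "(\<lambda>x. if i \<in> K j then x i else Y i \<omega>0) \<in> PiM (K j) (\<lambda>_. N) \<rightarrow>\<^sub>M N"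
      using d by (cases "i \<in> K j") auto
  next
    show "(\<lambda>x i. if i \<in> K j then x i else Y i \<omega>0) \<in> space (PiM (K j) (\<lambda>_. N)) \<rightarrow> UNIV \<rightarrow>\<^sub>E space N"
      using d by (auto simp: space_PiM PiE_iff)
  qed
  have "indep_vars (\<lambda>j. PiM (K j) (\<lambda>_. N)) (\<lambda>j \<omega>. restrict (\<lambda>i. Y i \<omega>) (K j)) L"
    by (rule indep_vars_restrict[OF indep _ disj]) simp
  then have "indep_vars (\<lambda>_. borel) (\<lambda>j \<omega>. F j (ext j (restrict (\<lambda>i. Y i \<omega>) (K j)))) L"
    by (rule indep_vars_compose2) (use F ext in \<open>auto intro: measurable_compose\<close>)
  moreover have "F j (ext j (restrict (\<lambda>i. Y i \<omega>) (K j))) = F j (\<lambda>i. Y i \<omega>)" if "j \<in> L" for j \<omega>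
    by (rule depends_onD[OF dep[OF that]]) (simp add: ext_def)
  ultimately show ?thesis
    by (subst indep_vars_cong[where Y="\<lambda>j \<omega>. F j (ext j (restrict (\<lambda>i. Y i \<omega>) (K j)))" and J=L]) auto
qed

lemma expectation_local_mult:
  fixes F G :: "('i \<Rightarrow> 'b) \<Rightarrow> real"
  assumes JK: "J \<inter> K = {}" and dF: "depends_on J F" and dG: "depends_on K G"
    and F[measurable]: "F \<in> borel_measurable (PiM UNIV (\<lambda>_. N))"
    and G[measurable]: "G \<in> borel_measurable (PiM UNIV (\<lambda>_. N))"
    and B: "\<And>x. \<bar>F x\<bar> \<le> B" "\<And>x. \<bar>G x\<bar> \<le> B"
  shows "expectation (\<lambda>\<omega>. F (\<lambda>i. Y i \<omega>) * G (\<lambda>i. Y i \<omega>))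
    = expectation (\<lambda>\<omega>. F (\<lambda>i. Y i \<omega>)) * expectation (\<lambda>\<omega>. G (\<lambda>i. Y i \<omega>))"
proof (rule indep_var_lebesgue_integral)
  have "indep_vars (\<lambda>_. borel) (\<lambda>j \<omega>. case_bool F G j (\<lambda>i. Y i \<omega>)) UNIV"
    using assms by (intro indep_vars_local[of "case_bool J K"])
      (auto simp: disjoint_family_on_def split: bool.split)
  then show "indep_var borel (\<lambda>\<omega>. F (\<lambda>i. Y i \<omega>)) borel (\<lambda>\<omega>. G (\<lambda>i. Y i \<omega>))"
    unfolding indep_var_def by (rule iffD1[OF indep_vars_cong, rotated -1]) (auto split: bool.split)
  show "integrable M (\<lambda>\<omega>. F (\<lambda>i. Y i \<omega>))" "integrable M (\<lambda>\<omega>. G (\<lambda>i. Y i \<omega>))"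
    by (rule integrable_const_bound[of _ B]; use B in simp)+
qed

end

text \<open>
  The clocks of the edges are indexed by two-element sets; this passes to their left endpoints.
\<close>

lemma (in prob_space) indep_vars_reindex_range:
  assumes f: "inj f" and X: "indep_vars (\<lambda>_. N) X (range f)"
  shows "indep_vars (\<lambda>_. N) (\<lambda>i. X (f i)) UNIV"
proof -
  let ?F = "\<lambda>i. {X i -` A \<inter> space M | A. A \<in> sets N}"
  have m: "X (f i) \<in> M \<rightarrow>\<^sub>M N" for i by (rule bspec[OF conjunct1[OF X[unfolded indep_vars_def2]] rangeI])
  have F: "indep_sets ?F (range f)" by (rule conjunct2[OF X[unfolded indep_vars_def2]])
  have "indep_sets (\<lambda>i. ?F (f i)) UNIV"
  proof (rule indep_setsI)
    show "?F (f i) \<subseteq> events" for i by (rule bspec[OF conjunct1[OF F[unfolded indep_sets_def]] rangeI])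
    fix A J assume J: "J \<noteq> {}" "finite J" and A: "\<forall>j\<in>J. A j \<in> ?F (f j)"
    have inv: "inv f (f j) = j" for j by (rule inv_f_f[OF f])
    have "prob (\<Inter>i\<in>f ` J. A (inv f i)) = (\<Prod>i\<in>f ` J. prob (A (inv f i)))"
    proof (rule indep_setsD[OF F])
      show "\<forall>i\<in>f ` J. A (inv f i) \<in> ?F i"
      proof
        fix i assume "i \<in> f ` J"
        then obtain j where i: "i = f j" and j: "j \<in> J" by blast
        show "A (inv f i) \<in> ?F i" unfolding i inv by (rule bspec[OF A j])
      qed
    qed (use J in auto)
    moreover have "(\<Prod>i\<in>f ` J. prob (A (inv f i))) = (\<Prod>j\<in>J. prob (A j))"
      by (subst prod.reindex[OF inj_on_subset[OF f subset_UNIV]]) (simp add: comp_def inv)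
    ultimately show "prob (\<Inter>j\<in>J. A j) = (\<Prod>j\<in>J. prob (A j))"
      by (simp only: image_image inv)
  qed
  then show ?thesis unfolding indep_vars_def2 using m by blast
qed

section \<open>Alternating sums over intervals: covariances\<close>

text \<open>
  The pair \<open>(a, m)\<close> stands for the interval \<open>{a..<a + m}\<close>.
\<close>

definition intervals :: "int \<Rightarrow> int \<Rightarrow> (int \<times> nat) set" where
  "intervals lo hi = {(a, m). 1 \<le> m \<and> lo \<le> a \<and> a + int m \<le> hi}"

lemma finite_intervals [simp]: "finite (intervals lo hi)"
proof (rule finite_subset)
  show "intervals lo hi \<subseteq> {lo..hi} \<times> {0..nat (hi - lo)}"
    by (auto simp: intervals_def)
qed simp

definition meets :: "int \<times> nat \<Rightarrow> int \<times> nat \<Rightarrow> bool" where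
  "meets I J \<longleftrightarrow> {fst I..<fst I + int (snd I)} \<inter> {fst J..<fst J + int (snd J)} \<noteq> {}"

lemma meets_iff: "1 \<le> k \<Longrightarrow> 1 \<le> l \<Longrightarrow> meets (a, k) (b, l) \<longleftrightarrow> a < b + int l \<and> b < a + int k"
proof
  assume "1 \<le> k" "1 \<le> l" "a < b + int l \<and> b < a + int k"
  then have "max a b \<in> {a..<a + int k} \<inter> {b..<b + int l}" by auto
  then show "meets (a, k) (b, l)" unfolding meets_def by auto
qed (auto simp: meets_def)

text \<open>
  A translation-invariant family of events, one for each interval and depending on the variables
  in this interval only. The base 16 is large enough that covariances remain summable after the
  loss of a square root in \<open>abs_cov_le\<close> and a count of the possible relative
  positions of two intervals.
\<close>

locale interval_pattern = iid_family M N Q Y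
  for M :: "'a measure" and N Q :: "'b measure" and Y :: "int \<Rightarrow> 'a \<Rightarrow> 'b" +
  fixes pattern :: "int \<Rightarrow> nat \<Rightarrow> (int \<Rightarrow> 'b) \<Rightarrow> bool" and C :: real
  assumes pattern_measurable [measurable]: "\<And>a m. Measurable.pred (PiM UNIV (\<lambda>_. N)) (pattern a m)"
    and pattern_local: "\<And>a m. depends_on {a..<a + int m} (pattern a m)"
    and pattern_shift: "\<And>a b m x. pattern (a + b) m x \<longleftrightarrow> pattern a m (\<lambda>i. x (b + i))"
    and pattern_small: "\<And>m. prob {\<omega> \<in> space M. pattern 0 m (\<lambda>i. Y i \<omega>)} \<le> C / 16 ^ m"
begin

definition U :: "int \<times> nat \<Rightarrow> 'a \<Rightarrow> real" where
  "U I \<omega> = of_bool (pattern (fst I) (snd I) (\<lambda>i. Y i \<omega>))"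

definition \<rho> :: "nat \<Rightarrow> real" where
  "\<rho> m = prob {\<omega> \<in> space M. pattern 0 m (\<lambda>i. Y i \<omega>)}"

lemma U_measurable [measurable]: "U I \<in> borel_measurable M"
  unfolding U_def by measurable

lemma U_integrable [simp]: "integrable M (U I)"
  by (rule integrable_const_bound[of _ 1]) (auto simp: U_def)

lemma UU_integrable [simp]: "integrable M (\<lambda>\<omega>. U I \<omega> * U J \<omega>)"
  by (rule integrable_const_bound[of _ 1]) (auto simp: U_def)

lemma expectation_U: "expectation (U (a, m)) = \<rho> m"
proof -
  have "expectation (U (a, m)) = expectation (\<lambda>\<omega>. of_bool (pattern 0 m (\<lambda>i. Y (a + i) \<omega>)) :: real)"
    unfolding U_def fst_conv snd_conv using pattern_shift[of 0 a m] by simp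
  also have "\<dots> = expectation (\<lambda>\<omega>. of_bool (pattern 0 m (\<lambda>i. Y i \<omega>)) :: real)"
    by (rule expectation_reindex[where F="\<lambda>x. of_bool (pattern 0 m x)"]) (auto simp: inj_def)
  also have "\<dots> = \<rho> m" unfolding \<rho>_def by (rule expectation_of_bool)
  finally show ?thesis .
qed

lemma \<rho>_bounds: "0 \<le> \<rho> m" "\<rho> m \<le> 1" "\<rho> m \<le> C / 16 ^ m"
  using pattern_small[of m] by (auto simp: \<rho>_def)

lemma C_nonneg: "0 \<le> C" using \<rho>_bounds[of 0] by simp

definition cov :: "int \<times> nat \<Rightarrow> int \<times> nat \<Rightarrow> real" where
  "cov I J = expectation (\<lambda>\<omega>. U I \<omega> * U J \<omega>) - \<rho> (snd I) * \<rho> (snd J)"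

lemma expectation_UU_disjoint:
  assumes "\<not> meets I J"
  shows "expectation (\<lambda>\<omega>. U I \<omega> * U J \<omega>) = \<rho> (snd I) * \<rho> (snd J)"
proof -
  have d: "depends_on {fst I..<fst I + int (snd I)} (\<lambda>x. of_bool (pattern (fst I) (snd I) x) :: real)" for I :: "int \<times> nat"
    by (rule depends_onI, rule arg_cong[where f=of_bool], rule depends_onD[OF pattern_local]) auto
  have "expectation (\<lambda>\<omega>. U I \<omega> * U J \<omega>) = expectation (U I) * expectation (U J)"
    unfolding U_def using assms
    by (intro expectation_local_mult[where B=1, OF _ d d]) (auto simp: meets_def)
  then show ?thesis using expectation_U[of "fst I" "snd I"] expectation_U[of "fst J" "snd J"] by simp
qed

lemma cov_disjoint: "\<not> meets I J \<Longrightarrow> cov I J = 0"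
  by (simp add: cov_def expectation_UU_disjoint)

text \<open>
  Both products are at most the probability of the longer pattern, hence at most \<open>C / 16 ^
  max k l\<close>.
\<close>

lemma abs_cov_le: "\<bar>cov (a, k) (b, l)\<bar> \<le> C / 4 ^ (k + l)"
proof -
  have "expectation (\<lambda>\<omega>. U (a, k) \<omega> * U (b, l) \<omega>) \<le> expectation (U (a, k))"
    by (rule integral_mono[OF UU_integrable U_integrable]) (auto simp: U_def)
  moreover have "expectation (\<lambda>\<omega>. U (a, k) \<omega> * U (b, l) \<omega>) \<le> expectation (U (b, l))"
    by (rule integral_mono[OF UU_integrable U_integrable]) (auto simp: U_def)
  moreover have "0 \<le> expectation (\<lambda>\<omega>. U (a, k) \<omega> * U (b, l) \<omega>)"
    by (rule Bochner_Integration.integral_nonneg) (auto simp: U_def)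
  moreover have "\<rho> k * \<rho> l \<le> \<rho> k" "\<rho> k * \<rho> l \<le> \<rho> l" "0 \<le> \<rho> k * \<rho> l"
    using \<rho>_bounds by (auto intro: mult_left_le mult_left_le_one_le)
  ultimately have "\<bar>cov (a, k) (b, l)\<bar> \<le> \<rho> k" "\<bar>cov (a, k) (b, l)\<bar> \<le> \<rho> l"
    unfolding cov_def expectation_U snd_conv by linarith+
  then have "\<bar>cov (a, k) (b, l)\<bar> \<le> C / 16 ^ max k l"
    using \<rho>_bounds(3)[of k] \<rho>_bounds(3)[of l] by (auto simp: max_def)
  also have "\<dots> \<le> C / 4 ^ (k + l)"
  proof (rule divide_left_mono)
    have "(4::real) ^ (k + l) \<le> 4 ^ (2 * max k l)" by (rule power_increasing) auto
    then show "(4::real) ^ (k + l) \<le> 16 ^ max k l" by (simp add: power_mult)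
  qed (use C_nonneg in auto)
  finally show ?thesis .
qed

definition altsum :: "(int \<times> nat) set \<Rightarrow> 'a \<Rightarrow> real" where
  "altsum A \<omega> = (\<Sum>I\<in>A. (-1) ^ snd I * U I \<omega>)"

lemma altsum_measurable [measurable]: "altsum A \<in> borel_measurable M"
  unfolding altsum_def by measurable

lemma altsum_abs_le: "finite A \<Longrightarrow> \<bar>altsum A \<omega>\<bar> \<le> real (card A)"
  unfolding altsum_def
  using sum_bounded_above[of A "\<lambda>I. \<bar>(-1) ^ snd I * U I \<omega>\<bar>" 1]
  by (intro order.trans[OF sum_abs]) (auto simp: abs_mult power_abs U_def)

lemma altsum_square_integrable: "finite A \<Longrightarrow> integrable M (\<lambda>\<omega>. (altsum A \<omega>)\<^sup>2)"
  by (rule integrable_const_bound[of _ "(real (card A))\<^sup>2"])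
    (auto intro!: always_eventually abs_le_square_iff[THEN iffD1] altsum_abs_le simp: abs_of_nonneg[of "real _"])

lemma altsum_integrable: "finite A \<Longrightarrow> integrable M (altsum A)"
  by (rule integrable_const_bound[of _ "real (card A)"]) (auto intro!: always_eventually altsum_abs_le)

lemma expectation_altsum: "expectation (altsum A) = (\<Sum>I\<in>A. (-1) ^ snd I * \<rho> (snd I))"
proof -
  have "expectation (altsum A) = (\<Sum>I\<in>A. expectation (\<lambda>\<omega>. (-1) ^ snd I * U I \<omega>))"
    unfolding altsum_def by (rule Bochner_Integration.integral_sum) simp
  also have "\<dots> = (\<Sum>I\<in>A. (-1) ^ snd I * \<rho> (snd I))"
    using expectation_U by (intro sum.cong) (auto simp: split_paired_all)
  finally show ?thesis .
qed

lemma expectation_altsum_mult: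
  "expectation (\<lambda>\<omega>. altsum A \<omega> * altsum B \<omega>)
    = (\<Sum>I\<in>A. \<Sum>J\<in>B. (-1) ^ (snd I + snd J) * expectation (\<lambda>\<omega>. U I \<omega> * U J \<omega>))"
proof -
  have "altsum A \<omega> * altsum B \<omega> = (\<Sum>I\<in>A. \<Sum>J\<in>B. (-1) ^ (snd I + snd J) * (U I \<omega> * U J \<omega>))" for \<omega>
    unfolding altsum_def sum_product by (intro sum.cong) (auto simp: power_add mult_ac)
  then have "expectation (\<lambda>\<omega>. altsum A \<omega> * altsum B \<omega>)
      = expectation (\<lambda>\<omega>. \<Sum>I\<in>A. \<Sum>J\<in>B. (-1) ^ (snd I + snd J) * (U I \<omega> * U J \<omega>))" by simp
  also have "\<dots> = (\<Sum>I\<in>A. \<Sum>J\<in>B. (-1) ^ (snd I + snd J) * expectation (\<lambda>\<omega>. U I \<omega> * U J \<omega>))"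
    by (subst Bochner_Integration.integral_sum, simp, intro sum.cong refl,
        subst Bochner_Integration.integral_sum) auto
  finally show ?thesis .
qed

lemma variance_altsum:
  assumes "finite A"
  shows "variance (altsum A) = (\<Sum>I\<in>A. \<Sum>J\<in>A. (-1) ^ (snd I + snd J) * cov I J)"
proof -
  have "variance (altsum A) = expectation (\<lambda>\<omega>. altsum A \<omega> * altsum A \<omega>) - (expectation (altsum A))\<^sup>2"
    using variance_eq[OF altsum_integrable altsum_square_integrable, OF assms assms]
    by (simp add: power2_eq_square)
  also have "\<dots> = (\<Sum>I\<in>A. \<Sum>J\<in>A. (-1) ^ (snd I + snd J) * cov I J)"
    unfolding expectation_altsum_mult expectation_altsum power2_eq_square sum_product sum_subtractf[symmetric]
    by (intro sum.cong refl) (simp add: cov_def algebra_simps power_add)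
  finally show ?thesis .
qed

text \<open>
  At most \<open>k + l\<close> intervals of length \<open>l\<close> meet a given interval of
  length \<open>k\<close>; all others are independent of it.
\<close>

lemma sum_cov_row_le:
  assumes A: "finite A" "\<And>I. I \<in> A \<Longrightarrow> 1 \<le> snd I" and k: "1 \<le> k"
  shows "(\<Sum>J\<in>A. \<bar>cov (a, k) J\<bar>) \<le> C / 2 ^ k"
proof -
  define L where "L = Max (insert 0 (snd ` A))"
  let ?O = "SIGMA l:{1..L}. {a - int l + 1..a + int k - 1}"
  have L: "snd J \<le> L" if "J \<in> A" for J
    unfolding L_def using A that by (intro Max_ge) auto
  have "(\<Sum>J\<in>A. \<bar>cov (a, k) J\<bar>) = (\<Sum>J\<in>{J \<in> A. meets (a, k) J}. \<bar>cov (a, k) J\<bar>)"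
    using A by (intro sum.mono_neutral_right) (auto simp: cov_disjoint)
  also have "\<dots> = (\<Sum>p\<in>(\<lambda>J. (snd J, fst J)) ` {J \<in> A. meets (a, k) J}. \<bar>cov (a, k) (snd p, fst p)\<bar>)"
    by (subst sum.reindex) (auto simp: inj_on_def)
  also have "\<dots> \<le> (\<Sum>p\<in>?O. \<bar>cov (a, k) (snd p, fst p)\<bar>)"
  proof (rule sum_mono2)
    show "(\<lambda>J. (snd J, fst J)) ` {J \<in> A. meets (a, k) J} \<subseteq> ?O"
    proof (rule image_subsetI)
      fix J assume "J \<in> {J \<in> A. meets (a, k) J}"
      moreover obtain b l where bl: "J = (b, l)" by (cases J)
      ultimately have J: "(b, l) \<in> A" "meets (a, k) (b, l)" by auto
      have "1 \<le> l" "l \<le> L" using A(2)[OF J(1)] L[OF J(1)] by auto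
      then show "(snd J, fst J) \<in> ?O" using k J(2) unfolding bl by (auto simp: meets_iff)
    qed
  qed auto
  also have "\<dots> = (\<Sum>l=1..L. \<Sum>b=a - int l + 1..a + int k - 1. \<bar>cov (a, k) (b, l)\<bar>)"
    by (subst sum.Sigma) (auto simp: case_prod_beta)
  also have "\<dots> \<le> (\<Sum>l=1..L. C / 2 ^ (k + l))"
  proof (rule sum_mono)
    fix l
    have "(\<Sum>b=a - int l + 1..a + int k - 1. \<bar>cov (a, k) (b, l)\<bar>) \<le> real (card {a - int l + 1..a + int k - 1}) * (C / 4 ^ (k + l))"
      by (rule sum_bounded_above) (rule abs_cov_le)
    also have "\<dots> \<le> 2 ^ (k + l) * (C / 4 ^ (k + l))"
    proof (rule mult_right_mono)
      have "card {a - int l + 1..a + int k - 1} \<le> k + l" by simp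
      also have "\<dots> \<le> 2 ^ (k + l)" using less_exp[of "k + l"] by simp
      finally have "real (card {a - int l + 1..a + int k - 1}) \<le> real (2 ^ (k + l))" by (rule of_nat_mono)
      then show "real (card {a - int l + 1..a + int k - 1}) \<le> 2 ^ (k + l)" by simp
    qed (use C_nonneg in auto)
    also have "\<dots> = C / 2 ^ (k + l)"
      using power_mult_distrib[of "2::real" 2 "k + l"] by simp
    finally show "(\<Sum>b=a - int l + 1..a + int k - 1. \<bar>cov (a, k) (b, l)\<bar>) \<le> C / 2 ^ (k + l)" .
  qed
  also have "\<dots> = C / 2 ^ k * (\<Sum>l=1..L. 1 / 2 ^ l)"
    by (simp add: sum_distrib_left power_add)
  also have "\<dots> \<le> C / 2 ^ k * 1"
  proof (rule mult_left_mono)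
    have "(\<Sum>l=1..L. 1 / 2 ^ l) = 1 - 1 / (2::real) ^ L" by (induction L) auto
    then show "(\<Sum>l=1..L. 1 / 2 ^ l) \<le> (1::real)" by simp
  qed (use C_nonneg in auto)
  finally show ?thesis by simp
qed

text \<open>
  The row sums of the covariance matrix decay geometrically in the length of the interval, and at
  most \<open>m\<close> intervals of length \<open>m\<close> contain a given point. So the
  variance is at most a constant for each point of a set that hits all intervals.
\<close>

lemma variance_altsum_le_hitting_set:
  assumes A: "finite A" "\<And>I. I \<in> A \<Longrightarrow> 1 \<le> snd I" and H: "finite H"
    and hit: "\<And>a m. (a, m) \<in> A \<Longrightarrow> {a..<a + int m} \<inter> H \<noteq> {}"
  shows "variance (altsum A) \<le> 2 * C * real (card H)"
proof -
  define L where "L = Max (insert 0 (snd ` A))"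
  have L: "snd J \<le> L" if "J \<in> A" for J
    unfolding L_def using A that by (intro Max_ge) auto
  let ?O = "SIGMA x:H. SIGMA m:{1..L}. {x - int m + 1..x}"
  have "variance (altsum A) \<le> (\<Sum>I\<in>A. \<Sum>J\<in>A. \<bar>cov I J\<bar>)"
  proof -
    have "(-1) ^ n * c \<le> \<bar>c\<bar>" for n and c :: real by (cases "even n") auto
    then show ?thesis unfolding variance_altsum[OF A(1)] by (intro sum_mono)
  qed
  also have "\<dots> \<le> (\<Sum>I\<in>A. C / 2 ^ snd I)"
  proof (rule sum_mono)
    fix I assume "I \<in> A"
    then show "(\<Sum>J\<in>A. \<bar>cov I J\<bar>) \<le> C / 2 ^ snd I"
      using sum_cov_row_le[OF A, of "snd I" "fst I"] A(2) by simp
  qed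
  also have "\<dots> \<le> (\<Sum>I\<in>(\<lambda>(x, m, a). (a, m)) ` ?O. C / 2 ^ snd I)"
  proof (rule sum_mono2)
    show "A \<subseteq> (\<lambda>(x, m, a). (a, m)) ` ?O"
    proof (rule subrelI)
      fix a m assume I: "(a, m) \<in> A"
      then obtain x where x: "x \<in> H" "a \<le> x" "x < a + int m" using hit[OF I] by auto
      moreover have "1 \<le> m" "m \<le> L" using A(2)[OF I] L[OF I] by auto
      ultimately show "(a, m) \<in> (\<lambda>(x, m, a). (a, m)) ` ?O"
        by (intro image_eqI[of _ _ "(x, m, a)"]) auto
    qed
  qed (use H C_nonneg in auto)
  also have "\<dots> \<le> (\<Sum>(x, m, a)\<in>?O. C / 2 ^ m)"
    using H C_nonneg by (intro order.trans[OF sum_image_le]) (auto simp: case_prod_beta comp_def)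
  also have "\<dots> = (\<Sum>x\<in>H. \<Sum>m=1..L. \<Sum>a=x - int m + 1..x. C / 2 ^ m)"
    using H by (subst sum.Sigma[symmetric], simp, simp, intro sum.cong refl, subst sum.Sigma[symmetric]) auto
  also have "\<dots> = real (card H) * (C * (\<Sum>m=1..L. real m / 2 ^ m))"
    by (simp add: sum_distrib_left mult.commute)
  also have "\<dots> \<le> real (card H) * (C * 2)"
  proof (intro mult_left_mono)
    have "(\<Sum>m=1..L. real m / 2 ^ m) = 2 - (real L + 2) / 2 ^ L"
      by (induction L) (auto simp: field_simps)
    then show "(\<Sum>m=1..L. real m / 2 ^ m) \<le> 2" by simp
  qed (use C_nonneg in auto)
  finally show ?thesis by (simp add: mult_ac)
qed

abbreviation T :: "nat \<Rightarrow> 'a \<Rightarrow> real" where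
  "T n \<equiv> altsum (intervals 1 (int n + 1))"

section \<open>Alternating sums over intervals: the central limit theorem\<close>

text \<open>
  The alternating sum as a functional on the path space, where locality and translation can be
  expressed.
\<close>

definition pattern_sum :: "(int \<times> nat) set \<Rightarrow> (int \<Rightarrow> 'b) \<Rightarrow> real" where
  "pattern_sum A x = (\<Sum>I\<in>A. (-1) ^ snd I * of_bool (pattern (fst I) (snd I) x))"

lemma pattern_sum_measurable [measurable]: "pattern_sum A \<in> borel_measurable (PiM UNIV (\<lambda>_. N))"
  unfolding pattern_sum_def by measurable

lemma altsum_eq_pattern_sum: "altsum A \<omega> = pattern_sum A (\<lambda>i. Y i \<omega>)"
  by (simp add: altsum_def pattern_sum_def U_def)

lemma pattern_sum_local:
  "depends_on {lo..<hi} (pattern_sum (intervals lo hi))"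
proof (rule depends_onI)
  fix x y :: "int \<Rightarrow> 'b" assume xy: "\<And>i. i \<in> {lo..<hi} \<Longrightarrow> x i = y i"
  show "pattern_sum (intervals lo hi) x = pattern_sum (intervals lo hi) y"
    unfolding pattern_sum_def
  proof (rule sum.cong[OF refl])
    fix I assume "I \<in> intervals lo hi"
    then have "pattern (fst I) (snd I) x = pattern (fst I) (snd I) y"
      by (intro depends_onD[OF pattern_local] xy) (auto simp: intervals_def)
    then show "(- 1) ^ snd I * of_bool (pattern (fst I) (snd I) x)
      = (- 1) ^ snd I * (of_bool (pattern (fst I) (snd I) y) :: real)" by (simp only:)
  qed
qed

lemma pattern_sum_shift:
  "pattern_sum (intervals (lo + b) (hi + b)) x = pattern_sum (intervals lo hi) (\<lambda>i. x (b + i))"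
proof -
  have "intervals (lo + b) (hi + b) = (\<lambda>I. (fst I + b, snd I)) ` intervals lo hi"
  proof (intro equalityI subsetI)
    fix I assume "I \<in> intervals (lo + b) (hi + b)"
    then show "I \<in> (\<lambda>I. (fst I + b, snd I)) ` intervals lo hi"
      by (intro image_eqI[of _ _ "(fst I - b, snd I)"]) (auto simp: intervals_def)
  qed (auto simp: intervals_def)
  then show ?thesis
    unfolding pattern_sum_def
    by (simp only:, subst sum.reindex, force simp: inj_on_def prod_eq_iff)
      (simp only: comp_def fst_conv snd_conv pattern_shift)
qed

lemma distr_altsum_shift:
  "distr M borel (altsum (intervals (lo + b) (hi + b))) = distr M borel (altsum (intervals lo hi))"
proof -
  have "inj ((+) b)" by simp
  interpret R: iid_family M N "distr Q N (\<lambda>x. x)" "\<lambda>j \<omega>. Y (b + j) \<omega>"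
    by (rule iid_reindex) simp_all
  have Q: "distr Q N (\<lambda>x. x) = Q" by (rule distr_id2) (simp add: sets_Q)
  have "distr M borel (altsum (intervals (lo + b) (hi + b)))
      = distr (distr M (PiM UNIV (\<lambda>_. N)) (\<lambda>\<omega> i. Y (b + i) \<omega>)) borel (pattern_sum (intervals lo hi))"
    by (subst distr_distr) (auto simp: comp_def altsum_eq_pattern_sum pattern_sum_shift intro!: distr_cong)
  also have "\<dots> = distr (distr M (PiM UNIV (\<lambda>_. N)) (\<lambda>\<omega> i. Y i \<omega>)) borel (pattern_sum (intervals lo hi))"
    unfolding R.path_law path_law Q ..
  also have "\<dots> = distr M borel (altsum (intervals lo hi))"
    by (subst distr_distr) (auto simp: comp_def altsum_eq_pattern_sum intro!: distr_cong)
  finally show ?thesis .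
qed

lemma block_end_le: "i < j \<Longrightarrow> int (i * p) + int p \<le> int (j * p)"
proof -
  assume "i < j"
  then have "i * p + p \<le> j * p" using mult_le_mono1[of "Suc i" j p] by simp
  from of_nat_mono[OF this, where 'a=int] show ?thesis by (simp only: of_nat_add)
qed

definition block :: "nat \<Rightarrow> nat \<Rightarrow> (int \<times> nat) set" where
  "block p j = intervals (1 + int (j * p)) (1 + int p + int (j * p))"

lemma finite_block_intervals [simp]: "finite (block p j)" by (simp add: block_def)

lemma indep_blocks: "indep_vars (\<lambda>_. borel) (\<lambda>j. altsum (block p j)) UNIV"
proof -
  have "disjoint_family (\<lambda>j. {1 + int (j * p)..<1 + int p + int (j * p)})"
  proof -
    have *: "{1 + int (i * p)..<1 + int p + int (i * p)} \<inter> {1 + int (j * p)..<1 + int p + int (j * p)} = {}"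
      if "i < j" for i j
      using block_end_le[OF that, of p] by auto
    show ?thesis
      unfolding disjoint_family_on_def using * by (metis Int_commute nat_neq_iff)
  qed
  then have "indep_vars (\<lambda>_. borel) (\<lambda>j \<omega>. pattern_sum (block p j) (\<lambda>i. Y i \<omega>)) UNIV"
    by (rule indep_vars_local) (auto simp: block_def intro: pattern_sum_local)
  then show ?thesis by (simp add: altsum_eq_pattern_sum[abs_def])
qed

lemma distr_block: "distr M borel (altsum (block p j)) = distr M borel (T p)"
  unfolding block_def using distr_altsum_shift[of 1 "int (j * p)" "1 + int p"] by (simp add: add_ac)

lemma expectation_block: "expectation (altsum (block p j)) = expectation (T p)"
proof -
  have "expectation (altsum A) = (\<integral>x. x \<partial>distr M borel (altsum A))" for A
    by (subst integral_distr) auto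
  then show ?thesis using distr_block by simp
qed

lemma variance_block: "variance (altsum (block p j)) = variance (T p)"
proof -
  have "expectation (\<lambda>\<omega>. (altsum A \<omega> - c)\<^sup>2) = (\<integral>x. (x - c)\<^sup>2 \<partial>distr M borel (altsum A))" for A c
    by (subst integral_distr) auto
  then show ?thesis using distr_block expectation_block by simp
qed

text \<open>
  An interval in \<open>{1..n}\<close> that is contained in none of the complete blocks contains
  the last point of a complete block or lies in the incomplete block at the end. These points are
  a hitting set.
\<close>

lemma variance_minus_blocks:
  assumes p: "0 < p"
  shows "variance (\<lambda>\<omega>. T n \<omega> - (\<Sum>j<n div p. altsum (block p j) \<omega>)) \<le> 2 * C * real (n div p + p)"
proof -
  let ?q = "n div p"
  let ?A = "intervals 1 (int n + 1)" and ?B = "\<Union>j<?q. block p j"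
  let ?H = "(\<lambda>j. int (j * p)) ` {1..?q} \<union> {int (?q * p) + 1..int n}"
  have qp: "?q * p \<le> n" by simp
  have sub: "?B \<subseteq> ?A"
  proof (intro UN_least)
    fix j assume "j \<in> {..<?q}"
    then have "int (j * p) + int p \<le> int (?q * p)" by (intro block_end_le) auto
    also have "\<dots> \<le> int n" using qp by (rule of_nat_mono)
    finally have "int (j * p) + int p \<le> int n" .
    moreover have "0 \<le> int (j * p)" by (rule of_nat_0_le_iff)
    ultimately show "block p j \<subseteq> ?A" unfolding block_def intervals_def
      by (auto simp del: of_nat_mult)
  qed
  have dj: "block p i \<inter> block p j = {}" if "i < j" for i j
    using block_end_le[OF that, of p] unfolding block_def intervals_def by auto
  then have dj': "i \<noteq> j \<Longrightarrow> block p i \<inter> block p j = {}" for i j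
    by (metis Int_commute nat_neq_iff)
  have sumB: "altsum ?B \<omega> = (\<Sum>j<?q. altsum (block p j) \<omega>)" for \<omega>
    unfolding altsum_def
    by (rule sum.UNION_disjoint) (simp_all add: dj')
  have "T n \<omega> - (\<Sum>j<?q. altsum (block p j) \<omega>) = altsum (?A - ?B) \<omega>" for \<omega>
    unfolding sumB[symmetric] unfolding altsum_def using sub by (simp add: sum_diff)
  then have "variance (\<lambda>\<omega>. T n \<omega> - (\<Sum>j<?q. altsum (block p j) \<omega>)) = variance (altsum (?A - ?B))" by simp
  also have "\<dots> \<le> 2 * C * real (card ?H)"
  proof (rule variance_altsum_le_hitting_set)
    fix a m assume I: "(a, m) \<in> ?A - ?B"
    then have m: "1 \<le> m" "1 \<le> a" "a + int m \<le> int n + 1" by (auto simp: intervals_def)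
    show "{a..<a + int m} \<inter> ?H \<noteq> {}"
    proof (cases "a \<le> int (?q * p)")
      case False
      then have "a \<in> {a..<a + int m} \<inter> ?H" using m by auto
      then show ?thesis by blast
    next
      case True
      define j where "j = nat (a - 1) div p"
      have "nat (a - 1) < ?q * p" using True m by linarith
      then have jq: "j < ?q" unfolding j_def by (simp add: less_mult_imp_div_less)
      have "j * p \<le> nat (a - 1)" "nat (a - 1) < Suc j * p"
        unfolding j_def using p dividend_less_div_times[of p "nat (a - 1)"] by (auto simp: add.commute)
      then have a: "int (j * p) \<le> a - 1" "a - 1 < int (Suc j * p)" using m by linarith+
      have "(a, m) \<notin> block p j" using I jq by blast
      then have "1 + int p + int (j * p) < a + int m" using m a unfolding block_def intervals_def by auto
      then have "int (Suc j * p) \<in> {a..<a + int m}" using a by auto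
      moreover have "int (Suc j * p) \<in> ?H" using jq by (intro UnI1 imageI) auto
      ultimately show ?thesis by blast
    qed
  next
    show "finite (?A - ?B)" by (intro finite_Diff finite_intervals)
    show "1 \<le> snd I" if "I \<in> ?A - ?B" for I using that by (auto simp: intervals_def)
  qed simp
  also have "\<dots> \<le> 2 * C * real (?q + p)"
  proof (intro mult_left_mono of_nat_mono)
    have "card ?H \<le> card ((\<lambda>j. int (j * p)) ` {1..?q}) + card {int (?q * p) + 1..int n}" by (rule card_Un_le)
    also have "card ((\<lambda>j. int (j * p)) ` {1..?q}) \<le> ?q" using card_image_le[of "{1..?q}"] by auto
    also have "card {int (?q * p) + 1..int n} = n - ?q * p"
    proof -
      have "card {int k + 1..int n} = n - k" if "k \<le> n" for k using that by simp
      from this[OF qp] show ?thesis .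
    qed
    also have "n - ?q * p \<le> p" using p mod_less_divisor[of p n] by (simp add: minus_div_mult_eq_mod)
    finally show "card ?H \<le> ?q + p" by simp
  qed (use C_nonneg in auto)
  finally show ?thesis .
qed

lemma div_over_tendsto:
  assumes p: "0 < p"
  shows "(\<lambda>n. real (n div p) / real n) \<longlonglongrightarrow> 1 / real p"
proof (rule real_tendsto_sandwich)
  have "real n / real p - 1 \<le> real (n div p)" for n
  proof -
    have "n < (n div p + 1) * p" using dividend_less_div_times[OF p, of n] by (simp add: add.commute)
    then have "real n < (real (n div p) + 1) * real p"
      by (metis of_nat_1 of_nat_add of_nat_less_iff of_nat_mult)
    then show ?thesis using p by (simp add: field_simps)
  qed
  then have lower: "(real n / real p - 1) / real n \<le> real (n div p) / real n" for n
    by (rule divide_right_mono) simp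
  show "\<forall>\<^sub>F n in sequentially. 1 / real p - 1 / real n \<le> real (n div p) / real n"
    using eventually_gt_at_top[of 0]
  proof eventually_elim
    case (elim n) then show ?case using lower[of n] by (simp add: diff_divide_distrib)
  qed
  have "real (n div p) \<le> real n / real p" for n
  proof -
    have "real (n div p * p) \<le> real n" by (intro of_nat_mono) simp
    then show ?thesis using p by (simp add: field_simps)
  qed
  then have upper: "real (n div p) / real n \<le> real n / real p / real n" for n
    by (rule divide_right_mono) simp
  show "\<forall>\<^sub>F n in sequentially. real (n div p) / real n \<le> 1 / real p"
    using eventually_gt_at_top[of 0]
  proof eventually_elim
    case (elim n) then show ?case using upper[of n] by simp
  qed
  have "(\<lambda>n. 1 / real p - 1 / real n) \<longlonglongrightarrow> 1 / real p - 0"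
    by (intro tendsto_diff tendsto_const lim_1_over_n)
  then show "(\<lambda>n. 1 / real p - 1 / real n) \<longlonglongrightarrow> 1 / real p" by simp
qed simp

text \<open>
  For a fixed block length \<open>p\<close> the sum of the blocks obeys the classical central
  limit theorem. What remains in the limit is the contribution of the intervals that fit in no
  block, of order \<open>1 / sqrt p\<close>.
\<close>

lemma char_error_limit:
  fixes p :: nat and \<theta> :: real
  defines "V \<equiv> variance (T p)"
  assumes p: "0 < p" and V: "0 < V"
  obtains f where "f \<longlonglongrightarrow> \<bar>\<theta>\<bar> * sqrt (2 * C / real p)"
    "\<And>n. 0 < n \<Longrightarrow> cmod ((CLINT \<omega>|M. iexp (\<theta> * ((T n \<omega> - expectation (T n)) / sqrt (real n))))
       - exp (- (V / real p * \<theta>\<^sup>2) / 2)) \<le> f n"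
proof -
  define X where "X j \<omega> = altsum (block p j) \<omega> - expectation (T p)" for j \<omega>
  define W where "W q \<omega> = (\<Sum>i<q. X i \<omega>)" for q \<omega>
  define \<theta>' where "\<theta>' = \<theta> * sqrt (V / real p)"
  define Z where "Z q \<omega> = W q \<omega> / sqrt (real q * V)" for q \<omega>
  \<comment> \<open>The summands bound the effect of the discarded intervals, of the normalisation by \<open>n
    div p\<close> instead of \<open>n / p\<close>, and of the distance of the block sums from
    the normal law.\<close>
  define f where "f n = \<bar>\<theta>\<bar> * sqrt (2 * C * (real (n div p) / real n + real p / real n))
      + \<bar>\<theta>\<bar> * (sqrt V * \<bar>sqrt (real (n div p) / real n) - sqrt (1 / real p)\<bar>)
      + cmod ((CLINT \<omega>|M. iexp (\<theta>' * Z (n div p) \<omega>)) - exp (- (\<theta>'\<^sup>2) / 2))" for n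
  have mX[measurable]: "X j \<in> borel_measurable M" for j unfolding X_def by measurable
  have mW[measurable]: "W q \<in> borel_measurable M" for q unfolding W_def by measurable
  have mZ[measurable]: "Z q \<in> borel_measurable M" for q unfolding Z_def by measurable
  have sX: "integrable M (\<lambda>\<omega>. (X j \<omega>)\<^sup>2)" for j
    unfolding X_def by (intro centered_square_integrable altsum_square_integrable) auto
  have iX: "integrable M (X j)" for j by (rule square_integrable_imp_integrable[OF _ sX]) simp
  have eX: "expectation (X j) = 0" for j
    unfolding X_def using altsum_integrable[of "block p j"] expectation_block by (simp add: prob_space)
  have vX: "variance (X j) = V" for j
    unfolding eX unfolding X_def V_def using variance_block[of p j] expectation_block by simp
  have indX: "indep_vars (\<lambda>_. borel) X UNIV"
    unfolding X_def using indep_vars_compose2[OF indep_blocks, of "\<lambda>_ x. x - expectation (T p)"] by simp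
  have sW: "integrable M (\<lambda>\<omega>. (W q \<omega>)\<^sup>2)" for q
    unfolding W_def
  proof (induction q)
    case (Suc q) then show ?case
      using integrable_square_add[OF _ _ Suc sX[of q]] by simp
  qed simp
  have iW: "integrable M (W q)" for q by (rule square_integrable_imp_integrable[OF _ sW]) simp
  have eW: "expectation (W q) = 0" for q
    unfolding W_def by (subst Bochner_Integration.integral_sum) (auto simp: iX eX)
  have vW: "expectation (\<lambda>\<omega>. (W q \<omega>)\<^sup>2) = real q * V" for q
  proof (induction q)
    case (Suc q)
    have "indep_var borel (X q) borel (\<lambda>\<omega>. \<Sum>i\<in>{..<q}. X i \<omega>)"
      by (rule indep_vars_sum) (auto intro: indep_vars_subset[OF indX])
    then have "expectation (\<lambda>\<omega>. X q \<omega> * W q \<omega>) = expectation (X q) * expectation (W q)"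
      using iX iW[of q] unfolding W_def by (intro indep_var_lebesgue_integral)
    then have 0: "expectation (\<lambda>\<omega>. X q \<omega> * W q \<omega>) = 0" by (simp add: eX)
    have "expectation (\<lambda>\<omega>. (W (Suc q) \<omega>)\<^sup>2)
        = expectation (\<lambda>\<omega>. (W q \<omega>)\<^sup>2 + 2 * (X q \<omega> * W q \<omega>) + (X q \<omega>)\<^sup>2)"
      by (intro Bochner_Integration.integral_cong) (auto simp: W_def power2_eq_square algebra_simps)
    also have "\<dots> = expectation (\<lambda>\<omega>. (W q \<omega>)\<^sup>2) + 2 * expectation (\<lambda>\<omega>. X q \<omega> * W q \<omega>)
        + expectation (\<lambda>\<omega>. (X q \<omega>)\<^sup>2)"
      using sW[of q] sX[of q] integrable_mult_of_squares[OF mX mW sX sW, of q q]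
      by (subst Bochner_Integration.integral_add; simp?)
    also have "\<dots> = real (Suc q) * V" using Suc 0 vX[of q] eX[of q] by (simp add: algebra_simps)
    finally show ?case .
  qed (simp add: W_def)
  have "weak_conv_m (\<lambda>q. distr M borel (\<lambda>\<omega>. (\<Sum>i<q. altsum (block p i) \<omega> - expectation (T p))
      / sqrt (real q * (sqrt V)\<^sup>2))) std_normal_distribution"
  proof (rule central_limit_theorem)
    show "indep_vars (\<lambda>_. borel) (\<lambda>j. altsum (block p j)) UNIV" by (rule indep_blocks)
    show "variance (altsum (block p j)) = (sqrt V)\<^sup>2" for j
      using V by (simp add: variance_block V_def)
  qed (use V in \<open>auto intro: altsum_square_integrable simp: expectation_block distr_block\<close>)
  then have "weak_conv_m (\<lambda>q. distr M borel (Z q)) std_normal_distribution"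
    using V by (simp add: Z_def[abs_def] W_def X_def)
  then have "(\<lambda>q. char (distr M borel (Z q)) \<theta>') \<longlonglongrightarrow> char std_normal_distribution \<theta>'"
    by (intro levy_continuity1 real_distribution_distr real_dist_normal_dist) auto
  moreover have "char (distr M borel (Z q)) \<theta>' = (CLINT \<omega>|M. iexp (\<theta>' * Z q \<omega>))" for q
    unfolding char_def by (subst integral_distr) auto
  ultimately have Zlim: "(\<lambda>q. CLINT \<omega>|M. iexp (\<theta>' * Z q \<omega>)) \<longlonglongrightarrow> exp (- (\<theta>'\<^sup>2) / 2)"
    by (simp add: char_std_normal_distribution)
  have "filterlim (\<lambda>n. n div p) at_top at_top" by (rule filterlim_at_top_div_const_nat[OF p])
  from filterlim_compose[OF Zlim this]
  have Zlim': "(\<lambda>n. cmod ((CLINT \<omega>|M. iexp (\<theta>' * Z (n div p) \<omega>)) - exp (- (\<theta>'\<^sup>2) / 2))) \<longlonglongrightarrow> 0"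
    by (intro tendsto_norm_zero LIM_zero)
  have base: "(\<lambda>n. real (n div p) / real n + real p / real n) \<longlonglongrightarrow> 1 / real p + 0"
    by (intro tendsto_add div_over_tendsto[OF p] lim_const_over_n)
  have "f \<longlonglongrightarrow> \<bar>\<theta>\<bar> * sqrt (2 * C * (1 / real p + 0)) + \<bar>\<theta>\<bar> * (sqrt V * \<bar>sqrt (1 / real p) - sqrt (1 / real p)\<bar>) + 0"
    unfolding f_def
    by (intro tendsto_add tendsto_mult tendsto_const tendsto_real_sqrt tendsto_rabs tendsto_diff
        base div_over_tendsto[OF p] Zlim')
  then have flim: "f \<longlonglongrightarrow> \<bar>\<theta>\<bar> * sqrt (2 * C / real p)" by simp
  have bound: "cmod ((CLINT \<omega>|M. iexp (\<theta> * ((T n \<omega> - expectation (T n)) / sqrt (real n))))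
       - exp (- (V / real p * \<theta>\<^sup>2) / 2)) \<le> f n" if n: "0 < n" for n
  proof -
    let ?q = "n div p"
    define R where "R \<omega> = T n \<omega> - (\<Sum>j<?q. altsum (block p j) \<omega>)" for \<omega>
    have mR[measurable]: "R \<in> borel_measurable M" unfolding R_def by measurable
    have iT: "integrable M (T n)" by (simp add: altsum_integrable)
    have Teq: "T n \<omega> = R \<omega> + W ?q \<omega> + real ?q * expectation (T p)" for \<omega>
      unfolding R_def W_def X_def by (simp add: sum_subtractf)
    then have Req: "R = (\<lambda>\<omega>. T n \<omega> - W ?q \<omega> - real ?q * expectation (T p))" by auto
    have sR: "integrable M (\<lambda>\<omega>. (R \<omega>)\<^sup>2)"
      unfolding Req
      by (intro centered_square_integrable integrable_square_diff sW altsum_square_integrable) auto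
    have iR: "integrable M R" by (rule square_integrable_imp_integrable[OF _ sR]) simp
    have eT: "expectation (T n) = expectation R + real ?q * expectation (T p)"
    proof -
      have "expectation (T n) = expectation (\<lambda>\<omega>. R \<omega> + W ?q \<omega> + real ?q * expectation (T p))"
        unfolding Teq[abs_def, symmetric] ..
      also have "\<dots> = expectation R + real ?q * expectation (T p)"
        using iR iW[of ?q] eW[of ?q] by (simp add: prob_space)
      finally show ?thesis .
    qed
    have cent: "T n \<omega> - expectation (T n) = (R \<omega> - expectation R) + W ?q \<omega>" for \<omega>
      unfolding eT by (simp add: Teq)
    have sRc: "integrable M (\<lambda>\<omega>. (R \<omega> - expectation R)\<^sup>2)"
      by (rule centered_square_integrable[OF mR sR])
    have ER: "expectation (\<lambda>\<omega>. \<bar>R \<omega> - expectation R\<bar>) \<le> sqrt (2 * C * real (?q + p))"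
    proof -
      have "expectation (\<lambda>\<omega>. \<bar>R \<omega> - expectation R\<bar>) \<le> sqrt (variance R)"
        by (rule expectation_abs_le_sqrt[OF _ sRc]) simp
      also have "\<dots> \<le> sqrt (2 * C * real (?q + p))"
        unfolding R_def by (intro real_sqrt_le_mono variance_minus_blocks p)
      finally show ?thesis .
    qed
    have EW: "expectation (\<lambda>\<omega>. \<bar>W ?q \<omega>\<bar>) \<le> sqrt (real ?q * V)"
      using expectation_abs_le_sqrt[OF mW sW, of ?q] vW[of ?q] by simp
    define c where "c = sqrt (V / real p) / sqrt (real ?q * V)"
    have diff: "\<theta> * ((T n \<omega> - expectation (T n)) / sqrt (real n)) - \<theta>' * Z ?q \<omega>
      = \<theta> / sqrt (real n) * (R \<omega> - expectation R) + \<theta> * (1 / sqrt (real n) - c) * W ?q \<omega>" for \<omega>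
      unfolding cent \<theta>'_def Z_def c_def by (simp add: algebra_simps add_divide_distrib diff_divide_distrib)
    have c: "\<bar>1 / sqrt (real n) - c\<bar> * sqrt (real ?q * V)
        \<le> sqrt V * \<bar>sqrt (real ?q / real n) - sqrt (1 / real p)\<bar>"
    proof (cases "?q = 0")
      case False
      have "\<bar>1 / sqrt (real n) - c\<bar> * sqrt (real ?q * V) = \<bar>(1 / sqrt (real n) - c) * sqrt (real ?q * V)\<bar>"
        using V by (simp add: abs_mult)
      also have "(1 / sqrt (real n) - c) * sqrt (real ?q * V) = sqrt V * (sqrt (real ?q / real n) - sqrt (1 / real p))"
        using V False by (simp add: c_def left_diff_distrib right_diff_distrib real_sqrt_mult real_sqrt_divide)
      finally show ?thesis using V by (simp add: abs_mult)
    qed (use V in auto)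
    have "cmod ((CLINT \<omega>|M. iexp (\<theta> * ((T n \<omega> - expectation (T n)) / sqrt (real n))))
         - (CLINT \<omega>|M. iexp (\<theta>' * Z ?q \<omega>)))
       \<le> expectation (\<lambda>\<omega>. \<bar>\<theta> * ((T n \<omega> - expectation (T n)) / sqrt (real n)) - \<theta>' * Z ?q \<omega>\<bar>)"
    proof (rule iexp_expectation_diff)
      show "integrable M (\<lambda>\<omega>. \<theta> * ((T n \<omega> - expectation (T n)) / sqrt (real n)) - \<theta>' * Z ?q \<omega>)"
        unfolding diff by (simp add: iR iW)
    qed simp_all
    also have "\<dots> \<le> expectation (\<lambda>\<omega>. \<bar>\<theta>\<bar> / sqrt (real n) * \<bar>R \<omega> - expectation R\<bar>
        + \<bar>\<theta>\<bar> * \<bar>1 / sqrt (real n) - c\<bar> * \<bar>W ?q \<omega>\<bar>)"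
      unfolding diff
      by (rule integral_mono) (auto simp: iR iW abs_mult abs_divide intro!: order.trans[OF abs_triangle_ineq])
    also have "\<dots> = \<bar>\<theta>\<bar> / sqrt (real n) * expectation (\<lambda>\<omega>. \<bar>R \<omega> - expectation R\<bar>)
        + \<bar>\<theta>\<bar> * \<bar>1 / sqrt (real n) - c\<bar> * expectation (\<lambda>\<omega>. \<bar>W ?q \<omega>\<bar>)"
      using iR iW[of ?q] by simp
    also have "\<dots> \<le> \<bar>\<theta>\<bar> / sqrt (real n) * sqrt (2 * C * real (?q + p))
        + \<bar>\<theta>\<bar> * \<bar>1 / sqrt (real n) - c\<bar> * sqrt (real ?q * V)"
      using ER EW by (intro add_mono mult_left_mono) auto
    also have "\<dots> \<le> \<bar>\<theta>\<bar> * sqrt (2 * C * (real ?q / real n + real p / real n))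
        + \<bar>\<theta>\<bar> * (sqrt V * \<bar>sqrt (real ?q / real n) - sqrt (1 / real p)\<bar>)"
    proof (rule add_mono)
      have "sqrt (2 * C * real (?q + p)) / sqrt (real n) = sqrt (2 * C * (real ?q / real n + real p / real n))"
        by (simp add: real_sqrt_divide[symmetric] add_divide_distrib distrib_left)
      then show "\<bar>\<theta>\<bar> / sqrt (real n) * sqrt (2 * C * real (?q + p))
          \<le> \<bar>\<theta>\<bar> * sqrt (2 * C * (real ?q / real n + real p / real n))"
        by (metis order.refl times_divide_eq_left times_divide_eq_right)
      show "\<bar>\<theta>\<bar> * \<bar>1 / sqrt (real n) - c\<bar> * sqrt (real ?q * V)
          \<le> \<bar>\<theta>\<bar> * (sqrt V * \<bar>sqrt (real ?q / real n) - sqrt (1 / real p)\<bar>)"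
        unfolding mult.assoc by (intro mult_left_mono c) simp
    qed
    finally have d: "cmod ((CLINT \<omega>|M. iexp (\<theta> * ((T n \<omega> - expectation (T n)) / sqrt (real n))))
         - (CLINT \<omega>|M. iexp (\<theta>' * Z ?q \<omega>)))
       \<le> \<bar>\<theta>\<bar> * sqrt (2 * C * (real ?q / real n + real p / real n))
        + \<bar>\<theta>\<bar> * (sqrt V * \<bar>sqrt (real ?q / real n) - sqrt (1 / real p)\<bar>)" .
    have e: "V / real p * \<theta>\<^sup>2 = \<theta>'\<^sup>2"
      unfolding \<theta>'_def using V by (simp add: power_mult_distrib)
    show ?thesis
      unfolding e f_def by (rule norm_diff_triangle_le[OF d order.refl])
  qed
  from flim bound show thesis by (rule that)
qed

text \<open>
  First \<open>n\<close> and then the block length \<open>p\<close> tends to infinity. The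
  variance limit is what makes the normal laws for block length \<open>p\<close> converge.
\<close>

theorem altsum_clt:
  assumes s: "0 < s2" and V: "(\<lambda>n. variance (T n) / real n) \<longlonglongrightarrow> s2"
  shows "variance_limit_and_clt M T s2"
  unfolding variance_limit_and_clt_iff[OF prob_space_axioms altsum_measurable s]
proof (intro conjI V allI)
  fix \<theta> :: real
  let ?\<phi> = "\<lambda>n. CLINT \<omega>|M. iexp (\<theta> * ((T n \<omega> - expectation (T n)) / sqrt (real n)))"
  let ?L = "exp (- (s2 * \<theta>\<^sup>2) / 2) :: real"
  let ?E = "\<lambda>p. exp (- (variance (T p) / real p * \<theta>\<^sup>2) / 2) :: real"
  show "?\<phi> \<longlonglongrightarrow> complex_of_real ?L"
  proof (rule LIMSEQ_I)
    fix \<epsilon> :: real assume \<epsilon>: "0 < \<epsilon>"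
    have "(\<lambda>p. \<bar>\<theta>\<bar> * sqrt (2 * C / real p)) \<longlonglongrightarrow> \<bar>\<theta>\<bar> * sqrt 0"
      by (intro tendsto_mult tendsto_const tendsto_real_sqrt lim_const_over_n)
    then have e1: "\<forall>\<^sub>F p in sequentially. \<bar>\<theta>\<bar> * sqrt (2 * C / real p) < \<epsilon> / 2"
      using \<epsilon> by (intro order_tendstoD(2)) auto
    have "(\<lambda>p. \<bar>?E p - ?L\<bar>) \<longlonglongrightarrow> \<bar>?L - ?L\<bar>"
      by (intro tendsto_intros V) simp
    then have e2: "\<forall>\<^sub>F p in sequentially. \<bar>?E p - ?L\<bar> < \<epsilon> / 2"
      using \<epsilon> by (intro order_tendstoD(2)) auto
    have e3: "\<forall>\<^sub>F p in sequentially. 0 < variance (T p) / real p"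
      using V s by (rule order_tendstoD(1))
    have "\<forall>\<^sub>F p in sequentially. \<bar>\<theta>\<bar> * sqrt (2 * C / real p) < \<epsilon> / 2 \<and> \<bar>?E p - ?L\<bar> < \<epsilon> / 2
        \<and> 0 < variance (T p) / real p \<and> 0 < p"
      using e1 e2 e3 eventually_gt_at_top[of 0] by eventually_elim simp
    then obtain p where p: "\<bar>\<theta>\<bar> * sqrt (2 * C / real p) < \<epsilon> / 2" "\<bar>?E p - ?L\<bar> < \<epsilon> / 2"
        "0 < variance (T p)" "0 < p"
      by (auto simp: eventually_sequentially zero_less_divide_iff)
    obtain f where f: "f \<longlonglongrightarrow> \<bar>\<theta>\<bar> * sqrt (2 * C / real p)"
      and fb: "\<And>n. 0 < n \<Longrightarrow> cmod (?\<phi> n - ?E p) \<le> f n"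
      using char_error_limit[OF p(4,3), of \<theta>] by blast
    have "\<forall>\<^sub>F n in sequentially. f n < \<epsilon> / 2"
      using f p(1) by (rule order_tendstoD(2))
    then have "\<forall>\<^sub>F n in sequentially. cmod (?\<phi> n - ?L) < \<epsilon>"
      using eventually_gt_at_top[of 0]
    proof eventually_elim
      case (elim n)
      have "cmod (?\<phi> n - ?L) \<le> f n + cmod (complex_of_real (?E p) - ?L)"
        by (rule norm_diff_triangle_le[OF fb order.refl]) (use elim in auto)
      also have "cmod (complex_of_real (?E p) - ?L) = \<bar>?E p - ?L\<bar>"
        by (simp only: of_real_diff[symmetric] norm_of_real)
      finally show ?case using elim p(2) by linarith
    qed
    then show "\<exists>no. \<forall>n\<ge>no. cmod (?\<phi> n - ?L) < \<epsilon>"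
      by (simp add: eventually_sequentially)
  qed
qed

end

section \<open>Alternating sums over intervals: the limiting variance\<close>

lemma Cesaro_mean_tendsto:
  fixes x :: "nat \<Rightarrow> real"
  assumes "x \<longlonglongrightarrow> L"
  shows "(\<lambda>n. (\<Sum>k<n. x k) / real n) \<longlonglongrightarrow> L"
proof (rule LIMSEQ_I)
  fix \<epsilon> :: real assume \<epsilon>: "0 < \<epsilon>"
  obtain K where K: "\<And>n. K \<le> n \<Longrightarrow> \<bar>x n - L\<bar> < \<epsilon> / 2"
    using LIMSEQ_D[OF assms, of "\<epsilon> / 2"] \<epsilon> by auto
  define B where "B = (\<Sum>k<K. \<bar>x k - L\<bar>)"
  have B0: "0 \<le> B" unfolding B_def by (rule sum_nonneg) simp
  obtain K' where K': "2 * B / \<epsilon> < real K'" using reals_Archimedean2 by blast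
  have "norm ((\<Sum>k<n. x k) / real n - L) < \<epsilon>" if n: "max (Suc K) (Suc K') \<le> n" for n
  proof -
    have n0: "0 < n" "K \<le> n" "real K' < real n" using n by auto
    have "2 * B < \<epsilon> * real n"
    proof -
      have "2 * B < \<epsilon> * real K'" using K' \<epsilon> by (simp add: field_simps)
      also have "\<dots> \<le> \<epsilon> * real n" using n0 \<epsilon> by (intro mult_left_mono) auto
      finally show ?thesis .
    qed
    have "(\<Sum>k<n. x k) / real n - L = (\<Sum>k<n. x k - L) / real n"
      using n0 by (simp add: sum_subtractf diff_divide_distrib)
    also have "\<bar>\<dots>\<bar> \<le> (\<Sum>k<n. \<bar>x k - L\<bar>) / real n"
      by (simp add: abs_divide divide_right_mono sum_abs)
    also have "(\<Sum>k<n. \<bar>x k - L\<bar>) = B + (\<Sum>k=K..<n. \<bar>x k - L\<bar>)"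
      unfolding B_def lessThan_atLeast0 by (rule sum.atLeastLessThan_concat[symmetric]) (use n0 in auto)
    also have "(\<Sum>k=K..<n. \<bar>x k - L\<bar>) \<le> real (card {K..<n}) * (\<epsilon> / 2)"
      by (rule sum_bounded_above) (use K in \<open>auto intro: less_imp_le\<close>)
    also have "\<dots> \<le> real n * (\<epsilon> / 2)" using \<epsilon> by (intro mult_right_mono) auto
    finally have "\<bar>(\<Sum>k<n. x k) / real n - L\<bar> \<le> (B + real n * (\<epsilon> / 2)) / real n"
      using n0 by (simp add: divide_right_mono)
    also have "\<dots> < \<epsilon>" using \<open>2 * B < \<epsilon> * real n\<close> n0 by (simp add: field_simps)
    finally show ?thesis by simp
  qed
  then show "\<exists>no. \<forall>n\<ge>no. norm ((\<Sum>k<n. x k) / real n - L) < \<epsilon>" by blast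
qed

text \<open>
  Grouping by the last point \<open>e\<close> shows how the sum grows with \<open>n\<close>.
\<close>

lemma sum_intervals:
  fixes f :: "int \<times> nat \<Rightarrow> 'c::comm_monoid_add"
  shows "sum f (intervals 1 (int n + 1)) = (\<Sum>e=1..n. \<Sum>l=1..e. f (int e - int l + 1, l))"
proof (induction n)
  case (Suc n)
  let ?E = "(\<lambda>l. (int (Suc n) - int l + 1, l)) ` {1..Suc n}"
  have eq: "intervals 1 (int (Suc n) + 1) = intervals 1 (int n + 1) \<union> ?E"
  proof (intro equalityI subsetI)
    fix I assume I: "I \<in> intervals 1 (int (Suc n) + 1)"
    show "I \<in> intervals 1 (int n + 1) \<union> ?E"
    proof (cases "fst I + int (snd I) \<le> int n + 1")
      case False
      with I have "fst I = int (Suc n) - int (snd I) + 1" "snd I \<in> {1..Suc n}"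
        by (auto simp: intervals_def)
      then have "I \<in> ?E" by (intro image_eqI[of _ _ "snd I"]) (auto simp: prod_eq_iff)
      then show ?thesis ..
    qed (use I in \<open>auto simp: intervals_def\<close>)
  qed (auto simp: intervals_def)
  have "sum f (intervals 1 (int (Suc n) + 1)) = sum f (intervals 1 (int n + 1)) + sum f ?E"
    unfolding eq by (rule sum.union_disjoint) (simp, simp, auto simp: intervals_def)
  also have "sum f ?E = (\<Sum>l=1..Suc n. f (int (Suc n) - int l + 1, l))"
    by (subst sum.reindex) (auto simp: inj_on_def)
  moreover have "(\<Sum>e=1..Suc n. g e) = (\<Sum>e=1..n. g e) + g (Suc n)" for g :: "nat \<Rightarrow> 'c" by simp
  ultimately show ?case by (simp only: Suc.IH)
qed (auto simp: intervals_def intro!: sum.neutral)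

lemma sum_alternating_signs: "(\<Sum>k<a. (-1) ^ k) = (of_bool (odd a) :: real)"
  by (induction a) auto

lemma sum_alternating_signs_from_1: "(\<Sum>l=1..a. (-1) ^ l) = (- of_bool (odd a) :: real)"
  by (induction a) auto

text \<open>
  This sum runs over the pairs of an interval of length \<open>a\<close> that ends at
  \<open>n\<close> and an overlapping interval of length \<open>l\<close> that ends at \<open>n -
  \<kappa>\<close>; the argument of \<open>\<rho>\<close> is the length of their union. The signs
  cancel for most of the pairs with the same union, and a union of length \<open>m\<close> keeps
  the weight \<open>m\<close>.
\<close>

lemma alternating_hull_sum:
  fixes \<rho> :: "nat \<Rightarrow> real"
  shows "(\<Sum>a=1..n. (-1) ^ a * (\<Sum>\<kappa><a. \<Sum>l=1..n - \<kappa>. (-1) ^ l * (if l \<le> a - \<kappa> then \<rho> a else \<rho> (l + \<kappa>))))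
    = - (\<Sum>m=1..n. (-1) ^ m * real m * \<rho> m)"
proof -
  have inner: "(\<Sum>\<kappa><a. \<Sum>l=1..n - \<kappa>. (-1) ^ l * (if l \<le> a - \<kappa> then \<rho> a else \<rho> (l + \<kappa>)))
    = - real ((a + 1) div 2) * \<rho> a + of_bool (odd a) * (\<Sum>m=a+1..n. (-1) ^ m * \<rho> m)"
    if a: "a \<le> n" for a
  proof -
    have "(\<Sum>l=1..n - \<kappa>. (-1) ^ l * (if l \<le> a - \<kappa> then \<rho> a else \<rho> (l + \<kappa>)))
      = - of_bool (odd (a - \<kappa>)) * \<rho> a + (-1) ^ \<kappa> * (\<Sum>m=a+1..n. (-1) ^ m * \<rho> m)" if k: "\<kappa> < a" for \<kappa>
    proof -
      have "(\<Sum>l=1..n - \<kappa>. (-1) ^ l * (if l \<le> a - \<kappa> then \<rho> a else \<rho> (l + \<kappa>)))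
        = (\<Sum>l=1..a - \<kappa>. (-1) ^ l * (if l \<le> a - \<kappa> then \<rho> a else \<rho> (l + \<kappa>)))
          + (\<Sum>l=a - \<kappa> + 1..n - \<kappa>. (-1) ^ l * (if l \<le> a - \<kappa> then \<rho> a else \<rho> (l + \<kappa>)))"
        (is "sum ?g _ = _")
        using sum.ub_add_nat[of 1 "a - \<kappa>" ?g "n - a"] a k by simp
      also have "(\<Sum>l=1..a - \<kappa>. (-1) ^ l * (if l \<le> a - \<kappa> then \<rho> a else \<rho> (l + \<kappa>)))
          = (\<Sum>l=1..a - \<kappa>. (-1) ^ l) * \<rho> a"
        unfolding sum_distrib_right by (intro sum.cong) auto
      also have "(\<Sum>l=a - \<kappa> + 1..n - \<kappa>. (-1) ^ l * (if l \<le> a - \<kappa> then \<rho> a else \<rho> (l + \<kappa>)))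
          = (\<Sum>l=a - \<kappa> + 1..n - \<kappa>. (-1) ^ l * \<rho> (l + \<kappa>))"
        by (intro sum.cong) auto
      also have "\<dots> = (\<Sum>m=a - \<kappa> + 1 + \<kappa>..n - \<kappa> + \<kappa>. (-1) ^ (m - \<kappa>) * \<rho> m)"
        by (subst sum.shift_bounds_cl_nat_ivl) simp
      also have "\<dots> = (-1) ^ \<kappa> * (\<Sum>m=a+1..n. (-1) ^ m * \<rho> m)"
        unfolding sum_distrib_left
      proof (rule sum.cong)
        fix m assume "m \<in> {a + 1..n}"
        then have "even (m - \<kappa>) \<longleftrightarrow> (even m \<longleftrightarrow> even \<kappa>)" using k by (simp add: even_diff_nat)
        then show "(-1) ^ (m - \<kappa>) * \<rho> m = (-1) ^ \<kappa> * ((-1) ^ m * \<rho> m)"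
          by (cases "even m"; cases "even \<kappa>") simp_all
      qed (use k a in auto)
      finally show ?thesis unfolding sum_alternating_signs_from_1 .
    qed
    then have "(\<Sum>\<kappa><a. \<Sum>l=1..n - \<kappa>. (-1) ^ l * (if l \<le> a - \<kappa> then \<rho> a else \<rho> (l + \<kappa>)))
      = (\<Sum>\<kappa><a. - of_bool (odd (a - \<kappa>)) * \<rho> a + (-1) ^ \<kappa> * (\<Sum>m=a+1..n. (-1) ^ m * \<rho> m))"
      by (intro sum.cong) auto
    also have "\<dots> = - (\<Sum>\<kappa><a. of_bool (odd (a - \<kappa>))) * \<rho> a + (\<Sum>\<kappa><a. (-1) ^ \<kappa>) * (\<Sum>m=a+1..n. (-1) ^ m * \<rho> m)"
      by (simp only: sum.distrib sum_distrib_right sum_negf mult_minus_left)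
    also have "(\<Sum>\<kappa><a. of_bool (odd (a - \<kappa>)) :: real) = (\<Sum>j<a. of_bool (odd (Suc j)))"
      by (rule sum.reindex_bij_witness[where i="\<lambda>j. a - Suc j" and j="\<lambda>j. a - Suc j"]) (auto simp: Suc_diff_Suc)
    also have "\<dots> = real ((a + 1) div 2)" by (induction a) auto
    finally show ?thesis unfolding sum_alternating_signs .
  qed
  have "(\<Sum>a=1..n. (-1) ^ a * (- real ((a + 1) div 2) * \<rho> a + of_bool (odd a) * (\<Sum>m=a+1..n. (-1) ^ m * \<rho> m)))
    = - (\<Sum>m=1..n. (-1) ^ m * real m * \<rho> m)"
  proof (induction n)
    case (Suc n)
    have odds: "(\<Sum>a=1..n. (-1) ^ a * of_bool (odd a)) = - real ((n + 1) div 2)" for n :: nat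
      by (induction n) auto
    have "(\<Sum>a=1..Suc n. (-1) ^ a * (- real ((a + 1) div 2) * \<rho> a + of_bool (odd a) * (\<Sum>m=a+1..Suc n. (-1) ^ m * \<rho> m)))
      = (\<Sum>a=1..n. (-1) ^ a * (- real ((a + 1) div 2) * \<rho> a + of_bool (odd a) * (\<Sum>m=a+1..Suc n. (-1) ^ m * \<rho> m)))
        - (-1) ^ Suc n * real ((n + 2) div 2) * \<rho> (Suc n)" by simp
    also have "(\<Sum>a=1..n. (-1) ^ a * (- real ((a + 1) div 2) * \<rho> a + of_bool (odd a) * (\<Sum>m=a+1..Suc n. (-1) ^ m * \<rho> m)))
      = (\<Sum>a=1..n. (-1) ^ a * (- real ((a + 1) div 2) * \<rho> a + of_bool (odd a) * (\<Sum>m=a+1..n. (-1) ^ m * \<rho> m))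
          + ((-1) ^ a * of_bool (odd a)) * ((-1) ^ Suc n * \<rho> (Suc n)))"
      by (intro sum.cong) (auto simp: algebra_simps)
    also have "\<dots> = - (\<Sum>m=1..n. (-1) ^ m * real m * \<rho> m) - real ((n + 1) div 2) * ((-1) ^ Suc n * \<rho> (Suc n))"
      unfolding sum.distrib Suc.IH sum_distrib_right[symmetric] odds by simp
    also have "\<dots> - (-1) ^ Suc n * real ((n + 2) div 2) * \<rho> (Suc n)
      = - (\<Sum>m=1..n. (-1) ^ m * real m * \<rho> m) - real ((n + 1) div 2 + (n + 2) div 2) * ((-1) ^ Suc n * \<rho> (Suc n))"
      by (simp add: algebra_simps)
    also have "(n + 1) div 2 + (n + 2) div 2 = Suc n" by arith
    finally show ?case by (simp add: mult_ac)
  qed simp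
  moreover have "(\<Sum>a=1..n. (-1) ^ a * (\<Sum>\<kappa><a. \<Sum>l=1..n - \<kappa>. (-1) ^ l * (if l \<le> a - \<kappa> then \<rho> a else \<rho> (l + \<kappa>))))
    = (\<Sum>a=1..n. (-1) ^ a * (- real ((a + 1) div 2) * \<rho> a + of_bool (odd a) * (\<Sum>m=a+1..n. (-1) ^ m * \<rho> m)))"
    by (rule sum.cong[OF refl]) (simp only: inner atLeastAtMost_iff)
  ultimately show ?thesis by simp
qed

lemma alternating_max_sum:
  fixes \<rho> :: "nat \<Rightarrow> real"
  shows "(\<Sum>a=1..n. \<Sum>b=1..n. (-1) ^ (a + b) * \<rho> (max a b)) = - (\<Sum>m=1..n. (-1) ^ m * \<rho> m)"
proof (induction n)
  case (Suc n)
  have "(\<Sum>a=1..Suc n. \<Sum>b=1..Suc n. (-1) ^ (a + b) * \<rho> (max a b))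
    = (\<Sum>a=1..n. (\<Sum>b=1..n. (-1) ^ (a + b) * \<rho> (max a b)) + (-1) ^ (a + Suc n) * \<rho> (max a (Suc n)))
      + (\<Sum>b=1..n. (-1) ^ (Suc n + b) * \<rho> (max (Suc n) b)) + \<rho> (Suc n)"
    by simp
  also have "(\<Sum>a=1..n. (\<Sum>b=1..n. (-1) ^ (a + b) * \<rho> (max a b)) + (-1) ^ (a + Suc n) * \<rho> (max a (Suc n)))
    = - (\<Sum>m=1..n. (-1) ^ m * \<rho> m) + (\<Sum>a=1..n. (-1) ^ (a + Suc n) * \<rho> (max a (Suc n)))"
    by (simp only: sum.distrib Suc.IH)
  also have "(\<Sum>a=1..n. (-1) ^ (a + Suc n) * \<rho> (max a (Suc n))) = (\<Sum>a=1..n. (-1) ^ a) * ((-1) ^ Suc n * \<rho> (Suc n))"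
    unfolding sum_distrib_right by (intro sum.cong) (auto simp: power_add max_def)
  also have "(\<Sum>b=1..n. (-1) ^ (Suc n + b) * \<rho> (max (Suc n) b)) = (\<Sum>a=1..n. (-1) ^ a) * ((-1) ^ Suc n * \<rho> (Suc n))"
    unfolding sum_distrib_right by (intro sum.cong) (auto simp: power_add max_def)
  finally show ?case unfolding sum_alternating_signs_from_1 by (cases "even n") auto
qed simp

text \<open>
  For intervals that share at least two points both patterns hold exactly if the pattern on the
  union holds. If they share one point, the probability differs by \<open>c\<close>, which is a
  function of the numbers of the remaining points of the two intervals.
\<close>

locale overlapping_pattern = interval_pattern M N Q Y pattern C
  for M :: "'a measure" and N Q :: "'b measure" and Y :: "int \<Rightarrow> 'a \<Rightarrow> 'b"
    and pattern :: "int \<Rightarrow> nat \<Rightarrow> (int \<Rightarrow> 'b) \<Rightarrow> bool" and C :: real +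
  fixes c :: "nat \<Rightarrow> nat \<Rightarrow> real" and r r1 rc :: real
  assumes pattern_nested: "\<And>a b l m x. pattern a m x \<Longrightarrow> a \<le> b \<Longrightarrow> b + int l \<le> a + int m \<Longrightarrow> pattern b l x"
    and pattern_overlap: "\<And>d k l. 1 \<le> d \<Longrightarrow> d < k \<Longrightarrow> k < d + l \<Longrightarrow>
      expectation (\<lambda>\<omega>. of_bool (pattern 0 k (\<lambda>i. Y i \<omega>)) * of_bool (pattern (int d) l (\<lambda>i. Y i \<omega>)))
      = prob {\<omega> \<in> space M. pattern 0 (d + l) (\<lambda>i. Y i \<omega>)} + (if d = k - 1 then c (k - 1) (l - 1) else 0)"
    and c_0: "\<And>j. c 0 j = 0" "\<And>j. c j 0 = 0"
    and r_lim: "(\<lambda>n. \<Sum>m=1..n. (-1) ^ m * prob {\<omega> \<in> space M. pattern 0 m (\<lambda>i. Y i \<omega>)}) \<longlonglongrightarrow> r"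
    and r1_lim: "(\<lambda>n. \<Sum>m=1..n. (-1) ^ m * real m * prob {\<omega> \<in> space M. pattern 0 m (\<lambda>i. Y i \<omega>)}) \<longlonglongrightarrow> r1"
    and rc_lim: "(\<lambda>n. \<Sum>k<n. (-1) ^ k * (\<Sum>i\<le>k. c (k - i) i)) \<longlonglongrightarrow> rc"
begin

lemma expectation_UU_shift:
  "expectation (\<lambda>\<omega>. U (a, k) \<omega> * U (a + d, l) \<omega>) = expectation (\<lambda>\<omega>. U (0, k) \<omega> * U (d, l) \<omega>)"
proof -
  have "expectation (\<lambda>\<omega>. U (a, k) \<omega> * U (a + d, l) \<omega>)
    = expectation (\<lambda>\<omega>. of_bool (pattern 0 k (\<lambda>i. Y (a + i) \<omega>)) * of_bool (pattern d l (\<lambda>i. Y (a + i) \<omega>)))"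
    unfolding U_def fst_conv snd_conv using pattern_shift[of 0 a] pattern_shift[of d a] by (simp add: add.commute)
  also have "\<dots> = expectation (\<lambda>\<omega>. of_bool (pattern 0 k (\<lambda>i. Y i \<omega>)) * of_bool (pattern d l (\<lambda>i. Y i \<omega>)))"
    by (rule expectation_reindex[where F="\<lambda>x. of_bool (pattern 0 k x) * of_bool (pattern d l x)"]) (auto simp: inj_def)
  finally show ?thesis unfolding U_def by simp
qed

lemma expectation_UU_nested:
  assumes "a \<le> b" "b + int l \<le> a + int m"
  shows "expectation (\<lambda>\<omega>. U (a, m) \<omega> * U (b, l) \<omega>) = \<rho> m"
proof -
  have "U (a, m) \<omega> * U (b, l) \<omega> = U (a, m) \<omega>" for \<omega>
    unfolding U_def using pattern_nested[OF _ assms] by auto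
  then show ?thesis by (simp only: expectation_U)
qed

text \<open>
  All pairs of overlapping intervals in \<open>{1..n}\<close> the second of which ends at
  \<open>n\<close>: if one contains the other, the pattern of the longer one implies that of the
  shorter one, and otherwise the pattern on the union is at work.
\<close>

lemma expectation_UU_end:
  assumes "1 \<le> a" "a \<le> n" "\<kappa> < a" "1 \<le> l" "l \<le> n - \<kappa>"
  shows "expectation (\<lambda>\<omega>. U (int (n - \<kappa>) - int l + 1, l) \<omega> * U (int n - int a + 1, a) \<omega>)
    = (if l \<le> a - \<kappa> then \<rho> a else \<rho> (l + \<kappa>)) + (if \<kappa> = a - 1 then c (l - 1) (a - 1) else 0)"
proof (cases "l \<le> a - \<kappa>")
  case True
  have "expectation (\<lambda>\<omega>. U (int n - int a + 1, a) \<omega> * U (int (n - \<kappa>) - int l + 1, l) \<omega>) = \<rho> a"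
    using assms True by (intro expectation_UU_nested) auto
  moreover have "c (l - 1) (a - 1) = 0" if "\<kappa> = a - 1" using that True assms c_0 by (cases "l = 1") auto
  ultimately show ?thesis using True by (simp add: mult.commute)
next
  case False
  show ?thesis
  proof (cases "\<kappa> = 0")
    case True
    have "expectation (\<lambda>\<omega>. U (int (n - \<kappa>) - int l + 1, l) \<omega> * U (int n - int a + 1, a) \<omega>) = \<rho> l"
      using assms True False by (intro expectation_UU_nested) auto
    then show ?thesis using True False assms c_0 by auto
  next
    case k: False
    define d where "d = l + \<kappa> - a"
    have d: "1 \<le> d" "d < l" "l < d + a" "d + a = l + \<kappa>" "d = l - 1 \<longleftrightarrow> \<kappa> = a - 1"
      using False k assms unfolding d_def by auto
    have start: "int n - int a + 1 = (int (n - \<kappa>) - int l + 1) + int d"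
      using False assms unfolding d_def by auto
    have "expectation (\<lambda>\<omega>. U (int (n - \<kappa>) - int l + 1, l) \<omega> * U (int n - int a + 1, a) \<omega>)
      = expectation (\<lambda>\<omega>. U (0, l) \<omega> * U (int d, a) \<omega>)"
      unfolding start by (rule expectation_UU_shift)
    also have "\<dots> = \<rho> (d + a) + (if d = l - 1 then c (l - 1) (a - 1) else 0)"
      unfolding U_def \<rho>_def fst_conv snd_conv by (rule pattern_overlap[OF d(1,2,3)])
    finally show ?thesis using d False by simp
  qed
qed

text \<open>
  The increment of \<open>T\<close> when the point \<open>n\<close> is added.
\<close>

definition \<Delta> :: "nat \<Rightarrow> 'a \<Rightarrow> real" where
  "\<Delta> n \<omega> = (\<Sum>a=1..n. (-1) ^ a * U (int n - int a + 1, a) \<omega>)"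

abbreviation \<mu> :: "nat \<Rightarrow> real" where "\<mu> n \<equiv> expectation (T n)"

definition R :: "nat \<Rightarrow> real" where "R n = (\<Sum>m=1..n. (-1) ^ m * \<rho> m)"

lemma \<Delta>_measurable [measurable]: "\<Delta> n \<in> borel_measurable M"
  unfolding \<Delta>_def by measurable

lemma T_eq: "T n \<omega> = (\<Sum>e=1..n. \<Delta> e \<omega>)"
  unfolding altsum_def sum_intervals \<Delta>_def by simp

lemma T_Suc: "T (Suc n) \<omega> = T n \<omega> + \<Delta> (Suc n) \<omega>"
  unfolding T_eq by simp

lemma \<Delta>_eq_altsum: "\<Delta> n \<omega> = altsum ((\<lambda>a. (int n - int a + 1, a)) ` {1..n}) \<omega>"
  unfolding altsum_def \<Delta>_def by (subst sum.reindex) (auto simp: inj_on_def)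

lemma \<Delta>_square_integrable: "integrable M (\<lambda>\<omega>. (\<Delta> n \<omega>)\<^sup>2)"
  unfolding \<Delta>_eq_altsum by (rule altsum_square_integrable) simp

lemma \<Delta>_integrable: "integrable M (\<Delta> n)"
  unfolding \<Delta>_eq_altsum[abs_def] by (rule altsum_integrable) simp

lemma expectation_\<Delta>: "expectation (\<Delta> n) = R n"
  unfolding \<Delta>_eq_altsum[abs_def] expectation_altsum R_def by (subst sum.reindex) (auto simp: inj_on_def)

lemma \<mu>_eq: "\<mu> n = (\<Sum>e=1..n. R e)"
  unfolding T_eq[abs_def] by (subst Bochner_Integration.integral_sum) (auto simp: \<Delta>_integrable expectation_\<Delta>)

text \<open>
  The intervals that end at \<open>n\<close> are nested, so the product of two patterns is the
  pattern of the longer interval.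
\<close>

lemma expectation_\<Delta>_square: "expectation (\<lambda>\<omega>. (\<Delta> n \<omega>)\<^sup>2) = - R n"
proof -
  have "expectation (\<lambda>\<omega>. (\<Delta> n \<omega>)\<^sup>2) = (\<Sum>a=1..n. \<Sum>b=1..n. (-1) ^ (a + b)
      * expectation (\<lambda>\<omega>. U (int n - int a + 1, a) \<omega> * U (int n - int b + 1, b) \<omega>))"
    unfolding \<Delta>_eq_altsum[abs_def] power2_eq_square expectation_altsum_mult
    by (subst sum.reindex, force simp: inj_on_def, simp only: comp_def, subst sum.reindex)
      (auto simp: inj_on_def)
  also have "\<dots> = (\<Sum>a=1..n. \<Sum>b=1..n. (-1) ^ (a + b) * \<rho> (max a b))"
  proof (intro sum.cong refl arg_cong2[where f="(*)"])
    fix a b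
    show "expectation (\<lambda>\<omega>. U (int n - int a + 1, a) \<omega> * U (int n - int b + 1, b) \<omega>) = \<rho> (max a b)"
    proof (cases "b \<le> a")
      case True
      then show ?thesis by (subst expectation_UU_nested) auto
    next
      case False
      then show ?thesis by (subst mult.commute, subst expectation_UU_nested) auto
    qed
  qed
  also have "\<dots> = - R n" unfolding alternating_max_sum R_def ..
  finally show ?thesis .
qed

text \<open>
  The intervals that end before the given one starts are independent of it. The others end at
  \<open>n - \<kappa>\<close> for some \<open>\<kappa> < a\<close>.
\<close>

lemma expectation_T_U_end:
  assumes a: "1 \<le> a" "a \<le> n"
  shows "expectation (\<lambda>\<omega>. T n \<omega> * U (int n - int a + 1, a) \<omega>)
    = \<rho> a * \<mu> (n - a) + (\<Sum>\<kappa><a. \<Sum>l=1..n - \<kappa>. (-1) ^ l * (if l \<le> a - \<kappa> then \<rho> a else \<rho> (l + \<kappa>)))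
      + (\<Sum>l=1..n + 1 - a. (-1) ^ l * c (l - 1) (a - 1))"
proof -
  let ?W = "\<lambda>e l. expectation (\<lambda>\<omega>. U (int e - int l + 1, l) \<omega> * U (int n - int a + 1, a) \<omega>)"
  have "expectation (\<lambda>\<omega>. T n \<omega> * U (int n - int a + 1, a) \<omega>) = (\<Sum>e=1..n. \<Sum>l=1..e. (-1) ^ l * ?W e l)"
    unfolding altsum_def sum_intervals sum_distrib_right fst_conv snd_conv mult.assoc
    by (subst Bochner_Integration.integral_sum, simp, intro sum.cong refl,
        subst Bochner_Integration.integral_sum) auto
  also have "\<dots> = (\<Sum>e=1..n - a. \<Sum>l=1..e. (-1) ^ l * ?W e l) + (\<Sum>e=n - a + 1..n. \<Sum>l=1..e. (-1) ^ l * ?W e l)"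
    using sum.ub_add_nat[of 1 "n - a" "\<lambda>e. \<Sum>l=1..e. (-1) ^ l * ?W e l" a] a by simp
  also have "(\<Sum>e=1..n - a. \<Sum>l=1..e. (-1) ^ l * ?W e l) = (\<Sum>e=1..n - a. \<Sum>l=1..e. (-1) ^ l * (\<rho> l * \<rho> a))"
  proof (intro sum.cong refl arg_cong2[where f="(*)"])
    fix e l assume "e \<in> {1..n - a}" "l \<in> {1..e}"
    then have "\<not> meets (int e - int l + 1, l) (int n - int a + 1, a)" using a by (subst meets_iff) auto
    from expectation_UU_disjoint[OF this] show "?W e l = \<rho> l * \<rho> a" by simp
  qed
  also have "\<dots> = \<rho> a * \<mu> (n - a)"
    unfolding \<mu>_eq R_def sum_distrib_left by (simp add: mult_ac)
  also have "(\<Sum>e=n - a + 1..n. \<Sum>l=1..e. (-1) ^ l * ?W e l) = (\<Sum>\<kappa><a. \<Sum>l=1..n - \<kappa>. (-1) ^ l * ?W (n - \<kappa>) l)"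
    by (rule sum.reindex_bij_witness[where i="\<lambda>\<kappa>. n - \<kappa>" and j="\<lambda>e. n - e"]) (use a in auto)
  also have "\<dots> = (\<Sum>\<kappa><a. \<Sum>l=1..n - \<kappa>. (-1) ^ l * (if l \<le> a - \<kappa> then \<rho> a else \<rho> (l + \<kappa>))
      + (-1) ^ l * (if \<kappa> = a - 1 then c (l - 1) (a - 1) else 0))"
    by (intro sum.cong refl, subst expectation_UU_end) (use a in \<open>auto simp: distrib_left\<close>)
  also have "\<dots> = (\<Sum>\<kappa><a. \<Sum>l=1..n - \<kappa>. (-1) ^ l * (if l \<le> a - \<kappa> then \<rho> a else \<rho> (l + \<kappa>)))
      + (\<Sum>\<kappa><a. if \<kappa> = a - 1 then \<Sum>l=1..n - \<kappa>. (-1) ^ l * c (l - 1) (a - 1) else 0)"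
    unfolding sum.distrib by (intro arg_cong2[where f="(+)"] refl sum.cong) auto
  also have "(\<Sum>\<kappa><a. if \<kappa> = a - 1 then \<Sum>l=1..n - \<kappa>. (-1) ^ l * c (l - 1) (a - 1) else 0)
      = (\<Sum>l=1..n + 1 - a. (-1) ^ l * c (l - 1) (a - 1))"
    using a by (subst sum.delta) auto
  finally show ?thesis by simp
qed

lemma expectation_T_\<Delta>:
  "expectation (\<lambda>\<omega>. T n \<omega> * \<Delta> n \<omega>)
    = (\<Sum>a=1..n. (-1) ^ a * \<rho> a * \<mu> (n - a)) - (\<Sum>m=1..n. (-1) ^ m * real m * \<rho> m)
      + (\<Sum>k<n. (-1) ^ k * (\<Sum>i\<le>k. c (k - i) i))"
proof -
  have TU: "integrable M (\<lambda>\<omega>. T n \<omega> * U I \<omega>)" for I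
    by (rule integrable_const_bound[of _ "real (card (intervals 1 (int n + 1)))"])
      (auto intro!: always_eventually altsum_abs_le simp: abs_mult U_def)
  have "expectation (\<lambda>\<omega>. T n \<omega> * \<Delta> n \<omega>)
    = expectation (\<lambda>\<omega>. \<Sum>a=1..n. (-1) ^ a * (T n \<omega> * U (int n - int a + 1, a) \<omega>))"
    unfolding \<Delta>_def sum_distrib_left by (intro Bochner_Integration.integral_cong refl sum.cong) simp
  also have "\<dots> = (\<Sum>a=1..n. (-1) ^ a * expectation (\<lambda>\<omega>. T n \<omega> * U (int n - int a + 1, a) \<omega>))"
    using TU by (subst Bochner_Integration.integral_sum) auto
  also have "\<dots> = (\<Sum>a=1..n. (-1) ^ a * (\<rho> a * \<mu> (n - a)
      + (\<Sum>\<kappa><a. \<Sum>l=1..n - \<kappa>. (-1) ^ l * (if l \<le> a - \<kappa> then \<rho> a else \<rho> (l + \<kappa>)))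
      + (\<Sum>l=1..n + 1 - a. (-1) ^ l * c (l - 1) (a - 1))))"
    by (intro sum.cong refl, subst expectation_T_U_end) auto
  also have "\<dots> = (\<Sum>a=1..n. (-1) ^ a * \<rho> a * \<mu> (n - a))
      + (\<Sum>a=1..n. (-1) ^ a * (\<Sum>\<kappa><a. \<Sum>l=1..n - \<kappa>. (-1) ^ l * (if l \<le> a - \<kappa> then \<rho> a else \<rho> (l + \<kappa>))))
      + (\<Sum>a=1..n. (-1) ^ a * (\<Sum>l=1..n + 1 - a. (-1) ^ l * c (l - 1) (a - 1)))"
    by (simp add: distrib_left sum.distrib mult.assoc)
  also have "(\<Sum>a=1..n. (-1) ^ a * (\<Sum>l=1..n + 1 - a. (-1) ^ l * c (l - 1) (a - 1)))
    = (\<Sum>k<n. (-1) ^ k * (\<Sum>i\<le>k. c (k - i) i))"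
  proof -
    have "(\<Sum>a=1..n. (-1) ^ a * (\<Sum>l=1..n + 1 - a. (-1) ^ l * c (l - 1) (a - 1)))
      = (\<Sum>a=1..n. \<Sum>l=1..n + 1 - a. (-1) ^ (a + l) * c (l - 1) (a - 1))"
      unfolding sum_distrib_left by (simp add: power_add mult.assoc)
    also have "\<dots> = (\<Sum>(a, l)\<in>(SIGMA a:{1..n}. {1..n + 1 - a}). (-1) ^ (a + l) * c (l - 1) (a - 1))"
      by (subst sum.Sigma) auto
    also have "\<dots> = (\<Sum>(i, j)\<in>{(i, j). i + j < n}. (-1) ^ (i + j) * c j i)"
      by (rule sum.reindex_bij_witness[where i="\<lambda>(i, j). (i + 1, j + 1)" and j="\<lambda>(a, l). (a - 1, l - 1)"])
        (auto simp: power_eq_if)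
    also have "\<dots> = (\<Sum>k<n. \<Sum>i\<le>k. (-1) ^ (i + (k - i)) * c (k - i) i)"
      by (rule sum.triangle_reindex)
    also have "\<dots> = (\<Sum>k<n. (-1) ^ k * (\<Sum>i\<le>k. c (k - i) i))"
      unfolding sum_distrib_left by (intro sum.cong) auto
    finally show ?thesis .
  qed
  finally show ?thesis unfolding alternating_hull_sum by simp
qed

text \<open>
  The increment is \<open>2 * Cov (T n) (\<Delta> n) - Var (\<Delta> n)\<close> at \<open>Suc
  n\<close>. The expectations \<open>\<mu>\<close>, which grow linearly, enter only through
  differences, so that every summand converges.
\<close>

lemma variance_increment:
  "variance (T (Suc n)) - variance (T n)
    = 2 * (- (\<Sum>a=1..Suc n. (-1) ^ a * \<rho> a * (\<mu> (Suc n) - \<mu> (Suc n - a)))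
        - (\<Sum>m=1..Suc n. (-1) ^ m * real m * \<rho> m) + (\<Sum>k<Suc n. (-1) ^ k * (\<Sum>i\<le>k. c (k - i) i)))
      + R (Suc n) + (R (Suc n))\<^sup>2"
proof -
  let ?N = "Suc n"
  have iT: "integrable M (T m)" "integrable M (\<lambda>\<omega>. (T m \<omega>)\<^sup>2)" for m
    by (auto intro: altsum_integrable altsum_square_integrable)
  have iTD: "integrable M (\<lambda>\<omega>. T ?N \<omega> * \<Delta> ?N \<omega>)"
    by (rule integrable_mult_of_squares) (use iT(2)[of ?N] \<Delta>_square_integrable in auto)
  have v: "variance (T m) = expectation (\<lambda>\<omega>. (T m \<omega>)\<^sup>2) - (\<mu> m)\<^sup>2" for m
    by (rule variance_eq[OF iT])
  have "expectation (\<lambda>\<omega>. (T n \<omega>)\<^sup>2) = expectation (\<lambda>\<omega>. (T ?N \<omega>)\<^sup>2 - 2 * (T ?N \<omega> * \<Delta> ?N \<omega>) + (\<Delta> ?N \<omega>)\<^sup>2)"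
    by (rule arg_cong[where f=expectation])
      (simp only: T_Suc fun_eq_iff power2_eq_square, simp add: algebra_simps)
  also have "\<dots> = expectation (\<lambda>\<omega>. (T ?N \<omega>)\<^sup>2) - 2 * expectation (\<lambda>\<omega>. T ?N \<omega> * \<Delta> ?N \<omega>) - R ?N"
    using iT(2)[of ?N] iTD \<Delta>_square_integrable expectation_\<Delta>_square by simp
  finally have e: "expectation (\<lambda>\<omega>. (T n \<omega>)\<^sup>2)
    = expectation (\<lambda>\<omega>. (T ?N \<omega>)\<^sup>2) - 2 * expectation (\<lambda>\<omega>. T ?N \<omega> * \<Delta> ?N \<omega>) - R ?N" .
  have m: "\<mu> n = \<mu> ?N - R ?N" unfolding \<mu>_eq by simp
  have s: "(\<Sum>a=1..?N. (-1) ^ a * \<rho> a * (\<mu> ?N - \<mu> (?N - a)))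
    = R ?N * \<mu> ?N - (\<Sum>a=1..?N. (-1) ^ a * \<rho> a * \<mu> (?N - a))"
    unfolding R_def sum_distrib_right sum_subtractf[symmetric] by (intro sum.cong) (auto simp: algebra_simps)
  show ?thesis
    unfolding v e s expectation_T_\<Delta> unfolding m by (simp add: power2_eq_square algebra_simps)
qed

lemma R_tendsto: "R \<longlonglongrightarrow> r"
  using r_lim unfolding R_def[abs_def] \<rho>_def .

lemma abs_R_le: "\<bar>R n\<bar> \<le> C"
proof -
  have "\<bar>R n\<bar> \<le> (\<Sum>m=1..n. \<rho> m)"
    unfolding R_def by (rule order.trans[OF sum_abs]) (simp add: abs_mult power_abs \<rho>_bounds)
  also have "\<dots> \<le> (\<Sum>m=1..n. C / 2 ^ m)"
  proof (rule sum_mono)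
    fix m
    have "C / 16 ^ m \<le> C / 2 ^ m" using C_nonneg by (intro divide_left_mono power_mono) auto
    then show "\<rho> m \<le> C / 2 ^ m" using \<rho>_bounds(3)[of m] by linarith
  qed
  also have "\<dots> = C * (1 - 1 / 2 ^ n)"
    by (induction n) (auto simp: algebra_simps)
  also have "\<dots> \<le> C * 1" using C_nonneg by (intro mult_left_mono) auto
  finally show ?thesis by simp
qed

text \<open>
  Since \<open>\<mu> n - \<mu> (n - a)\<close> is the sum of the last \<open>a\<close> increments,
  it tends to \<open>a * r\<close>. The summands are dominated by a geometric series, and
  Tannery's theorem applies.
\<close>

lemma convolution_tendsto:
  "(\<lambda>n. \<Sum>a=1..n. (-1) ^ a * \<rho> a * (\<mu> n - \<mu> (n - a))) \<longlonglongrightarrow> r * r1"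
proof -
  have incr: "\<mu> n - \<mu> (n - a) = (\<Sum>i<a. R (n - i))" if "a \<le> n" for n a
  proof -
    have "\<mu> n = (\<Sum>e=1..n - a. R e) + (\<Sum>e=n - a + 1..n. R e)"
      unfolding \<mu>_eq using sum.ub_add_nat[of 1 "n - a" R a] that by simp
    moreover have "(\<Sum>e=n - a + 1..n. R e) = (\<Sum>i<a. R (n - i))"
      by (rule sum.reindex_bij_witness[where i="\<lambda>i. n - i" and j="\<lambda>e. n - e"]) (use that in auto)
    ultimately show ?thesis unfolding \<mu>_eq by simp
  qed
  define f where "f a n = (if a \<in> {1..n} then (-1) ^ a * \<rho> a * (\<mu> n - \<mu> (n - a)) else 0)" for a n
  define g where "g a = (-1) ^ a * \<rho> a * (real a * r)" for a
  have lim: "f a \<longlonglongrightarrow> g a" for a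
  proof (cases "a = 0")
    case False
    have "(\<lambda>n. (-1) ^ a * \<rho> a * (\<Sum>i<a. R (n - i))) \<longlonglongrightarrow> (-1) ^ a * \<rho> a * (\<Sum>i<a. r)"
    proof (intro tendsto_mult tendsto_const tendsto_sum)
      fix i :: nat
      show "(\<lambda>n. R (n - i)) \<longlonglongrightarrow> r"
        by (rule LIMSEQ_offset[of _ i]) (simp add: R_tendsto)
    qed
    moreover have "\<forall>\<^sub>F n in sequentially. (-1) ^ a * \<rho> a * (\<Sum>i<a. R (n - i)) = f a n"
      using eventually_ge_at_top[of a] by eventually_elim (use False incr in \<open>auto simp: f_def\<close>)
    ultimately have "f a \<longlonglongrightarrow> (-1) ^ a * \<rho> a * (\<Sum>i<a. r)"
      by (rule Lim_transform_eventually)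
    then show ?thesis by (simp add: g_def)
  next
    case True
    have "f 0 = (\<lambda>_. 0)" by (simp add: f_def fun_eq_iff)
    then show ?thesis using True by (simp add: g_def)
  qed
  have bound: "norm (f a n) \<le> C * C * (1 / 2) ^ a" for a n
  proof (cases "a \<in> {1..n}")
    case True
    have "\<bar>\<Sum>i<a. R (n - i)\<bar> \<le> (\<Sum>i<a. C)"
      by (rule order.trans[OF sum_abs]) (intro sum_mono abs_R_le)
    then have 1: "\<bar>\<mu> n - \<mu> (n - a)\<bar> \<le> 2 ^ a * C"
    proof -
      have "real a \<le> 2 ^ a" using less_imp_le[OF less_exp[of a]] by (metis of_nat_le_iff of_nat_numeral of_nat_power)
      then have "real a * C \<le> 2 ^ a * C" using C_nonneg by (rule mult_right_mono)
      with \<open>\<bar>\<Sum>i<a. R (n - i)\<bar> \<le> (\<Sum>i<a. C)\<close> show ?thesis using incr[of a n] True by simp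
    qed
    have "norm (f a n) = \<rho> a * \<bar>\<mu> n - \<mu> (n - a)\<bar>"
      using True by (simp add: f_def abs_mult power_abs \<rho>_bounds)
    also have "\<dots> \<le> C / 16 ^ a * (2 ^ a * C)"
      using \<rho>_bounds 1 C_nonneg by (intro mult_mono) auto
    also have "\<dots> = C * C * (1 / 8) ^ a"
      using power_mult_distrib[of "2::real" 8 a] by (simp add: power_divide)
    also have "\<dots> \<le> C * C * (1 / 2) ^ a"
      using C_nonneg by (intro mult_left_mono power_mono) auto
    finally show ?thesis .
  qed (auto simp: f_def C_nonneg)
  have "summable (\<lambda>a. C * C * (1 / 2 :: real) ^ a)"
    by (intro summable_mult summable_geometric) simp
  moreover have "eventually (\<lambda>(a, n). norm (f a n) \<le> C * C * (1 / 2) ^ a) (sequentially \<times>\<^sub>F sequentially)"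
    by (rule always_eventually) (use bound in auto)
  ultimately have T: "summable (\<lambda>a. norm (g a)) \<and> (\<lambda>n. \<Sum>a. f a n) \<longlonglongrightarrow> (\<Sum>a. g a)"
    using tannerys_theorem[of f g sequentially "\<lambda>a. C * C * (1 / 2) ^ a", OF lim] by simp
  have "(\<Sum>a. f a n) = (\<Sum>a=1..n. (-1) ^ a * \<rho> a * (\<mu> n - \<mu> (n - a)))" for n
    by (subst suminf_finite[of "{1..n}"]) (auto simp: f_def)
  moreover have "(\<Sum>a. g a) = r * r1"
  proof -
    have "(\<lambda>n. \<Sum>a<n. g a) \<longlonglongrightarrow> (\<Sum>a. g a)"
      using T by (intro summable_LIMSEQ summable_norm_cancel[of g]) simp
    then have "(\<lambda>n. \<Sum>a<Suc n. g a) \<longlonglongrightarrow> (\<Sum>a. g a)" by (rule LIMSEQ_Suc)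
    moreover have "(\<Sum>a<Suc n. g a) = r * (\<Sum>m=1..n. (-1) ^ m * real m * \<rho> m)" for n
      by (induction n) (auto simp: g_def algebra_simps)
    moreover have "(\<lambda>n. r * (\<Sum>m=1..n. (-1) ^ m * real m * \<rho> m)) \<longlonglongrightarrow> r * r1"
      using r1_lim unfolding \<rho>_def by (rule tendsto_mult_left)
    ultimately show ?thesis by (metis (no_types, lifting) LIMSEQ_unique ext)
  qed
  ultimately show ?thesis using T by simp
qed

text \<open>
  The increments of the variance converge, hence so do their Cesaro means, which are
  \<open>variance (T n) / n\<close>.
\<close>

theorem variance_T_limit:
  "(\<lambda>n. variance (T n) / real n) \<longlonglongrightarrow> r - 2 * r1 + r\<^sup>2 - 2 * r * r1 + 2 * rc"
proof -
  have "(\<lambda>n. variance (T (Suc n)) - variance (T n)) \<longlonglongrightarrow> 2 * (- (r * r1) - r1 + rc) + r + r\<^sup>2"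
    unfolding variance_increment
    using LIMSEQ_Suc[OF convolution_tendsto] LIMSEQ_Suc[OF r1_lim[folded \<rho>_def]] LIMSEQ_Suc[OF rc_lim]
      LIMSEQ_Suc[OF R_tendsto]
    by (intro tendsto_intros)
  from Cesaro_mean_tendsto[OF this]
  have "(\<lambda>n. (variance (T n) - variance (T 0)) / real n) \<longlonglongrightarrow> 2 * (- (r * r1) - r1 + rc) + r + r\<^sup>2"
    by (simp only: sum_lessThan_telescope[of "\<lambda>k. variance (T k)"])
  moreover have "variance (T 0) = 0"
  proof -
    have "intervals 1 (int 0 + 1) = {}" by (auto simp: intervals_def)
    then have T0: "T 0 = (\<lambda>_. 0)" by (simp add: altsum_def fun_eq_iff)
    show ?thesis unfolding T0 by simp
  qed
  ultimately show ?thesis by (simp add: algebra_simps)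
qed

end

text \<open>
  A path with \<open>n\<close> vertices has \<open>n - 1\<close> edges, so the processes driven by
  edges lead to \<open>T (n - 1)\<close>.
\<close>

lemma (in overlapping_pattern) predecessor_limit:
  assumes s2: "0 < s2" and T: "variance_limit_and_clt M T s2"
  shows "variance_limit_and_clt M (\<lambda>n. T (n - 1)) s2"
proof (rule variance_limit_and_clt_transfer[OF prob_space_axioms _ _ _ _ _ s2 T])
  have fin: "finite (intervals a b)" for a b by (rule finite_intervals)
  show "T n \<in> borel_measurable M" "T (n - 1) \<in> borel_measurable M" for n by (rule altsum_measurable)+
  show "integrable M (\<lambda>\<omega>. (T n \<omega>)\<^sup>2)" "integrable M (\<lambda>\<omega>. (T (n - 1) \<omega>)\<^sup>2)" for n
    by (rule altsum_square_integrable[OF fin])+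
  show "expectation (\<lambda>\<omega>. (T (n - 1) \<omega> - T n \<omega>)\<^sup>2) \<le> \<bar>C\<bar>" for n
  proof (cases n)
    case (Suc k)
    have "(\<lambda>\<omega>. (T (n - 1) \<omega> - T n \<omega>)\<^sup>2) = (\<lambda>\<omega>. (\<Delta> (Suc k) \<omega>)\<^sup>2)"
      unfolding Suc diff_Suc_1 T_Suc by (simp add: fun_eq_iff)
    then show ?thesis using expectation_\<Delta>_square[of "Suc k"] abs_R_le[of "Suc k"] by simp
  qed simp
qed

section \<open>Chains of decreasing clocks\<close>

text \<open>
  The values \<open>u > f 0 > \<dots> > f (m - 1)\<close> form a chain. A site that rings at time
  \<open>u\<close> can be influenced only through such chains.
\<close>

primrec descending :: "nat \<Rightarrow> real \<Rightarrow> (nat \<Rightarrow> real) \<Rightarrow> bool" where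
  "descending 0 u f \<longleftrightarrow> True"
| "descending (Suc m) u f \<longleftrightarrow> f 0 < u \<and> descending m (f 0) (\<lambda>i. f (Suc i))"

text \<open>
  A site with clock \<open>u\<close> sees the sites with clocks \<open>f 0\<close>, \<open>f
  1\<close>, \<open>\<dots>\<close> on one side, the first \<open>m\<close> of which exist. It is
  blocked from this side if the neighbour rings earlier and is not blocked from its own far side.
\<close>

primrec unblocked :: "nat \<Rightarrow> real \<Rightarrow> (nat \<Rightarrow> real) \<Rightarrow> bool" where
  "unblocked 0 u f \<longleftrightarrow> True"
| "unblocked (Suc m) u f \<longleftrightarrow> \<not> (f 0 < u \<and> unblocked m (f 0) (\<lambda>i. f (Suc i)))"

text \<open>
  Starting from \<open>u\<close>, the values increase below \<open>t\<close> to a peak and then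
  decrease.
\<close>

primrec unimodal :: "real \<Rightarrow> nat \<Rightarrow> real \<Rightarrow> (nat \<Rightarrow> real) \<Rightarrow> bool" where
  "unimodal t 0 u f \<longleftrightarrow> True"
| "unimodal t (Suc m) u f \<longleftrightarrow> (if f 0 < u then descending m (f 0) (\<lambda>i. f (Suc i))
     else f 0 < t \<and> unimodal t m (f 0) (\<lambda>i. f (Suc i)))"

lemma descending_iff: "descending m u f \<longleftrightarrow> (\<forall>i<m. f i < (case i of 0 \<Rightarrow> u | Suc j \<Rightarrow> f j))"
proof (induction m arbitrary: u f)
  case (Suc m)
  have "(case i of 0 \<Rightarrow> f 0 | Suc j \<Rightarrow> f (Suc j)) = f i" for i by (cases i) auto
  then show ?case unfolding descending.simps Suc.IH All_less_Suc2 by simp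
qed simp

lemma descending_cong: "(\<And>i. i < m \<Longrightarrow> f i = g i) \<Longrightarrow> descending m u f = descending m u g"
proof (induction m arbitrary: u f g)
  case (Suc m)
  have "f 0 = g 0" "descending m (g 0) (\<lambda>i. f (Suc i)) = descending m (g 0) (\<lambda>i. g (Suc i))"
    by (rule Suc.prems, simp, rule Suc.IH, rule Suc.prems, simp)
  then show ?case by simp
qed simp

lemma descending_weaken: "descending k u f \<Longrightarrow> u \<le> u' \<Longrightarrow> descending k u' f"
  by (cases k) auto

lemma descending_iff_steps:
  "descending m u f \<longleftrightarrow> (\<forall>i<m. f i < u) \<and> (\<forall>i. Suc i < m \<longrightarrow> f (Suc i) < f i)"
proof (induction m arbitrary: u f)
  case (Suc m)
  have "(\<forall>i<Suc m. f i < u) \<and> (\<forall>i. Suc i < Suc m \<longrightarrow> f (Suc i) < f i)"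
    if h: "f 0 < u" "\<forall>i<m. f (Suc i) < f 0" "\<forall>i. Suc i < m \<longrightarrow> f (Suc (Suc i)) < f (Suc i)"
  proof (intro conjI allI impI)
    fix i assume "i < Suc m" then show "f i < u" using h by (cases i) force+
  next
    fix i assume "Suc i < Suc m" then show "f (Suc i) < f i" using h by (cases i) auto
  qed
  moreover have "f 0 < u \<and> (\<forall>i<m. f (Suc i) < f 0) \<and> (\<forall>i. Suc i < m \<longrightarrow> f (Suc (Suc i)) < f (Suc i))"
    if h: "\<forall>i<Suc m. f i < u" "\<forall>i. Suc i < Suc m \<longrightarrow> f (Suc i) < f i"
  proof (intro conjI allI impI)
    fix i assume "i < m"
    then show "f (Suc i) < f 0"
    proof (induction i)
      case (Suc i)
      then have "f (Suc i) < f 0" by simp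
      moreover have "f (Suc (Suc i)) < f (Suc i)" using h(2) Suc.prems by simp
      ultimately show ?case by simp
    qed (use h(2) in simp)
  qed (use h in auto)
  ultimately show ?case unfolding descending.simps Suc.IH by blast
qed simp

text \<open>
  The indicators are 1 up to the length of the maximal chain and 0 afterwards, so the alternating
  sum is 1 if this length is even and 0 if it is odd.
\<close>

lemma of_bool_unblocked:
  "of_bool (unblocked m u f) = (\<Sum>a\<le>m. (-1) ^ a * of_bool (descending a u f) :: real)"
proof (induction m arbitrary: u f)
  case (Suc m)
  have "(\<Sum>a\<le>Suc m. (-1) ^ a * of_bool (descending a u f) :: real)
    = 1 + (\<Sum>a\<le>m. (-1) ^ Suc a * of_bool (descending (Suc a) u f))"
    by (subst sum.atMost_Suc_shift) simp
  also have "\<dots> = 1 - of_bool (f 0 < u) * (\<Sum>a\<le>m. (-1) ^ a * of_bool (descending a (f 0) (\<lambda>i. f (Suc i))))"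
    by (auto simp: sum_negf)
  also have "\<dots> = of_bool (unblocked (Suc m) u f)"
    unfolding Suc.IH[symmetric] by simp
  finally show ?case by simp
qed simp

text \<open>
  Once a chain is broken, nothing beyond the break matters. This is what makes the processes
  local.
\<close>

lemma unblocked_stable:
  "\<not> descending k u f \<Longrightarrow> k \<le> m \<Longrightarrow> unblocked m u f = unblocked k u f"
proof (induction k arbitrary: m u f)
  case (Suc k)
  then obtain m' where "m = Suc m'" by (cases m) auto
  then show ?case using Suc.IH[of "f 0" "\<lambda>i. f (Suc i)" m'] Suc.prems by auto
qed simp

lemma measurable_descending [measurable (raw)]:
  assumes "g \<in> borel_measurable K" "\<And>i. (\<lambda>x. f x i) \<in> borel_measurable K"
  shows "Measurable.pred K (\<lambda>x. descending m (g x) (f x))"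
  using assms
proof (induction m arbitrary: g f)
  case (Suc m)
  have [measurable]: "\<And>i. (\<lambda>x. f x i) \<in> borel_measurable K" "g \<in> borel_measurable K" by fact+
  have [measurable]: "Measurable.pred K (\<lambda>x. descending m (f x 0) (\<lambda>i. f x (Suc i)))"
    by (rule Suc.IH) measurable
  show ?case unfolding descending.simps by measurable
qed simp

lemma measurable_unimodal [measurable (raw)]:
  assumes "g \<in> borel_measurable K" "\<And>i. (\<lambda>x. f x i) \<in> borel_measurable K"
  shows "Measurable.pred K (\<lambda>x. unimodal t m (g x) (f x))"
  using assms
proof (induction m arbitrary: g f)
  case (Suc m)
  have [measurable]: "\<And>i. (\<lambda>x. f x i) \<in> borel_measurable K" "g \<in> borel_measurable K" by fact+
  have [measurable]: "Measurable.pred K (\<lambda>x. unimodal t m (f x 0) (\<lambda>i. f x (Suc i)))"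
    by (rule Suc.IH) measurable
  show ?case unfolding unimodal.simps by measurable
qed simp

text \<open>
  At most one \<open>j\<close> contributes, namely the point where the labels switch from
  \<open>\<not> d\<close> to \<open>d\<close>; it exists unless a label \<open>d\<close> is
  followed by \<open>\<not> d\<close>.
\<close>

lemma sum_switching_points:
  "(\<Sum>j\<le>n. of_bool ((\<forall>i<j. \<not> d i) \<and> (\<forall>i. j \<le> i \<and> i < n \<longrightarrow> d i)) :: real)
    = of_bool (\<forall>i. Suc i < n \<longrightarrow> d i \<longrightarrow> d (Suc i))"
proof (induction n)
  case (Suc n)
  have "(\<Sum>j\<le>n. of_bool ((\<forall>i<j. \<not> d i) \<and> (\<forall>i. j \<le> i \<and> i < Suc n \<longrightarrow> d i)) :: real)
    = (\<Sum>j\<le>n. of_bool (d n) * of_bool ((\<forall>i<j. \<not> d i) \<and> (\<forall>i. j \<le> i \<and> i < n \<longrightarrow> d i)))"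
    by (rule sum.cong) (auto simp: less_Suc_eq)
  also have "\<dots> = of_bool (d n) * of_bool (\<forall>i. Suc i < n \<longrightarrow> d i \<longrightarrow> d (Suc i))"
    unfolding sum_distrib_left[symmetric] Suc.IH ..
  finally have "(\<Sum>j\<le>Suc n. of_bool ((\<forall>i<j. \<not> d i) \<and> (\<forall>i. j \<le> i \<and> i < Suc n \<longrightarrow> d i)) :: real)
    = of_bool (d n) * of_bool (\<forall>i. Suc i < n \<longrightarrow> d i \<longrightarrow> d (Suc i)) + of_bool (\<forall>i<Suc n. \<not> d i)"
    by simp
  also have "\<dots> = of_bool (\<forall>i. Suc i < Suc n \<longrightarrow> d i \<longrightarrow> d (Suc i))"
  proof (cases "d n")
    case True
    then have "(\<forall>i. Suc i < Suc n \<longrightarrow> d i \<longrightarrow> d (Suc i)) \<longleftrightarrow> (\<forall>i. Suc i < n \<longrightarrow> d i \<longrightarrow> d (Suc i))"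
      by (metis Suc_lessD Suc_lessI Suc_less_eq)
    then show ?thesis using True by auto
  next
    case False
    have "(\<forall>i<Suc n. \<not> d i) \<longleftrightarrow> (\<forall>i. Suc i < Suc n \<longrightarrow> d i \<longrightarrow> d (Suc i))"
    proof
      assume h: "\<forall>i. Suc i < Suc n \<longrightarrow> d i \<longrightarrow> d (Suc i)"
      have "i + k = n \<Longrightarrow> \<not> d i" for i k
      proof (induction k arbitrary: i)
        case (Suc k)
        then have "\<not> d (Suc i)" by (intro Suc.IH) simp
        then show ?case using h Suc.prems by auto
      qed (use False in simp)
      then show "\<forall>i<Suc n. \<not> d i" by (metis le_iff_add less_Suc_eq_le)
    qed simp
    then show ?thesis using False by simp
  qed
  finally show ?case .
qed simp

text \<open>
  The part of \<open>Q\<close> on \<open>(0, 1)\<close> has density \<open>\<theta>\<close> and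
  the rest of the mass lies beyond 1. This covers uniform clocks with \<open>\<theta> = 1\<close>
  and, with \<open>\<theta> = 1 / 2\<close>, the clocks of edges that attack in a prescribed
  direction.
\<close>

definition uniform_below :: "real measure \<Rightarrow> real \<Rightarrow> bool" where
  "uniform_below Q \<theta> \<longleftrightarrow> (AE s in Q. 0 < s) \<and> (\<forall>u\<le>1. AE s in Q. s \<noteq> u) \<and>
     (\<forall>a b f. 0 \<le> a \<longrightarrow> a \<le> b \<longrightarrow> b \<le> 1 \<longrightarrow> continuous_on {a..b} f \<longrightarrow>
       (\<integral>s. indicator {a<..<b} s * f s \<partial>Q) = \<theta> * integral {a..b} f)"

lemma integral_power_shift:
  fixes a b c k :: real
  assumes "a \<le> b" "k \<noteq> 0"
  shows "integral {a..b} (\<lambda>s. (c + k * s) ^ m) = ((c + k * b) ^ Suc m - (c + k * a) ^ Suc m) / (k * (real m + 1))"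
proof -
  have "((\<lambda>s. (c + k * s) ^ Suc m / (k * (real m + 1))) has_vector_derivative (c + k * s) ^ m) (at s within {a..b})" for s
    unfolding has_real_derivative_iff_has_vector_derivative[symmetric]
  proof -
    have "((\<lambda>s. (c + k * s) ^ Suc m) has_real_derivative real (Suc m) * ((c + k * s) ^ m * k)) (at s within {a..b})"
      by (auto intro!: derivative_eq_intros simp del: power_Suc)
    then have "((\<lambda>s. (c + k * s) ^ Suc m / (k * (real m + 1))) has_real_derivative
        real (Suc m) * ((c + k * s) ^ m * k) / (k * (real m + 1))) (at s within {a..b})"
      by (rule DERIV_cdivide)
    moreover have "real (Suc m) * ((c + k * s) ^ m * k) / (k * (real m + 1)) = (c + k * s) ^ m"
      using assms(2) by (simp add: add.commute)
    ultimately show "((\<lambda>s. (c + k * s) ^ Suc m / (k * (real m + 1))) has_real_derivative (c + k * s) ^ m) (at s within {a..b})"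
      by simp
  qed
  then have "((\<lambda>s. (c + k * s) ^ m) has_integral
      (c + k * b) ^ Suc m / (k * (real m + 1)) - (c + k * a) ^ Suc m / (k * (real m + 1))) {a..b}"
    using assms(1) by (intro fundamental_theorem_of_calculus)
  then show ?thesis by (simp add: integral_unique diff_divide_distrib)
qed

lemma prob_space_uniform: "prob_space (uniform_measure lborel {0<..<1::real})"
  by (rule prob_space_uniform_measure) auto

lemma uniform_eq_density: "uniform_measure lborel {0<..<1::real} = density lborel (indicator {0<..<1})"
  unfolding uniform_measure_def by (intro density_cong) (auto simp: indicator_def)

lemma uniform_below_uniform: "uniform_below (uniform_measure lborel {0<..<1}) 1"
  unfolding uniform_below_def
proof (intro conjI allI impI)
  have AE: "AE s in uniform_measure lborel {0<..<1::real}. P s" if "AE s in lborel. s \<in> {0<..<1} \<longrightarrow> P s" for P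
    unfolding uniform_eq_density using that by (subst AE_density) (auto simp: indicator_def)
  show "AE s in uniform_measure lborel {0<..<1::real}. 0 < s"
    by (rule AE) auto
  show "AE s in uniform_measure lborel {0<..<1::real}. s \<noteq> u" for u
    by (rule AE) (use AE_lborel_singleton[of u] in auto)
next
  fix a b :: real and f :: "real \<Rightarrow> real"
  assume ab: "0 \<le> a" "a \<le> b" "b \<le> 1" and f: "continuous_on {a..b} f"
  have "(\<lambda>s. indicator {a<..<b} s *\<^sub>R f s) \<in> borel_measurable borel"
    using f by (intro borel_measurable_continuous_on_indicator)
      (auto intro: continuous_on_subset)
  then have [measurable]: "(\<lambda>s. indicator {a<..<b} s * f s) \<in> borel_measurable borel" by simp
  have "(\<integral>s. indicator {a<..<b} s * f s \<partial>uniform_measure lborel {0<..<1})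
    = (\<integral>s. indicator {0<..<1} s *\<^sub>R (indicator {a<..<b} s * f s) \<partial>lborel)"
    unfolding uniform_eq_density ennreal_indicator[symmetric]
    by (subst integral_density) auto
  also have "\<dots> = (\<integral>s. indicator {a..b} s *\<^sub>R f s \<partial>lborel)"
  proof (rule integral_cong_AE)
    have "(\<lambda>s. indicator {a..b} s *\<^sub>R f s) \<in> borel_measurable borel"
      using f by (intro borel_measurable_continuous_on_indicator) auto
    then show "(\<lambda>s. indicator {a..b} s *\<^sub>R f s) \<in> borel_measurable lborel" by simp
    show "AE s in lborel. indicator {0<..<1} s *\<^sub>R (indicator {a<..<b} s * f s) = indicator {a..b} s *\<^sub>R f s"
      using AE_lborel_singleton[of a] AE_lborel_singleton[of b]
      by eventually_elim (use ab in \<open>auto simp: indicator_def\<close>)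
  qed simp
  also have "\<dots> = integral {a..b} f"
    using set_borel_integral_eq_integral(2)[OF borel_integrable_atLeastAtMost'[OF f]]
    by (simp add: set_lebesgue_integral_def)
  finally show "(\<integral>s. indicator {a<..<b} s * f s \<partial>uniform_measure lborel {0<..<1}) = 1 * integral {a..b} f"
    by simp
qed

locale clock_sequence = iid_family M borel Q Z
  for M :: "'a measure" and Q :: "real measure" and Z :: "nat \<Rightarrow> 'a \<Rightarrow> real" +
  fixes \<theta> :: real
  assumes uniform_below: "uniform_below Q \<theta>"
begin

text \<open>
  Condition on the first clock and use that the shifted sequence has the same law.
\<close>

lemma expectation_first_clock:
  assumes [measurable]: "Measurable.pred (borel \<Otimes>\<^sub>M PiM UNIV (\<lambda>_. borel)) (\<lambda>p. F (fst p) (snd p))"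
  shows "expectation (\<lambda>\<omega>. of_bool (F (Z 0 \<omega>) (\<lambda>i. Z (Suc i) \<omega>)) :: real)
    = (\<integral>s. expectation (\<lambda>\<omega>. of_bool (F s (\<lambda>i. Z i \<omega>))) \<partial>Q)"
proof -
  have shift [measurable]: "(\<lambda>z i. z (Suc i)) \<in> PiM UNIV (\<lambda>_. borel) \<rightarrow>\<^sub>M PiM UNIV (\<lambda>_. borel :: real measure)"
    by (rule measurable_PiM_single') (auto simp: space_PiM PiE_iff)
  have 1: "Measurable.pred (PiM UNIV (\<lambda>_. borel)) (\<lambda>z. F (z 0) (\<lambda>i. z (Suc i)))"
    using measurable_compose[OF measurable_Pair[OF measurable_component_singleton shift] assms, of 0] by simp
  have 2: "Measurable.pred (PiM UNIV (\<lambda>_. borel)) (F s)" for s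
    using measurable_compose[OF measurable_Pair[OF measurable_const measurable_ident_sets[OF refl]] assms, of s] by simp
  have "expectation (\<lambda>\<omega>. of_bool (F (Z 0 \<omega>) (\<lambda>i. Z (Suc i) \<omega>)) :: real)
    = (\<integral>s. expectation (\<lambda>\<omega>. of_bool (F s (\<lambda>i. Z (Suc i) \<omega>))) \<partial>Q)"
    using expectation_condition[where F="\<lambda>z. of_bool (F (z 0) (\<lambda>i. z (Suc i)))" and v=0 and B=1] 1 by simp
  also have "\<dots> = (\<integral>s. expectation (\<lambda>\<omega>. of_bool (F s (\<lambda>i. Z i \<omega>))) \<partial>Q)"
  proof (rule Bochner_Integration.integral_cong[OF refl])
    fix s
    have "expectation (\<lambda>\<omega>. (\<lambda>z. of_bool (F s z) :: real) (\<lambda>i. Z (Suc i) \<omega>))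
      = expectation (\<lambda>\<omega>. (\<lambda>z. of_bool (F s z) :: real) (\<lambda>i. Z i \<omega>))"
      by (rule expectation_reindex) (use 2 in simp_all)
    then show "expectation (\<lambda>\<omega>. of_bool (F s (\<lambda>i. Z (Suc i) \<omega>)) :: real)
      = expectation (\<lambda>\<omega>. of_bool (F s (\<lambda>i. Z i \<omega>)))" .
  qed
  finally show ?thesis .
qed

lemma integral_below:
  assumes "0 \<le> a" "a \<le> b" "b \<le> 1" "continuous_on {a..b} f"
  shows "(\<integral>s. indicator {a<..<b} s * f s \<partial>Q) = \<theta> * integral {a..b} f"
  using uniform_below assms by (auto simp: uniform_below_def)

lemma AE_Q: "AE s in Q. 0 < s" "u \<le> 1 \<Longrightarrow> AE s in Q. s \<noteq> u"
  using uniform_below by (auto simp: uniform_below_def)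

text \<open>
  Conditioning on the first clock gives the recursion \<open>p\<^sub>m\<^sub>+\<^sub>1 u =
  \<theta> * (\<integral>s=0..u. p\<^sub>m s)\<close> for the probabilities.
\<close>

lemma expectation_descending:
  assumes "0 \<le> u" "u \<le> 1"
  shows "expectation (\<lambda>\<omega>. of_bool (descending m u (\<lambda>i. Z i \<omega>)) :: real) = (\<theta> * u) ^ m / fact m"
  using assms
proof (induction m arbitrary: u)
  case (Suc m)
  have "expectation (\<lambda>\<omega>. of_bool (descending (Suc m) u (\<lambda>i. Z i \<omega>)) :: real)
    = (\<integral>s. expectation (\<lambda>\<omega>. of_bool (s < u \<and> descending m s (\<lambda>i. Z i \<omega>))) \<partial>Q)"
    unfolding descending.simps by (rule expectation_first_clock) measurable
  also have "\<dots> = (\<integral>s. indicator {0<..<u} s * ((\<theta> * s) ^ m / fact m) \<partial>Q)"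
  proof (rule integral_cong_AE)
    show "AE s in Q. expectation (\<lambda>\<omega>. of_bool (s < u \<and> descending m s (\<lambda>i. Z i \<omega>)))
        = indicator {0<..<u} s * ((\<theta> * s) ^ m / fact m)"
      using AE_Q(1)
    proof eventually_elim
      case (elim s)
      then show ?case using Suc.IH[of s] Suc.prems by (cases "s < u") auto
    qed
  qed measurable
  also have "\<dots> = \<theta> * integral {0..u} (\<lambda>s. (\<theta> * s) ^ m / fact m)"
    using Suc.prems by (intro integral_below) (auto intro!: continuous_intros)
  also have "integral {0..u} (\<lambda>s. (\<theta> * s) ^ m / fact m) = \<theta> ^ m / fact m * integral {0..u} (\<lambda>s. (0 + 1 * s) ^ m)"
    by (subst integral_mult_right[symmetric]) (simp add: power_mult_distrib)
  also have "\<theta> * \<dots> = (\<theta> * u) ^ Suc m / fact (Suc m)"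
    using Suc.prems by (subst integral_power_shift) (auto simp: power_mult_distrib field_simps)
  finally show ?case .
qed (simp add: prob_space)

text \<open>
  Condition on the first clock \<open>s\<close>: for \<open>s < u\<close> the remaining clocks
  must decrease, for \<open>u < s < t\<close> they continue a unimodal sequence from
  \<open>s\<close>.
\<close>

lemma expectation_unimodal:
  assumes \<theta>: "\<theta> = 1" and "0 \<le> u" "u \<le> t" "t \<le> 1"
  shows "expectation (\<lambda>\<omega>. of_bool (unimodal t m u (\<lambda>i. Z i \<omega>)) :: real) = ((2 * t - u) ^ m + u ^ m) / (2 * fact m)"
  using assms(2-)
proof (induction m arbitrary: u)
  case (Suc m)
  have u1: "u \<le> 1" using Suc.prems assms by simp
  have "expectation (\<lambda>\<omega>. of_bool (unimodal t (Suc m) u (\<lambda>i. Z i \<omega>)) :: real)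
    = (\<integral>s. expectation (\<lambda>\<omega>. of_bool (if s < u then descending m s (\<lambda>i. Z i \<omega>)
         else s < t \<and> unimodal t m s (\<lambda>i. Z i \<omega>))) \<partial>Q)"
    unfolding unimodal.simps by (rule expectation_first_clock) measurable
  also have "\<dots> = (\<integral>s. indicator {0<..<u} s * (s ^ m / fact m)
      + indicator {u<..<t} s * (((2 * t - s) ^ m + s ^ m) / (2 * fact m)) \<partial>Q)"
  proof (rule integral_cong_AE)
    show "AE s in Q. expectation (\<lambda>\<omega>. of_bool (if s < u then descending m s (\<lambda>i. Z i \<omega>)
         else s < t \<and> unimodal t m s (\<lambda>i. Z i \<omega>))) = indicator {0<..<u} s * (s ^ m / fact m)
      + indicator {u<..<t} s * (((2 * t - s) ^ m + s ^ m) / (2 * fact m))"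
      using AE_Q(1) AE_Q(2)[OF u1]
    proof eventually_elim
      case (elim s)
      then show ?case using Suc.IH[of s] Suc.prems expectation_descending[of s m] \<theta>
        by (cases "s < u"; cases "s < t") auto
    qed
  qed measurable
  also have "\<dots> = (\<integral>s. indicator {0<..<u} s * (s ^ m / fact m) \<partial>Q)
      + (\<integral>s. indicator {u<..<t} s * (((2 * t - s) ^ m + s ^ m) / (2 * fact m)) \<partial>Q)"
  proof (rule Bochner_Integration.integral_add)
    interpret Q: prob_space Q by (rule prob_space_Q)
    have bd: "integrable Q (\<lambda>s. indicator {a<..<b} s * f s)"
      if "continuous_on {a..b} f" "f \<in> borel_measurable borel" for a b :: real and f :: "real \<Rightarrow> real"
    proof -
      from compact_imp_bounded[OF compact_continuous_image[OF that(1) compact_Icc]]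
      obtain B where "\<forall>x\<in>{a..b}. \<bar>f x\<bar> \<le> B" unfolding bounded_iff by auto
      then have "\<bar>indicator {a<..<b} s * f s\<bar> \<le> max 0 B" for s
        by (auto simp: indicator_def le_max_iff_disj)
      then show ?thesis using that(2) by (intro Q.integrable_const_bound[of _ "max 0 B"]) auto
    qed
    show "integrable Q (\<lambda>s. indicator {0<..<u} s * (s ^ m / fact m))"
      "integrable Q (\<lambda>s. indicator {u<..<t} s * (((2 * t - s) ^ m + s ^ m) / (2 * fact m)))"
      by (intro bd; auto intro!: continuous_intros)+
  qed
  also have "\<dots> = integral {0..u} (\<lambda>s. s ^ m / fact m) + integral {u..t} (\<lambda>s. ((2 * t - s) ^ m + s ^ m) / (2 * fact m))"
    using Suc.prems \<theta> by (simp add: integral_below continuous_intros)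
  also have "integral {0..u} (\<lambda>s. s ^ m / fact m) = integral {0..u} (\<lambda>s. (0 + 1 * s) ^ m) / fact m"
    by simp
  also have "\<dots> = u ^ Suc m / fact (Suc m)"
    using Suc.prems by (subst integral_power_shift) (auto simp: field_simps)
  also have "integral {u..t} (\<lambda>s. ((2 * t - s) ^ m + s ^ m) / (2 * fact m))
    = (integral {u..t} (\<lambda>s. (2 * t + (-1) * s) ^ m) + integral {u..t} (\<lambda>s. (0 + 1 * s) ^ m)) / (2 * fact m)"
    by (subst Henstock_Kurzweil_Integration.integral_add[symmetric])
      (auto intro!: integrable_continuous_real continuous_intros)
  also have "\<dots> = ((2 * t - u) ^ Suc m - u ^ Suc m) / (2 * fact (Suc m))"
    using Suc.prems by (subst integral_power_shift, simp, simp, subst integral_power_shift)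
      (auto simp: divide_simps, simp_all add: algebra_simps)
  also have "u ^ Suc m / fact (Suc m) + ((2 * t - u) ^ Suc m - u ^ Suc m) / (2 * fact (Suc m))
    = ((2 * t - u) ^ Suc m + u ^ Suc m) / (2 * fact (Suc m))"
    by (simp add: add_divide_distrib diff_divide_distrib)
  finally show ?case .
qed (simp add: prob_space)

lemma prob_descending:
  assumes "0 \<le> u" "u \<le> 1"
  shows "prob {\<omega> \<in> space M. descending m u (\<lambda>i. Z i \<omega>)} = (\<theta> * u) ^ m / fact m"
  using expectation_descending[OF assms] by (simp only: expectation_of_bool)

end

section \<open>The interval patterns of blocking\<close>

lemma coordinate_measurable [measurable]:
  "(\<lambda>x. x i) \<in> borel_measurable (PiM UNIV (\<lambda>_. borel :: real measure))"
  by (rule measurable_component_singleton) simp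

definition valley_free :: "real \<Rightarrow> nat \<Rightarrow> (nat \<Rightarrow> real) \<Rightarrow> bool" where
  "valley_free t m g \<longleftrightarrow> (\<forall>i<m. g i < t) \<and> (\<forall>i. i + 2 < m \<longrightarrow> \<not> (g (i + 1) < g i \<and> g (i + 1) < g (i + 2)))"

text \<open>
  Without valleys, a sequence that has decreased once never increases again.
\<close>

lemma valley_free_Suc:
  assumes "inj g"
  shows "valley_free t (Suc m) g \<longleftrightarrow> g 0 < t \<and> unimodal t m (g 0) (\<lambda>i. g (Suc i))"
  using assms
proof (induction m arbitrary: g)
  case (Suc m)
  have inj: "inj (\<lambda>i. g (Suc i))" using inj_compose[OF Suc.prems inj_Suc] by (simp add: comp_def)
  have ne: "g i = g j \<longleftrightarrow> i = j" for i j using Suc.prems by (simp add: inj_eq)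
  have "valley_free t (Suc (Suc m)) g \<longleftrightarrow> g 0 < t \<and> valley_free t (Suc m) (\<lambda>i. g (Suc i))
      \<and> (0 < m \<longrightarrow> \<not> (g 1 < g 0 \<and> g 1 < g 2))"
  proof -
    have "(\<forall>i. i + 2 < Suc (Suc m) \<longrightarrow> \<not> (g (i + 1) < g i \<and> g (i + 1) < g (i + 2)))
      \<longleftrightarrow> (0 < m \<longrightarrow> \<not> (g 1 < g 0 \<and> g 1 < g 2))
        \<and> (\<forall>i. i + 2 < Suc m \<longrightarrow> \<not> (g (Suc (i + 1)) < g (Suc i) \<and> g (Suc (i + 1)) < g (Suc (i + 2))))"
      (is "(\<forall>i. ?P i) \<longleftrightarrow> ?A \<and> (\<forall>i. ?Q i)")
    proof -
      have "(\<forall>i. ?P i) \<longleftrightarrow> ?P 0 \<and> (\<forall>i. ?P (Suc i))" by (metis not0_implies_Suc)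
      then show ?thesis by (simp add: numeral_2_eq_2)
    qed
    then show ?thesis unfolding valley_free_def All_less_Suc2[of "Suc m"] by blast
  qed
  also have "\<dots> \<longleftrightarrow> g 0 < t \<and> g 1 < t \<and> unimodal t m (g 1) (\<lambda>i. g (Suc (Suc i)))
      \<and> (0 < m \<longrightarrow> \<not> (g 1 < g 0 \<and> g 1 < g 2))"
    using Suc.IH[OF inj] by auto
  also have "\<dots> \<longleftrightarrow> g 0 < t \<and> unimodal t (Suc m) (g 0) (\<lambda>i. g (Suc i))"
  proof (cases "g 1 < g 0")
    case True
    show ?thesis
    proof (cases m)
      case (Suc k)
      have "g 1 < g 2 \<or> g 2 < g 1" using ne[of 1 2] by linarith
      then show ?thesis using True Suc by (auto simp: numeral_2_eq_2)
    qed (use True in auto)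
  qed auto
  finally show ?case .
qed (simp add: valley_free_def)

lemma valley_free_subinterval:
  assumes "valley_free t m g" "d + l \<le> m"
  shows "valley_free t l (\<lambda>i. g (d + i))"
  unfolding valley_free_def
proof (intro conjI allI impI)
  fix i assume "i < l"
  then show "g (d + i) < t" using assms unfolding valley_free_def by auto
next
  fix i assume "i + 2 < l"
  then have "d + i + 2 < m" using assms by simp
  then have "\<not> (g (d + i + 1) < g (d + i) \<and> g (d + i + 1) < g (d + i + 2))"
    using assms(1) unfolding valley_free_def by blast
  then show "\<not> (g (d + (i + 1)) < g (d + i) \<and> g (d + (i + 1)) < g (d + (i + 2)))"
    by (metis add.assoc)
qed

lemma valley_free_rev:
  "valley_free t m (\<lambda>i. x (a + int i)) = valley_free t m (\<lambda>i. x (a + int m - 1 - int i))"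
proof -
  have half: "valley_free t m (\<lambda>i. x (a + int m - 1 - int i))"
    if v: "valley_free t m (\<lambda>i. x (a + int i))" for a x
    unfolding valley_free_def
  proof (intro conjI allI impI)
    fix i assume "i < m"
    then have "m - 1 - i < m" by simp
    then have "x (a + int (m - 1 - i)) < t" using v unfolding valley_free_def by blast
    moreover have "a + int (m - 1 - i) = a + int m - 1 - int i" using \<open>i < m\<close> by auto
    ultimately show "x (a + int m - 1 - int i) < t" by (simp only:)
  next
    fix i assume i: "i + 2 < m"
    define j where "j = m - 3 - i"
    have "j + 2 < m" using i unfolding j_def by auto
    then have "\<not> (x (a + int (j + 1)) < x (a + int j) \<and> x (a + int (j + 1)) < x (a + int (j + 2)))"
      using v unfolding valley_free_def by blast
    moreover have "a + int (j + 1) = a + int m - 1 - int (i + 1)" "a + int j = a + int m - 1 - int (i + 2)"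
      "a + int (j + 2) = a + int m - 1 - int i" using i unfolding j_def by auto
    ultimately show "\<not> (x (a + int m - 1 - int (i + 1)) < x (a + int m - 1 - int i)
        \<and> x (a + int m - 1 - int (i + 1)) < x (a + int m - 1 - int (i + 2)))" by (simp only:) blast
  qed
  have "valley_free t m (\<lambda>i. x (a + int i))" if v: "valley_free t m (\<lambda>i. x (a + int m - 1 - int i))"
  proof -
    have "valley_free t m (\<lambda>i. (\<lambda>k. x (- k)) (1 - a - int m + int i))" using v by (simp add: algebra_simps)
    from half[OF this] show ?thesis by (simp add: algebra_simps)
  qed
  then show ?thesis using half[of x a] by blast
qed

text \<open>
  Every three consecutive positions of the union lie in one of the two intervals, since these
  share at least two positions.
\<close>

lemma valley_free_overlap:
  assumes d: "d + 1 < k" "k < d + l"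
  shows "valley_free t k g \<and> valley_free t l (\<lambda>i. g (d + i)) \<longleftrightarrow> valley_free t (d + l) g"
proof
  assume h: "valley_free t k g \<and> valley_free t l (\<lambda>i. g (d + i))"
  show "valley_free t (d + l) g"
    unfolding valley_free_def
  proof (intro conjI allI impI)
    fix i assume i: "i < d + l"
    show "g i < t"
    proof (cases "i < k")
      case False
      then have "i - d < l" "d + (i - d) = i" using i d by auto
      moreover from this have "g (d + (i - d)) < t" using h unfolding valley_free_def by blast
      ultimately show ?thesis by (simp only:)
    qed (use h in \<open>auto simp: valley_free_def\<close>)
  next
    fix i assume i: "i + 2 < d + l"
    show "\<not> (g (i + 1) < g i \<and> g (i + 1) < g (i + 2))"
    proof (cases "i + 2 < k")
      case False
      then have di: "d + (i - d) = i" "d + (i - d + 1) = i + 1" "d + (i - d + 2) = i + 2" "i - d + 2 < l"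
        using d i by auto
      then have "\<not> (g (d + (i - d + 1)) < g (d + (i - d)) \<and> g (d + (i - d + 1)) < g (d + (i - d + 2)))"
        using h unfolding valley_free_def by blast
      then show ?thesis unfolding di(1-3) .
    qed (use h in \<open>unfold valley_free_def, blast\<close>)
  qed
next
  assume h: "valley_free t (d + l) g"
  show "valley_free t k g \<and> valley_free t l (\<lambda>i. g (d + i))"
    using valley_free_subinterval[OF h, of 0 k] valley_free_subinterval[OF h, of d l] d by simp
qed

text \<open>
  The condition under the sum says that there is a peak below \<open>t\<close> at
  \<open>j\<close>, from which the values decrease in both directions. A sequence with distinct
  values has such a position, and then only one, if and only if it has no valley.
\<close>

lemma valley_free_peaks:
  assumes "inj g"
  shows "(\<Sum>j\<le>n. of_bool (g j < t \<and> (\<forall>i<j. g i < g (Suc i)) \<and> (\<forall>i. j \<le> i \<and> i < n \<longrightarrow> g (Suc i) < g i)) :: real)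
    = of_bool (valley_free t (Suc n) g)"
proof -
  let ?d = "\<lambda>i. g (Suc i) < g i"
  have ne: "g i < g (Suc i) \<longleftrightarrow> \<not> ?d i" for i using injD[OF assms, of i "Suc i"] by fastforce
  have "of_bool (g j < t \<and> (\<forall>i<j. g i < g (Suc i)) \<and> (\<forall>i. j \<le> i \<and> i < n \<longrightarrow> g (Suc i) < g i))
    = of_bool (\<forall>i<Suc n. g i < t) * (of_bool ((\<forall>i<j. \<not> ?d i) \<and> (\<forall>i. j \<le> i \<and> i < n \<longrightarrow> ?d i)) :: real)"
    if j: "j \<le> n" for j
  proof -
    have "g i \<le> g j" if P: "\<forall>i<j. \<not> ?d i" "\<forall>i. j \<le> i \<and> i < n \<longrightarrow> ?d i" and i: "i \<le> n" for i
    proof (cases "i \<le> j")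
      case True
      then show ?thesis
      proof (induction rule: inc_induct)
        case (step k) then show ?case using P(1) by force
      qed simp
    next
      case False
      then have "j \<le> i" by simp
      then show ?thesis using i
      proof (induction rule: dec_induct)
        case (step k) then show ?case using P(2) by force
      qed simp
    qed
    then show ?thesis unfolding ne using j by (auto simp: less_Suc_eq_le intro: le_less_trans)
  qed
  then have "(\<Sum>j\<le>n. of_bool (g j < t \<and> (\<forall>i<j. g i < g (Suc i)) \<and> (\<forall>i. j \<le> i \<and> i < n \<longrightarrow> g (Suc i) < g i)) :: real)
    = (\<Sum>j\<le>n. of_bool (\<forall>i<Suc n. g i < t) * of_bool ((\<forall>i<j. \<not> ?d i) \<and> (\<forall>i. j \<le> i \<and> i < n \<longrightarrow> ?d i)))"
    by (intro sum.cong) auto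
  also have "\<dots> = of_bool (\<forall>i<Suc n. g i < t) * of_bool (\<forall>i. Suc i < n \<longrightarrow> ?d i \<longrightarrow> ?d (Suc i))"
    unfolding sum_distrib_left[symmetric] sum_switching_points ..
  also have "\<dots> = of_bool (valley_free t (Suc n) g)"
  proof -
    have "(\<forall>i. Suc i < n \<longrightarrow> ?d i \<longrightarrow> ?d (Suc i)) \<longleftrightarrow> (\<forall>i. i + 2 < Suc n \<longrightarrow> \<not> (g (i + 1) < g i \<and> g (i + 1) < g (i + 2)))"
      using ne by (auto simp: numeral_2_eq_2)
    then show ?thesis unfolding valley_free_def by auto
  qed
  finally show ?thesis .
qed

lemma AE_uniform:
  "AE s in uniform_measure lborel {0<..<1::real}. 0 < s \<and> s < 1"
  "AE s in uniform_measure lborel {0<..<1::real}. s \<noteq> u"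
  unfolding uniform_eq_density using AE_lborel_singleton[of u]
  by (subst AE_density; auto simp: indicator_def elim!: eventually_mono)+

lemma exp_sum_tendsto: "(\<lambda>n. \<Sum>m=1..n. x ^ m / fact m) \<longlonglongrightarrow> exp x - (1::real)"
proof -
  have "(\<lambda>n. \<Sum>m<Suc n. x ^ m / fact m) \<longlonglongrightarrow> exp x"
    using exp_converges[of x] unfolding sums_def by (intro LIMSEQ_Suc) (simp add: divide_inverse mult.commute)
  then have "(\<lambda>n. (\<Sum>m<Suc n. x ^ m / fact m) - 1) \<longlonglongrightarrow> exp x - 1"
    by (intro tendsto_diff tendsto_const)
  moreover have "(\<Sum>m<Suc n. x ^ m / fact m) - 1 = (\<Sum>m=1..n. x ^ m / fact m)" for n
    by (induction n) auto
  ultimately show ?thesis by simp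
qed

lemma exp_moment_tendsto: "(\<lambda>n. \<Sum>m=1..n. real m * (x ^ m / fact m)) \<longlonglongrightarrow> x * exp (x::real)"
proof -
  have "(\<lambda>n. x * (\<Sum>m<n. x ^ m / fact m)) \<longlonglongrightarrow> x * exp x"
    using exp_converges[of x] unfolding sums_def by (intro tendsto_mult_left) (simp add: divide_inverse mult.commute)
  moreover have "x * (\<Sum>m<n. x ^ m / fact m) = (\<Sum>m=1..n. real m * (x ^ m / fact m))" for n
  proof (induction n)
    case (Suc n)
    have "real (Suc n) * (x ^ Suc n / fact (Suc n)) = x * (x ^ n / fact n)"
      by (simp add: fact_Suc del: of_nat_Suc)
    then show ?case using Suc by (simp add: distrib_left del: fact_Suc power_Suc of_nat_Suc)
  qed simp
  ultimately show ?thesis by simp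
qed

text \<open>
  The value \<open>x = 2 * t\<close> with \<open>t \<le> 1\<close> is the largest that occurs,
  whence \<open>32 = 16 * 2\<close>.
\<close>

lemma exp_tail_bound:
  fixes x :: real
  assumes "0 \<le> x" "x \<le> 2"
  shows "x ^ m / fact m \<le> exp 32 / 16 ^ m"
proof -
  have "(16 * x) ^ m / fact m \<le> (32 :: real) ^ m / fact m"
    using assms by (intro divide_right_mono power_mono) auto
  also have "\<dots> \<le> exp 32"
    using sum_le_suminf[OF summable_exp[of "32::real"], of "{m}"] by (simp add: exp_def field_simps)
  finally show ?thesis by (simp add: power_mult_distrib field_simps)
qed

locale uniform_clocks = iid_family M borel "uniform_measure lborel {0<..<1}" Y
  for M :: "'a measure" and Y :: "int \<Rightarrow> 'a \<Rightarrow> real" +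
  fixes t :: real
  assumes t: "0 < t" "t \<le> 1"
begin

lemma clock_sequence_reindex: "inj \<sigma> \<Longrightarrow> clock_sequence M (uniform_measure lborel {0<..<1}) (\<lambda>j \<omega>. Y (\<sigma> j) \<omega>) 1"
proof -
  assume "inj \<sigma>"
  then interpret iid_family M borel "distr (uniform_measure lborel {0<..<1}) borel (\<lambda>x. x)" "\<lambda>j \<omega>. Y (\<sigma> j) \<omega>"
    by (rule iid_reindex) simp
  have "distr (uniform_measure lborel {0<..<1}) borel (\<lambda>x. x) = uniform_measure lborel {0<..<1::real}"
    by (rule distr_id2) simp
  then show ?thesis
    using iid_family_axioms uniform_below_uniform
    by (simp add: clock_sequence_def clock_sequence_axioms_def)
qed

lemma integral_uniform:
  fixes f :: "real \<Rightarrow> real"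
  shows "0 \<le> a \<Longrightarrow> a \<le> b \<Longrightarrow> b \<le> 1 \<Longrightarrow> continuous_on {a..b} f \<Longrightarrow>
    (\<integral>s. indicator {a<..<b} s * f s \<partial>uniform_measure lborel {0<..<1}) = integral {a..b} f"
  using uniform_below_uniform by (simp add: uniform_below_def)

lemma AE_Y: "AE \<omega> in M. 0 < Y i \<omega> \<and> Y i \<omega> < 1" "AE \<omega> in M. Y i \<omega> \<noteq> u"
proof -
  have "AE s in distr M borel (Y i). 0 < s \<and> s < 1" "AE s in distr M borel (Y i). s \<noteq> u"
    unfolding law by (rule AE_uniform)+
  then show "AE \<omega> in M. 0 < Y i \<omega> \<and> Y i \<omega> < 1" "AE \<omega> in M. Y i \<omega> \<noteq> u"
    by (subst (asm) (1 2) AE_distr_iff; simp)+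
qed

lemma AE_neq:
  assumes ij: "i \<noteq> j"
  shows "AE \<omega> in M. Y i \<omega> \<noteq> Y j \<omega>"
proof -
  have "expectation (\<lambda>\<omega>. of_bool (Y i \<omega> = Y j \<omega>) :: real)
    = (\<integral>s. expectation (\<lambda>\<omega>. of_bool (s = Y j \<omega>)) \<partial>uniform_measure lborel {0<..<1})"
  proof -
    have [measurable]: "Measurable.pred (PiM UNIV (\<lambda>_. borel :: real measure)) (\<lambda>x. x i = x j)"
      unfolding pred_def by (rule borel_measurable_eq) (rule coordinate_measurable)+
    have "(\<lambda>x. of_bool (x i = x j) :: real) \<in> borel_measurable (PiM UNIV (\<lambda>_. borel :: real measure))"
      by measurable
    from expectation_condition[OF this, where v=i and B=1] show ?thesis using ij by simp
  qed
  also have "\<dots> = (\<integral>s. 0 \<partial>uniform_measure lborel {0<..<1::real})"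
  proof (rule Bochner_Integration.integral_cong[OF refl])
    fix s
    have "expectation (\<lambda>\<omega>. of_bool (s = Y j \<omega>) :: real) = expectation (\<lambda>_. 0)"
      by (rule integral_cong_AE) (use AE_Y(2)[of j s] in \<open>auto elim!: eventually_mono\<close>)
    then show "expectation (\<lambda>\<omega>. of_bool (s = Y j \<omega>) :: real) = 0" by simp
  qed
  finally have "expectation (\<lambda>\<omega>. of_bool (Y i \<omega> = Y j \<omega>) :: real) = 0" by simp
  moreover have "integrable M (\<lambda>\<omega>. of_bool (Y i \<omega> = Y j \<omega>) :: real)"
    by (rule integrable_const_bound[of _ 1]) auto
  ultimately have "AE \<omega> in M. (of_bool (Y i \<omega> = Y j \<omega>) :: real) = 0"
    by (subst (asm) integral_nonneg_eq_0_iff_AE) auto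
  then show ?thesis by (auto elim!: eventually_mono)
qed

definition generic :: "'a \<Rightarrow> bool" where
  "generic \<omega> \<longleftrightarrow> inj (\<lambda>i. Y i \<omega>) \<and> (\<forall>i. 0 < Y i \<omega> \<and> Y i \<omega> < 1 \<and> Y i \<omega> \<noteq> t)"

lemma AE_generic: "AE \<omega> in M. generic \<omega>"
proof -
  have "AE \<omega> in M. \<forall>i j. i \<noteq> j \<longrightarrow> Y i \<omega> \<noteq> Y j \<omega>"
    unfolding AE_all_countable using AE_neq by auto
  moreover have "AE \<omega> in M. \<forall>i. 0 < Y i \<omega> \<and> Y i \<omega> < 1 \<and> Y i \<omega> \<noteq> t"
    unfolding AE_all_countable using AE_Y by simp
  ultimately show ?thesis
    by eventually_elim (auto simp: generic_def inj_def)
qed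

abbreviation site_pattern :: "int \<Rightarrow> nat \<Rightarrow> (int \<Rightarrow> real) \<Rightarrow> bool" where
  "site_pattern a m x \<equiv> valley_free t m (\<lambda>i. x (a + int i))"

lemma expectation_unimodal_right:
  assumes "0 \<le> u" "u \<le> t"
  shows "expectation (\<lambda>\<omega>. of_bool (unimodal t m u (\<lambda>i. Y (v + 1 + int i) \<omega>)) :: real) = ((2 * t - u) ^ m + u ^ m) / (2 * fact m)"
  by (rule clock_sequence.expectation_unimodal[OF clock_sequence_reindex]) (use assms t in \<open>auto simp: inj_def\<close>)

lemma expectation_unimodal_left:
  assumes "0 \<le> u" "u \<le> t"
  shows "expectation (\<lambda>\<omega>. of_bool (unimodal t m u (\<lambda>i. Y (v - 1 - int i) \<omega>)) :: real) = ((2 * t - u) ^ m + u ^ m) / (2 * fact m)"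
  by (rule clock_sequence.expectation_unimodal[OF clock_sequence_reindex]) (use assms t in \<open>auto simp: inj_def\<close>)

lemma site_pattern_right:
  assumes "inj x"
  shows "site_pattern v (Suc m) x \<longleftrightarrow> x v < t \<and> unimodal t m (x v) (\<lambda>i. x (v + 1 + int i))"
proof -
  have "inj (\<lambda>i. x (v + int i))" by (rule injI) (auto dest: injD[OF assms])
  from valley_free_Suc[OF this] show ?thesis by (simp add: add_ac)
qed

lemma site_pattern_left:
  assumes "inj x"
  shows "site_pattern (v - int m) (Suc m) x \<longleftrightarrow> x v < t \<and> unimodal t m (x v) (\<lambda>i. x (v - 1 - int i))"
proof -
  have "inj (\<lambda>i. x (v - int i))" by (rule injI) (auto dest: injD[OF assms])
  from valley_free_Suc[OF this]
  have "valley_free t (Suc m) (\<lambda>i. x (v - int i)) \<longleftrightarrow> x v < t \<and> unimodal t m (x v) (\<lambda>i. x (v - 1 - int i))"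
    by (simp add: algebra_simps)
  then show ?thesis unfolding valley_free_rev[of t "Suc m" x "v - int m"] by (simp add: algebra_simps)
qed

lemma site_pattern_measurable [measurable]: "Measurable.pred (PiM UNIV (\<lambda>_. borel)) (site_pattern a m)"
  unfolding valley_free_def by measurable

text \<open>
  A fictitious clock with value 0 in front of the interval turns the condition into unimodality.
\<close>

lemma prob_site_pattern:
  "prob {\<omega> \<in> space M. site_pattern 0 (Suc m) (\<lambda>i. Y i \<omega>)} = (2 * t) ^ Suc m / (2 * fact (Suc m))"
proof -
  have "prob {\<omega> \<in> space M. site_pattern 0 (Suc m) (\<lambda>i. Y i \<omega>)}
    = expectation (\<lambda>\<omega>. of_bool (site_pattern 0 (Suc m) (\<lambda>i. Y i \<omega>)))"
    by (rule expectation_of_bool[symmetric])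
  also have "\<dots> = expectation (\<lambda>\<omega>. of_bool (unimodal t (Suc m) 0 (\<lambda>i. Y (-1 + 1 + int i) \<omega>)))"
  proof (rule integral_cong_AE)
    show "AE \<omega> in M. (of_bool (site_pattern 0 (Suc m) (\<lambda>i. Y i \<omega>)) :: real)
      = of_bool (unimodal t (Suc m) 0 (\<lambda>i. Y (-1 + 1 + int i) \<omega>))"
      using AE_generic
    proof eventually_elim
      case (elim \<omega>)
      then have "\<not> Y 0 \<omega> < 0" by (simp add: generic_def not_less less_imp_le)
      then show ?case using site_pattern_right[where x="\<lambda>i. Y i \<omega>" and v=0 and m=m] elim
        by (simp add: generic_def)
    qed
  qed measurable
  also have "\<dots> = (2 * t) ^ Suc m / (2 * fact (Suc m))"
    using t by (subst expectation_unimodal_right) simp_all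
  finally show ?thesis .
qed

text \<open>
  For two patterns that share exactly one site, conditioning on the clock \<open>u\<close> of this
  site makes the two sides independent and each of them unimodal when read from the common site.
\<close>

definition touching :: "nat \<Rightarrow> nat \<Rightarrow> real" where
  "touching i j = integral {0..t} (\<lambda>u. ((2 * t - u) ^ i + u ^ i) / (2 * fact i) * (((2 * t - u) ^ j + u ^ j) / (2 * fact j)))"

lemma expectation_touching:
  "expectation (\<lambda>\<omega>. of_bool (site_pattern 0 (Suc i) (\<lambda>k. Y k \<omega>)) * of_bool (site_pattern (int i) (Suc j) (\<lambda>k. Y k \<omega>)))
    = touching i j"
proof -
  let ?L = "\<lambda>s x. unimodal t i s (\<lambda>k. x (int i - 1 - int k))"
  let ?R = "\<lambda>s x. unimodal t j s (\<lambda>k. x (int i + 1 + int k))"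
  let ?U = "uniform_measure lborel {0<..<1::real}"
  let ?F = "\<lambda>x. of_bool (0 < x (int i) \<and> x (int i) < t) * (of_bool (?L (x (int i)) x) * of_bool (?R (x (int i)) x)) :: real"
  have "expectation (\<lambda>\<omega>. of_bool (site_pattern 0 (Suc i) (\<lambda>k. Y k \<omega>)) * of_bool (site_pattern (int i) (Suc j) (\<lambda>k. Y k \<omega>)))
    = expectation (\<lambda>\<omega>. ?F (\<lambda>k. Y k \<omega>))"
  proof (rule integral_cong_AE)
    show "AE \<omega> in M. of_bool (site_pattern 0 (Suc i) (\<lambda>k. Y k \<omega>)) * of_bool (site_pattern (int i) (Suc j) (\<lambda>k. Y k \<omega>))
      = ?F (\<lambda>k. Y k \<omega>)"
      using AE_generic
    proof eventually_elim
      case (elim \<omega>)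
      then have "inj (\<lambda>k. Y k \<omega>)" "0 < Y (int i) \<omega>" by (simp_all add: generic_def)
      note this(2)
      with site_pattern_right[OF \<open>inj (\<lambda>k. Y k \<omega>)\<close>, where v="int i" and m=j]
        site_pattern_left[OF \<open>inj (\<lambda>k. Y k \<omega>)\<close>, where v="int i" and m=i]
      show ?case by simp
    qed
  qed measurable
  also have "\<dots> = (\<integral>s. expectation (\<lambda>\<omega>. ?F ((\<lambda>k. Y k \<omega>)(int i := s))) \<partial>?U)"
  proof (rule expectation_condition[where F="?F" and B=1])
    have "(\<lambda>x. unimodal t m (x v) (\<lambda>k. x (w k))) \<in> PiM UNIV (\<lambda>_. borel) \<rightarrow>\<^sub>M count_space UNIV"
      for m and v :: int and w :: "nat \<Rightarrow> int"
      by (rule measurable_unimodal) (rule coordinate_measurable)+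
    note [measurable] = this
    show "?F \<in> borel_measurable (PiM UNIV (\<lambda>_. borel))" by measurable
  qed auto
  also have "\<dots> = (\<integral>s. indicator {0<..<t} s * (((2 * t - s) ^ i + s ^ i) / (2 * fact i) * (((2 * t - s) ^ j + s ^ j) / (2 * fact j))) \<partial>?U)"
  proof (rule Bochner_Integration.integral_cong[OF refl])
    have F: "expectation (\<lambda>\<omega>. ?F ((\<lambda>k. Y k \<omega>)(int i := s)))
      = of_bool (0 < s \<and> s < t) * expectation (\<lambda>\<omega>. of_bool (?L s (\<lambda>k. Y k \<omega>)) * of_bool (?R s (\<lambda>k. Y k \<omega>)))" for s
      by simp
    have prod: "expectation (\<lambda>\<omega>. of_bool (?L s (\<lambda>k. Y k \<omega>)) * of_bool (?R s (\<lambda>k. Y k \<omega>)))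
      = expectation (\<lambda>\<omega>. of_bool (?L s (\<lambda>k. Y k \<omega>))) * expectation (\<lambda>\<omega>. of_bool (?R s (\<lambda>k. Y k \<omega>)) :: real)" for s
    proof (rule expectation_local_mult[where F="\<lambda>x. of_bool (?L s x)" and G="\<lambda>x. of_bool (?R s x)" and B=1])
      show "{..<int i} \<inter> {int i<..} = {}" by auto
      show "depends_on {..<int i} (\<lambda>x. of_bool (?L s x) :: real)"
        by (rule depends_onI, rule arg_cong[where f=of_bool], rule arg_cong[where f="unimodal t i s"], rule ext) auto
      show "depends_on {int i<..} (\<lambda>x. of_bool (?R s x) :: real)"
        by (rule depends_onI, rule arg_cong[where f=of_bool], rule arg_cong[where f="unimodal t j s"], rule ext) auto
      have "(\<lambda>x. unimodal t m s (\<lambda>k. x (w k))) \<in> PiM UNIV (\<lambda>_. borel) \<rightarrow>\<^sub>M count_space UNIV"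
        for m and w :: "nat \<Rightarrow> int"
        by (rule measurable_unimodal) (simp_all add: coordinate_measurable)
      note [measurable] = this
      show "(\<lambda>x. of_bool (?L s x) :: real) \<in> borel_measurable (PiM UNIV (\<lambda>_. borel))"
        "(\<lambda>x. of_bool (?R s x) :: real) \<in> borel_measurable (PiM UNIV (\<lambda>_. borel))"
        by measurable
    qed auto
    fix s
    show "expectation (\<lambda>\<omega>. ?F ((\<lambda>k. Y k \<omega>)(int i := s)))
      = indicator {0<..<t} s * (((2 * t - s) ^ i + s ^ i) / (2 * fact i) * (((2 * t - s) ^ j + s ^ j) / (2 * fact j)))"
      unfolding F prod
      using expectation_unimodal_right[of s j "int i"] expectation_unimodal_left[of s i "int i"]
      by (cases "0 < s \<and> s < t") auto
  qed
  also have "\<dots> = touching i j"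
    unfolding touching_def using t by (intro integral_uniform) (auto intro!: continuous_intros)
  finally show ?thesis .
qed

lemma touching_0: "touching 0 j = (2 * t) ^ Suc j / (2 * fact (Suc j))" "touching j 0 = (2 * t) ^ Suc j / (2 * fact (Suc j))"
proof -
  have "integral {0..t} (\<lambda>s. ((2 * t + (-1) * s) ^ j + (0 + 1 * s) ^ j) / (2 * fact j)) = (2 * t) ^ Suc j / (2 * fact (Suc j))"
  proof -
    have "integral {0..t} (\<lambda>s. ((2 * t + (-1) * s) ^ j + (0 + 1 * s) ^ j) / (2 * fact j))
      = (integral {0..t} (\<lambda>s. (2 * t + (-1) * s) ^ j) + integral {0..t} (\<lambda>s. (0 + 1 * s) ^ j)) / (2 * fact j)"
      by (subst Henstock_Kurzweil_Integration.integral_add[symmetric])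
        (auto intro!: integrable_continuous_real continuous_intros)
    also have "\<dots> = (2 * t) ^ Suc j / (2 * fact (Suc j))"
      using t by (subst integral_power_shift, simp, simp, subst integral_power_shift)
        (auto simp: divide_simps, simp_all add: algebra_simps)
    finally show ?thesis .
  qed
  then show "touching 0 j = (2 * t) ^ Suc j / (2 * fact (Suc j))" "touching j 0 = (2 * t) ^ Suc j / (2 * fact (Suc j))"
    by (simp_all add: touching_def)
qed

text \<open>
  Summing over the position of the common site turns the integrand into four binomial expansions,
  those of the \<open>k\<close>-th powers of \<open>2 * (2 * t - u)\<close>, \<open>2 * t\<close>
  (twice) and \<open>2 * u\<close>.
\<close>

lemma sum_touching:
  "(\<Sum>i\<le>k. touching (k - i) i) = (2 * t) ^ Suc k / 4 * (2 ^ k / fact (Suc k) + 1 / fact k)"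
proof -
  have binom: "(\<Sum>i\<le>k. x ^ (k - i) / fact (k - i) * (y ^ i / fact i)) = (x + y) ^ k / fact k" for x y :: real
  proof -
    have "(x + y) ^ k = (\<Sum>i\<le>k. of_nat (k choose i) * x ^ (k - i) * y ^ i)"
      using binomial_ring[of y x k] by (simp add: add.commute mult_ac)
    then show ?thesis
      by (simp add: sum_divide_distrib) (intro sum.cong refl, simp add: binomial_fact field_simps)
  qed
  have p: "(\<Sum>i\<le>k. ((2 * t - u) ^ (k - i) + u ^ (k - i)) / (2 * fact (k - i)) * (((2 * t - u) ^ i + u ^ i) / (2 * fact i)))
    = (2 ^ k * (2 * t + (-1) * u) ^ k + 2 * (2 * t) ^ k + 2 ^ k * (0 + 1 * u) ^ k) / (4 * fact k)" for u
  proof -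
    let ?A = "2 * t - u"
    have "(\<Sum>i\<le>k. (?A ^ (k - i) + u ^ (k - i)) / (2 * fact (k - i)) * ((?A ^ i + u ^ i) / (2 * fact i)))
      = (\<Sum>i\<le>k. (?A ^ (k - i) / fact (k - i) * (?A ^ i / fact i) + ?A ^ (k - i) / fact (k - i) * (u ^ i / fact i)
        + u ^ (k - i) / fact (k - i) * (?A ^ i / fact i) + u ^ (k - i) / fact (k - i) * (u ^ i / fact i)) / 4)"
      by (intro sum.cong refl) (simp add: field_simps)
    also have "\<dots> = ((?A + ?A) ^ k / fact k + (?A + u) ^ k / fact k + (u + ?A) ^ k / fact k + (u + u) ^ k / fact k) / 4"
      unfolding sum_divide_distrib[symmetric] sum.distrib binom ..
    also have "?A + ?A = 2 * (2 * t + (-1) * u)" by simp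
    also have "u + u = 2 * (0 + 1 * u)" by simp
    also have "?A + u = 2 * t" by simp
    also have "u + ?A = 2 * t" by simp
    finally show ?thesis
      unfolding power_mult_distrib[of 2 "2 * t + (-1) * u"] power_mult_distrib[of 2 "0 + 1 * u"]
      by (simp only: add_divide_distrib) simp
  qed
  have "(\<Sum>i\<le>k. touching (k - i) i) = integral {0..t} (\<lambda>u. \<Sum>i\<le>k. ((2 * t - u) ^ (k - i) + u ^ (k - i)) / (2 * fact (k - i)) * (((2 * t - u) ^ i + u ^ i) / (2 * fact i)))"
    unfolding touching_def
    by (rule integral_sum[symmetric]) (auto intro!: integrable_continuous_real continuous_intros)
  also have "\<dots> = (2 ^ k * integral {0..t} (\<lambda>u. (2 * t + (-1) * u) ^ k) + integral {0..t} (\<lambda>u. 2 * (2 * t) ^ k)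
      + 2 ^ k * integral {0..t} (\<lambda>u. (0 + 1 * u) ^ k)) / (4 * fact k)"
  proof -
    have i: "(\<lambda>u. 2 ^ k * (2 * t + (-1) * u) ^ k) integrable_on {0..t}" "(\<lambda>u. 2 * (2 * t) ^ k) integrable_on {0..t}"
      "(\<lambda>u. 2 ^ k * (0 + 1 * u) ^ k) integrable_on {0..t}"
      by (intro integrable_continuous_real continuous_intros)+
    show ?thesis
      unfolding p integral_divide integral_mult_right[symmetric]
      by (simp only: Henstock_Kurzweil_Integration.integral_add integrable_add i)
  qed
  also have "\<dots> = (2 * t) ^ Suc k / 4 * (2 ^ k / fact (Suc k) + 1 / fact k)"
    using t by (subst integral_power_shift, simp, simp, subst integral_power_shift)
      (auto simp: divide_simps, simp_all add: algebra_simps)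
  finally show ?thesis .
qed

text \<open>
  If one of the intervals is the common site alone, it is contained in the other and there is no
  excess.
\<close>

definition site_excess :: "nat \<Rightarrow> nat \<Rightarrow> real" where
  "site_excess i j = (if i = 0 \<or> j = 0 then 0 else touching i j - (2 * t) ^ Suc (i + j) / (2 * fact (Suc (i + j))))"

lemma sum_site_excess:
  "(\<Sum>i\<le>k. site_excess (k - i) i) = (2 * t) ^ Suc k / 4 * (2 ^ k / fact (Suc k) - 1 / fact k)"
proof (cases "k = 0")
  case False
  let ?\<rho> = "(2 * t) ^ Suc k / (2 * fact (Suc k))"
  have "(\<Sum>i\<le>k. site_excess (k - i) i) = (\<Sum>i\<le>k. touching (k - i) i - ?\<rho>)"
    by (rule sum.cong) (auto simp: site_excess_def touching_0)
  also have "\<dots> = (2 * t) ^ Suc k / 4 * (2 ^ k / fact (Suc k) + 1 / fact k) - real (Suc k) * ?\<rho>"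
    unfolding sum_subtractf sum_touching by simp
  also have "real (Suc k) * ?\<rho> = (2 * t) ^ Suc k / (2 * fact k)"
    by (simp add: fact_Suc del: power_Suc of_nat_Suc)
  also have "(2 * t) ^ Suc k / 4 * (2 ^ k / fact (Suc k) + 1 / fact k) - (2 * t) ^ Suc k / (2 * fact k)
    = (2 * t) ^ Suc k / 4 * (2 ^ k / fact (Suc k) - 1 / fact k)"
    by (simp add: algebra_simps add_divide_distrib)
  finally show ?thesis .
qed (simp add: site_excess_def)

text \<open>
  The three limits are evaluated from the exponential series: the first two at \<open>- 2 *
  t\<close>, the last one from \<open>sum_site_excess\<close> at \<open>- 4 * t\<close> and
  \<open>- 2 * t\<close>.
\<close>

lemma blocking_overlapping_pattern:
  "overlapping_pattern M borel (uniform_measure lborel {0<..<1}) Y site_pattern (exp 32) site_excess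
    ((exp (- 2 * t) - 1) / 2) (- t * exp (- 2 * t)) ((1 - exp (- 4 * t)) / 8 - t * exp (- 2 * t) / 2)"
proof (unfold_locales)
  fix a b :: int and m l :: nat and x :: "int \<Rightarrow> real"
  show "Measurable.pred (PiM UNIV (\<lambda>_. borel)) (site_pattern a m)" by measurable
  show "depends_on {a..<a + int m} (site_pattern a m)"
    by (rule depends_onI) (auto simp: valley_free_def)
  show "site_pattern (a + b) m x \<longleftrightarrow> site_pattern a m (\<lambda>i. x (b + i))"
    by (simp add: add_ac)
  show "prob {\<omega> \<in> space M. site_pattern 0 m (\<lambda>i. Y i \<omega>)} \<le> exp 32 / 16 ^ m"
  proof (cases m)
    case (Suc k)
    have "prob {\<omega> \<in> space M. site_pattern 0 m (\<lambda>i. Y i \<omega>)} = ((2 * t) ^ m / fact m) / 2"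
      unfolding Suc prob_site_pattern by simp
    also have "\<dots> \<le> (2 * t) ^ m / fact m"
    proof -
      have half: "y / 2 \<le> y" if "0 \<le> y" for y :: real using that by simp
      show ?thesis by (rule half) (use t in simp)
    qed
    also have "\<dots> \<le> exp 32 / 16 ^ m" using t by (intro exp_tail_bound) auto
    finally show ?thesis .
  qed (simp add: order.trans[OF prob_le_1])
  show "site_pattern b l x" if p: "site_pattern a m x" and ab: "a \<le> b" "b + int l \<le> a + int m"
  proof -
    define d where "d = nat (b - a)"
    have d: "b + int i = a + int (d + i)" for i using ab unfolding d_def by simp
    have "d + l \<le> m" using ab unfolding d_def by simp
    from valley_free_subinterval[OF p this] show ?thesis by (simp only: d)
  qed
next
  fix d k l :: nat assume d: "1 \<le> d" "d < k" "k < d + l"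
  show "expectation (\<lambda>\<omega>. of_bool (site_pattern 0 k (\<lambda>i. Y i \<omega>)) * of_bool (site_pattern (int d) l (\<lambda>i. Y i \<omega>)))
    = prob {\<omega> \<in> space M. site_pattern 0 (d + l) (\<lambda>i. Y i \<omega>)} + (if d = k - 1 then site_excess (k - 1) (l - 1) else 0)"
  proof (cases "d = k - 1")
    case True
    obtain l' where l': "l = Suc l'" "0 < l'" using d True by (cases l) auto
    have k: "k = Suc d" using True d by simp
    have e: "d + l = Suc (d + l')" using l' by simp
    show ?thesis
      using expectation_touching[of d l'] d l' unfolding e prob_site_pattern
      by (simp add: k site_excess_def)
  next
    case False
    have dk: "d + 1 < k" using False d by simp
    have "of_bool (site_pattern 0 k x) * of_bool (site_pattern (int d) l x) = (of_bool (site_pattern 0 (d + l) x) :: real)" for x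
      using valley_free_overlap[OF dk d(3), of t "\<lambda>i. x (int i)"] by (simp flip: of_bool_conj)
    then have "of_bool (site_pattern 0 k (\<lambda>i. Y i \<omega>)) * of_bool (site_pattern (int d) l (\<lambda>i. Y i \<omega>))
      = (of_bool (site_pattern 0 (d + l) (\<lambda>i. Y i \<omega>)) :: real)" for \<omega> .
    then have "expectation (\<lambda>\<omega>. of_bool (site_pattern 0 k (\<lambda>i. Y i \<omega>)) * of_bool (site_pattern (int d) l (\<lambda>i. Y i \<omega>)) :: real)
      = prob {\<omega> \<in> space M. site_pattern 0 (d + l) (\<lambda>i. Y i \<omega>)}"
      by (simp only: expectation_of_bool)
    then show ?thesis using False by simp
  qed
next
  show "site_excess 0 j = 0" "site_excess j 0 = 0" for j by (simp_all add: site_excess_def)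
  have \<rho>: "(-1) ^ m * prob {\<omega> \<in> space M. site_pattern 0 m (\<lambda>i. Y i \<omega>)} = 1 / 2 * ((- 2 * t) ^ m / fact m)" if m: "1 \<le> m" for m
  proof -
    obtain k where k: "m = Suc k" using m by (cases m) auto
    have "(- 2 * t) ^ m = ((-1) * (2 * t)) ^ m" by simp
    also have "\<dots> = (-1) ^ m * (2 * t) ^ m" by (rule power_mult_distrib)
    finally have e: "(- 2 * t) ^ m = (-1) ^ m * (2 * t) ^ m" .
    show ?thesis unfolding e unfolding k prob_site_pattern
      by (simp only: times_divide_eq_right times_divide_eq_left mult_1 divide_divide_eq_left mult.commute[of 2])
  qed
  have "(\<lambda>n. 1 / 2 * (\<Sum>m=1..n. (- 2 * t) ^ m / fact m)) \<longlonglongrightarrow> 1 / 2 * (exp (- 2 * t) - 1)"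
    by (intro tendsto_mult_left exp_sum_tendsto)
  also have "(\<lambda>n. 1 / 2 * (\<Sum>m=1..n. (- 2 * t) ^ m / fact m))
    = (\<lambda>n. \<Sum>m=1..n. (-1) ^ m * prob {\<omega> \<in> space M. site_pattern 0 m (\<lambda>i. Y i \<omega>)})"
    unfolding sum_distrib_left by (intro ext sum.cong refl \<rho>[symmetric]) simp
  finally show "(\<lambda>n. \<Sum>m=1..n. (-1) ^ m * prob {\<omega> \<in> space M. site_pattern 0 m (\<lambda>i. Y i \<omega>)}) \<longlonglongrightarrow> (exp (- 2 * t) - 1) / 2"
    by simp
  have "(\<lambda>n. 1 / 2 * (\<Sum>m=1..n. real m * ((- 2 * t) ^ m / fact m))) \<longlonglongrightarrow> 1 / 2 * (- 2 * t * exp (- 2 * t))"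
    by (intro tendsto_mult_left exp_moment_tendsto)
  also have "(\<lambda>n. 1 / 2 * (\<Sum>m=1..n. real m * ((- 2 * t) ^ m / fact m)))
    = (\<lambda>n. \<Sum>m=1..n. (-1) ^ m * real m * prob {\<omega> \<in> space M. site_pattern 0 m (\<lambda>i. Y i \<omega>)})"
    unfolding sum_distrib_left
  proof (intro ext sum.cong refl)
    fix n m :: nat assume "m \<in> {1..n}"
    then have m: "1 \<le> m" by simp
    have "1 / 2 * (real m * ((- 2 * t) ^ m / fact m)) = real m * (1 / 2 * ((- 2 * t) ^ m / fact m))"
      by (rule mult.left_commute)
    also have "\<dots> = (-1) ^ m * real m * prob {\<omega> \<in> space M. site_pattern 0 m (\<lambda>i. Y i \<omega>)}"
      unfolding \<rho>[OF m, symmetric] by (simp only: mult_ac)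
    finally show "1 / 2 * (real m * ((- 2 * t) ^ m / fact m)) = (-1) ^ m * real m * prob {\<omega> \<in> space M. site_pattern 0 m (\<lambda>i. Y i \<omega>)}" .
  qed
  finally show "(\<lambda>n. \<Sum>m=1..n. (-1) ^ m * real m * prob {\<omega> \<in> space M. site_pattern 0 m (\<lambda>i. Y i \<omega>)}) \<longlonglongrightarrow> - t * exp (- 2 * t)"
    by simp
  have "(\<lambda>n. - 1 / 8 * (\<Sum>m=1..n. (- 4 * t) ^ m / fact m) + 1 / 4 * (\<Sum>m=1..n. real m * ((- 2 * t) ^ m / fact m)))
    \<longlonglongrightarrow> - 1 / 8 * (exp (- 4 * t) - 1) + 1 / 4 * (- 2 * t * exp (- 2 * t))"
    by (intro tendsto_add tendsto_mult_left exp_moment_tendsto exp_sum_tendsto)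
  moreover have "- 1 / 8 * (\<Sum>m=1..n. (- 4 * t) ^ m / fact m) + 1 / 4 * (\<Sum>m=1..n. real m * ((- 2 * t) ^ m / fact m))
    = (\<Sum>k<n. (-1) ^ k * (\<Sum>i\<le>k. site_excess (k - i) i))" for n
    unfolding sum_site_excess
  proof (induction n)
    case (Suc n)
    have "- 1 / 8 * ((- 4 * t) ^ Suc n / fact (Suc n)) + 1 / 4 * (real (Suc n) * ((- 2 * t) ^ Suc n / fact (Suc n)))
      = (-1) ^ n * ((2 * t) ^ Suc n / 4 * (2 ^ n / fact (Suc n) - 1 / fact n))"
    proof -
      have "(- 4 * t) ^ Suc n = ((-1) * 2 * (2 * t)) ^ Suc n" by simp
      also have "\<dots> = (-1) ^ Suc n * 2 ^ Suc n * (2 * t) ^ Suc n" by (simp only: power_mult_distrib)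
      also have "\<dots> = - ((-1) ^ n * 2 * 2 ^ n * (2 * t) ^ Suc n)"
        unfolding power_Suc[of "-1"] power_Suc[of 2] by (simp del: power_Suc)
      finally have 4: "(- 4 * t) ^ Suc n = - ((-1) ^ n * 2 * 2 ^ n * (2 * t) ^ Suc n)" .
      have "(- 2 * t) ^ Suc n = ((-1) * (2 * t)) ^ Suc n" by simp
      also have "\<dots> = (-1) ^ Suc n * (2 * t) ^ Suc n" by (rule power_mult_distrib)
      also have "\<dots> = - ((-1) ^ n * (2 * t) ^ Suc n)"
        unfolding power_Suc[of "-1"] by (simp del: power_Suc)
      finally have 2: "(- 2 * t) ^ Suc n = - ((-1) ^ n * (2 * t) ^ Suc n)" .
      have 3: "real (Suc n) * (y / fact (Suc n)) = y / fact n" for y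
        by (simp add: fact_Suc del: of_nat_Suc)
      show ?thesis unfolding 3 unfolding 4 2 by (simp add: algebra_simps del: power_Suc fact_Suc)
    qed
    note step = this
    have split: "(\<Sum>m=1..Suc n. f m) = (\<Sum>m=1..n. f m) + f (Suc n)" for f :: "nat \<Rightarrow> real" by simp
    show ?case
      unfolding split sum.lessThan_Suc distrib_left Suc.IH[symmetric] step[symmetric] by (simp only: add_ac)
  qed simp
  moreover have "- 1 / 8 * (exp (- 4 * t) - 1) + 1 / 4 * (- 2 * t * exp (- 2 * t))
    = (1 - exp (- 4 * t)) / 8 - t * exp (- 2 * t) / 2" by (simp add: diff_divide_distrib)
  ultimately show "(\<lambda>n. \<Sum>k<n. (-1) ^ k * (\<Sum>i\<le>k. site_excess (k - i) i)) \<longlonglongrightarrow> (1 - exp (- 4 * t)) / 8 - t * exp (- 2 * t) / 2"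
    by (simp only:)
qed

lemma blocking_altsum_limit:
  "variance_limit_and_clt M (interval_pattern.altsum Y site_pattern \<circ> (\<lambda>n. intervals 1 (int n + 1))) (sigma2_BL t)"
proof -
  interpret overlapping_pattern M borel "uniform_measure lborel {0<..<1}" Y site_pattern "exp 32" site_excess
    "(exp (- 2 * t) - 1) / 2" "- t * exp (- 2 * t)" "(1 - exp (- 4 * t)) / 8 - t * exp (- 2 * t) / 2"
    by (rule blocking_overlapping_pattern)
  have e: "exp (- 4 * t) = exp (- 2 * t) * exp (- 2 * t)" by (simp flip: exp_add)
  have "(exp (- 2 * t) - 1) / 2 - 2 * (- t * exp (- 2 * t)) + ((exp (- 2 * t) - 1) / 2)\<^sup>2
      - 2 * ((exp (- 2 * t) - 1) / 2) * (- t * exp (- 2 * t)) + 2 * ((1 - exp (- 4 * t)) / 8 - t * exp (- 2 * t) / 2)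
    = sigma2_BL t"
    unfolding sigma2_BL_def e by (simp add: power2_eq_square field_simps)
  with variance_T_limit have "(\<lambda>n. variance (T n) / real n) \<longlonglongrightarrow> sigma2_BL t" by (simp only:)
  then show ?thesis
    unfolding comp_def using t by (intro altsum_clt) (simp_all add: sigma2_BL_def)
qed

end

section \<open>The interval patterns of annihilation\<close>

text \<open>
  An edge \<open>{i, i + 1}\<close> is described by its clock and the statement that it attacks
  its left endpoint \<open>i\<close>. The value 2 lies beyond all times that occur, so that an
  edge with the other direction breaks every chain.
\<close>

definition left_clock :: "real \<times> bool \<Rightarrow> real" where
  "left_clock y = (if snd y then fst y else 2)"

definition right_clock :: "real \<times> bool \<Rightarrow> real" where
  "right_clock y = (if snd y then 2 else fst y)"

lemma clock_less_iff:
  "u \<le> 1 \<Longrightarrow> left_clock y < u \<longleftrightarrow> snd y \<and> fst y < u"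
  "u \<le> 1 \<Longrightarrow> right_clock y < u \<longleftrightarrow> \<not> snd y \<and> fst y < u"
  by (auto simp: left_clock_def right_clock_def)

text \<open>
  All edges have rung by time \<open>t\<close>, all attacks point towards one vertex, the sink,
  and the clocks decrease with the distance from it. Stated locally: an edge that attacks its left
  endpoint is followed by one with the same direction and a smaller clock, and if both of two
  consecutive edges attack their right endpoints, the clock of the second one is larger.
\<close>

definition funnel :: "real \<Rightarrow> nat \<Rightarrow> (nat \<Rightarrow> real \<times> bool) \<Rightarrow> bool" where
  "funnel t m g \<longleftrightarrow> (\<forall>i<m. fst (g i) < t) \<and>
     (\<forall>i. i + 1 < m \<longrightarrow> (if snd (g i) then snd (g (i + 1)) \<and> fst (g (i + 1)) < fst (g i)
        else snd (g (i + 1)) \<or> fst (g i) < fst (g (i + 1))))"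

text \<open>
  The summand for \<open>j\<close> is the event that the \<open>j\<close>-th vertex is the sink;
  it is where the direction of the attacks switches.
\<close>

lemma funnel_sinks:
  assumes t: "t \<le> 1"
  shows "(\<Sum>j\<le>m. of_bool (descending (m - j) t (\<lambda>i. left_clock (g (j + i))) \<and> descending j t (\<lambda>i. right_clock (g (j - 1 - i)))) :: real)
    = of_bool (funnel t m g)"
proof -
  let ?d = "\<lambda>i. snd (g i)" and ?s = "\<lambda>i. fst (g i)"
  let ?E = "(\<forall>i<m. ?s i < t) \<and> (\<forall>i. i + 1 < m \<longrightarrow> (?d i \<and> ?d (i + 1) \<longrightarrow> ?s (i + 1) < ?s i) \<and> (\<not> ?d i \<and> \<not> ?d (i + 1) \<longrightarrow> ?s i < ?s (i + 1)))"
  have "descending (m - j) t (\<lambda>i. left_clock (g (j + i))) \<and> descending j t (\<lambda>i. right_clock (g (j - 1 - i)))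
    \<longleftrightarrow> ?E \<and> (\<forall>i<j. \<not> ?d i) \<and> (\<forall>i. j \<le> i \<and> i < m \<longrightarrow> ?d i)" if j: "j \<le> m" for j
  proof -
    have R: "descending (m - j) t (\<lambda>i. left_clock (g (j + i)))
      \<longleftrightarrow> (\<forall>i. j \<le> i \<and> i < m \<longrightarrow> ?d i \<and> ?s i < t) \<and> (\<forall>i. j \<le> i \<and> i + 1 < m \<longrightarrow> ?s (i + 1) < ?s i)"
      (is "_ \<longleftrightarrow> ?A \<and> ?B")
    proof -
      have 1: "(\<forall>i<m - j. left_clock (g (j + i)) < t) \<longleftrightarrow> ?A"
        unfolding clock_less_iff[OF t]
      proof
        assume h: "\<forall>i<m - j. ?d (j + i) \<and> ?s (j + i) < t"
        show ?A
        proof (intro allI impI)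
          fix i assume "j \<le> i \<and> i < m"
          then show "?d i \<and> ?s i < t" using h[rule_format, of "i - j"] by auto
        qed
      qed auto
      have 2: "(\<forall>i. Suc i < m - j \<longrightarrow> left_clock (g (j + Suc i)) < left_clock (g (j + i))) \<longleftrightarrow> ?B" if ?A
      proof
        assume h: "\<forall>i. Suc i < m - j \<longrightarrow> left_clock (g (j + Suc i)) < left_clock (g (j + i))"
        show ?B
        proof (intro allI impI)
          fix i assume i: "j \<le> i \<and> i + 1 < m"
          then have "Suc (i - j) < m - j" by auto
          then have "left_clock (g (j + Suc (i - j))) < left_clock (g (j + (i - j)))" using h by blast
          moreover have "j + Suc (i - j) = i + 1" "j + (i - j) = i" using i by auto
          ultimately have "left_clock (g (i + 1)) < left_clock (g i)" by (simp only:)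
          then show "?s (i + 1) < ?s i" using \<open>?A\<close> i by (auto simp: left_clock_def)
        qed
      next
        assume ?B
        then show "\<forall>i. Suc i < m - j \<longrightarrow> left_clock (g (j + Suc i)) < left_clock (g (j + i))"
          using \<open>?A\<close> by (auto simp: left_clock_def)
      qed
      show ?thesis unfolding descending_iff_steps using 1 2 by blast
    qed
    have L: "descending j t (\<lambda>i. right_clock (g (j - 1 - i)))
      \<longleftrightarrow> (\<forall>i<j. \<not> ?d i \<and> ?s i < t) \<and> (\<forall>i. i + 1 < j \<longrightarrow> ?s i < ?s (i + 1))"
      (is "_ \<longleftrightarrow> ?A \<and> ?B")
    proof -
      have 1: "(\<forall>i<j. right_clock (g (j - 1 - i)) < t) \<longleftrightarrow> ?A"
        unfolding clock_less_iff[OF t]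
      proof
        assume h: "\<forall>i<j. \<not> ?d (j - 1 - i) \<and> ?s (j - 1 - i) < t"
        show ?A
        proof (intro allI impI)
          fix i assume "i < j"
          then show "\<not> ?d i \<and> ?s i < t" using h[rule_format, of "j - 1 - i"] by auto
        qed
      qed auto
      have 2: "(\<forall>i. Suc i < j \<longrightarrow> right_clock (g (j - 1 - Suc i)) < right_clock (g (j - 1 - i))) \<longleftrightarrow> ?B" if ?A
      proof
        assume h: "\<forall>i. Suc i < j \<longrightarrow> right_clock (g (j - 1 - Suc i)) < right_clock (g (j - 1 - i))"
        show ?B
        proof (intro allI impI)
          fix i assume i: "i + 1 < j"
          then have "Suc (j - 2 - i) < j" by auto
          then have "right_clock (g (j - 1 - Suc (j - 2 - i))) < right_clock (g (j - 1 - (j - 2 - i)))"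
            using h by blast
          moreover have "j - 1 - Suc (j - 2 - i) = i" "j - 1 - (j - 2 - i) = i + 1" using i by auto
          ultimately have "right_clock (g i) < right_clock (g (i + 1))" by (simp only:)
          then show "?s i < ?s (i + 1)" using \<open>?A\<close> i by (auto simp: right_clock_def)
        qed
      next
        assume B: ?B
        show "\<forall>i. Suc i < j \<longrightarrow> right_clock (g (j - 1 - Suc i)) < right_clock (g (j - 1 - i))"
        proof (intro allI impI)
          fix i assume i: "Suc i < j"
          then have e: "j - 1 - i = (j - 1 - Suc i) + 1" by auto
          have "j - 1 - Suc i + 1 < j" using i by auto
          then have "?s (j - 1 - Suc i) < ?s (j - 1 - i)" using B unfolding e by blast
          moreover have "\<not> ?d (j - 1 - Suc i)" "\<not> ?d (j - 1 - i)" using \<open>?A\<close> i by auto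
          ultimately show "right_clock (g (j - 1 - Suc i)) < right_clock (g (j - 1 - i))"
            by (simp only: right_clock_def if_False)
        qed
      qed
      show ?thesis unfolding descending_iff_steps using 1 2 by blast
    qed
    show ?thesis
    proof
      assume h: "descending (m - j) t (\<lambda>i. left_clock (g (j + i))) \<and> descending j t (\<lambda>i. right_clock (g (j - 1 - i)))"
      have s: "?s i < t" if "i < m" for i using h that unfolding R L by (cases "i < j") auto
      have "(?d i \<and> ?d (i + 1) \<longrightarrow> ?s (i + 1) < ?s i) \<and> (\<not> ?d i \<and> \<not> ?d (i + 1) \<longrightarrow> ?s i < ?s (i + 1))" if "i + 1 < m" for i
        using h that unfolding R L by (cases "i + 1 < j"; cases "j \<le> i") auto
      then show "?E \<and> (\<forall>i<j. \<not> ?d i) \<and> (\<forall>i. j \<le> i \<and> i < m \<longrightarrow> ?d i)" using h s unfolding R L by blast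
    next
      assume h: "?E \<and> (\<forall>i<j. \<not> ?d i) \<and> (\<forall>i. j \<le> i \<and> i < m \<longrightarrow> ?d i)"
      then show "descending (m - j) t (\<lambda>i. left_clock (g (j + i))) \<and> descending j t (\<lambda>i. right_clock (g (j - 1 - i)))"
        unfolding R L using j by auto
    qed
  qed
  then have "(\<Sum>j\<le>m. of_bool (descending (m - j) t (\<lambda>i. left_clock (g (j + i))) \<and> descending j t (\<lambda>i. right_clock (g (j - 1 - i)))) :: real)
    = (\<Sum>j\<le>m. of_bool ?E * of_bool ((\<forall>i<j. \<not> ?d i) \<and> (\<forall>i. j \<le> i \<and> i < m \<longrightarrow> ?d i)))"
    by (intro sum.cong refl) (simp only: atMost_iff of_bool_conj)
  also have "\<dots> = of_bool ?E * of_bool (\<forall>i. Suc i < m \<longrightarrow> ?d i \<longrightarrow> ?d (Suc i))"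
    unfolding sum_distrib_left[symmetric] sum_switching_points ..
  also have "\<dots> = of_bool (funnel t m g)"
  proof -
    have "?E \<and> (\<forall>i. Suc i < m \<longrightarrow> ?d i \<longrightarrow> ?d (Suc i)) \<longleftrightarrow> funnel t m g"
      unfolding funnel_def by auto
    then show ?thesis by (simp only: of_bool_conj[symmetric])
  qed
  finally show ?thesis .
qed

lemma funnel_cong:
  assumes "\<And>i. i < m \<Longrightarrow> g i = h i"
  shows "funnel t m g = funnel t m h"
  by (simp add: funnel_def assms cong: imp_cong)

lemma funnel_subinterval:
  assumes "funnel t m g" "d + l \<le> m"
  shows "funnel t l (\<lambda>i. g (d + i))"
  unfolding funnel_def
proof (intro conjI allI impI)
  fix i assume "i < l"
  then show "fst (g (d + i)) < t" using assms unfolding funnel_def by auto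
next
  fix i assume "i + 1 < l"
  then have "d + i + 1 < m" using assms by simp
  then have "if snd (g (d + i)) then snd (g (d + i + 1)) \<and> fst (g (d + i + 1)) < fst (g (d + i))
        else snd (g (d + i + 1)) \<or> fst (g (d + i)) < fst (g (d + i + 1))"
    using assms(1) unfolding funnel_def by blast
  then show "if snd (g (d + i)) then snd (g (d + (i + 1))) \<and> fst (g (d + (i + 1))) < fst (g (d + i))
        else snd (g (d + (i + 1))) \<or> fst (g (d + i)) < fst (g (d + (i + 1)))"
    by (simp only: add.assoc)
qed

text \<open>
  A funnel is a condition on single edges and pairs of consecutive edges, so one common edge is
  enough.
\<close>

lemma funnel_overlap:
  assumes d: "d < k" "k < d + l"
  shows "funnel t k g \<and> funnel t l (\<lambda>i. g (d + i)) \<longleftrightarrow> funnel t (d + l) g"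
proof
  assume h: "funnel t k g \<and> funnel t l (\<lambda>i. g (d + i))"
  show "funnel t (d + l) g"
    unfolding funnel_def
  proof (intro conjI allI impI)
    fix i assume i: "i < d + l"
    show "fst (g i) < t"
    proof (cases "i < k")
      case False
      then have "i - d < l" "d + (i - d) = i" using i d by auto
      moreover from this have "fst (g (d + (i - d))) < t" using h unfolding funnel_def by blast
      ultimately show ?thesis by (simp only:)
    qed (use h in \<open>auto simp: funnel_def\<close>)
  next
    fix i assume i: "i + 1 < d + l"
    show "if snd (g i) then snd (g (i + 1)) \<and> fst (g (i + 1)) < fst (g i) else snd (g (i + 1)) \<or> fst (g i) < fst (g (i + 1))"
    proof (cases "i + 1 < k")
      case False
      then have di: "d + (i - d) = i" "d + (i - d + 1) = i + 1" "i - d + 1 < l" using d i by auto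
      then have "if snd (g (d + (i - d))) then snd (g (d + (i - d + 1))) \<and> fst (g (d + (i - d + 1))) < fst (g (d + (i - d)))
        else snd (g (d + (i - d + 1))) \<or> fst (g (d + (i - d))) < fst (g (d + (i - d + 1)))"
        using h unfolding funnel_def by blast
      then show ?thesis unfolding di(1,2) .
    qed (use h in \<open>unfold funnel_def, blast\<close>)
  qed
next
  assume h: "funnel t (d + l) g"
  show "funnel t k g \<and> funnel t l (\<lambda>i. g (d + i))"
    using funnel_subinterval[OF h, of 0 k] funnel_subinterval[OF h, of d l] d by simp
qed

abbreviation fair_clock :: "(real \<times> bool) measure" where
  "fair_clock \<equiv> uniform_measure lborel {0<..<1} \<Otimes>\<^sub>M measure_pmf (bernoulli_pmf (1 / 2))"

lemma clock_measurable [measurable]: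
  "left_clock \<in> borel_measurable (borel \<Otimes>\<^sub>M count_space UNIV)"
  "right_clock \<in> borel_measurable (borel \<Otimes>\<^sub>M count_space UNIV)"
  unfolding left_clock_def[abs_def] right_clock_def[abs_def] by measurable

lemma sets_fair_clock [measurable_cong]: "sets fair_clock = sets (borel \<Otimes>\<^sub>M count_space UNIV)"
  by (intro sets_pair_measure_cong) simp_all

lemma distr_fst_fair_clock: "distr fair_clock borel fst = uniform_measure lborel {0<..<1}"
proof -
  interpret prob_space "uniform_measure lborel {0<..<1::real}" by (rule prob_space_uniform)
  have "distr fair_clock (uniform_measure lborel {0<..<1}) fst = uniform_measure lborel {0<..<1}"
    by (rule prob_space.distr_pair_fst) (rule measure_pmf.prob_space_axioms)
  then show ?thesis by (metis distr_cong sets_lborel sets_uniform_measure)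
qed

lemma uniform_below_directed:
  assumes z: "z = left_clock \<or> z = right_clock"
  shows "uniform_below (distr fair_clock borel z) (1 / 2)"
  unfolding uniform_below_def
proof (intro conjI allI impI)
  let ?U = "uniform_measure lborel {0<..<1::real}"
  interpret U: prob_space ?U by (rule prob_space_uniform)
  interpret P: pair_prob_space ?U "measure_pmf (bernoulli_pmf (1 / 2))" ..
  have mz[measurable]: "z \<in> borel_measurable fair_clock" using z by auto
  have AE_fst: "AE y in fair_clock. R (fst y)" if "AE s in ?U. R s" for R
  proof (rule AE_distrD[where f=fst and M'=borel and P=R])
    show "fst \<in> fair_clock \<rightarrow>\<^sub>M borel" by measurable
    show "AE s in distr fair_clock borel fst. R s" using that by (simp only: distr_fst_fair_clock)
  qed
  have U: "AE s in ?U. 0 < s" "u \<le> 1 \<Longrightarrow> AE s in ?U. s \<noteq> u" for u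
    using uniform_below_uniform by (auto simp: uniform_below_def)
  have "AE y in fair_clock. 0 < z y"
    using AE_fst[OF U(1)] by eventually_elim (use z in \<open>auto simp: left_clock_def right_clock_def\<close>)
  then show "AE s in distr fair_clock borel z. 0 < s" by (subst AE_distr_iff) auto
  fix u :: real assume u: "u \<le> 1"
  have "AE y in fair_clock. z y \<noteq> u"
    using AE_fst[OF U(2)[OF u]] by eventually_elim (use z u in \<open>auto simp: left_clock_def right_clock_def split: if_splits\<close>)
  then show "AE s in distr fair_clock borel z. s \<noteq> u" by (subst AE_distr_iff) auto
next
  let ?U = "uniform_measure lborel {0<..<1::real}"
  interpret U: prob_space ?U by (rule prob_space_uniform)
  interpret P: pair_prob_space ?U "measure_pmf (bernoulli_pmf (1 / 2))" ..
  have mz[measurable]: "z \<in> borel_measurable fair_clock" using z by auto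
  fix a b :: real and f :: "real \<Rightarrow> real"
  assume ab: "0 \<le> a" "a \<le> b" "b \<le> 1" and f: "continuous_on {a..b} f"
  have "(\<lambda>s. indicator {a<..<b} s *\<^sub>R f s) \<in> borel_measurable borel"
    using f by (intro borel_measurable_continuous_on_indicator) (auto intro: continuous_on_subset)
  then have [measurable]: "(\<lambda>s. indicator {a<..<b} s * f s) \<in> borel_measurable borel" by simp
  from compact_imp_bounded[OF compact_continuous_image[OF f compact_Icc]]
  obtain B where "\<forall>x\<in>{a..b}. \<bar>f x\<bar> \<le> B" unfolding bounded_iff by auto
  then have B: "\<bar>indicator {a<..<b} s * f s\<bar> \<le> max 0 B" for s
    by (auto simp: indicator_def le_max_iff_disj)
  have "(\<integral>s. indicator {a<..<b} s * f s \<partial>distr fair_clock borel z) = (\<integral>y. indicator {a<..<b} (z y) * f (z y) \<partial>fair_clock)"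
    by (subst integral_distr) auto
  also have "\<dots> = (\<integral>s. (\<integral>c. indicator {a<..<b} (z (s, c)) * f (z (s, c)) \<partial>measure_pmf (bernoulli_pmf (1 / 2))) \<partial>?U)"
  proof -
    have "(\<lambda>y. indicator {a<..<b} (z y) * f (z y)) \<in> borel_measurable fair_clock"
      by (rule measurable_compose[OF mz]) measurable
    then have "integrable fair_clock (\<lambda>y. indicator {a<..<b} (z y) * f (z y))"
      using B by (intro P.integrable_const_bound[of _ "max 0 B"]) auto
    from P.integral_fst'[OF this] show ?thesis ..
  qed
  also have "\<dots> = (\<integral>s. 1 / 2 * (indicator {a<..<b} s * f s) \<partial>?U)"
    using z ab by (intro Bochner_Integration.integral_cong refl)
      (auto simp: integral_bernoulli_pmf left_clock_def right_clock_def indicator_def)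
  also have "\<dots> = 1 / 2 * integral {a..b} f"
    using uniform_below_uniform ab f by (simp add: uniform_below_def)
  finally show "(\<integral>s. indicator {a<..<b} s * f s \<partial>distr fair_clock borel z) = 1 / 2 * integral {a..b} f" .
qed

locale directed_clocks = iid_family M "borel \<Otimes>\<^sub>M count_space UNIV" fair_clock Y
  for M :: "'a measure" and Y :: "int \<Rightarrow> 'a \<Rightarrow> real \<times> bool" +
  fixes t :: real
  assumes t: "0 < t" "t \<le> 1"
begin

lemma uniform_clocks_fst: "uniform_clocks M (\<lambda>i \<omega>. fst (Y i \<omega>)) t"
proof -
  have "inj (\<lambda>i::int. i)" by simp
  then have "iid_family M borel (distr fair_clock borel fst) (\<lambda>i \<omega>. fst (Y i \<omega>))"
    by (rule iid_reindex) simp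
  then show ?thesis using t
    unfolding distr_fst_fair_clock by (simp add: uniform_clocks_def uniform_clocks_axioms_def)
qed

lemma clock_sequence_reindex:
  assumes "inj \<sigma>" "z = left_clock \<or> z = right_clock"
  shows "clock_sequence M (distr fair_clock borel z) (\<lambda>j \<omega>. z (Y (\<sigma> j) \<omega>)) (1 / 2)"
proof -
  have "iid_family M borel (distr fair_clock borel z) (\<lambda>j \<omega>. z (Y (\<sigma> j) \<omega>))"
    using assms by (intro iid_reindex) auto
  then show ?thesis
    using uniform_below_directed[OF assms(2)] by (simp add: clock_sequence_def clock_sequence_axioms_def)
qed

abbreviation edge_pattern :: "int \<Rightarrow> nat \<Rightarrow> (int \<Rightarrow> real \<times> bool) \<Rightarrow> bool" where
  "edge_pattern a m x \<equiv> funnel t m (\<lambda>i. x (a + int i))"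

lemma clock_coordinate_measurable [measurable]:
  "(\<lambda>x. x i) \<in> PiM UNIV (\<lambda>_. borel \<Otimes>\<^sub>M count_space UNIV :: (real \<times> bool) measure) \<rightarrow>\<^sub>M borel \<Otimes>\<^sub>M count_space UNIV"
  by (rule measurable_component_singleton) simp

lemma edge_pattern_measurable [measurable]:
  "Measurable.pred (PiM UNIV (\<lambda>_. borel \<Otimes>\<^sub>M count_space UNIV)) (edge_pattern a m)"
  unfolding funnel_def by measurable

text \<open>
  Sum over the sink; the edges on its two sides are independent, and the binomial theorem gives
  \<open>(t / 2 + t / 2) ^ m / m!\<close>.
\<close>

lemma prob_edge_pattern: "prob {\<omega> \<in> space M. edge_pattern 0 m (\<lambda>i. Y i \<omega>)} = t ^ m / fact m"
proof -
  let ?L = "\<lambda>j x. descending (m - j) t (\<lambda>i. left_clock (x (int j + int i)))"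
  let ?R = "\<lambda>j x. descending j t (\<lambda>i. right_clock (x (int j - 1 - int i)))"
  have mL: "(\<lambda>x. of_bool (?L j x) :: real) \<in> borel_measurable (PiM UNIV (\<lambda>_. borel \<Otimes>\<^sub>M count_space UNIV))" for j
  proof -
    have [measurable]: "Measurable.pred (PiM UNIV (\<lambda>_. borel \<Otimes>\<^sub>M count_space UNIV)) (?L j)"
      by (rule measurable_descending) measurable
    show ?thesis by measurable
  qed
  have mR: "(\<lambda>x. of_bool (?R j x) :: real) \<in> borel_measurable (PiM UNIV (\<lambda>_. borel \<Otimes>\<^sub>M count_space UNIV))" for j
  proof -
    have [measurable]: "Measurable.pred (PiM UNIV (\<lambda>_. borel \<Otimes>\<^sub>M count_space UNIV)) (?R j)"
      by (rule measurable_descending) measurable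
    show ?thesis by measurable
  qed
  have "prob {\<omega> \<in> space M. edge_pattern 0 m (\<lambda>i. Y i \<omega>)}
    = expectation (\<lambda>\<omega>. of_bool (edge_pattern 0 m (\<lambda>i. Y i \<omega>)))"
    by (rule expectation_of_bool[symmetric])
  also have "\<dots> = expectation (\<lambda>\<omega>. \<Sum>j\<le>m. of_bool (?L j (\<lambda>i. Y i \<omega>)) * of_bool (?R j (\<lambda>i. Y i \<omega>)))"
  proof (rule Bochner_Integration.integral_cong[OF refl])
    fix \<omega>
    have "(of_bool (edge_pattern 0 m (\<lambda>i. Y i \<omega>)) :: real) = (\<Sum>j\<le>m. of_bool (descending (m - j) t (\<lambda>i. left_clock (Y (0 + int (j + i)) \<omega>))
        \<and> descending j t (\<lambda>i. right_clock (Y (0 + int (j - 1 - i)) \<omega>))))"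
      by (rule funnel_sinks[OF t(2), symmetric])
    also have "\<dots> = (\<Sum>j\<le>m. of_bool (?L j (\<lambda>i. Y i \<omega>)) * of_bool (?R j (\<lambda>i. Y i \<omega>)))"
    proof (rule sum.cong[OF refl])
      fix j
      have "descending j t (\<lambda>i. right_clock (Y (0 + int (j - 1 - i)) \<omega>)) = ?R j (\<lambda>i. Y i \<omega>)"
        by (rule descending_cong, rule arg_cong[where f=right_clock], rule arg_cong[where f="\<lambda>i. Y i \<omega>"]) auto
      then show "of_bool (descending (m - j) t (\<lambda>i. left_clock (Y (0 + int (j + i)) \<omega>))
        \<and> descending j t (\<lambda>i. right_clock (Y (0 + int (j - 1 - i)) \<omega>)))
        = (of_bool (?L j (\<lambda>i. Y i \<omega>)) * of_bool (?R j (\<lambda>i. Y i \<omega>)) :: real)" by simp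
    qed
    finally show "of_bool (edge_pattern 0 m (\<lambda>i. Y i \<omega>))
      = (\<Sum>j\<le>m. of_bool (?L j (\<lambda>i. Y i \<omega>)) * of_bool (?R j (\<lambda>i. Y i \<omega>)) :: real)" .
  qed
  also have "\<dots> = (\<Sum>j\<le>m. expectation (\<lambda>\<omega>. of_bool (?L j (\<lambda>i. Y i \<omega>)) * of_bool (?R j (\<lambda>i. Y i \<omega>))))"
  proof (rule Bochner_Integration.integral_sum)
    fix j
    have "(\<lambda>\<omega>. of_bool (?L j (\<lambda>i. Y i \<omega>)) * of_bool (?R j (\<lambda>i. Y i \<omega>)) :: real) \<in> borel_measurable M"
      using measurable_compose[OF path_measurable mL] measurable_compose[OF path_measurable mR] by (rule borel_measurable_times)
    then show "integrable M (\<lambda>\<omega>. of_bool (?L j (\<lambda>i. Y i \<omega>)) * of_bool (?R j (\<lambda>i. Y i \<omega>)) :: real)"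
      by (rule integrable_const_bound[rotated, of _ 1]) auto
  qed
  also have "\<dots> = (\<Sum>j\<le>m. (1 / 2 * t) ^ (m - j) / fact (m - j) * ((1 / 2 * t) ^ j / fact j))"
  proof (rule sum.cong[OF refl])
    fix j
    have "expectation (\<lambda>\<omega>. of_bool (?L j (\<lambda>i. Y i \<omega>)) * of_bool (?R j (\<lambda>i. Y i \<omega>)))
      = expectation (\<lambda>\<omega>. of_bool (?L j (\<lambda>i. Y i \<omega>))) * expectation (\<lambda>\<omega>. of_bool (?R j (\<lambda>i. Y i \<omega>)) :: real)"
    proof (rule expectation_local_mult[where F="\<lambda>x. of_bool (?L j x)" and G="\<lambda>x. of_bool (?R j x)" and B=1])
      show "{int j..} \<inter> {..<int j} = {}" by auto
      show "depends_on {int j..} (\<lambda>x. of_bool (?L j x) :: real)"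
        by (rule depends_onI, rule arg_cong[where f=of_bool], rule arg_cong[where f="descending (m - j) t"], rule ext) auto
      show "depends_on {..<int j} (\<lambda>x. of_bool (?R j x) :: real)"
        by (rule depends_onI, rule arg_cong[where f=of_bool], rule arg_cong[where f="descending j t"], rule ext) auto
    qed (auto intro: mL mR)
    also have "expectation (\<lambda>\<omega>. of_bool (?L j (\<lambda>i. Y i \<omega>)) :: real) = (1 / 2 * t) ^ (m - j) / fact (m - j)"
      by (rule clock_sequence.expectation_descending[OF clock_sequence_reindex]) (use t in \<open>auto simp: inj_def\<close>)
    also have "expectation (\<lambda>\<omega>. of_bool (?R j (\<lambda>i. Y i \<omega>)) :: real) = (1 / 2 * t) ^ j / fact j"
      by (rule clock_sequence.expectation_descending[OF clock_sequence_reindex]) (use t in \<open>auto simp: inj_def\<close>)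
    finally show "expectation (\<lambda>\<omega>. of_bool (?L j (\<lambda>i. Y i \<omega>)) * of_bool (?R j (\<lambda>i. Y i \<omega>)))
      = (1 / 2 * t) ^ (m - j) / fact (m - j) * ((1 / 2 * t) ^ j / fact j)" .
  qed
  also have "\<dots> = (1 / 2 * t + 1 / 2 * t) ^ m / fact m"
  proof -
    have "(1 / 2 * t + 1 / 2 * t) ^ m = (\<Sum>i\<le>m. of_nat (m choose i) * (1 / 2 * t) ^ (m - i) * (1 / 2 * t) ^ i)"
      using binomial_ring[of "1 / 2 * t" "1 / 2 * t" m] by (simp only: mult_ac)
    then show ?thesis
      by (simp only: sum_divide_distrib) (intro sum.cong refl, simp add: binomial_fact field_simps)
  qed
  finally show ?thesis by simp
qed

text \<open>
  There is no excess here: already one common edge determines the pattern on the union.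
\<close>

lemma annihilation_overlapping_pattern:
  "overlapping_pattern M (borel \<Otimes>\<^sub>M count_space UNIV) fair_clock Y edge_pattern (exp 32) (\<lambda>_ _. 0)
    (exp (- t) - 1) (- t * exp (- t)) 0"
proof (unfold_locales)
  fix a b :: int and m l :: nat and x :: "int \<Rightarrow> real \<times> bool"
  show "Measurable.pred (PiM UNIV (\<lambda>_. borel \<Otimes>\<^sub>M count_space UNIV)) (edge_pattern a m)" by measurable
  show "depends_on {a..<a + int m} (edge_pattern a m)"
    by (rule depends_onI, rule funnel_cong) simp
  show "edge_pattern (a + b) m x \<longleftrightarrow> edge_pattern a m (\<lambda>i. x (b + i))"
    by (simp add: add_ac)
  show "prob {\<omega> \<in> space M. edge_pattern 0 m (\<lambda>i. Y i \<omega>)} \<le> exp 32 / 16 ^ m"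
    unfolding prob_edge_pattern using t by (intro exp_tail_bound) auto
  show "edge_pattern b l x" if p: "edge_pattern a m x" and ab: "a \<le> b" "b + int l \<le> a + int m"
  proof -
    define d where "d = nat (b - a)"
    have d: "b + int i = a + int (d + i)" for i using ab unfolding d_def by simp
    have "d + l \<le> m" using ab unfolding d_def by simp
    from funnel_subinterval[OF p this] show ?thesis by (simp only: d)
  qed
next
  fix d k l :: nat assume d: "1 \<le> d" "d < k" "k < d + l"
  have "of_bool (edge_pattern 0 k x) * of_bool (edge_pattern (int d) l x) = (of_bool (edge_pattern 0 (d + l) x) :: real)" for x
    using funnel_overlap[OF d(2,3), of t "\<lambda>i. x (int i)"] by (simp flip: of_bool_conj)
  then have "of_bool (edge_pattern 0 k (\<lambda>i. Y i \<omega>)) * of_bool (edge_pattern (int d) l (\<lambda>i. Y i \<omega>))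
      = (of_bool (edge_pattern 0 (d + l) (\<lambda>i. Y i \<omega>)) :: real)" for \<omega> .
  then have "expectation (\<lambda>\<omega>. of_bool (edge_pattern 0 k (\<lambda>i. Y i \<omega>)) * of_bool (edge_pattern (int d) l (\<lambda>i. Y i \<omega>)) :: real)
      = prob {\<omega> \<in> space M. edge_pattern 0 (d + l) (\<lambda>i. Y i \<omega>)}"
    by (simp only: expectation_of_bool)
  then show "expectation (\<lambda>\<omega>. of_bool (edge_pattern 0 k (\<lambda>i. Y i \<omega>)) * of_bool (edge_pattern (int d) l (\<lambda>i. Y i \<omega>)))
    = prob {\<omega> \<in> space M. edge_pattern 0 (d + l) (\<lambda>i. Y i \<omega>)} + (if d = k - 1 then 0 else 0)" by simp
next
  show "(0::real) = 0" by simp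
  have sgn: "(- t) ^ m = (-1) ^ m * t ^ m" for m using power_mult_distrib[of "-1" t m] by simp
  have "(\<lambda>n. \<Sum>m=1..n. (- t) ^ m / fact m) \<longlonglongrightarrow> exp (- t) - 1" by (rule exp_sum_tendsto)
  then show "(\<lambda>n. \<Sum>m=1..n. (-1) ^ m * prob {\<omega> \<in> space M. edge_pattern 0 m (\<lambda>i. Y i \<omega>)}) \<longlonglongrightarrow> exp (- t) - 1"
    unfolding prob_edge_pattern sgn by (simp only: times_divide_eq_right)
  have "(\<lambda>n. \<Sum>m=1..n. real m * ((- t) ^ m / fact m)) \<longlonglongrightarrow> - t * exp (- t)" by (rule exp_moment_tendsto)
  then show "(\<lambda>n. \<Sum>m=1..n. (-1) ^ m * real m * prob {\<omega> \<in> space M. edge_pattern 0 m (\<lambda>i. Y i \<omega>)}) \<longlonglongrightarrow> - t * exp (- t)"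
    unfolding prob_edge_pattern sgn by (simp only: times_divide_eq_right mult_ac)
  show "(\<lambda>n. \<Sum>k<n. (-1) ^ k * (\<Sum>i\<le>k. 0)) \<longlonglongrightarrow> (0 :: real)" by simp
qed

lemma sigma2_AN_pos: "0 < sigma2_AN t"
proof -
  \<comment> \<open>For \<open>t = 1\<close> the quadratic bound on \<open>exp t\<close> gives equality, so it
    is applied to \<open>exp (1 / 4)\<close> instead.\<close>
  have "exp t < 1 + 2 * t"
  proof (cases "t = 1")
    case True
    have "exp (1 / 4) \<le> 1 + 1 / 4 + (1 / 4 :: real)\<^sup>2" by (rule exp_bound) auto
    then have "exp (1 / 4 :: real) \<le> 21 / 16" by (simp add: power2_eq_square)
    then have "exp (1 / 4 :: real) ^ 4 \<le> (21 / 16) ^ 4" by (rule power_mono) simp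
    also have "exp (1 / 4 :: real) ^ 4 = exp 1" by (simp flip: exp_of_nat_mult)
    finally show ?thesis using True by (simp add: power4_eq_xxxx)
  next
    case False
    have "exp t \<le> 1 + t + t\<^sup>2" using t by (intro exp_bound) auto
    also have "t\<^sup>2 < t" using False t by (simp add: power2_eq_square)
    finally show ?thesis by simp
  qed
  then have "exp t * exp (- 2 * t) < (1 + 2 * t) * exp (- 2 * t)" by (rule mult_strict_right_mono) simp
  moreover have "exp t * exp (- 2 * t) = exp (- t)" by (simp flip: exp_add)
  ultimately show ?thesis unfolding sigma2_AN_def by linarith
qed

lemma annihilation_altsum_limit:
  "variance_limit_and_clt M (interval_pattern.altsum Y edge_pattern \<circ> (\<lambda>n. intervals 1 (int n + 1))) (sigma2_AN t)"
proof -
  interpret overlapping_pattern M "borel \<Otimes>\<^sub>M count_space UNIV" fair_clock Y edge_pattern "exp 32" "\<lambda>_ _. 0"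
    "exp (- t) - 1" "- t * exp (- t)" 0
    by (rule annihilation_overlapping_pattern)
  have e: "exp (- 2 * t) = exp (- t) * exp (- t)" by (simp flip: exp_add)
  have "exp (- t) - 1 - 2 * (- t * exp (- t)) + (exp (- t) - 1)\<^sup>2 - 2 * (exp (- t) - 1) * (- t * exp (- t)) + 2 * 0 = sigma2_AN t"
    unfolding sigma2_AN_def e by (simp add: power2_eq_square algebra_simps)
  with variance_T_limit have "(\<lambda>n. variance (T n) / real n) \<longlonglongrightarrow> sigma2_AN t" by (simp only:)
  then show ?thesis
    unfolding comp_def by (intro altsum_clt sigma2_AN_pos)
qed

end

section \<open>The finite processes in terms of chains\<close>

lemma run_length_le_card:
  fixes v :: int
  assumes "finite A" "\<And>i. i < n \<Longrightarrow> v + int i \<in> A"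
  shows "n \<le> card A"
proof -
  have "n = card ((\<lambda>i. v + int i) ` {..<n})" by (subst card_image) (auto simp: inj_on_def)
  also have "\<dots> \<le> card A" using assms by (intro card_mono) auto
  finally show ?thesis .
qed

text \<open>
  A chain of decreasing clocks inside \<open>A\<close> has at most \<open>card A\<close> members,
  so \<open>unblocked\<close> with a larger bound satisfies the unbounded recursion.
\<close>

lemma chain_recursion_exists:
  fixes c :: "int \<Rightarrow> real"
  assumes A: "finite A"
  shows "\<exists>R. \<forall>v u. u \<le> 2 \<longrightarrow> (R v u \<longleftrightarrow> \<not> (v \<in> A \<and> c v < u \<and> R (v + 1) (c v)))"
proof -
  define n where "n = Suc (card A)"
  \<comment> \<open>Positions outside \<open>A\<close> get the clock 2, which is not smaller than any
    admissible \<open>u\<close>.\<close>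
  define c' where "c' i = (if i \<in> A then c i else 2)" for i
  define R where "R v u = unblocked (Suc n) u (\<lambda>i. c' (v + int i))" for v u
  have "R v u \<longleftrightarrow> \<not> (v \<in> A \<and> c v < u \<and> R (v + 1) (c v))" if u: "u \<le> 2" for v u
  proof -
    have "unblocked n (c' v) (\<lambda>i. c' (v + 1 + int i)) = R (v + 1) (c' v)" if "c' v < u"
    proof -
      have "\<not> descending n (c' v) (\<lambda>i. c' (v + 1 + int i))"
      proof
        assume "descending n (c' v) (\<lambda>i. c' (v + 1 + int i))"
        then have lt: "c' (v + 1 + int i) < 2" if "i < n" for i
          using that \<open>c' v < u\<close> u unfolding descending_iff_steps by force
        have "v + 1 + int i \<in> A" if "i < n" for i
          using lt[OF that] by (simp add: c'_def split: if_splits)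
        then have "n \<le> card A" using A by (intro run_length_le_card[of A n "v + 1"])
        then show False by (simp add: n_def)
      qed
      then show ?thesis unfolding R_def by (intro unblocked_stable[symmetric]) auto
    qed
    moreover have "R v u \<longleftrightarrow> \<not> (c' v < u \<and> unblocked n (c' v) (\<lambda>i. c' (v + 1 + int i)))"
      unfolding R_def unblocked.simps(2) by (simp add: add_ac)
    ultimately show ?thesis using u by (auto simp: c'_def)
  qed
  then show ?thesis by blast
qed

text \<open>
  To evaluate the recursion at \<open>v\<close> it suffices to follow it up to the first break of
  the chain or to the end of \<open>A\<close>.
\<close>

lemma chain_recursion_eq:
  fixes c :: "int \<Rightarrow> real"
  assumes R: "\<And>v u. u \<le> 2 \<Longrightarrow> R v u \<longleftrightarrow> \<not> (v \<in> A \<and> c v < u \<and> R (v + 1) (c v))"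
    and u: "u \<le> 2" and run: "\<And>i. i < k \<Longrightarrow> v + int i \<in> A"
    and stop: "v + int k \<notin> A \<or> \<not> descending k u (\<lambda>i. c (v + int i))"
  shows "R v u \<longleftrightarrow> unblocked k u (\<lambda>i. c (v + int i))"
  using u run stop
proof (induction k arbitrary: v u)
  case 0
  then show ?case using R[of u v] by simp
next
  case (Suc k)
  have "v \<in> A" using Suc.prems(2)[of 0] by simp
  show ?case
  proof (cases "c v < u")
    case True
    have "R (v + 1) (c v) \<longleftrightarrow> unblocked k (c v) (\<lambda>i. c (v + 1 + int i))"
    proof (rule Suc.IH)
      show "c v \<le> 2" using True Suc.prems(1) by simp
      show "v + 1 + int i \<in> A" if "i < k" for i using Suc.prems(2)[of "Suc i"] that by (simp add: add_ac)
      show "v + 1 + int k \<notin> A \<or> \<not> descending k (c v) (\<lambda>i. c (v + 1 + int i))"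
        using Suc.prems(3) True by (simp add: add_ac)
    qed
    then show ?thesis using R[OF Suc.prems(1), of v] True \<open>v \<in> A\<close> by (simp add: add_ac)
  qed (use R[OF Suc.prems(1), of v] in simp)
qed

lemma left_chain_recursion_exists:
  fixes c :: "int \<Rightarrow> real"
  assumes A: "finite A"
  shows "\<exists>L. \<forall>v u. u \<le> 2 \<longrightarrow> (L v u \<longleftrightarrow> \<not> (v \<in> A \<and> c v < u \<and> L (v - 1) (c v)))"
proof -
  from chain_recursion_exists[of "uminus ` A" "\<lambda>i. c (- i)"] A
  obtain R where R: "\<And>v u. u \<le> 2 \<Longrightarrow> R v u \<longleftrightarrow> \<not> (v \<in> uminus ` A \<and> c (- v) < u \<and> R (v + 1) (c (- v)))"
    by auto
  have "R (- v) u \<longleftrightarrow> \<not> (v \<in> A \<and> c v < u \<and> R (- (v - 1)) (c v))" if "u \<le> 2" for v u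
    using R[OF that, of "- v"] by (auto simp: add.commute)
  then show ?thesis by (intro exI[of _ "\<lambda>v. R (- v)"]) blast
qed

lemma left_chain_recursion_eq:
  fixes c :: "int \<Rightarrow> real"
  assumes L: "\<And>v u. u \<le> 2 \<Longrightarrow> L v u \<longleftrightarrow> \<not> (v \<in> A \<and> c v < u \<and> L (v - 1) (c v))"
    and u: "u \<le> 2" and run: "\<And>i. i < k \<Longrightarrow> v - int i \<in> A"
    and stop: "v - int k \<notin> A \<or> \<not> descending k u (\<lambda>i. c (v - int i))"
  shows "L v u \<longleftrightarrow> unblocked k u (\<lambda>i. c (v - int i))"
proof -
  have "(\<lambda>w. L (- w)) (- v) u \<longleftrightarrow> unblocked k u (\<lambda>i. (\<lambda>w. c (- w)) (- v + int i))"
  proof (rule chain_recursion_eq[where A="uminus ` A"])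
    fix u :: real and w :: int assume "u \<le> 2"
    from L[OF this, of "- w"] show "L (- w) u \<longleftrightarrow> \<not> (w \<in> uminus ` A \<and> c (- w) < u \<and> L (- (w + 1)) (c (- w)))"
      by (auto simp: image_iff)
  qed (use assms in \<open>auto simp: image_iff algebra_simps intro!: bexI[rotated]\<close>)
  then show ?thesis by simp
qed

lemma arrivals_props:
  assumes "finite I"
  shows "distinct (arrivals \<tau> I t)" "set (arrivals \<tau> I t) = {i \<in> I. \<tau> i \<le> t}" "sorted (map \<tau> (arrivals \<tau> I t))"
proof -
  obtain xs where "distinct xs" "set xs = {i \<in> I. \<tau> i \<le> t}"
    using finite_distinct_list[of "{i \<in> I. \<tau> i \<le> t}"] assms by auto
  then have "\<exists>xs. distinct xs \<and> set xs = {i \<in> I. \<tau> i \<le> t} \<and> sorted (map \<tau> xs)"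
    by (intro exI[of _ "sort_key \<tau> xs"]) auto
  from someI_ex[OF this]
  show "distinct (arrivals \<tau> I t)" "set (arrivals \<tau> I t) = {i \<in> I. \<tau> i \<le> t}" "sorted (map \<tau> (arrivals \<tau> I t))"
    unfolding arrivals_def by blast+
qed

definition line_edge :: "int \<Rightarrow> int set" where "line_edge i = {i, i + 1}"

lemma line_edge_eq_iff: "line_edge i = line_edge j \<longleftrightarrow> i = j"
  by (auto simp: line_edge_def doubleton_eq_iff)

lemma inj_line_edge: "inj line_edge" by (auto simp: inj_def line_edge_eq_iff)

lemma int_edges_eq: "int_edges = range line_edge"
  by (auto simp: int_edges_def line_edge_def)

lemma line_neighbours: "{u, v} \<in> induced_edges int_edges W \<longleftrightarrow> u \<in> W \<and> v \<in> W \<and> (u = v + 1 \<or> u = v - 1)"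
  by (auto simp: induced_edges_def int_edges_def doubleton_eq_iff)

lemma induced_line_edges: "induced_edges int_edges W = line_edge ` {i. i \<in> W \<and> i + 1 \<in> W}"
  by (auto simp: induced_edges_def int_edges_eq line_edge_def)

text \<open>
  When a site rings, each of its neighbours that rang before has itself been influenced from its
  far side only, because the site in between was still vacant. So the two sides are governed by
  two separate one-sided recursions \<open>R\<close> and \<open>L\<close>.
\<close>

lemma blocking_prefix:
  fixes \<tau> :: "int \<Rightarrow> real"
  assumes inj: "inj_on \<tau> W"
    and R: "\<And>v u. u \<le> 2 \<Longrightarrow> R v u \<longleftrightarrow> \<not> (v \<in> W \<and> \<tau> v < u \<and> R (v + 1) (\<tau> v))"
    and L: "\<And>v u. u \<le> 2 \<Longrightarrow> L v u \<longleftrightarrow> \<not> (v \<in> W \<and> \<tau> v < u \<and> L (v - 1) (\<tau> v))"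
    and xs: "distinct xs" "sorted (map \<tau> xs)" "set xs \<subseteq> W"
      "\<And>v w. v \<in> set xs \<Longrightarrow> w \<in> W \<Longrightarrow> \<tau> w < \<tau> v \<Longrightarrow> w \<in> set xs"
    and le: "\<And>v. v \<in> W \<Longrightarrow> \<tau> v \<le> 2"
  shows "fold (blocking_step (induced_edges int_edges W)) xs (\<lambda>_. 0) v
    = of_bool (v \<in> set xs \<and> R (v + 1) (\<tau> v) \<and> L (v - 1) (\<tau> v))"
  using xs
proof (induction xs arbitrary: v rule: rev_induct)
  case (snoc a xs)
  let ?x = "fold (blocking_step (induced_edges int_edges W)) xs (\<lambda>_. 0)"
  have aW: "a \<in> W" "a \<notin> set xs" using snoc.prems by auto
  have lt: "\<tau> w < \<tau> a" if "w \<in> set xs" for w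
  proof -
    have "\<tau> w \<le> \<tau> a" using snoc.prems(2) that by (auto simp: sorted_append)
    moreover have "\<tau> w \<noteq> \<tau> a" using inj_onD[OF inj, of w a] that snoc.prems(3) aW by auto
    ultimately show ?thesis by simp
  qed
  have in_xs: "w \<in> set xs \<longleftrightarrow> w \<in> W \<and> \<tau> w < \<tau> a" for w
    using lt snoc.prems(3) snoc.prems(4)[of a w] by auto
  have IH: "?x v = of_bool (v \<in> set xs \<and> R (v + 1) (\<tau> v) \<and> L (v - 1) (\<tau> v))" for v
  proof (rule snoc.IH)
    show "distinct xs" "sorted (map \<tau> xs)" "set xs \<subseteq> W" using snoc.prems by (auto simp: sorted_append)
    show "w \<in> set xs" if "v \<in> set xs" "w \<in> W" "\<tau> w < \<tau> v" for v w
      using that in_xs by (meson order.strict_trans)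
  qed
  have right: "?x (a + 1) = 0 \<longleftrightarrow> R (a + 1) (\<tau> a)"
  proof -
    have "L a (\<tau> (a + 1))" if "a + 1 \<in> set xs"
      using L[of "\<tau> (a + 1)" a] lt[OF that] le[of "a + 1"] in_xs[of "a + 1"] that by auto
    then show ?thesis using R[OF le[OF aW(1)], of "a + 1"] in_xs[of "a + 1"] by (auto simp: IH)
  qed
  have left: "?x (a - 1) = 0 \<longleftrightarrow> L (a - 1) (\<tau> a)"
  proof -
    have "R a (\<tau> (a - 1))" if "a - 1 \<in> set xs"
      using R[of "\<tau> (a - 1)" a] lt[OF that] le[of "a - 1"] in_xs[of "a - 1"] that by auto
    then show ?thesis using L[OF le[OF aW(1)], of "a - 1"] in_xs[of "a - 1"] by (auto simp: IH)
  qed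
  have outside: "?x w = 0" if "w \<notin> W" for w using that snoc.prems(3) by (auto simp: IH)
  have "(\<forall>u. {u, a} \<in> induced_edges int_edges W \<longrightarrow> ?x u = 0) \<longleftrightarrow> ?x (a + 1) = 0 \<and> ?x (a - 1) = 0"
    using aW outside unfolding line_neighbours by auto
  then have step: "blocking_step (induced_edges int_edges W) a ?x
    = (if R (a + 1) (\<tau> a) \<and> L (a - 1) (\<tau> a) then ?x(a := 1) else ?x)"
    unfolding blocking_step_def[of _ a ?x] by (simp only: right left)
  show ?case
    using aW(2) by (cases "v = a") (auto simp: step IH)
qed simp

lemma blocking_formula_list:
  fixes \<tau> :: "int \<Rightarrow> real"
  assumes W: "finite W" and inj: "inj_on \<tau> W" and \<tau>: "\<And>v. v \<in> W \<Longrightarrow> \<tau> v \<le> 2"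
    and xs: "distinct xs" "sorted (map \<tau> xs)" "set xs = {v \<in> W. \<tau> v \<le> t}"
    and v: "v \<in> W"
    and right: "\<And>i. i < k \<Longrightarrow> v + 1 + int i \<in> W"
      "v + 1 + int k \<notin> W \<or> \<not> descending k (\<tau> v) (\<lambda>i. \<tau> (v + 1 + int i))"
    and left: "\<And>i. i < l \<Longrightarrow> v - 1 - int i \<in> W"
      "v - 1 - int l \<notin> W \<or> \<not> descending l (\<tau> v) (\<lambda>i. \<tau> (v - 1 - int i))"
  shows "fold (blocking_step (induced_edges int_edges W)) xs (\<lambda>_. 0) v
    = of_bool (\<tau> v \<le> t \<and> unblocked k (\<tau> v) (\<lambda>i. \<tau> (v + 1 + int i)) \<and> unblocked l (\<tau> v) (\<lambda>i. \<tau> (v - 1 - int i)))"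
proof -
  obtain R where R: "\<And>v u. u \<le> 2 \<Longrightarrow> R v u \<longleftrightarrow> \<not> (v \<in> W \<and> \<tau> v < u \<and> R (v + 1) (\<tau> v))"
    using chain_recursion_exists[OF W, of \<tau>] by blast
  obtain L where L: "\<And>v u. u \<le> 2 \<Longrightarrow> L v u \<longleftrightarrow> \<not> (v \<in> W \<and> \<tau> v < u \<and> L (v - 1) (\<tau> v))"
    using left_chain_recursion_exists[OF W, of \<tau>] by blast
  have "fold (blocking_step (induced_edges int_edges W)) xs (\<lambda>_. 0) v
    = of_bool (v \<in> set xs \<and> R (v + 1) (\<tau> v) \<and> L (v - 1) (\<tau> v))"
    by (rule blocking_prefix[OF inj R L xs(1,2) _ _ \<tau>]) (auto simp: xs(3))
  moreover have "R (v + 1) (\<tau> v) \<longleftrightarrow> unblocked k (\<tau> v) (\<lambda>i. \<tau> (v + 1 + int i))"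
    by (rule chain_recursion_eq[OF R \<tau>[OF v] right])
  moreover have "L (v - 1) (\<tau> v) \<longleftrightarrow> unblocked l (\<tau> v) (\<lambda>i. \<tau> (v - 1 - int i))"
    by (rule left_chain_recursion_eq[OF L \<tau>[OF v] left])
  ultimately show ?thesis using v by (simp add: xs(3))
qed

text \<open>
  The formula in terms of \<open>R\<close> and \<open>L\<close> depends only on the set of sites
  that have rung, so any list of them sorted by their clocks leads to the same state.
\<close>

lemma blocking_list_unique:
  fixes \<tau> :: "int \<Rightarrow> real"
  assumes W: "finite W" and inj: "inj_on \<tau> W" and \<tau>: "\<And>v. v \<in> W \<Longrightarrow> \<tau> v \<le> 2"
    and xs: "distinct xs" "sorted (map \<tau> xs)" "set xs = {v \<in> W. \<tau> v \<le> t}"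
  shows "fold (blocking_step (induced_edges int_edges W)) xs (\<lambda>_. 0) = finite_blocking int_edges \<tau> t W"
proof -
  obtain R where R: "\<And>v u. u \<le> 2 \<Longrightarrow> R v u \<longleftrightarrow> \<not> (v \<in> W \<and> \<tau> v < u \<and> R (v + 1) (\<tau> v))"
    using chain_recursion_exists[OF W, of \<tau>] by blast
  obtain L where L: "\<And>v u. u \<le> 2 \<Longrightarrow> L v u \<longleftrightarrow> \<not> (v \<in> W \<and> \<tau> v < u \<and> L (v - 1) (\<tau> v))"
    using left_chain_recursion_exists[OF W, of \<tau>] by blast
  have *: "fold (blocking_step (induced_edges int_edges W)) ys (\<lambda>_. 0) v
    = of_bool (v \<in> {v \<in> W. \<tau> v \<le> t} \<and> R (v + 1) (\<tau> v) \<and> L (v - 1) (\<tau> v))"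
    if ys: "distinct ys" "sorted (map \<tau> ys)" "set ys = {v \<in> W. \<tau> v \<le> t}" for ys v
    unfolding ys(3)[symmetric]
    by (rule blocking_prefix[OF inj R L ys(1,2) _ _ \<tau>]) (auto simp: ys(3))
  show ?thesis
    unfolding finite_blocking_def fun_eq_iff
    by (simp only: *[OF xs] *[OF arrivals_props(1)[OF W] arrivals_props(3)[OF W] arrivals_props(2)[OF W]]) simp
qed

lemma finite_blocking_cases: "finite_blocking E \<tau> t W v = 0 \<or> finite_blocking E \<tau> t W v = 1"
proof -
  have "fold (blocking_step F) xs (\<lambda>_. 0) v = 0 \<or> fold (blocking_step F) xs (\<lambda>_. 0) v = 1" for F xs
    by (induction xs rule: rev_induct) (auto simp: blocking_step_def)
  then show ?thesis by (simp add: finite_blocking_def)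
qed

lemma finite_blocking_outside:
  assumes "finite W" "v \<notin> W"
  shows "finite_blocking E \<tau> t W v = 0"
proof -
  have "v \<notin> set xs \<Longrightarrow> fold (blocking_step F) xs (\<lambda>_. 0) v = 0" for F xs
    by (induction xs rule: rev_induct) (auto simp: blocking_step_def)
  then show ?thesis unfolding finite_blocking_def using assms arrivals_props(2)[OF assms(1), of \<tau> t] by auto
qed

text \<open>
  A dimer on the edge \<open>{i, i + 1}\<close> is a particle at \<open>i\<close> in blocking RSA
  on the line graph. The induction carries along that states are 0 or 1 and that no two neighbours
  are occupied.
\<close>

lemma dimer_fold:
  assumes js: "distinct js" "set js \<subseteq> {i. i \<in> W \<and> i + 1 \<in> W}"
  defines "y \<equiv> fold (blocking_step (induced_edges int_edges {i. i \<in> W \<and> i + 1 \<in> W})) js (\<lambda>_. 0)"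
  shows "fold dimer_step (map line_edge js) (\<lambda>_. 0) v = y (v - 1) + y v
    \<and> (y v = 0 \<or> y v = 1) \<and> (y (v - 1) = 0 \<or> y v = 0) \<and> (v \<notin> set js \<longrightarrow> y v = 0)"
  using js unfolding y_def
proof (induction js arbitrary: v rule: rev_induct)
  case (snoc a xs)
  let ?A = "{i. i \<in> W \<and> i + 1 \<in> W}"
  let ?y = "fold (blocking_step (induced_edges int_edges ?A)) xs (\<lambda>_. 0)"
  let ?x = "fold dimer_step (map line_edge xs) (\<lambda>_. 0)"
  have a: "a \<notin> set xs" "a \<in> ?A" using snoc.prems by auto
  have IH: "?x v = ?y (v - 1) + ?y v" "?y v = 0 \<or> ?y v = 1" "?y (v - 1) = 0 \<or> ?y v = 0"
    "v \<notin> set xs \<Longrightarrow> ?y v = 0" for v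
    using snoc.IH[of v] snoc.prems by auto
  have outside: "?y w = 0" if "w \<notin> ?A" for w using IH(4)[of w] that snoc.prems(2) by auto
  have nb: "(\<forall>u. {u, a} \<in> induced_edges int_edges ?A \<longrightarrow> ?y u = 0) \<longleftrightarrow> ?y (a + 1) = 0 \<and> ?y (a - 1) = 0"
    using a outside unfolding line_neighbours by auto
  have ystep: "blocking_step (induced_edges int_edges ?A) a ?y
    = (if ?y (a + 1) = 0 \<and> ?y (a - 1) = 0 then ?y(a := 1) else ?y)"
    unfolding blocking_step_def[of _ a ?y] by (simp only: nb)
  have ya: "?y a = 0" using IH(4) a by simp
  have free: "(\<forall>u\<in>line_edge a. ?x u = 0) \<longleftrightarrow> ?y (a + 1) = 0 \<and> ?y (a - 1) = 0"
    using IH(1)[of a] IH(1)[of "a + 1"] ya by (auto simp: line_edge_def)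
  have xstep: "dimer_step (line_edge a) ?x
    = (if ?y (a + 1) = 0 \<and> ?y (a - 1) = 0 then (\<lambda>w. if w \<in> line_edge a then 1 else ?x w) else ?x)"
    unfolding dimer_step_def[of _ ?x] by (simp only: free)
  define y where "y = ?y"
  define x where "x = ?x"
  have goal: "(if y (a + 1) = 0 \<and> y (a - 1) = 0 then (\<lambda>w. if w \<in> line_edge a then 1 else x w) else x) v
      = (if y (a + 1) = 0 \<and> y (a - 1) = 0 then y(a := 1) else y) (v - 1)
        + (if y (a + 1) = 0 \<and> y (a - 1) = 0 then y(a := 1) else y) v
    \<and> ((if y (a + 1) = 0 \<and> y (a - 1) = 0 then y(a := 1) else y) v = 0
        \<or> (if y (a + 1) = 0 \<and> y (a - 1) = 0 then y(a := 1) else y) v = 1)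
    \<and> ((if y (a + 1) = 0 \<and> y (a - 1) = 0 then y(a := 1) else y) (v - 1) = 0
        \<or> (if y (a + 1) = 0 \<and> y (a - 1) = 0 then y(a := 1) else y) v = 0)
    \<and> (v \<notin> set (xs @ [a]) \<longrightarrow> (if y (a + 1) = 0 \<and> y (a - 1) = 0 then y(a := 1) else y) v = 0)"
    using IH[of v, folded x_def y_def] ya[folded y_def]
    by (cases "v = a"; cases "v = a + 1") (auto simp: line_edge_def)
  show ?case
    unfolding map_append fold_append comp_def list.map fold.simps id_def xstep ystep
    using goal unfolding x_def y_def .
qed simp

lemma list_of_line_edges:
  assumes "set es \<subseteq> range line_edge"
  obtains js where "es = map line_edge js"
proof
  show "es = map line_edge (map (the_inv line_edge) es)"
    using assms by (auto simp: map_idI f_the_inv_into_f[OF inj_line_edge] comp_def intro!: map_idI[symmetric])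
qed

lemma edge_arrivals:
  fixes \<tau> :: "int set \<Rightarrow> real"
  assumes W: "finite W"
  obtains js where "arrivals \<tau> (induced_edges int_edges W) t = map line_edge js" "distinct js"
    "sorted (map (\<lambda>i. \<tau> (line_edge i)) js)" "set js = {i \<in> {i. i \<in> W \<and> i + 1 \<in> W}. \<tau> (line_edge i) \<le> t}"
proof -
  have fin: "finite (induced_edges int_edges W)"
    using W unfolding induced_line_edges by (intro finite_imageI) (rule finite_subset[of _ W]; auto)
  note p = arrivals_props[OF fin, of \<tau> t]
  have "set (arrivals \<tau> (induced_edges int_edges W) t) \<subseteq> range line_edge"
    using p(2) induced_line_edges by auto
  then obtain js where js: "arrivals \<tau> (induced_edges int_edges W) t = map line_edge js"
    by (rule list_of_line_edges)
  have "set js = {i \<in> {i. i \<in> W \<and> i + 1 \<in> W}. \<tau> (line_edge i) \<le> t}"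
  proof -
    have mem: "i \<in> set js \<longleftrightarrow> line_edge i \<in> set (arrivals \<tau> (induced_edges int_edges W) t)" for i
      unfolding js by (auto simp: line_edge_eq_iff)
    show ?thesis
      by (rule set_eqI) (simp only: mem p(2), auto simp: induced_line_edges line_edge_eq_iff)
  qed
  moreover have "distinct js" "sorted (map (\<lambda>i. \<tau> (line_edge i)) js)"
    using p(1,3) unfolding js by (auto simp: distinct_map comp_def)
  ultimately show ?thesis by (intro that[of js] js)
qed

lemma dimer_eq_blocking:
  fixes \<tau> :: "int set \<Rightarrow> real" and t :: real
  assumes W: "finite W" and inj: "inj (\<lambda>i. \<tau> (line_edge i))" and \<tau>: "\<And>i. \<tau> (line_edge i) \<le> 2"
  defines "B \<equiv> finite_blocking int_edges (\<lambda>i. \<tau> (line_edge i)) t {i. i \<in> W \<and> i + 1 \<in> W}"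
  shows "finite_dimer int_edges \<tau> t W v = B (v - 1) + B v"
proof -
  let ?A = "{i. i \<in> W \<and> i + 1 \<in> W}"
  have fA: "finite ?A" using W by (rule finite_subset[rotated]) auto
  obtain js where js: "arrivals \<tau> (induced_edges int_edges W) t = map line_edge js" "distinct js"
    "sorted (map (\<lambda>i. \<tau> (line_edge i)) js)" "set js = {i \<in> ?A. \<tau> (line_edge i) \<le> t}"
    by (rule edge_arrivals[OF W])
  have "fold (blocking_step (induced_edges int_edges ?A)) js (\<lambda>_. 0) = B"
    unfolding B_def by (rule blocking_list_unique[OF fA inj_on_subset[OF inj subset_UNIV] \<tau> js(2,3,4)])
  then show ?thesis
    unfolding finite_dimer_def js(1) using dimer_fold[OF js(2), of W v] js(4) by auto
qed

text \<open>
  A vertex is alive at time \<open>u\<close> unless it has been attacked successfully from the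
  right or from the left. An attack through an edge succeeds if the attacking vertex is still
  alive; since the attacked vertex has not attacked it through this edge, this is decided on the
  far side of the attacking vertex.
\<close>

lemma annihilation_prefix:
  fixes \<tau> :: "int \<Rightarrow> real" and b :: "int \<Rightarrow> bool"
  assumes inj: "inj_on \<tau> P" and le: "\<And>i. i \<in> P \<Longrightarrow> \<tau> i \<le> t"
    and R: "\<And>v u. u \<le> t \<Longrightarrow> R v u \<longleftrightarrow> \<not> (v \<in> P \<and> b v \<and> \<tau> v < u \<and> R (v + 1) (\<tau> v))"
    and L: "\<And>v u. u \<le> t \<Longrightarrow> L v u \<longleftrightarrow> \<not> (v - 1 \<in> P \<and> \<not> b (v - 1) \<and> \<tau> (v - 1) < u \<and> L (v - 1) (\<tau> (v - 1)))"
    and D: "\<And>i. D (line_edge i) = (if b i then i else i + 1)"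
    and xs: "distinct xs" "sorted (map \<tau> xs)" "set xs \<subseteq> P"
    and u: "\<And>i. i \<in> P \<Longrightarrow> i \<in> set xs \<longleftrightarrow> \<tau> i < u" "u \<le> t"
  shows "fold (annihilation_step D) (map line_edge xs) (\<lambda>_. 1) v = of_bool (R v u \<and> L v u)"
  using xs u
proof (induction xs arbitrary: v u rule: rev_induct)
  case Nil
  have "\<not> \<tau> i < u" if "i \<in> P" for i using Nil.prems(4)[OF that] by simp
  then have "R v u" "L v u" using R[OF Nil.prems(5), of v] L[OF Nil.prems(5), of v] by blast+
  then show ?case by simp
next
  case (snoc a xs)
  let ?x = "fold (annihilation_step D) (map line_edge xs) (\<lambda>_. 1 :: real)"
  have a: "a \<in> P" "a \<notin> set xs" "\<tau> a < u" using snoc.prems by auto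
  have lt: "\<tau> w < \<tau> a" if "w \<in> set xs" for w
  proof -
    have "\<tau> w \<le> \<tau> a" using snoc.prems(2) that by (auto simp: sorted_append)
    moreover have "\<tau> w \<noteq> \<tau> a" using inj_onD[OF inj, of w a] that snoc.prems(3) a by auto
    ultimately show ?thesis by simp
  qed
  have before: "i \<in> set xs \<longleftrightarrow> \<tau> i < \<tau> a" if "i \<in> P" for i
  proof
    assume "\<tau> i < \<tau> a"
    then have "\<tau> i < u" "i \<noteq> a" using a by auto
    then show "i \<in> set xs" using snoc.prems(4)[OF that] by auto
  qed (rule lt)
  have IH: "?x v = of_bool (R v (\<tau> a) \<and> L v (\<tau> a))" for v
    by (rule snoc.IH) (use snoc.prems before le[OF a(1)] in \<open>auto simp: sorted_append\<close>)
  have same: "\<tau> i < u \<longleftrightarrow> \<tau> i < \<tau> a" if "i \<in> P" "i \<noteq> a" for i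
    using snoc.prems(4)[OF that(1)] before[OF that(1)] that(2) by auto
  have R': "R v u \<longleftrightarrow> R v (\<tau> a)" if "v \<noteq> a" for v
    using R[OF snoc.prems(5), of v] R[OF le[OF a(1)], of v] same[of v] that by blast
  have L': "L v u \<longleftrightarrow> L v (\<tau> a)" if "v \<noteq> a + 1" for v
    using L[OF snoc.prems(5), of v] L[OF le[OF a(1)], of v] same[of "v - 1"] that by (auto simp: eq_diff_eq)
  have Ra: "R a (\<tau> a)" "R a u \<longleftrightarrow> \<not> (b a \<and> R (a + 1) (\<tau> a))"
    using R[OF le[OF a(1)], of a] R[OF snoc.prems(5), of a] a by auto
  have La: "L (a + 1) (\<tau> a)" "L (a + 1) u \<longleftrightarrow> \<not> (\<not> b a \<and> L a (\<tau> a))"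
    using L[OF le[OF a(1)], of "a + 1"] L[OF snoc.prems(5), of "a + 1"] a by auto
  have alive: "(\<forall>u\<in>line_edge a. ?x u = 1) \<longleftrightarrow> L a (\<tau> a) \<and> R (a + 1) (\<tau> a)"
    using Ra La by (auto simp: line_edge_def IH)
  have step: "annihilation_step D (line_edge a) ?x
    = (if L a (\<tau> a) \<and> R (a + 1) (\<tau> a) then ?x((if b a then a else a + 1) := 0) else ?x)"
    unfolding annihilation_step_def[of D _ ?x] by (simp only: alive D)
  consider "v = a" | "v = a + 1" | "v \<noteq> a" "v \<noteq> a + 1" by blast
  then show ?case
    by cases (use Ra La R'[of v] L'[of v] in \<open>auto simp: step IH\<close>)
qed

lemma annihilation_formula:
  fixes \<tau> :: "int set \<Rightarrow> real" and D :: "int set \<Rightarrow> int"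
  defines "y \<equiv> \<lambda>i. (\<tau> (line_edge i), D (line_edge i) = i)"
  assumes W: "finite W" and inj: "inj (\<lambda>i. \<tau> (line_edge i))" and \<tau>: "\<And>i. \<tau> (line_edge i) \<le> 1 \<and> \<tau> (line_edge i) \<noteq> t"
    and t: "t \<le> 1" and D: "\<And>i. D (line_edge i) \<in> line_edge i"
    and right: "\<And>i. i < k \<Longrightarrow> v + int i \<in> W \<and> v + int i + 1 \<in> W"
      "\<not> (v + int k \<in> W \<and> v + int k + 1 \<in> W) \<or> \<not> descending k t (\<lambda>i. left_clock (y (v + int i)))"
    and left: "\<And>i. i < l \<Longrightarrow> v - 1 - int i \<in> W \<and> v - int i \<in> W"
      "\<not> (v - 1 - int l \<in> W \<and> v - int l \<in> W) \<or> \<not> descending l t (\<lambda>i. right_clock (y (v - 1 - int i)))"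
  shows "finite_annihilation int_edges \<tau> D t W v
    = of_bool (unblocked k t (\<lambda>i. left_clock (y (v + int i))) \<and> unblocked l t (\<lambda>i. right_clock (y (v - 1 - int i))))"
proof -
  let ?A = "{i. i \<in> W \<and> i + 1 \<in> W}"
  let ?P = "{i \<in> ?A. \<tau> (line_edge i) \<le> t}"
  have fA: "finite ?A" using W by (rule finite_subset[rotated]) auto
  obtain js where js: "arrivals \<tau> (induced_edges int_edges W) t = map line_edge js" "distinct js"
    "sorted (map (\<lambda>i. \<tau> (line_edge i)) js)" "set js = ?P"
    by (rule edge_arrivals[OF W])
  obtain R where R: "\<And>v u. u \<le> 2 \<Longrightarrow> R v u \<longleftrightarrow> \<not> (v \<in> ?A \<and> left_clock (y v) < u \<and> R (v + 1) (left_clock (y v)))"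
    using chain_recursion_exists[OF fA, of "\<lambda>i. left_clock (y i)"] by blast
  obtain L where L: "\<And>v u. u \<le> 2 \<Longrightarrow> L v u \<longleftrightarrow> \<not> (v \<in> ?A \<and> right_clock (y v) < u \<and> L (v - 1) (right_clock (y v)))"
    using left_chain_recursion_exists[OF fA, of "\<lambda>i. right_clock (y i)"] by blast
  have "fold (annihilation_step D) (map line_edge js) (\<lambda>_. 1) v = of_bool (R v t \<and> (\<lambda>v u. L (v - 1) u) v t)"
  proof (rule annihilation_prefix[where P="{i \<in> ?A. \<tau> (line_edge i) \<le> t}" and \<tau>="\<lambda>i. \<tau> (line_edge i)"
        and b="\<lambda>i. D (line_edge i) = i" and t=t])
    show "inj_on (\<lambda>i. \<tau> (line_edge i)) ?P" by (rule inj_on_subset[OF inj]) simp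
    show "R w u \<longleftrightarrow> \<not> (w \<in> ?P \<and> D (line_edge w) = w \<and> \<tau> (line_edge w) < u \<and> R (w + 1) (\<tau> (line_edge w)))"
      if "u \<le> t" for w u
      using R[of u w] that t by (auto simp: y_def left_clock_def)
    show "L (w - 1) u \<longleftrightarrow> \<not> (w - 1 \<in> ?P \<and> D (line_edge (w - 1)) \<noteq> w - 1 \<and> \<tau> (line_edge (w - 1)) < u
        \<and> L (w - 1 - 1) (\<tau> (line_edge (w - 1))))"
      if "u \<le> t" for w u
      using L[of u "w - 1"] that t by (auto simp: y_def right_clock_def)
    show "D (line_edge i) = (if D (line_edge i) = i then i else i + 1)" for i
      using D[of i] by (auto simp: line_edge_def)
    show "i \<in> set js \<longleftrightarrow> \<tau> (line_edge i) < t" if "i \<in> ?P" for i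
      using that \<tau>[of i] by (auto simp: js(4) less_le)
  qed (use js in auto)
  moreover have "R v t \<longleftrightarrow> unblocked k t (\<lambda>i. left_clock (y (v + int i)))"
    by (rule chain_recursion_eq[OF R]) (use t right in auto)
  moreover have "L (v - 1) t \<longleftrightarrow> unblocked l t (\<lambda>i. right_clock (y (v - 1 - int i)))"
    by (rule left_chain_recursion_eq[OF L]) (use t left in \<open>auto simp: algebra_simps\<close>)
  ultimately show ?thesis unfolding finite_annihilation_def js(1) by simp
qed

section \<open>Infinite volume and measurability\<close>

lemma exhausting_UNIV_I:
  assumes "\<And>n. finite (Ws n)" "\<And>i. \<exists>n. \<forall>m\<ge>n. i \<in> Ws m"
  shows "exhausting Ws UNIV"
proof -
  have "i \<in> (\<Union>n. \<Inter>m\<in>{n..}. Ws m)" for i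
  proof -
    obtain n where "\<forall>m\<ge>n. i \<in> Ws m" using assms(2) by blast
    then show ?thesis by (intro UN_I[of n] INT_I) auto
  qed
  then show ?thesis using assms(1) by (auto simp: exhausting_def simp del: UN_iff INT_iff)
qed

text \<open>
  An exhausting sequence eventually contains every finite set.
\<close>

lemma extend_to_infinite_eqI:
  fixes X :: "int set \<Rightarrow> int \<Rightarrow> real"
  assumes "\<And>W. finite W \<Longrightarrow> {- int k..int k} \<subseteq> W \<Longrightarrow> X W v = x"
  shows "extend_to_infinite X UNIV v = x"
proof -
  have lim: "(\<lambda>n. X (Ws n) v) \<longlonglongrightarrow> x" if Ws: "exhausting Ws UNIV" for Ws
  proof -
    have "\<exists>n. \<forall>m\<ge>n. i \<in> Ws m" for i
      using Ws unfolding exhausting_def by (metis (no_types, lifting) INT_E UNIV_I UN_E atLeast_iff)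
    then obtain N where N: "\<And>i m. N i \<le> m \<Longrightarrow> i \<in> Ws m" by metis
    define K where "K = Max (N ` {- int k..int k})"
    have "{- int k..int k} \<subseteq> Ws m" if "K \<le> m" for m
    proof
      fix i assume i: "i \<in> {- int k..int k}"
      then have "N i \<le> K" unfolding K_def by (intro Max_ge) auto
      then show "i \<in> Ws m" using that by (intro N) simp
    qed
    moreover have "finite (Ws m)" for m using Ws by (simp add: exhausting_def)
    ultimately have "\<forall>\<^sub>F m in sequentially. X (Ws m) v = x"
      unfolding eventually_sequentially by (intro exI[of _ K] allI impI assms)
    then show ?thesis by (rule tendsto_eventually)
  qed
  have "exhausting (\<lambda>n. {- int n..int n}) UNIV"
  proof -
    have "\<exists>n. \<forall>m\<ge>n. - int m \<le> i \<and> i \<le> int m" for i :: int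
      by (rule exI[of _ "nat \<bar>i\<bar>"]) auto
    then show ?thesis by (intro exhausting_UNIV_I) auto
  qed
  then have "(THE x. \<forall>Ws. exhausting Ws UNIV \<longrightarrow> (\<lambda>n. X (Ws n) v) \<longlonglongrightarrow> x) = x"
    using lim by (intro the_equality) (auto intro: LIMSEQ_unique)
  then show ?thesis by (simp add: extend_to_infinite_def)
qed

text \<open>
  A sequence of zeros and ones converges only if it is eventually constant, so convergence along
  all exhausting sequences means that the value is constant on all large finite sets: otherwise
  one could choose exhausting sequences with both values. Only countably many sets enter this
  condition, so it is measurable.
\<close>

lemma extend_to_infinite_01:
  fixes X :: "int set \<Rightarrow> int \<Rightarrow> real"
  assumes X: "\<And>W. finite W \<Longrightarrow> X W v = 0 \<or> X W v = 1"
  shows "extend_to_infinite X UNIV v =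
    (if \<exists>k. \<forall>W\<in>Collect finite. {- int k..int k} \<subseteq> W \<longrightarrow> X W v = 1 then 1
     else if \<exists>k. \<forall>W\<in>Collect finite. {- int k..int k} \<subseteq> W \<longrightarrow> X W v = 0 then 0 else (THE x. False))"
proof -
  consider (1) k where "\<forall>W\<in>Collect finite. {- int k..int k} \<subseteq> W \<longrightarrow> X W v = 1"
    | (0) k where "\<forall>W\<in>Collect finite. {- int k..int k} \<subseteq> W \<longrightarrow> X W v = 0"
      "\<not> (\<exists>k. \<forall>W\<in>Collect finite. {- int k..int k} \<subseteq> W \<longrightarrow> X W v = 1)"
    | (none) "\<not> (\<exists>k. \<forall>W\<in>Collect finite. {- int k..int k} \<subseteq> W \<longrightarrow> X W v = 1)"
      "\<not> (\<exists>k. \<forall>W\<in>Collect finite. {- int k..int k} \<subseteq> W \<longrightarrow> X W v = 0)" by blast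
  then show ?thesis
  proof cases
    case 1
    then have c: "\<exists>k. \<forall>W\<in>Collect finite. {- int k..int k} \<subseteq> W \<longrightarrow> X W v = 1" by blast
    have "extend_to_infinite X UNIV v = 1" by (rule extend_to_infinite_eqI[of k]) (use 1 in blast)
    then show ?thesis unfolding if_P[OF c] .
  next
    case 0
    then have c: "\<exists>k. \<forall>W\<in>Collect finite. {- int k..int k} \<subseteq> W \<longrightarrow> X W v = 0" by blast
    have "extend_to_infinite X UNIV v = 0" by (rule extend_to_infinite_eqI[of k]) (use 0 in blast)
    then show ?thesis unfolding if_not_P[OF 0(2)] if_P[OF c] .
  next
    case none
    have exh: "exhausting Ws UNIV" if "\<And>n. finite (Ws n)" "\<And>n. {- int n..int n} \<subseteq> Ws n" for Ws :: "nat \<Rightarrow> int set"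
    proof -
      have "\<exists>n. \<forall>m\<ge>n. i \<in> Ws m" for i :: int
      proof (intro exI[of _ "nat \<bar>i\<bar>"] allI impI)
        fix m assume "nat \<bar>i\<bar> \<le> m"
        then have "i \<in> {- int m..int m}" by auto
        then show "i \<in> Ws m" using that(2) by blast
      qed
      then show ?thesis using that(1) by (intro exhausting_UNIV_I)
    qed
    have no: "\<not> (\<forall>Ws. exhausting Ws UNIV \<longrightarrow> (\<lambda>n. X (Ws n) v) \<longlonglongrightarrow> x)" for x
    proof
      assume lim: "\<forall>Ws. exhausting Ws UNIV \<longrightarrow> (\<lambda>n. X (Ws n) v) \<longlonglongrightarrow> x"
      have "\<forall>k. \<exists>W. finite W \<and> {- int k..int k} \<subseteq> W \<and> X W v = 0"
      proof
        fix k
        obtain W where "finite W" "{- int k..int k} \<subseteq> W" "X W v \<noteq> 1" using none(1) by blast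
        then show "\<exists>W. finite W \<and> {- int k..int k} \<subseteq> W \<and> X W v = 0" using X[of W] by blast
      qed
      then obtain W0 where W0: "\<And>k. finite (W0 k)" "\<And>k. {- int k..int k} \<subseteq> W0 k" "\<And>k. X (W0 k) v = 0" by metis
      have "\<forall>k. \<exists>W. finite W \<and> {- int k..int k} \<subseteq> W \<and> X W v = 1"
      proof
        fix k
        obtain W where "finite W" "{- int k..int k} \<subseteq> W" "X W v \<noteq> 0" using none(2) by blast
        then show "\<exists>W. finite W \<and> {- int k..int k} \<subseteq> W \<and> X W v = 1" using X[of W] by blast
      qed
      then obtain W1 where W1: "\<And>k. finite (W1 k)" "\<And>k. {- int k..int k} \<subseteq> W1 k" "\<And>k. X (W1 k) v = 1" by metis
      have "(\<lambda>n. X (W0 n) v) \<longlonglongrightarrow> x" "(\<lambda>n. X (W1 n) v) \<longlonglongrightarrow> x" using lim exh W0 W1 by blast+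
      then have "(\<lambda>n. 0 :: real) \<longlonglongrightarrow> x" "(\<lambda>n. 1 :: real) \<longlonglongrightarrow> x" by (simp_all add: W0 W1)
      then have "x = 0" "x = 1" by (auto simp: LIMSEQ_const_iff)
      then show False by simp
    qed
    have "extend_to_infinite X UNIV v = (THE x. False)"
      unfolding extend_to_infinite_def by (simp only: no infinite_UNIV_int if_False)
    then show ?thesis unfolding if_not_P[OF none(1)] if_not_P[OF none(2)] .
  qed
qed

lemma measurable_extend_to_infinite:
  fixes X :: "'a \<Rightarrow> int set \<Rightarrow> int \<Rightarrow> real"
  assumes X: "\<And>\<omega> W. finite W \<Longrightarrow> X \<omega> W v = 0 \<or> X \<omega> W v = 1"
    and m: "\<And>W. finite W \<Longrightarrow> (\<lambda>\<omega>. X \<omega> W v) \<in> borel_measurable M"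
  shows "(\<lambda>\<omega>. extend_to_infinite (X \<omega>) UNIV v) \<in> borel_measurable M"
proof -
  let ?w = "from_nat_into (Collect finite) :: nat \<Rightarrow> int set"
  have fin: "finite (?w i)" for i
    using from_nat_into[of "Collect finite :: int set set" i] by blast
  have [measurable]: "(\<lambda>\<omega>. X \<omega> (?w i) v) \<in> borel_measurable M" for i by (rule m[OF fin])
  have "(\<forall>W\<in>Collect finite. R W) \<longleftrightarrow> (\<forall>i. R (?w i))" for R
    using range_from_nat_into[of "Collect finite :: int set set"] countable_Collect_finite[where 'a=int]
    by (metis (no_types, lifting) empty_Collect_eq finite.emptyI fin mem_Collect_eq rangeE)
  then have "(\<lambda>\<omega>. \<forall>W\<in>Collect finite. {- int k..int k} \<subseteq> W \<longrightarrow> X \<omega> W v = c)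
    = (\<lambda>\<omega>. \<forall>i. {- int k..int k} \<subseteq> ?w i \<longrightarrow> X \<omega> (?w i) v = c)" for k and c :: real
    by simp
  then have [measurable]: "Measurable.pred M (\<lambda>\<omega>. \<forall>W\<in>Collect finite. {- int k..int k} \<subseteq> W \<longrightarrow> X \<omega> W v = c)" for k and c :: real
    by simp
  have eq: "extend_to_infinite (X \<omega>) UNIV v =
    (if \<exists>k. \<forall>W\<in>Collect finite. {- int k..int k} \<subseteq> W \<longrightarrow> X \<omega> W v = 1 then 1
     else if \<exists>k. \<forall>W\<in>Collect finite. {- int k..int k} \<subseteq> W \<longrightarrow> X \<omega> W v = 0 then 0 else (THE x. False))" for \<omega>
    by (rule extend_to_infinite_01) (rule X)
  show ?thesis unfolding eq by measurable
qed

text \<open>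
  The order of arrival is chosen among the finitely many distinct lists over \<open>I\<close>, and
  the choice depends only on the set \<open>A\<close> of those that are admissible.
\<close>

lemma measurable_arrivals:
  fixes \<tau> :: "'i \<Rightarrow> 'a \<Rightarrow> real" and h :: "'i list \<Rightarrow> 'a \<Rightarrow> real"
  assumes I: "finite I" and \<tau>: "\<And>i. i \<in> I \<Longrightarrow> \<tau> i \<in> borel_measurable M"
    and h: "\<And>xs. set xs \<subseteq> I \<Longrightarrow> h xs \<in> borel_measurable M"
  shows "(\<lambda>\<omega>. h (arrivals (\<lambda>i. \<tau> i \<omega>) I t) \<omega>) \<in> borel_measurable M"
proof -
  define L where "L = {xs. set xs \<subseteq> I \<and> distinct xs}"
  have L: "finite L" unfolding L_def using finite_subset_distinct[OF I] .
  define P where "P xs \<omega> \<longleftrightarrow> distinct xs \<and> set xs = {i \<in> I. \<tau> i \<omega> \<le> t} \<and> sorted (map (\<lambda>i. \<tau> i \<omega>) xs)" for xs \<omega>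
  define A where "A \<omega> = {xs \<in> L. P xs \<omega>}" for \<omega>
  have arr: "arrivals (\<lambda>i. \<tau> i \<omega>) I t = (SOME xs. xs \<in> A \<omega>)" for \<omega>
    unfolding arrivals_def by (rule arg_cong[where f=Eps]) (auto simp: A_def P_def L_def)
  have mP: "Measurable.pred M (P xs)" if "xs \<in> L" for xs
  proof -
    have sub: "set xs \<subseteq> I" "distinct xs" using that by (auto simp: L_def)
    have "Measurable.pred M (\<lambda>\<omega>. sorted (map (\<lambda>i. \<tau> i \<omega>) ys))" if "set ys \<subseteq> I" for ys
      using that
    proof (induction ys)
      case (Cons y ys)
      then have [measurable]: "Measurable.pred M (\<lambda>\<omega>. sorted (map (\<lambda>i. \<tau> i \<omega>) ys))" "\<tau> y \<in> borel_measurable M"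
        using \<tau> by auto
      have "Measurable.pred M (\<lambda>\<omega>. \<forall>z\<in>set ys. \<tau> y \<omega> \<le> \<tau> z \<omega>)"
      proof (rule pred_intros_finite(3))
        fix z assume "z \<in> set ys"
        then have [measurable]: "\<tau> z \<in> borel_measurable M" using Cons.prems by (auto intro: \<tau>)
        show "Measurable.pred M (\<lambda>\<omega>. \<tau> y \<omega> \<le> \<tau> z \<omega>)" by measurable
      qed simp
      then show ?case by simp
    qed simp
    note [measurable] = this[OF sub(1)]
    have [measurable]: "Measurable.pred M (\<lambda>\<omega>. \<forall>i\<in>I. i \<in> set xs \<longleftrightarrow> \<tau> i \<omega> \<le> t)"
    proof (rule pred_intros_finite(3))
      fix i assume "i \<in> I"
      then have [measurable]: "\<tau> i \<in> borel_measurable M" by (rule \<tau>)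
      show "Measurable.pred M (\<lambda>\<omega>. i \<in> set xs \<longleftrightarrow> \<tau> i \<omega> \<le> t)" by measurable
    qed (rule I)
    have "P xs = (\<lambda>\<omega>. (\<forall>i\<in>I. i \<in> set xs \<longleftrightarrow> \<tau> i \<omega> \<le> t) \<and> sorted (map (\<lambda>i. \<tau> i \<omega>) xs))"
      using sub by (auto simp: P_def fun_eq_iff)
    then show ?thesis by simp
  qed
  have mA: "Measurable.pred M (\<lambda>\<omega>. A \<omega> = B)" if "B \<in> Pow L" for B
  proof -
    have "Measurable.pred M (\<lambda>\<omega>. \<forall>xs\<in>L. P xs \<omega> \<longleftrightarrow> xs \<in> B)"
    proof (rule pred_intros_finite(3))
      fix xs assume "xs \<in> L"
      note [measurable] = mP[OF this]
      show "Measurable.pred M (\<lambda>\<omega>. P xs \<omega> \<longleftrightarrow> xs \<in> B)" by measurable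
    qed (rule L)
    moreover have "(\<lambda>\<omega>. A \<omega> = B) = (\<lambda>\<omega>. \<forall>xs\<in>L. P xs \<omega> \<longleftrightarrow> xs \<in> B)"
      using that by (auto simp: A_def fun_eq_iff)
    ultimately show ?thesis by simp
  qed
  have "h (arrivals (\<lambda>i. \<tau> i \<omega>) I t) \<omega> = (\<Sum>B\<in>Pow L. of_bool (A \<omega> = B \<and> B \<noteq> {}) * h (SOME xs. xs \<in> B) \<omega>)" for \<omega>
  proof -
    have ne: "A \<omega> \<noteq> {}"
      using arrivals_props[OF I, of "\<lambda>i. \<tau> i \<omega>" t] unfolding A_def P_def L_def by blast
    have "(\<Sum>B\<in>Pow L. of_bool (A \<omega> = B \<and> B \<noteq> {}) * h (SOME xs. xs \<in> B) \<omega>)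
      = (\<Sum>B\<in>{A \<omega>}. of_bool (A \<omega> = B \<and> B \<noteq> {}) * h (SOME xs. xs \<in> B) \<omega>)"
      using L by (intro sum.mono_neutral_right) (auto simp: A_def)
    then show ?thesis using ne by (simp add: arr)
  qed
  moreover have "(\<lambda>\<omega>. \<Sum>B\<in>Pow L. of_bool (A \<omega> = B \<and> B \<noteq> {}) * h (SOME xs. xs \<in> B) \<omega>) \<in> borel_measurable M"
  proof (rule borel_measurable_sum)
    fix B assume B: "B \<in> Pow L"
    note [measurable] = mA[OF B]
    show "(\<lambda>\<omega>. of_bool (A \<omega> = B \<and> B \<noteq> {}) * h (SOME xs. xs \<in> B) \<omega>) \<in> borel_measurable M"
    proof (cases "B = {}")
      case False
      then have "(SOME xs. xs \<in> B) \<in> B" by (metis all_not_in_conv someI_ex)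
      then have [measurable]: "h (SOME xs. xs \<in> B) \<in> borel_measurable M" using B h by (auto simp: L_def)
      show ?thesis by measurable
    qed simp
  qed
  ultimately show ?thesis by simp
qed

lemma finite_induced_edges: "finite W \<Longrightarrow> finite (induced_edges int_edges W)"
  unfolding induced_line_edges by (intro finite_imageI) (rule finite_subset[of _ W]; auto)

lemma measurable_finite_blocking:
  assumes "finite W" "\<And>i. i \<in> W \<Longrightarrow> \<tau> i \<in> borel_measurable M"
  shows "(\<lambda>\<omega>. finite_blocking E (\<lambda>i. \<tau> i \<omega>) t W v) \<in> borel_measurable M"
  unfolding finite_blocking_def
  by (rule measurable_arrivals[where h="\<lambda>xs \<omega>. fold (blocking_step (induced_edges E W)) xs (\<lambda>_. 0) v"]) (use assms in auto)

lemma measurable_finite_dimer: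
  assumes "finite W" "\<And>e. e \<in> int_edges \<Longrightarrow> \<tau> e \<in> borel_measurable M"
  shows "(\<lambda>\<omega>. finite_dimer int_edges (\<lambda>e. \<tau> e \<omega>) t W v) \<in> borel_measurable M"
  unfolding finite_dimer_def
  by (rule measurable_arrivals[where h="\<lambda>xs \<omega>. fold dimer_step xs (\<lambda>_. 0) v"])
    (use assms finite_induced_edges in \<open>auto simp: induced_edges_def\<close>)

lemma measurable_finite_annihilation:
  assumes W: "finite W" and \<tau>: "\<And>e. e \<in> int_edges \<Longrightarrow> \<tau> e \<in> borel_measurable M"
    and D: "\<And>e. e \<in> int_edges \<Longrightarrow> D e \<in> M \<rightarrow>\<^sub>M count_space UNIV"
  shows "(\<lambda>\<omega>. finite_annihilation int_edges (\<lambda>e. \<tau> e \<omega>) (\<lambda>e. D e \<omega>) t W v) \<in> borel_measurable M"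
  unfolding finite_annihilation_def
proof (rule measurable_arrivals[where h="\<lambda>xs \<omega>. fold (annihilation_step (\<lambda>e. D e \<omega>)) xs (\<lambda>_. 1) v"])
  fix xs assume "set xs \<subseteq> induced_edges int_edges W"
  then have "set xs \<subseteq> int_edges" by (auto simp: induced_edges_def)
  then show "(\<lambda>\<omega>. fold (annihilation_step (\<lambda>e. D e \<omega>)) xs (\<lambda>_. 1) v) \<in> borel_measurable M"
  proof (induction xs arbitrary: v rule: rev_induct)
    case (snoc e xs)
    let ?x = "\<lambda>\<omega>. fold (annihilation_step (\<lambda>e. D e \<omega>)) xs (\<lambda>_. 1 :: real)"
    have [measurable]: "(\<lambda>\<omega>. ?x \<omega> u) \<in> borel_measurable M" for u using snoc by auto
    have [measurable]: "D e \<in> M \<rightarrow>\<^sub>M count_space UNIV" using snoc.prems by (intro D) auto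
    have [measurable]: "Measurable.pred M (\<lambda>\<omega>. \<forall>u\<in>e. ?x \<omega> u = 1)"
      by (rule pred_intros_countable_bounded(3)) (auto intro: countableI_type)
    have "fold (annihilation_step (\<lambda>e. D e \<omega>)) (xs @ [e]) (\<lambda>_. 1) v
      = (if (\<forall>u\<in>e. ?x \<omega> u = 1) \<and> D e \<omega> = v then 0 else ?x \<omega> v)" for \<omega>
      by (auto simp: annihilation_step_def[of _ e])
    then show ?case by simp
  qed simp
qed (use finite_induced_edges[OF W] \<tau> in \<open>auto simp: induced_edges_def\<close>)

lemma finite_dimer_cases: "finite_dimer E \<tau> t W v = 0 \<or> finite_dimer E \<tau> t W v = 1"
proof -
  have "fold dimer_step xs (\<lambda>_. 0) v = 0 \<or> fold dimer_step xs (\<lambda>_. 0) v = 1" for xs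
    by (induction xs rule: rev_induct) (auto simp: dimer_step_def)
  then show ?thesis by (simp add: finite_dimer_def)
qed

lemma finite_annihilation_cases: "finite_annihilation E \<tau> D t W v = 0 \<or> finite_annihilation E \<tau> D t W v = 1"
proof -
  have "fold (annihilation_step D) xs (\<lambda>_. 1) v = 0 \<or> fold (annihilation_step D) xs (\<lambda>_. 1) v = 1" for xs
    by (induction xs rule: rev_induct) (auto simp: annihilation_step_def)
  then show ?thesis by (simp add: finite_annihilation_def)
qed

section \<open>Regrouping chains into intervals; boundary effects\<close>

text \<open>
  The pair \<open>(s, m)\<close> stands for the interval of the vertices from \<open>s\<close> to
  \<open>s + m\<close>, with \<open>m\<close> edges.
\<close>

definition vertex_intervals :: "nat \<Rightarrow> (int \<times> nat) set" where
  "vertex_intervals n = {(s, m). 1 \<le> s \<and> s + int m \<le> int n}"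

lemma finite_vertex_intervals [simp]: "finite (vertex_intervals n)"
proof (rule finite_subset)
  show "vertex_intervals n \<subseteq> {1..int n} \<times> {0..n}" by (auto simp: vertex_intervals_def)
qed simp

text \<open>
  A site \<open>v\<close> with chains of lengths \<open>a\<close> to the right and
  \<open>b\<close> to the left spans the interval from \<open>v - b\<close> to \<open>v +
  a\<close>; conversely \<open>v\<close> is a point of this interval.
\<close>

lemma sum_chains_eq_sum_intervals:
  fixes f :: "int \<Rightarrow> nat \<Rightarrow> nat \<Rightarrow> real"
  shows "(\<Sum>v\<in>segment n. \<Sum>a\<le>nat (int n - v). \<Sum>b\<le>nat (v - 1). f v a b)
    = (\<Sum>p\<in>vertex_intervals n. \<Sum>j\<le>snd p. f (fst p + int j) (snd p - j) j)"
proof -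
  have "(\<Sum>v\<in>segment n. \<Sum>a\<le>nat (int n - v). \<Sum>b\<le>nat (v - 1). f v a b)
    = (\<Sum>(v, a, b)\<in>(SIGMA v:segment n. {..nat (int n - v)} \<times> {..nat (v - 1)}). f v a b)"
    by (subst sum.Sigma[symmetric]) (auto simp: sum.cartesian_product segment_def)
  also have "\<dots> = (\<Sum>(p, j)\<in>(SIGMA p:vertex_intervals n. {..snd p}). f (fst p + int j) (snd p - j) j)"
    by (rule sum.reindex_bij_witness[where i="\<lambda>(p, j). (fst p + int j, snd p - j, j)"
          and j="\<lambda>(v, a, b). ((v - int b, a + b), b)"])
      (auto simp: vertex_intervals_def segment_def)
  also have "\<dots> = (\<Sum>p\<in>vertex_intervals n. \<Sum>j\<le>snd p. f (fst p + int j) (snd p - j) j)"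
    by (subst sum.Sigma[symmetric]) auto
  finally show ?thesis .
qed

text \<open>
  The event \<open>E k \<and> E l\<close> is at most as likely as the rarer one of the two events.
\<close>

lemma (in prob_space) square_sum_events_le:
  assumes [measurable]: "\<And>k. Measurable.pred M (E k)"
    and p: "\<And>k. k < n \<Longrightarrow> prob {\<omega> \<in> space M. E k \<omega>} \<le> C / 16 ^ k"
    and C: "0 \<le> C"
  shows "expectation (\<lambda>\<omega>. (\<Sum>k<n. of_bool (E k \<omega>))\<^sup>2) \<le> 2 * C"
proof -
  have "expectation (\<lambda>\<omega>. (\<Sum>k<n. of_bool (E k \<omega>))\<^sup>2) = expectation (\<lambda>\<omega>. \<Sum>k<n. \<Sum>l<n. of_bool (E k \<omega> \<and> E l \<omega>) :: real)"
    by (simp only: power2_eq_square sum_product of_bool_conj)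
  also have "\<dots> = (\<Sum>k<n. \<Sum>l<n. expectation (\<lambda>\<omega>. of_bool (E k \<omega> \<and> E l \<omega>)))"
  proof -
    have "integrable M (\<lambda>\<omega>. of_bool (E k \<omega> \<and> E l \<omega>) :: real)" for k l
      by (rule integrable_const_bound[of _ 1]) auto
    then show ?thesis by (simp only: Bochner_Integration.integral_sum Bochner_Integration.integrable_sum)
  qed
  also have "\<dots> \<le> (\<Sum>k<n. \<Sum>l<n. C / 4 ^ (k + l))"
  proof (intro sum_mono)
    fix k l assume kl: "k \<in> {..<n}" "l \<in> {..<n}"
    have one: "expectation (\<lambda>\<omega>. of_bool (E k \<omega> \<and> E l \<omega>)) \<le> C / 16 ^ i" if "i = k \<or> i = l" for i
    proof -
      have "expectation (\<lambda>\<omega>. of_bool (E k \<omega> \<and> E l \<omega>)) = prob {\<omega> \<in> space M. E k \<omega> \<and> E l \<omega>}"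
        by (rule expectation_of_bool)
      also have "\<dots> \<le> prob {\<omega> \<in> space M. E i \<omega>}" using that by (intro finite_measure_mono) auto
      also have "\<dots> \<le> C / 16 ^ i" using that kl by (intro p) auto
      finally show ?thesis .
    qed
    have "expectation (\<lambda>\<omega>. of_bool (E k \<omega> \<and> E l \<omega>)) \<le> C / 16 ^ max k l"
      by (rule one) (auto simp: max_def)
    also have "\<dots> \<le> C / 4 ^ (k + l)"
    proof (rule divide_left_mono)
      have "(4::real) ^ (k + l) \<le> 4 ^ (2 * max k l)" by (rule power_increasing) auto
      then show "(4::real) ^ (k + l) \<le> 16 ^ max k l" by (simp add: power_mult)
    qed (use C in auto)
    finally show "expectation (\<lambda>\<omega>. of_bool (E k \<omega> \<and> E l \<omega>)) \<le> C / 4 ^ (k + l)" .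
  qed
  also have "\<dots> = C * ((\<Sum>k<n. 1 / 4 ^ k) * (\<Sum>l<n. 1 / 4 ^ l))"
    unfolding sum_product unfolding sum_distrib_left by (intro sum.cong refl) (simp add: power_add)
  also have "\<dots> \<le> C * (4 / 3 * (4 / 3))"
  proof -
    have "(\<Sum>k<n. 1 / 4 ^ k) = (4 / 3) * (1 - 1 / (4::real) ^ n)"
    proof (induction n)
      case (Suc n)
      show ?case unfolding sum.lessThan_Suc Suc.IH by (simp add: field_simps)
    qed simp
    then have "(\<Sum>k<n. 1 / 4 ^ k) \<le> (4 / 3 :: real)" by simp
    then show ?thesis using C by (intro mult_left_mono mult_mono) (auto intro: sum_nonneg)
  qed
  also have "\<dots> \<le> 2 * C" using C by simp
  finally show ?thesis .
qed

text \<open>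
  The events \<open>E k\<close> and \<open>F k\<close> will say that the chain from the site at
  distance \<open>k\<close> from the right or left end of the segment reaches this end. The error
  \<open>D\<close> is at most the number of sites for which this happens.
\<close>

lemma (in prob_space) boundary_square_le:
  fixes D :: "'a \<Rightarrow> real"
  assumes [measurable]: "\<And>k. Measurable.pred M (E k)" "\<And>k. Measurable.pred M (F k)"
    and p: "\<And>k. k < n \<Longrightarrow> prob {\<omega> \<in> space M. E k \<omega>} \<le> C / 16 ^ k" "\<And>k. k < n \<Longrightarrow> prob {\<omega> \<in> space M. F k \<omega>} \<le> C / 16 ^ k"
    and C: "0 \<le> C" and D: "AE \<omega> in M. \<bar>D \<omega>\<bar> \<le> (\<Sum>k<n. of_bool (E k \<omega>)) + (\<Sum>k<n. of_bool (F k \<omega>))"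
    and [measurable]: "D \<in> borel_measurable M"
  shows "expectation (\<lambda>\<omega>. (D \<omega>)\<^sup>2) \<le> 8 * C"
proof -
  let ?G = "\<lambda>\<omega>. \<Sum>k<n. of_bool (E k \<omega>) :: real" and ?H = "\<lambda>\<omega>. \<Sum>k<n. of_bool (F k \<omega>) :: real"
  have bd: "0 \<le> (\<Sum>k<n. of_bool (A k) :: real)" "(\<Sum>k<n. of_bool (A k) :: real) \<le> real n" for A
    using sum_bounded_above[of "{..<n}" "\<lambda>k. of_bool (A k) :: real" 1] by (auto intro: sum_nonneg)
  have iG: "integrable M (\<lambda>\<omega>. (?G \<omega>)\<^sup>2)" and iH: "integrable M (\<lambda>\<omega>. (?H \<omega>)\<^sup>2)"
  proof -
    have "integrable M (\<lambda>\<omega>. (\<Sum>k<n. of_bool (A k \<omega>) :: real)\<^sup>2)" if [measurable]: "\<And>k. Measurable.pred M (A k)" for A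
    proof (rule integrable_const_bound)
      show "AE \<omega> in M. norm ((\<Sum>k<n. of_bool (A k \<omega>) :: real)\<^sup>2) \<le> (real n)\<^sup>2"
      proof (intro always_eventually allI)
        fix \<omega>
        have "(\<Sum>k<n. of_bool (A k \<omega>) :: real)\<^sup>2 \<le> (real n)\<^sup>2" by (intro power_mono bd)
        then show "norm ((\<Sum>k<n. of_bool (A k \<omega>) :: real)\<^sup>2) \<le> (real n)\<^sup>2"
          by (simp only: real_norm_def abs_power2)
      qed
    qed (intro borel_measurable_power borel_measurable_sum, measurable)
    from this[of E] this[of F] assms(1,2)
    show "integrable M (\<lambda>\<omega>. (?G \<omega>)\<^sup>2)" "integrable M (\<lambda>\<omega>. (?H \<omega>)\<^sup>2)" by blast+
  qed
  have "expectation (\<lambda>\<omega>. (D \<omega>)\<^sup>2) \<le> expectation (\<lambda>\<omega>. 2 * (?G \<omega>)\<^sup>2 + 2 * (?H \<omega>)\<^sup>2)"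
  proof (rule integral_mono_AE')
    show "integrable M (\<lambda>\<omega>. 2 * (?G \<omega>)\<^sup>2 + 2 * (?H \<omega>)\<^sup>2)" using iG iH by simp
    show "AE \<omega> in M. (D \<omega>)\<^sup>2 \<le> 2 * (?G \<omega>)\<^sup>2 + 2 * (?H \<omega>)\<^sup>2"
      using D
    proof eventually_elim
      case (elim \<omega>)
      then have "\<bar>D \<omega>\<bar>\<^sup>2 \<le> (?G \<omega> + ?H \<omega>)\<^sup>2" by (intro power_mono) auto
      also have "\<dots> \<le> 2 * (?G \<omega>)\<^sup>2 + 2 * (?H \<omega>)\<^sup>2"
        using sum_squares_bound[of "?G \<omega>" "?H \<omega>"] by (simp add: power2_sum)
      finally show ?case by simp
    qed
  qed simp
  also have "\<dots> = 2 * expectation (\<lambda>\<omega>. (?G \<omega>)\<^sup>2) + 2 * expectation (\<lambda>\<omega>. (?H \<omega>)\<^sup>2)" using iG iH by simp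
  also have "\<dots> \<le> 2 * (2 * C) + 2 * (2 * C)"
    using p C by (intro add_mono mult_left_mono square_sum_events_le) auto
  finally show ?thesis by simp
qed

text \<open>
  The state of \<open>v\<close> in \<open>W\<close> no longer depends on \<open>W\<close> once
  \<open>W\<close> contains the stretch from \<open>v - l\<close> to \<open>v + k\<close> and the
  chains from \<open>v\<close> to the right and to the left have stopped within it, that is,
  \<open>R k v\<close> and \<open>L l v\<close> fail. Since long chains are exponentially rare,
  all chains stop almost surely and the state in \<open>\<int>\<close> exists; it differs from the
  state in the segment only at sites whose chains reach the boundary.
\<close>

lemma (in prob_space) infinite_volume_transfer:
  fixes X :: "'a \<Rightarrow> int set \<Rightarrow> int \<Rightarrow> real"
  assumes X: "\<And>\<omega> W v. finite W \<Longrightarrow> X \<omega> W v = 0 \<or> X \<omega> W v = 1"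
    and m: "\<And>W v. finite W \<Longrightarrow> (\<lambda>\<omega>. X \<omega> W v) \<in> borel_measurable M"
    and RL [measurable]: "\<And>k v. Measurable.pred M (R k v)" "\<And>k v. Measurable.pred M (L k v)"
    and pR: "\<And>k v. prob {\<omega> \<in> space M. R k v \<omega>} \<le> C / 16 ^ k"
    and pL: "\<And>k v. prob {\<omega> \<in> space M. L k v \<omega>} \<le> C / 16 ^ k"
    and loc: "AE \<omega> in M. \<forall>v k l. \<not> R k v \<omega> \<longrightarrow> \<not> L l v \<omega> \<longrightarrow>
      (\<exists>x. \<forall>W. finite W \<longrightarrow> {v - int l..v + int k} \<subseteq> W \<longrightarrow> X \<omega> W v = x)"
    and s2: "0 < s2"
    and S: "variance_limit_and_clt M (\<lambda>n \<omega>. \<Sum>v\<in>segment n. X \<omega> (segment n) v) s2"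
  shows "variance_limit_and_clt M (\<lambda>n \<omega>. \<Sum>v\<in>segment n. extend_to_infinite (X \<omega>) UNIV v) s2"
proof -
  let ?y = "\<lambda>v \<omega>. extend_to_infinite (X \<omega>) UNIV v"
  let ?S = "\<lambda>n \<omega>. \<Sum>v\<in>segment n. X \<omega> (segment n) v" and ?T = "\<lambda>n \<omega>. \<Sum>v\<in>segment n. ?y v \<omega>"
  have C: "0 \<le> C" using pR[of 0 0] measure_nonneg[of M] by (metis div_by_1 order.trans power_0)
  have my [measurable]: "?y v \<in> borel_measurable M" for v by (rule measurable_extend_to_infinite[OF X m])
  have mS [measurable]: "?S n \<in> borel_measurable M" for n
    by (intro borel_measurable_sum m) (simp add: segment_def)
  have mT [measurable]: "?T n \<in> borel_measurable M" for n by measurable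
  have stop: "AE \<omega> in M. \<exists>k. \<not> P k \<omega>"
    if [measurable]: "\<And>k. Measurable.pred M (P k)" and p: "\<And>k. prob {\<omega> \<in> space M. P k \<omega>} \<le> C / 16 ^ k"
    for P :: "nat \<Rightarrow> 'a \<Rightarrow> bool"
  proof -
    have "prob {\<omega> \<in> space M. \<forall>k. P k \<omega>} \<le> C * (1 / 16) ^ k" for k
    proof -
      have "prob {\<omega> \<in> space M. \<forall>k. P k \<omega>} \<le> prob {\<omega> \<in> space M. P k \<omega>}" by (intro finite_measure_mono) auto
      also have "\<dots> \<le> C * (1 / 16) ^ k" using p[of k] by (simp add: power_divide)
      finally show ?thesis .
    qed
    moreover have "(\<lambda>k. C * (1 / 16) ^ k) \<longlonglongrightarrow> C * 0" by (intro tendsto_mult_left LIMSEQ_power_zero) simp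
    ultimately have "prob {\<omega> \<in> space M. \<forall>k. P k \<omega>} \<le> C * 0" by (intro LIMSEQ_le_const) auto
    then have "prob {\<omega> \<in> space M. \<forall>k. P k \<omega>} = 0" by (simp add: measure_le_0_iff)
    then have "emeasure M {\<omega> \<in> space M. \<forall>k. P k \<omega>} = 0" by (simp add: emeasure_eq_measure)
    then show ?thesis by (intro AE_I[of _ _ "{\<omega> \<in> space M. \<forall>k. P k \<omega>}"]) auto
  qed
  have "AE \<omega> in M. \<forall>v. (\<exists>k. \<not> R k v \<omega>) \<and> (\<exists>k. \<not> L k v \<omega>)"
    unfolding AE_all_countable AE_conj_iff by (intro allI conjI stop RL pR pL)
  with loc have good: "AE \<omega> in M. \<forall>v. (?y v \<omega> = 0 \<or> ?y v \<omega> = 1) \<and>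
      (\<forall>k l W. \<not> R k v \<omega> \<longrightarrow> \<not> L l v \<omega> \<longrightarrow> finite W \<longrightarrow> {v - int l..v + int k} \<subseteq> W \<longrightarrow> X \<omega> W v = ?y v \<omega>)"
  proof eventually_elim
    case (elim \<omega>)
    show ?case
    proof
      fix v
      have y: "X \<omega> W v = ?y v \<omega>" if "\<not> R k v \<omega>" "\<not> L l v \<omega>" "finite W" "{v - int l..v + int k} \<subseteq> W" for k l W
      proof -
        obtain x where x: "\<And>W. finite W \<Longrightarrow> {v - int l..v + int k} \<subseteq> W \<Longrightarrow> X \<omega> W v = x"
          using elim(1) \<open>\<not> R k v \<omega>\<close> \<open>\<not> L l v \<omega>\<close> by blast
        define K where "K = nat \<bar>v\<bar> + k + l"
        have "?y v \<omega> = x"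
        proof (rule extend_to_infinite_eqI[of K])
          fix W' :: "int set" assume "finite W'" "{- int K..int K} \<subseteq> W'"
          moreover have "{v - int l..v + int k} \<subseteq> {- int K..int K}" by (auto simp: K_def)
          ultimately show "X \<omega> W' v = x" by (intro x) auto
        qed
        then show ?thesis using x[OF that(3,4)] by simp
      qed
      obtain k l where kl: "\<not> R k v \<omega>" "\<not> L l v \<omega>" using elim(2) by blast
      have "?y v \<omega> = 0 \<or> ?y v \<omega> = 1"
        using y[OF kl, of "{v - int l..v + int k}"] X[of "{v - int l..v + int k}" \<omega> v] by simp
      then show "(?y v \<omega> = 0 \<or> ?y v \<omega> = 1) \<and>
        (\<forall>k l W. \<not> R k v \<omega> \<longrightarrow> \<not> L l v \<omega> \<longrightarrow> finite W \<longrightarrow> {v - int l..v + int k} \<subseteq> W \<longrightarrow> X \<omega> W v = ?y v \<omega>)"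
        using y by blast
    qed
  qed
  have count_le: "\<bar>\<Sum>v\<in>segment n. z v\<bar> \<le> real n" if "\<And>v. z v = 0 \<or> z v = (1::real)" for n z
  proof -
    have "\<bar>\<Sum>v\<in>segment n. z v\<bar> \<le> (\<Sum>v\<in>segment n. \<bar>z v\<bar>)" by (rule sum_abs)
    also have "\<dots> \<le> (\<Sum>v\<in>segment n. 1)"
    proof (rule sum_mono)
      fix v show "\<bar>z v\<bar> \<le> 1" using that[of v] by auto
    qed
    finally show ?thesis by (simp add: segment_def)
  qed
  have sqS: "integrable M (\<lambda>\<omega>. (?S n \<omega>)\<^sup>2)" for n
  proof (rule integrable_const_bound[of _ "(real n)\<^sup>2"])
    have fin: "finite (segment n)" by (simp add: segment_def)
    show "AE \<omega> in M. norm ((?S n \<omega>)\<^sup>2) \<le> (real n)\<^sup>2"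
      using power_mono[OF count_le[of "X _ (segment n)", OF X[OF fin]], where n=2] by simp
  qed measurable
  have sqT: "integrable M (\<lambda>\<omega>. (?T n \<omega>)\<^sup>2)" for n
  proof (rule integrable_const_bound[of _ "(real n)\<^sup>2"])
    show "AE \<omega> in M. norm ((?T n \<omega>)\<^sup>2) \<le> (real n)\<^sup>2"
      using good
    proof eventually_elim
      case (elim \<omega>)
      then show ?case using power_mono[OF count_le[of "\<lambda>v. ?y v \<omega>"], where n=2] by simp
    qed
  qed measurable
  have "expectation (\<lambda>\<omega>. (?T n \<omega> - ?S n \<omega>)\<^sup>2) \<le> 8 * C" for n
  proof (rule boundary_square_le[where E="\<lambda>k. R k (int n - int k)" and F="\<lambda>k. L k (int k + 1)" and n=n])
    show "AE \<omega> in M. \<bar>?T n \<omega> - ?S n \<omega>\<bar>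
        \<le> (\<Sum>k<n. of_bool (R k (int n - int k) \<omega>)) + (\<Sum>k<n. of_bool (L k (int k + 1) \<omega>))"
      using good
    proof eventually_elim
      case (elim \<omega>)
      have "\<bar>?T n \<omega> - ?S n \<omega>\<bar> \<le> (\<Sum>v\<in>segment n. \<bar>?y v \<omega> - X \<omega> (segment n) v\<bar>)"
        unfolding sum_subtractf[symmetric] by (rule sum_abs)
      also have "\<dots> \<le> (\<Sum>v\<in>segment n. of_bool (R (nat (int n - v)) v \<omega>) + of_bool (L (nat (v - 1)) v \<omega>))"
      proof (rule sum_mono)
        fix v assume v: "v \<in> segment n"
        have fin: "finite (segment n)" by (simp add: segment_def)
        have sub: "{v - int (nat (v - 1))..v + int (nat (int n - v))} \<subseteq> segment n" using v by (auto simp: segment_def)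
        have y: "?y v \<omega> = 0 \<or> ?y v \<omega> = 1"
          "\<not> R (nat (int n - v)) v \<omega> \<Longrightarrow> \<not> L (nat (v - 1)) v \<omega> \<Longrightarrow> X \<omega> (segment n) v = ?y v \<omega>"
          using elim fin sub by blast+
        have x: "X \<omega> (segment n) v = 0 \<or> X \<omega> (segment n) v = 1" by (rule X[OF fin])
        show "\<bar>?y v \<omega> - X \<omega> (segment n) v\<bar> \<le> of_bool (R (nat (int n - v)) v \<omega>) + of_bool (L (nat (v - 1)) v \<omega>)"
        proof (cases "R (nat (int n - v)) v \<omega> \<or> L (nat (v - 1)) v \<omega>")
          case True
          then have "(1 :: real) \<le> of_bool (R (nat (int n - v)) v \<omega>) + of_bool (L (nat (v - 1)) v \<omega>)" by auto
          moreover have "\<bar>?y v \<omega> - X \<omega> (segment n) v\<bar> \<le> 1" using x y(1) by auto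
          ultimately show ?thesis by linarith
        next
          case False
          then have "X \<omega> (segment n) v = ?y v \<omega>" by (intro y(2)) auto
          then show ?thesis by simp
        qed
      qed
      also have "\<dots> = (\<Sum>v\<in>segment n. of_bool (R (nat (int n - v)) v \<omega>)) + (\<Sum>v\<in>segment n. of_bool (L (nat (v - 1)) v \<omega>))"
        by (rule sum.distrib)
      also have "(\<Sum>v\<in>segment n. of_bool (R (nat (int n - v)) v \<omega>)) = (\<Sum>k<n. of_bool (R k (int n - int k) \<omega>) :: real)"
        by (rule sum.reindex_bij_witness[where i="\<lambda>k. int n - int k" and j="\<lambda>v. nat (int n - v)"])
          (auto simp: segment_def)
      also have "(\<Sum>v\<in>segment n. of_bool (L (nat (v - 1)) v \<omega>)) = (\<Sum>k<n. of_bool (L k (int k + 1) \<omega>) :: real)"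
        by (rule sum.reindex_bij_witness[where i="\<lambda>k. int k + 1" and j="\<lambda>v. nat (v - 1)"])
          (auto simp: segment_def add.commute)
      finally show ?case .
    qed
  qed (use pR pL C in auto)
  then show ?thesis
    by (intro variance_limit_and_clt_transfer[OF prob_space_axioms mS mT sqS sqT _ s2 S])
qed

context uniform_clocks
begin

abbreviation blocking_T :: "nat \<Rightarrow> 'a \<Rightarrow> real" where
  "blocking_T n \<equiv> interval_pattern.altsum Y site_pattern (intervals 1 (int n + 1))"

abbreviation finite_count :: "nat \<Rightarrow> 'a \<Rightarrow> real" where
  "finite_count n \<omega> \<equiv> \<Sum>v\<in>segment n. finite_blocking int_edges (\<lambda>i. Y i \<omega>) t (segment n) v"

abbreviation infinite_state :: "int \<Rightarrow> 'a \<Rightarrow> real" where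
  "infinite_state v \<omega> \<equiv> blocking_rsa int_edges (\<lambda>i. Y i \<omega>) t UNIV v"

abbreviation right_run :: "nat \<Rightarrow> int \<Rightarrow> 'a \<Rightarrow> bool" where
  "right_run k v \<omega> \<equiv> descending k (Y v \<omega>) (\<lambda>i. Y (v + 1 + int i) \<omega>)"

abbreviation left_run :: "nat \<Rightarrow> int \<Rightarrow> 'a \<Rightarrow> bool" where
  "left_run k v \<omega> \<equiv> descending k (Y v \<omega>) (\<lambda>i. Y (v - 1 - int i) \<omega>)"

lemma finite_blocking_formula:
  assumes g: "generic \<omega>" and W: "finite W" and v: "v \<in> W"
    and right: "\<And>i. i < k \<Longrightarrow> v + 1 + int i \<in> W" "v + 1 + int k \<notin> W \<or> \<not> right_run k v \<omega>"
    and left: "\<And>i. i < l \<Longrightarrow> v - 1 - int i \<in> W" "v - 1 - int l \<notin> W \<or> \<not> left_run l v \<omega>"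
  shows "finite_blocking int_edges (\<lambda>i. Y i \<omega>) t W v
    = of_bool (Y v \<omega> < t \<and> unblocked k (Y v \<omega>) (\<lambda>i. Y (v + 1 + int i) \<omega>) \<and> unblocked l (Y v \<omega>) (\<lambda>i. Y (v - 1 - int i) \<omega>))"
proof -
  have inj: "inj_on (\<lambda>i. Y i \<omega>) W" using g unfolding generic_def by (auto intro: inj_on_subset)
  have le: "Y i \<omega> \<le> 2" for i using g unfolding generic_def by (metis less_imp_le order.trans one_le_numeral)
  have t': "Y v \<omega> \<le> t \<longleftrightarrow> Y v \<omega> < t" using g unfolding generic_def by (auto simp: less_le)
  show ?thesis
    unfolding finite_blocking_def t'[symmetric]
    by (rule blocking_formula_list[where \<tau>="\<lambda>i. Y i \<omega>", OF W inj le arrivals_props(1)[OF W] arrivals_props(3)[OF W]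
          arrivals_props(2)[OF W] v right left])
qed

text \<open>
  The product of the two alternating sums for \<open>v\<close> is regrouped by intervals, and in
  each interval the sum over \<open>v\<close> counts its peaks. The sign changes because an
  interval that consists of \<open>v\<close>, \<open>a\<close> sites to the right and
  \<open>b\<close> sites to the left has length \<open>a + b + 1\<close>.
\<close>

lemma finite_count_eq:
  assumes g: "generic \<omega>"
  shows "finite_count n \<omega> = - blocking_T n \<omega>"
proof -
  interpret overlapping_pattern M borel "uniform_measure lborel {0<..<1}" Y site_pattern "exp 32" site_excess
    "(exp (- 2 * t) - 1) / 2" "- t * exp (- 2 * t)" "(1 - exp (- 4 * t)) / 8 - t * exp (- 2 * t) / 2"
    by (rule blocking_overlapping_pattern)
  let ?f = "\<lambda>v a b. (-1) ^ (a + b) * of_bool (Y v \<omega> < t \<and> right_run a v \<omega> \<and> left_run b v \<omega>) :: real"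
  have inj: "inj (\<lambda>i. Y i \<omega>)" using g by (simp add: generic_def)
  have "finite_blocking int_edges (\<lambda>i. Y i \<omega>) t (segment n) v
    = (\<Sum>a\<le>nat (int n - v). \<Sum>b\<le>nat (v - 1). ?f v a b)" if v: "v \<in> segment n" for v
  proof -
    have "finite_blocking int_edges (\<lambda>i. Y i \<omega>) t (segment n) v
      = of_bool (Y v \<omega> < t \<and> unblocked (nat (int n - v)) (Y v \<omega>) (\<lambda>i. Y (v + 1 + int i) \<omega>)
          \<and> unblocked (nat (v - 1)) (Y v \<omega>) (\<lambda>i. Y (v - 1 - int i) \<omega>))"
      by (rule finite_blocking_formula[OF g]) (use v in \<open>auto simp: segment_def\<close>)
    also have "\<dots> = of_bool (Y v \<omega> < t) * ((\<Sum>a\<le>nat (int n - v). (-1) ^ a * of_bool (right_run a v \<omega>))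
        * (\<Sum>b\<le>nat (v - 1). (-1) ^ b * of_bool (left_run b v \<omega>)))"
      by (simp only: of_bool_conj of_bool_unblocked)
    also have "\<dots> = (\<Sum>a\<le>nat (int n - v). \<Sum>b\<le>nat (v - 1). ?f v a b)"
      unfolding sum_product unfolding sum_distrib_left of_bool_conj power_add by (intro sum.cong refl) (simp only: mult_ac)
    finally show ?thesis .
  qed
  then have "finite_count n \<omega> = (\<Sum>v\<in>segment n. \<Sum>a\<le>nat (int n - v). \<Sum>b\<le>nat (v - 1). ?f v a b)"
    by (rule sum.cong[OF refl])
  also have "\<dots> = (\<Sum>p\<in>vertex_intervals n. \<Sum>j\<le>snd p. ?f (fst p + int j) (snd p - j) j)"
    by (rule sum_chains_eq_sum_intervals)
  also have "\<dots> = (\<Sum>p\<in>vertex_intervals n. (-1) ^ snd p * of_bool (site_pattern (fst p) (Suc (snd p)) (\<lambda>i. Y i \<omega>)))"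
  proof (rule sum.cong[OF refl])
    fix p :: "int \<times> nat"
    obtain s m where p: "p = (s, m)" by (cases p)
    let ?g = "\<lambda>i. Y (s + int i) \<omega>"
    have "inj ?g" by (rule injI) (auto dest: injD[OF inj])
    from valley_free_peaks[OF this, where n=m and t=t]
    have peaks: "(\<Sum>j\<le>m. of_bool (?g j < t \<and> (\<forall>i<j. ?g i < ?g (Suc i)) \<and> (\<forall>i. j \<le> i \<and> i < m \<longrightarrow> ?g (Suc i) < ?g i)) :: real)
      = of_bool (valley_free t (Suc m) ?g)" .
    have "?f (s + int j) (m - j) j = (-1) ^ m * of_bool (?g j < t \<and> (\<forall>i<j. ?g i < ?g (Suc i)) \<and> (\<forall>i. j \<le> i \<and> i < m \<longrightarrow> ?g (Suc i) < ?g i))"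
      if j: "j \<le> m" for j
    proof -
      have R: "right_run (m - j) (s + int j) \<omega> \<longleftrightarrow> (\<forall>i. j \<le> i \<and> i < m \<longrightarrow> ?g (Suc i) < ?g i)"
      proof -
        have e: "(case i of 0 \<Rightarrow> Y (s + int j) \<omega> | Suc k \<Rightarrow> Y (s + int j + 1 + int k) \<omega>) = ?g (j + i)" for i
          by (cases i) (auto simp: add_ac)
        have e': "Y (s + int j + 1 + int i) \<omega> = ?g (Suc (j + i))" for i by (simp add: add_ac)
        have "(\<forall>i<m - j. ?g (Suc (j + i)) < ?g (j + i)) \<longleftrightarrow> (\<forall>i. j \<le> i \<and> i < m \<longrightarrow> ?g (Suc i) < ?g i)"
        proof (intro iffI allI impI; (elim conjE)?)
          fix i assume h: "\<forall>i<m - j. ?g (Suc (j + i)) < ?g (j + i)" and i: "j \<le> i" "i < m"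
          have "i - j < m - j" "j + (i - j) = i" using i by auto
          then show "?g (Suc i) < ?g i" using h[rule_format, of "i - j"] by simp
        next
          fix i assume h: "\<forall>i. j \<le> i \<and> i < m \<longrightarrow> ?g (Suc i) < ?g i" and i: "i < m - j"
          show "?g (Suc (j + i)) < ?g (j + i)" using i by (intro h[rule_format]) auto
        qed
        then show ?thesis unfolding descending_iff unfolding e unfolding e' .
      qed
      have L: "left_run j (s + int j) \<omega> \<longleftrightarrow> (\<forall>i<j. ?g i < ?g (Suc i))"
      proof -
        have e: "(case i of 0 \<Rightarrow> Y (s + int j) \<omega> | Suc k \<Rightarrow> Y (s + int j - 1 - int k) \<omega>) = ?g (j - i)"
          "Y (s + int j - 1 - int i) \<omega> = ?g (j - Suc i)" if "i < j" for i
          using that by (cases i; auto simp: of_nat_diff algebra_simps)+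
        have "left_run j (s + int j) \<omega> \<longleftrightarrow> (\<forall>i<j. ?g (j - Suc i) < ?g (j - i))"
          unfolding descending_iff by (simp only: e cong: imp_cong)
        also have "\<dots> \<longleftrightarrow> (\<forall>i<j. ?g i < ?g (Suc i))"
        proof
          assume h: "\<forall>i<j. ?g (j - Suc i) < ?g (j - i)"
          show "\<forall>i<j. ?g i < ?g (Suc i)"
          proof (intro allI impI)
            fix i assume "i < j"
            then have "j - Suc i < j" "j - Suc (j - Suc i) = i" "j - (j - Suc i) = Suc i" by auto
            then show "?g i < ?g (Suc i)" using h[rule_format, of "j - Suc i"] by simp
          qed
        next
          assume h: "\<forall>i<j. ?g i < ?g (Suc i)"
          show "\<forall>i<j. ?g (j - Suc i) < ?g (j - i)"
          proof (intro allI impI)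
            fix i assume "i < j"
            then have "j - Suc i < j" "Suc (j - Suc i) = j - i" by auto
            then show "?g (j - Suc i) < ?g (j - i)" using h[rule_format, of "j - Suc i"] by simp
          qed
        qed
        finally show ?thesis .
      qed
      have "m - j + j = m" using j by simp
      then show ?thesis unfolding R L by (simp only: conj_ac)
    qed
    then have "(\<Sum>j\<le>m. ?f (s + int j) (m - j) j)
      = (\<Sum>j\<le>m. (-1) ^ m * of_bool (?g j < t \<and> (\<forall>i<j. ?g i < ?g (Suc i)) \<and> (\<forall>i. j \<le> i \<and> i < m \<longrightarrow> ?g (Suc i) < ?g i)))"
      by (intro sum.cong refl) (simp only: atMost_iff)
    also have "\<dots> = (-1) ^ m * of_bool (valley_free t (Suc m) ?g)"
      unfolding sum_distrib_left[symmetric] peaks ..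
    finally show "(\<Sum>j\<le>snd p. ?f (fst p + int j) (snd p - j) j)
      = (-1) ^ snd p * of_bool (site_pattern (fst p) (Suc (snd p)) (\<lambda>i. Y i \<omega>))"
      unfolding p fst_conv snd_conv .
  qed
  also have "\<dots> = (\<Sum>I\<in>intervals 1 (int n + 1). - ((-1) ^ snd I * U I \<omega>))"
    by (rule sum.reindex_bij_witness[where i="\<lambda>I. (fst I, snd I - 1)" and j="\<lambda>p. (fst p, Suc (snd p))"])
      (auto simp: vertex_intervals_def intervals_def U_def)
  also have "\<dots> = - blocking_T n \<omega>"
    unfolding altsum_def sum_negf ..
  finally show ?thesis .
qed


end

section \<open>The three processes\<close>

context uniform_clocks
begin

lemma measurable_chain: "Measurable.pred M (\<lambda>\<omega>. descending k u (\<lambda>i. Y (\<sigma> i) \<omega>))"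
  by (rule measurable_descending) measurable

lemma prob_chain_le:
  assumes "inj \<sigma>"
  shows "prob {\<omega> \<in> space M. descending k 1 (\<lambda>i. Y (\<sigma> i) \<omega>)} \<le> exp 32 / 16 ^ k"
  using clock_sequence.prob_descending[OF clock_sequence_reindex[OF assms], of 1 k] exp_tail_bound[of 1 k] by simp

text \<open>
  The clocks are below 1, so a chain that is broken when it starts at level 1 is also broken when
  it starts at \<open>Y v \<omega>\<close>. With level 1 the event does not involve the clock of
  \<open>v\<close>.
\<close>

lemma blocking_locality:
  assumes g: "generic \<omega>" and R: "\<not> descending k 1 (\<lambda>i. Y (v + 1 + int i) \<omega>)"
    and L: "\<not> descending l 1 (\<lambda>i. Y (v - 1 - int i) \<omega>)"
  shows "\<exists>x. \<forall>W. finite W \<longrightarrow> {v - int l..v + int k} \<subseteq> W \<longrightarrow> finite_blocking int_edges (\<lambda>i. Y i \<omega>) t W v = x"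
proof (intro exI allI impI)
  fix W :: "int set" assume W: "finite W" "{v - int l..v + int k} \<subseteq> W"
  have "Y v \<omega> \<le> 1" using g unfolding generic_def by (simp add: less_imp_le)
  then have nR: "\<not> right_run k v \<omega>" and nL: "\<not> left_run l v \<omega>" using R L descending_weaken by blast+
  show "finite_blocking int_edges (\<lambda>i. Y i \<omega>) t W v
    = of_bool (Y v \<omega> < t \<and> unblocked k (Y v \<omega>) (\<lambda>i. Y (v + 1 + int i) \<omega>) \<and> unblocked l (Y v \<omega>) (\<lambda>i. Y (v - 1 - int i) \<omega>))"
  proof (rule finite_blocking_formula[OF g W(1)])
    show "v \<in> W" using W(2) by auto
    show "v + 1 + int i \<in> W" if "i < k" for i using that W(2) by auto
    show "v - 1 - int i \<in> W" if "i < l" for i using that W(2) by auto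
  qed (use nR nL in auto)
qed

lemma sigma2_BL_pos: "0 < sigma2_BL t"
  using t by (simp add: sigma2_BL_def)

lemma finite_count_measurable: "finite_count n \<in> borel_measurable M"
  by (intro borel_measurable_sum measurable_finite_blocking) (auto simp: segment_def)

lemma blocking_finite_limit: "variance_limit_and_clt M finite_count (sigma2_BL t)"
proof -
  interpret overlapping_pattern M borel "uniform_measure lborel {0<..<1}" Y site_pattern "exp 32" site_excess
    "(exp (- 2 * t) - 1) / 2" "- t * exp (- 2 * t)" "(1 - exp (- 4 * t)) / 8 - t * exp (- 2 * t) / 2"
    by (rule blocking_overlapping_pattern)
  have "variance_limit_and_clt M finite_count ((- 1)\<^sup>2 * sigma2_BL t)"
  proof (rule variance_limit_and_clt_affine_AE[where S="\<lambda>n. T n" and d="\<lambda>_. 0", OF prob_space_axioms])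
    show "variance_limit_and_clt M (\<lambda>n. T n) (sigma2_BL t)" using blocking_altsum_limit by (simp only: comp_def)
    show "AE \<omega> in M. \<forall>n. finite_count n \<omega> = - 1 * T n \<omega> + 0"
      using AE_generic by eventually_elim (simp add: finite_count_eq)
  qed (auto intro: sigma2_BL_pos finite_count_measurable altsum_square_integrable)
  then show ?thesis by simp
qed

lemma blocking_infinite_limit:
  "variance_limit_and_clt M (\<lambda>n \<omega>. \<Sum>v\<in>segment n. infinite_state v \<omega>) (sigma2_BL t)"
  unfolding blocking_rsa_def
proof (rule infinite_volume_transfer[where R="\<lambda>k v \<omega>. descending k 1 (\<lambda>i. Y (v + 1 + int i) \<omega>)"
      and L="\<lambda>k v \<omega>. descending k 1 (\<lambda>i. Y (v - 1 - int i) \<omega>)" and C="exp 32"])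
  show "AE \<omega> in M. \<forall>v k l. \<not> descending k 1 (\<lambda>i. Y (v + 1 + int i) \<omega>) \<longrightarrow> \<not> descending l 1 (\<lambda>i. Y (v - 1 - int i) \<omega>) \<longrightarrow>
      (\<exists>x. \<forall>W. finite W \<longrightarrow> {v - int l..v + int k} \<subseteq> W \<longrightarrow> finite_blocking int_edges (\<lambda>i. Y i \<omega>) t W v = x)"
    using AE_generic by eventually_elim (intro allI impI blocking_locality)
qed (auto intro!: finite_blocking_cases measurable_finite_blocking measurable_chain prob_chain_le sigma2_BL_pos blocking_finite_limit
    simp: inj_def)

text \<open>
  Each dimer occupies two sites, and the \<open>n\<close> sites of the segment span \<open>n -
  1\<close> edges.
\<close>

lemma sum_dimers:
  assumes "inj (\<lambda>i. \<tau> (line_edge i))" "\<And>i. \<tau> (line_edge i) \<le> 2"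
  shows "(\<Sum>v\<in>segment n. finite_dimer int_edges \<tau> t (segment n) v)
    = 2 * (\<Sum>v\<in>segment (n - 1). finite_blocking int_edges (\<lambda>i. \<tau> (line_edge i)) t (segment (n - 1)) v)"
proof -
  let ?B = "finite_blocking int_edges (\<lambda>i. \<tau> (line_edge i)) t (segment (n - 1))"
  have A: "{i. i \<in> segment n \<and> i + 1 \<in> segment n} = segment (n - 1)" by (auto simp: segment_def)
  have fin: "finite (segment m)" for m by (simp add: segment_def)
  have out: "?B v = 0" if "v \<notin> segment (n - 1)" for v by (rule finite_blocking_outside[OF fin that])
  have "(\<Sum>v\<in>segment n. finite_dimer int_edges \<tau> t (segment n) v) = (\<Sum>v\<in>segment n. ?B (v - 1) + ?B v)"
    by (intro sum.cong refl) (simp only: dimer_eq_blocking[OF fin assms] A)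
  also have "\<dots> = (\<Sum>v\<in>segment n. ?B (v - 1)) + (\<Sum>v\<in>segment n. ?B v)" by (rule sum.distrib)
  also have "(\<Sum>v\<in>segment n. ?B (v - 1)) = (\<Sum>v\<in>(\<lambda>v. v - 1) ` segment n. ?B v)"
    by (subst sum.reindex) (auto simp: inj_on_def)
  also have "\<dots> = (\<Sum>v\<in>segment (n - 1). ?B v)"
  proof (rule sum.mono_neutral_right)
    show "segment (n - 1) \<subseteq> (\<lambda>v. v - 1) ` segment n"
    proof
      fix v assume "v \<in> segment (n - 1)"
      then have "v + 1 \<in> segment n" by (auto simp: segment_def)
      then show "v \<in> (\<lambda>v. v - 1) ` segment n" by (intro image_eqI[of _ _ "v + 1"]) auto
    qed
  qed (use fin out in auto)
  also have "(\<Sum>v\<in>segment n. ?B v) = (\<Sum>v\<in>segment (n - 1). ?B v)"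
    by (rule sum.mono_neutral_right) (use fin out in \<open>auto simp: segment_def\<close>)
  finally show ?thesis by simp
qed

context
  fixes \<tau> :: "int set \<Rightarrow> 'a \<Rightarrow> real"
  assumes \<tau>: "\<And>i. \<tau> (line_edge i) = Y i"
begin

lemma measurable_edge_clock: "e \<in> int_edges \<Longrightarrow> \<tau> e \<in> borel_measurable M"
  unfolding int_edges_eq by (auto simp: \<tau>)

lemma generic_edge_clocks:
  assumes "generic \<omega>"
  shows "inj (\<lambda>i. \<tau> (line_edge i) \<omega>)" "\<tau> (line_edge i) \<omega> \<le> 2"
proof -
  show "inj (\<lambda>i. \<tau> (line_edge i) \<omega>)" using assms by (simp add: \<tau> generic_def)
  have "Y i \<omega> < 1" using assms by (simp add: generic_def)
  then show "\<tau> (line_edge i) \<omega> \<le> 2" by (simp add: \<tau>)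
qed

lemma dimer_finite_limit:
  "variance_limit_and_clt M (\<lambda>n \<omega>. \<Sum>v\<in>segment n. finite_dimer int_edges (\<lambda>e. \<tau> e \<omega>) t (segment n) v) (sigma2_DI t)"
proof -
  interpret overlapping_pattern M borel "uniform_measure lborel {0<..<1}" Y site_pattern "exp 32" site_excess
    "(exp (- 2 * t) - 1) / 2" "- t * exp (- 2 * t)" "(1 - exp (- 4 * t)) / 8 - t * exp (- 2 * t) / 2"
    by (rule blocking_overlapping_pattern)
  let ?Z = "\<lambda>n \<omega>. \<Sum>v\<in>segment n. finite_dimer int_edges (\<lambda>e. \<tau> e \<omega>) t (segment n) v"
  have "variance_limit_and_clt M ?Z ((- 2)\<^sup>2 * sigma2_BL t)"
  proof (rule variance_limit_and_clt_affine_AE[where S="\<lambda>n. T (n - 1)" and d="\<lambda>_. 0", OF prob_space_axioms])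
    show "variance_limit_and_clt M (\<lambda>n. T (n - 1)) (sigma2_BL t)"
      using blocking_altsum_limit by (intro predecessor_limit sigma2_BL_pos) (simp only: comp_def)
    show "?Z n \<in> borel_measurable M" for n
      by (intro borel_measurable_sum measurable_finite_dimer measurable_edge_clock) (auto simp: segment_def)
    show "AE \<omega> in M. \<forall>n. ?Z n \<omega> = - 2 * T (n - 1) \<omega> + 0"
      using AE_generic
    proof eventually_elim
      case (elim \<omega>)
      show ?case
      proof
        fix n
        have "?Z n \<omega> = 2 * finite_count (n - 1) \<omega>"
          using sum_dimers[of "\<lambda>e. \<tau> e \<omega>", OF generic_edge_clocks[OF elim]] by (simp only: \<tau>)
        then show "?Z n \<omega> = - 2 * T (n - 1) \<omega> + 0" using finite_count_eq[OF elim, of "n - 1"] by simp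
      qed
    qed
  qed (auto intro: sigma2_BL_pos altsum_square_integrable)
  then show ?thesis by (simp add: sigma2_BL_def sigma2_DI_def mult.assoc)
qed

text \<open>
  The factor 16 pays for the missing link; for \<open>k = 0\<close> the chain is empty and the
  bound exceeds 1.
\<close>

lemma prob_shorter_chain_le:
  assumes "inj \<sigma>"
  shows "prob {\<omega> \<in> space M. descending (k - 1) 1 (\<lambda>i. Y (\<sigma> i) \<omega>)} \<le> 16 * exp 32 / 16 ^ k"
proof (cases k)
  case 0
  have "(1::real) \<le> 16 * exp 32" using exp_ge_add_one_self[of "32::real"] by linarith
  then show ?thesis using order.trans[OF prob_le_1] 0 by (simp only: power_0 div_by_1)
next
  case (Suc m)
  then show ?thesis using prob_chain_le[OF assms, of m] by simp
qed

text \<open>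
  The state of the vertex \<open>v\<close> is determined by the edges at \<open>v - 1\<close> and
  \<open>v\<close>. Their chains to the right both contain the links from \<open>v + 1\<close> on,
  and those to the left the links from \<open>v - 2\<close> on, so it suffices that these stop.
\<close>

lemma dimer_infinite_limit:
  "variance_limit_and_clt M (\<lambda>n \<omega>. \<Sum>v\<in>segment n. dimer_rsa int_edges (\<lambda>e. \<tau> e \<omega>) t UNIV v) (sigma2_DI t)"
  unfolding dimer_rsa_def
proof (rule infinite_volume_transfer[where R="\<lambda>k v \<omega>. descending (k - 1) 1 (\<lambda>i. Y (v + 1 + int i) \<omega>)"
      and L="\<lambda>k v \<omega>. descending (k - 1) 1 (\<lambda>i. Y (v - 2 - int i) \<omega>)" and C="16 * exp 32"])
  show "AE \<omega> in M. \<forall>v k l. \<not> descending (k - 1) 1 (\<lambda>i. Y (v + 1 + int i) \<omega>) \<longrightarrow> \<not> descending (l - 1) 1 (\<lambda>i. Y (v - 2 - int i) \<omega>) \<longrightarrow>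
      (\<exists>x. \<forall>W. finite W \<longrightarrow> {v - int l..v + int k} \<subseteq> W \<longrightarrow> finite_dimer int_edges (\<lambda>e. \<tau> e \<omega>) t W v = x)"
    using AE_generic
  proof eventually_elim
    case (elim \<omega>)
    show ?case
    proof (intro allI impI)
      fix v k l
      assume R: "\<not> descending (k - 1) 1 (\<lambda>i. Y (v + 1 + int i) \<omega>)" and L: "\<not> descending (l - 1) 1 (\<lambda>i. Y (v - 2 - int i) \<omega>)"
      obtain k' l' where kl: "k = Suc k'" "l = Suc l'" using R L by (cases k; cases l) auto
      have Y1: "Y i \<omega> \<le> 1" for i using elim by (simp add: generic_def less_imp_le)
      have R': "\<not> descending k 1 (\<lambda>i. Y (v - 1 + 1 + int i) \<omega>)"
      proof
        assume "descending k 1 (\<lambda>i. Y (v - 1 + 1 + int i) \<omega>)"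
        then have "descending k' (Y v \<omega>) (\<lambda>i. Y (v + 1 + int i) \<omega>)" by (simp add: kl add_ac)
        then show False using R descending_weaken[OF _ Y1] by (simp add: kl)
      qed
      have L': "\<not> descending l 1 (\<lambda>i. Y (v - 1 - int i) \<omega>)"
      proof
        assume "descending l 1 (\<lambda>i. Y (v - 1 - int i) \<omega>)"
        then have "descending l' (Y (v - 1) \<omega>) (\<lambda>i. Y (v - 2 - int i) \<omega>)" by (simp add: kl algebra_simps)
        then show False using L descending_weaken[OF _ Y1] by (simp add: kl)
      qed
      have L2: "\<not> descending (l - 1) 1 (\<lambda>i. Y (v - 1 - 1 - int i) \<omega>)" using L by simp
      obtain x1 where x1: "\<And>W. finite W \<Longrightarrow> {v - int l..v + int (k - 1)} \<subseteq> W \<Longrightarrow> finite_blocking int_edges (\<lambda>i. Y i \<omega>) t W v = x1"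
        using blocking_locality[OF elim R L'] by blast
      obtain x2 where x2: "\<And>W. finite W \<Longrightarrow> {v - 1 - int (l - 1)..v - 1 + int k} \<subseteq> W \<Longrightarrow> finite_blocking int_edges (\<lambda>i. Y i \<omega>) t W (v - 1) = x2"
        using blocking_locality[OF elim R' L2] by blast
      show "\<exists>x. \<forall>W. finite W \<longrightarrow> {v - int l..v + int k} \<subseteq> W \<longrightarrow> finite_dimer int_edges (\<lambda>e. \<tau> e \<omega>) t W v = x"
      proof (intro exI allI impI)
        fix W :: "int set" assume W: "finite W" "{v - int l..v + int k} \<subseteq> W"
        let ?A = "{i. i \<in> W \<and> i + 1 \<in> W}"
        have fA: "finite ?A" using W(1) by (rule finite_subset[rotated]) auto
        have "{v - int l..v + int (k - 1)} \<subseteq> ?A" "{v - 1 - int (l - 1)..v - 1 + int k} \<subseteq> ?A"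
          using W(2) by (auto simp: kl)
        then have "finite_blocking int_edges (\<lambda>i. Y i \<omega>) t ?A (v - 1) + finite_blocking int_edges (\<lambda>i. Y i \<omega>) t ?A v = x2 + x1"
          using x1 x2 fA by simp
        then show "finite_dimer int_edges (\<lambda>e. \<tau> e \<omega>) t W v = x2 + x1"
          using dimer_eq_blocking[of W "\<lambda>e. \<tau> e \<omega>", OF W(1) generic_edge_clocks[OF elim]] by (simp only: \<tau>)
      qed
    qed
  qed
  show "0 < sigma2_DI t" using t by (simp add: sigma2_DI_def)
  show "prob {\<omega> \<in> space M. descending (k - 1) 1 (\<lambda>i. Y (v + 1 + int i) \<omega>)} \<le> 16 * exp 32 / 16 ^ k"
    "prob {\<omega> \<in> space M. descending (k - 1) 1 (\<lambda>i. Y (v - 2 - int i) \<omega>)} \<le> 16 * exp 32 / 16 ^ k" for k v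
    by (rule prob_shorter_chain_le; simp add: inj_def)+
qed (rule finite_dimer_cases measurable_finite_dimer measurable_edge_clock measurable_chain dimer_finite_limit | assumption)+

end

end

context directed_clocks
begin

context
  fixes \<tau> :: "int set \<Rightarrow> 'a \<Rightarrow> real" and D :: "int set \<Rightarrow> 'a \<Rightarrow> int"
  assumes Y: "\<And>i \<omega>. (\<tau> (line_edge i) \<omega>, D (line_edge i) \<omega> = i) = Y i \<omega>"
    and D: "\<And>i. D (line_edge i) \<in> M \<rightarrow>\<^sub>M count_space UNIV" "AE \<omega> in M. \<forall>i. D (line_edge i) \<omega> \<in> line_edge i"
begin

abbreviation right_chain :: "nat \<Rightarrow> int \<Rightarrow> 'a \<Rightarrow> bool" where
  "right_chain k v \<omega> \<equiv> descending k t (\<lambda>i. left_clock (Y (v + int i) \<omega>))"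

abbreviation left_chain :: "nat \<Rightarrow> int \<Rightarrow> 'a \<Rightarrow> bool" where
  "left_chain k v \<omega> \<equiv> descending k t (\<lambda>i. right_clock (Y (v - 1 - int i) \<omega>))"

abbreviation admissible :: "'a \<Rightarrow> bool" where
  "admissible \<omega> \<equiv> uniform_clocks.generic (\<lambda>i \<omega>. fst (Y i \<omega>)) t \<omega> \<and> (\<forall>i. D (line_edge i) \<omega> \<in> line_edge i)"

abbreviation ann :: "int set \<Rightarrow> int \<Rightarrow> 'a \<Rightarrow> real" where
  "ann W v \<omega> \<equiv> finite_annihilation int_edges (\<lambda>e. \<tau> e \<omega>) (\<lambda>e. D e \<omega>) t W v"

lemma AE_admissible: "AE \<omega> in M. admissible \<omega>"
  using uniform_clocks.AE_generic[OF uniform_clocks_fst] D(2) by (simp add: AE_conj_iff)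

lemma annihilation_state:
  assumes a: "admissible \<omega>" and W: "finite W"
    and right: "\<And>i. i < k \<Longrightarrow> v + int i \<in> W \<and> v + int i + 1 \<in> W"
      "\<not> (v + int k \<in> W \<and> v + int k + 1 \<in> W) \<or> \<not> right_chain k v \<omega>"
    and left: "\<And>i. i < l \<Longrightarrow> v - 1 - int i \<in> W \<and> v - int i \<in> W"
      "\<not> (v - 1 - int l \<in> W \<and> v - int l \<in> W) \<or> \<not> left_chain l v \<omega>"
  shows "ann W v \<omega> = of_bool (unblocked k t (\<lambda>i. left_clock (Y (v + int i) \<omega>)) \<and> unblocked l t (\<lambda>i. right_clock (Y (v - 1 - int i) \<omega>)))"
proof -
  interpret S: uniform_clocks M "\<lambda>i \<omega>. fst (Y i \<omega>)" t by (rule uniform_clocks_fst)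
  have g: "S.generic \<omega>" and d: "\<And>i. D (line_edge i) \<omega> \<in> line_edge i" using a by auto
  have \<tau>: "\<tau> (line_edge i) \<omega> = fst (Y i \<omega>)" for i unfolding Y[symmetric] by simp
  have inj: "inj (\<lambda>i. \<tau> (line_edge i) \<omega>)" unfolding \<tau> using g by (simp add: S.generic_def)
  have le: "\<tau> (line_edge i) \<omega> \<le> 1 \<and> \<tau> (line_edge i) \<omega> \<noteq> t" for i
    unfolding \<tau> using g by (simp add: S.generic_def less_imp_le)
  show ?thesis
    using annihilation_formula[of W "\<lambda>e. \<tau> e \<omega>" t "\<lambda>e. D e \<omega>" k v l, OF W inj le t(2) d right(1)]
    unfolding Y using right(2) left by blast
qed

lemma measurable_chains [measurable]:
  "Measurable.pred M (right_chain k v)" "Measurable.pred M (left_chain k v)"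
  by (rule measurable_descending; measurable)+

lemma prob_chains_le:
  "prob {\<omega> \<in> space M. right_chain k v \<omega>} \<le> exp 32 / 16 ^ k" "prob {\<omega> \<in> space M. left_chain k v \<omega>} \<le> exp 32 / 16 ^ k"
proof -
  have le: "(1 / 2 * t) ^ k / fact k \<le> exp 32 / 16 ^ k" using t by (intro exp_tail_bound) auto
  have "prob {\<omega> \<in> space M. right_chain k v \<omega>} = (1 / 2 * t) ^ k / fact k"
    by (rule clock_sequence.prob_descending[OF clock_sequence_reindex[where z=left_clock and \<sigma>="\<lambda>i. v + int i"]]) (use t in \<open>auto simp: inj_def\<close>)
  with le show "prob {\<omega> \<in> space M. right_chain k v \<omega>} \<le> exp 32 / 16 ^ k" by simp
  have "prob {\<omega> \<in> space M. left_chain k v \<omega>} = (1 / 2 * t) ^ k / fact k"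
    by (rule clock_sequence.prob_descending[OF clock_sequence_reindex[where z=right_clock and \<sigma>="\<lambda>i. v - 1 - int i"]]) (use t in \<open>auto simp: inj_def\<close>)
  with le show "prob {\<omega> \<in> space M. left_chain k v \<omega>} \<le> exp 32 / 16 ^ k" by simp
qed

lemma measurable_ann: "finite W \<Longrightarrow> ann W v \<in> borel_measurable M"
proof (rule measurable_finite_annihilation)
  fix e assume "e \<in> int_edges"
  then obtain i where e: "e = line_edge i" unfolding int_edges_eq by auto
  have "\<tau> e = (\<lambda>\<omega>. fst (Y i \<omega>))" unfolding Y[symmetric] e by simp
  then show "\<tau> e \<in> borel_measurable M" by simp
  show "D e \<in> M \<rightarrow>\<^sub>M count_space UNIV" unfolding e by (rule D)
qed

text \<open>
  Again the product of two alternating sums is regrouped by intervals, and in each interval the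
  sum over \<open>v\<close> counts its sinks. The intervals without edges contribute 1 for each
  vertex.
\<close>

lemma annihilation_count_eq:
  assumes a: "admissible \<omega>"
  shows "(\<Sum>v\<in>segment n. ann (segment n) v \<omega>)
    = 1 * interval_pattern.altsum Y edge_pattern (intervals 1 (int (n - 1) + 1)) \<omega> + real n"
proof -
  interpret overlapping_pattern M "borel \<Otimes>\<^sub>M count_space UNIV" fair_clock Y edge_pattern "exp 32" "\<lambda>_ _. 0"
    "exp (- t) - 1" "- t * exp (- t)" 0
    by (rule annihilation_overlapping_pattern)
  let ?f = "\<lambda>v a b. (-1) ^ (a + b) * of_bool (right_chain a v \<omega> \<and> left_chain b v \<omega>) :: real"
  let ?u = "\<lambda>p. (-1) ^ snd p * of_bool (edge_pattern (fst p) (snd p) (\<lambda>i. Y i \<omega>)) :: real"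
  have "ann (segment n) v \<omega> = (\<Sum>a\<le>nat (int n - v). \<Sum>b\<le>nat (v - 1). ?f v a b)" if v: "v \<in> segment n" for v
  proof -
    have "ann (segment n) v \<omega> = of_bool (unblocked (nat (int n - v)) t (\<lambda>i. left_clock (Y (v + int i) \<omega>))
        \<and> unblocked (nat (v - 1)) t (\<lambda>i. right_clock (Y (v - 1 - int i) \<omega>)))"
      by (rule annihilation_state[OF a]) (use v in \<open>auto simp: segment_def\<close>)
    also have "\<dots> = (\<Sum>a\<le>nat (int n - v). (-1) ^ a * of_bool (right_chain a v \<omega>))
        * (\<Sum>b\<le>nat (v - 1). (-1) ^ b * of_bool (left_chain b v \<omega>))"
      by (simp only: of_bool_conj of_bool_unblocked)
    also have "\<dots> = (\<Sum>a\<le>nat (int n - v). \<Sum>b\<le>nat (v - 1). ?f v a b)"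
      unfolding sum_product of_bool_conj power_add by (intro sum.cong refl) (simp only: mult_ac)
    finally show ?thesis .
  qed
  then have "(\<Sum>v\<in>segment n. ann (segment n) v \<omega>) = (\<Sum>v\<in>segment n. \<Sum>a\<le>nat (int n - v). \<Sum>b\<le>nat (v - 1). ?f v a b)"
    by (rule sum.cong[OF refl])
  also have "\<dots> = (\<Sum>p\<in>vertex_intervals n. \<Sum>j\<le>snd p. ?f (fst p + int j) (snd p - j) j)"
    by (rule sum_chains_eq_sum_intervals)
  also have "\<dots> = (\<Sum>p\<in>vertex_intervals n. ?u p)"
  proof (rule sum.cong[OF refl])
    fix p :: "int \<times> nat"
    obtain s m where p: "p = (s, m)" by (cases p)
    let ?g = "\<lambda>i. Y (s + int i) \<omega>"
    have "?f (s + int j) (m - j) j = (-1) ^ m * of_bool (descending (m - j) t (\<lambda>i. left_clock (?g (j + i)))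
        \<and> descending j t (\<lambda>i. right_clock (?g (j - 1 - i))))" if j: "j \<le> m" for j
    proof -
      have R: "right_chain (m - j) (s + int j) \<omega> = descending (m - j) t (\<lambda>i. left_clock (?g (j + i)))"
        by (rule descending_cong) (simp add: add.assoc)
      have L: "left_chain j (s + int j) \<omega> = descending j t (\<lambda>i. right_clock (?g (j - 1 - i)))"
        by (rule descending_cong, rule arg_cong[where f=right_clock], rule arg_cong[where f="\<lambda>i. Y i \<omega>"]) auto
      have "m - j + j = m" using j by simp
      then show ?thesis unfolding R L by (simp only:)
    qed
    then have "(\<Sum>j\<le>m. ?f (s + int j) (m - j) j)
      = (\<Sum>j\<le>m. (-1) ^ m * of_bool (descending (m - j) t (\<lambda>i. left_clock (?g (j + i)))
        \<and> descending j t (\<lambda>i. right_clock (?g (j - 1 - i)))))"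
      by (intro sum.cong refl) (simp only: atMost_iff)
    also have "\<dots> = (-1) ^ m * of_bool (funnel t m ?g)"
      unfolding sum_distrib_left[symmetric] funnel_sinks[OF t(2), where g="?g"] ..
    finally show "(\<Sum>j\<le>snd p. ?f (fst p + int j) (snd p - j) j) = ?u p"
      unfolding p fst_conv snd_conv .
  qed
  also have "\<dots> = (\<Sum>p\<in>vertex_intervals n - {p. snd p = 0}. ?u p) + (\<Sum>p\<in>vertex_intervals n \<inter> {p. snd p = 0}. ?u p)"
    using sum.Int_Diff[OF finite_vertex_intervals, of ?u n "{p. snd p = 0}"] by (simp only: add.commute)
  also have "vertex_intervals n - {p. snd p = 0} = intervals 1 (int (n - 1) + 1)"
    by (auto simp: vertex_intervals_def intervals_def)
  also have "(\<Sum>p\<in>intervals 1 (int (n - 1) + 1). ?u p) = T (n - 1) \<omega>"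
    unfolding altsum_def U_def ..
  also have "(\<Sum>p\<in>vertex_intervals n \<inter> {p. snd p = 0}. ?u p) = (\<Sum>p\<in>(\<lambda>v. (v, 0 :: nat)) ` segment n. 1)"
    by (rule sum.cong) (auto simp: vertex_intervals_def segment_def funnel_def)
  also have "\<dots> = real n" by (subst sum.reindex) (auto simp: inj_on_def segment_def)
  finally show ?thesis by simp
qed

lemma annihilation_finite_limit:
  "variance_limit_and_clt M (\<lambda>n \<omega>. \<Sum>v\<in>segment n. ann (segment n) v \<omega>) (sigma2_AN t)"
proof -
  interpret overlapping_pattern M "borel \<Otimes>\<^sub>M count_space UNIV" fair_clock Y edge_pattern "exp 32" "\<lambda>_ _. 0"
    "exp (- t) - 1" "- t * exp (- t)" 0
    by (rule annihilation_overlapping_pattern)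
  have "variance_limit_and_clt M (\<lambda>n \<omega>. \<Sum>v\<in>segment n. ann (segment n) v \<omega>) (1\<^sup>2 * sigma2_AN t)"
  proof (rule variance_limit_and_clt_affine_AE[where S="\<lambda>n. T (n - 1)" and d=real, OF prob_space_axioms])
    show "variance_limit_and_clt M (\<lambda>n. T (n - 1)) (sigma2_AN t)"
      using annihilation_altsum_limit by (intro predecessor_limit sigma2_AN_pos) (simp only: comp_def)
    show "AE \<omega> in M. \<forall>n. (\<Sum>v\<in>segment n. ann (segment n) v \<omega>) = 1 * T (n - 1) \<omega> + real n"
      using AE_admissible by eventually_elim (intro allI annihilation_count_eq)
  qed (auto intro!: sigma2_AN_pos borel_measurable_sum measurable_ann altsum_square_integrable simp: segment_def)
  then show ?thesis by simp
qed

lemma annihilation_infinite_limit: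
  "variance_limit_and_clt M (\<lambda>n \<omega>. \<Sum>v\<in>segment n. annihilation int_edges (\<lambda>e. \<tau> e \<omega>) (\<lambda>e. D e \<omega>) t UNIV v) (sigma2_AN t)"
  unfolding annihilation_def
proof (rule infinite_volume_transfer[where R=right_chain and L=left_chain and C="exp 32"])
  show "AE \<omega> in M. \<forall>v k l. \<not> right_chain k v \<omega> \<longrightarrow> \<not> left_chain l v \<omega> \<longrightarrow>
      (\<exists>x. \<forall>W. finite W \<longrightarrow> {v - int l..v + int k} \<subseteq> W \<longrightarrow> ann W v \<omega> = x)"
    using AE_admissible
  proof eventually_elim
    case (elim \<omega>)
    show ?case
    proof (intro allI impI exI)
      fix v k l W assume RL: "\<not> right_chain k v \<omega>" "\<not> left_chain l v \<omega>" and W: "finite W" "{v - int l..v + int k} \<subseteq> W"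
      show "ann W v \<omega> = of_bool (unblocked k t (\<lambda>i. left_clock (Y (v + int i) \<omega>)) \<and> unblocked l t (\<lambda>i. right_clock (Y (v - 1 - int i) \<omega>)))"
      proof (rule annihilation_state[OF elim W(1)])
        show "v + int i \<in> W \<and> v + int i + 1 \<in> W" if "i < k" for i using that W(2) by auto
        show "v - 1 - int i \<in> W \<and> v - int i \<in> W" if "i < l" for i using that W(2) by auto
      qed (use RL in auto)
    qed
  qed
  show "finite W \<Longrightarrow> ann W v \<omega> = 0 \<or> ann W v \<omega> = 1" for \<omega> W v by (rule finite_annihilation_cases)
qed (rule measurable_ann measurable_chains prob_chains_le sigma2_AN_pos annihilation_finite_limit | assumption)+

end

end

lemma fair_direction:
  "distr (uniform_measure lborel {0<..<1::real} \<Otimes>\<^sub>M measure_pmf (pmf_of_set (line_edge i))) (borel \<Otimes>\<^sub>M count_space UNIV)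
     (\<lambda>p. (fst p, snd p = i)) = fair_clock"
proof -
  let ?U = "uniform_measure lborel {0<..<1::real}" and ?P = "measure_pmf (pmf_of_set (line_edge i))"
  interpret U: prob_space ?U by (rule prob_space_uniform)
  have [simp]: "finite (line_edge i)" "line_edge i \<noteq> {}" "card (line_edge i) = 2" by (auto simp: line_edge_def)
  have "map_pmf (\<lambda>x. x = i) (pmf_of_set (line_edge i)) = bernoulli_pmf (1 / 2)"
  proof (rule pmf_eqI)
    fix b :: bool
    have "line_edge i \<inter> {x. (x = i) = b} = (if b then {i} else {i + 1})" by (auto simp: line_edge_def)
    then have "pmf (map_pmf (\<lambda>x. x = i) (pmf_of_set (line_edge i))) b = 1 / 2"
      by (simp add: pmf_map vimage_def measure_pmf_of_set Int_def)
    then show "pmf (map_pmf (\<lambda>x. x = i) (pmf_of_set (line_edge i))) b = pmf (bernoulli_pmf (1 / 2)) b" by (cases b) auto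
  qed
  then have b: "distr ?P (count_space UNIV) (\<lambda>x. x = i) = measure_pmf (bernoulli_pmf (1 / 2))"
    by (simp flip: map_pmf_rep_eq)
  have "fair_clock = distr ?U ?U (\<lambda>x. x) \<Otimes>\<^sub>M distr ?P (count_space UNIV) (\<lambda>x. x = i)"
    unfolding b by (simp add: distr_id2)
  also have "\<dots> = distr (?U \<Otimes>\<^sub>M ?P) (?U \<Otimes>\<^sub>M count_space UNIV) (\<lambda>(x, y). (x, y = i))"
    by (rule pair_measure_distr) (auto simp: b measure_pmf.sigma_finite_measure_axioms)
  also have "\<dots> = distr (?U \<Otimes>\<^sub>M ?P) (borel \<Otimes>\<^sub>M count_space UNIV) (\<lambda>p. (fst p, snd p = i))"
    by (rule distr_cong) (auto intro!: sets_pair_measure_cong)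
  finally show ?thesis ..
qed

theorem theorem11:
  fixes M :: "'a measure" and t :: real
    and \<tau>\<^sub>V :: "int \<Rightarrow> 'a \<Rightarrow> real"
    and \<tau>\<^sub>E :: "int set \<Rightarrow> 'a \<Rightarrow> real"
    and D :: "int set \<Rightarrow> 'a \<Rightarrow> int"
  assumes "prob_space M" and "0 < t" and "t \<le> 1"
  shows
    "(iid_uniform_clocks M \<tau>\<^sub>V UNIV \<longrightarrow>
        (let X = (\<lambda>\<omega>. blocking_rsa int_edges (\<lambda>v. \<tau>\<^sub>V v \<omega>) t) in
          variance_limit_and_clt M (\<lambda>n \<omega>. occupied_count (X \<omega>) (segment n) UNIV) (sigma2_BL t) \<and>
          variance_limit_and_clt M (\<lambda>n \<omega>. occupied_count (X \<omega>) (segment n) (segment n)) (sigma2_BL t))) \<and>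
     (iid_uniform_clocks M \<tau>\<^sub>E int_edges \<longrightarrow>
        (let X = (\<lambda>\<omega>. dimer_rsa int_edges (\<lambda>e. \<tau>\<^sub>E e \<omega>) t) in
          variance_limit_and_clt M (\<lambda>n \<omega>. occupied_count (X \<omega>) (segment n) UNIV) (sigma2_DI t) \<and>
          variance_limit_and_clt M (\<lambda>n \<omega>. occupied_count (X \<omega>) (segment n) (segment n)) (sigma2_DI t))) \<and>
     (uniform_clocks_fair_directions M \<tau>\<^sub>E D int_edges \<longrightarrow>
        (let X = (\<lambda>\<omega>. annihilation int_edges (\<lambda>e. \<tau>\<^sub>E e \<omega>) (\<lambda>e. D e \<omega>) t) in
          variance_limit_and_clt M (\<lambda>n \<omega>. occupied_count (X \<omega>) (segment n) UNIV) (sigma2_AN t) \<and>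
          variance_limit_and_clt M (\<lambda>n \<omega>. occupied_count (X \<omega>) (segment n) (segment n)) (sigma2_AN t)))"
proof -
  interpret prob_space M by fact
  have finite_state: "occupied_count (extend_to_infinite X) (segment n) (segment n) = (\<Sum>v\<in>segment n. X (segment n) v)"
    for X :: "int set \<Rightarrow> int \<Rightarrow> real" and n
    by (simp add: occupied_count_def extend_to_infinite_def segment_def)
  have sites: "uniform_clocks M \<tau>\<^sub>V t" if "iid_uniform_clocks M \<tau>\<^sub>V UNIV"
    using that assms by (auto simp: iid_uniform_clocks_def uniform_clocks_def uniform_clocks_axioms_def iid_family_def iid_family_axioms_def)
  have edges: "uniform_clocks M (\<lambda>i. \<tau>\<^sub>E (line_edge i)) t" if "iid_uniform_clocks M \<tau>\<^sub>E int_edges"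
    using that assms unfolding iid_uniform_clocks_def int_edges_eq uniform_clocks_def uniform_clocks_axioms_def iid_family_def iid_family_axioms_def
    by (auto intro: indep_vars_reindex_range[OF inj_line_edge])
  have directed: "directed_clocks M (\<lambda>i \<omega>. (\<tau>\<^sub>E (line_edge i) \<omega>, D (line_edge i) \<omega> = i)) t \<and>
      (\<forall>i. D (line_edge i) \<in> M \<rightarrow>\<^sub>M count_space UNIV) \<and> (AE \<omega> in M. \<forall>i. D (line_edge i) \<omega> \<in> line_edge i)"
    if fair: "uniform_clocks_fair_directions M \<tau>\<^sub>E D int_edges"
  proof -
    let ?Z = "\<lambda>i \<omega>. (\<tau>\<^sub>E (line_edge i) \<omega>, D (line_edge i) \<omega>)" and ?N = "borel \<Otimes>\<^sub>M count_space UNIV :: (real \<times> int) measure"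
    let ?h = "\<lambda>i p. (fst p, snd p = i) :: real \<times> bool"
    have ind: "indep_vars (\<lambda>_. ?N) ?Z UNIV"
      using fair unfolding uniform_clocks_fair_directions_def int_edges_eq by (intro indep_vars_reindex_range[OF inj_line_edge]) auto
    have law: "distr M ?N (?Z i) = uniform_measure lborel {0<..<1} \<Otimes>\<^sub>M measure_pmf (pmf_of_set (line_edge i))" for i
      using fair by (auto simp: uniform_clocks_fair_directions_def int_edges_eq)
    have mZ [measurable]: "?Z i \<in> M \<rightarrow>\<^sub>M ?N" for i using ind by (auto simp: indep_vars_def2)
    have mh [measurable]: "?h i \<in> ?N \<rightarrow>\<^sub>M borel \<Otimes>\<^sub>M count_space UNIV" for i by measurable
    have "indep_vars (\<lambda>_. borel \<Otimes>\<^sub>M count_space UNIV) (\<lambda>i \<omega>. ?h i (?Z i \<omega>)) UNIV"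
      by (rule indep_vars_compose2[OF ind]) (rule mh)
    moreover have "distr M (borel \<Otimes>\<^sub>M count_space UNIV) (\<lambda>\<omega>. ?h i (?Z i \<omega>)) = fair_clock" for i
    proof -
      have "distr M (borel \<Otimes>\<^sub>M count_space UNIV) (\<lambda>\<omega>. ?h i (?Z i \<omega>))
        = distr (distr M ?N (?Z i)) (borel \<Otimes>\<^sub>M count_space UNIV) (?h i)"
        by (subst distr_distr[OF mh mZ]) (simp add: comp_def)
      then show ?thesis unfolding law fair_direction .
    qed
    ultimately have 1: "directed_clocks M (\<lambda>i \<omega>. (\<tau>\<^sub>E (line_edge i) \<omega>, D (line_edge i) \<omega> = i)) t"
      using assms prob_space_axioms
      by (auto simp: directed_clocks_def directed_clocks_axioms_def iid_family_def iid_family_axioms_def)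
    have D: "D (line_edge i) \<in> M \<rightarrow>\<^sub>M count_space UNIV" for i
      using measurable_compose[OF mZ measurable_snd] by simp
    have "AE \<omega> in M. D (line_edge i) \<omega> \<in> line_edge i" for i
    proof -
      let ?P = "measure_pmf (pmf_of_set (line_edge i))" and ?U = "uniform_measure lborel {0<..<1::real}"
      have "finite (line_edge i)" "line_edge i \<noteq> {}" by (auto simp: line_edge_def)
      then have "emeasure ?P (- line_edge i) = 0" by (simp add: emeasure_pmf_of_set)
      then have "emeasure (?U \<Otimes>\<^sub>M ?P) (UNIV \<times> - line_edge i) = 0"
        by (subst measure_pmf.emeasure_pair_measure_Times) auto
      then have "AE p in distr M ?N (?Z i). snd p \<in> line_edge i"
        unfolding law by (intro AE_I[of _ _ "UNIV \<times> - line_edge i"]) auto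
      then show ?thesis by (simp add: AE_distr_iff)
    qed
    then show ?thesis using 1 D by (simp add: AE_all_countable)
  qed
  show ?thesis
    unfolding Let_def
  proof (intro conjI impI)
    assume "iid_uniform_clocks M \<tau>\<^sub>V UNIV"
    then interpret uniform_clocks M \<tau>\<^sub>V t by (rule sites)
    show "variance_limit_and_clt M (\<lambda>n \<omega>. occupied_count (blocking_rsa int_edges (\<lambda>v. \<tau>\<^sub>V v \<omega>) t) (segment n) UNIV) (sigma2_BL t)"
      unfolding occupied_count_def by (rule blocking_infinite_limit)
    show "variance_limit_and_clt M (\<lambda>n \<omega>. occupied_count (blocking_rsa int_edges (\<lambda>v. \<tau>\<^sub>V v \<omega>) t) (segment n) (segment n)) (sigma2_BL t)"
      unfolding blocking_rsa_def finite_state by (rule blocking_finite_limit)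
  next
    assume "iid_uniform_clocks M \<tau>\<^sub>E int_edges"
    then interpret uniform_clocks M "\<lambda>i. \<tau>\<^sub>E (line_edge i)" t by (rule edges)
    show "variance_limit_and_clt M (\<lambda>n \<omega>. occupied_count (dimer_rsa int_edges (\<lambda>e. \<tau>\<^sub>E e \<omega>) t) (segment n) UNIV) (sigma2_DI t)"
      unfolding occupied_count_def by (rule dimer_infinite_limit) simp
    show "variance_limit_and_clt M (\<lambda>n \<omega>. occupied_count (dimer_rsa int_edges (\<lambda>e. \<tau>\<^sub>E e \<omega>) t) (segment n) (segment n)) (sigma2_DI t)"
      unfolding dimer_rsa_def finite_state by (rule dimer_finite_limit) simp
  next
    assume fair: "uniform_clocks_fair_directions M \<tau>\<^sub>E D int_edges"
    interpret directed_clocks M "\<lambda>i \<omega>. (\<tau>\<^sub>E (line_edge i) \<omega>, D (line_edge i) \<omega> = i)" t using directed[OF fair] by blast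
    show "variance_limit_and_clt M (\<lambda>n \<omega>. occupied_count (annihilation int_edges (\<lambda>e. \<tau>\<^sub>E e \<omega>) (\<lambda>e. D e \<omega>) t) (segment n) UNIV) (sigma2_AN t)"
      unfolding occupied_count_def by (rule annihilation_infinite_limit) (use directed[OF fair] in auto)
    show "variance_limit_and_clt M (\<lambda>n \<omega>. occupied_count (annihilation int_edges (\<lambda>e. \<tau>\<^sub>E e \<omega>) (\<lambda>e. D e \<omega>) t) (segment n) (segment n)) (sigma2_AN t)"
      unfolding annihilation_def finite_state by (rule annihilation_finite_limit) (use directed[OF fair] in auto)
  qed
qed

end
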